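(* Let $R$ be a sharp divisible valuative monoid of height one, with an ordered embedding $R^{\mathrm{gp}}\hookrightarrow\mathbf{R}$ with image $V$, so that $R=V_{\ge0}$. The functors $\sigma\mapsto M_\sigma=\sigma\cap L_\sigma$ and $M\mapsto\sigma_M$ are essentially inverse equivalences between the categories of $R$-toric monoids and special $V$-cones. In particular, for any special $V$-cone $\sigma$, the monoid $M_\sigma$ is $R$-toric.
   Context: Monoids are commutative, written additively; $M^{\mathrm{gp}}$ is the Grothendieck group. A valuative monoid is an integral monoid $R$ with $R^{\mathrm{gp}}=R\cup(-R)$; sharp means $R^\times=0$; height one means that the associated totally ordered group $R^{\mathrm{gp}}$ is nonzero and embeds into $\mathbf{R}$ as an ordered group. As $R$ is divisible, $V$ is a $\mathbf{Q}$-vector subspace of $V_{\mathbf{R}}:=\mathbf{R}$. Put $\mathfrak{m}_R=R\setminus\{0\}$. An $R$-toric monoid is an $R$-monoid $P$ (a monoid with a homomorphism $R\to P$) which is integral, saturated, torsion-free, finitely generated over $R$ (generated by finitely many elements over the image of $R$) and flat, i.e. $R\to P$ is injective. Morphisms are homomorphisms of $R$-monoids. A $V$-lattice is a torsion-free abelian group $L$ containing $V$ and finitely generated over $V$; then $L\cong V\oplus\mathbf{Z}^n$. A $V$-lattice in a real vector space $W$ is a subgroup $L\subset W$ which is a $V$-lattice such that $V\subset L$ spans a line $V_{\mathbf{R}}$ in $W$ with $V=L\cap V_{\mathbf{R}}$ and $L/V$ is a lattice in $W/V_{\mathbf{R}}$; equivalently, $W=\mathbf{R}^{1+n}$ and $L=V\oplus\mathbf{Z}^n$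 in a suitable basis. Every abstract $V$-lattice $L$ embeds canonically in $L_{\mathbf{R}}=(L\otimes\mathbf{R})\oplus_{V\otimes\mathbf{R}}V_{\mathbf{R}}$ as a $V$-lattice. For $\pi\in\mathfrak{m}_R$, $v_\pi\in W$ denotes its image under $R\subset V\subset L\subset W$. A special $V$-cone is a triple $\sigma=(\sigma,L_\sigma,W_\sigma)$ where $W_\sigma$ is a real vector space, $L_\sigma$ a $V$-lattice in $W_\sigma$, and $\sigma\subseteq W_\sigma$ a polyhedral cone with vertex at $0$ and non-empty interior, spanned by finitely many elements of $L_\sigma$, such that $v_\pi\in\sigma$ for $\pi\in\mathfrak{m}_R$. A morphism $\sigma\to\tau$ is a linear map $f\colon W_\sigma\to W_\tau$ with $f(v_\pi)=v_\pi$, $f(L_\sigma)\subseteq L_\tau$, $f(\sigma)\subseteq\tau$. For an $R$-toric monoid $M$, $\sigma_M$ is given by $L_{\sigma}=M^{\mathrm{gp}}$, $W_{\sigma}=(M^{\mathrm{gp}})_{\mathbf{R}}$, and $\sigma$ the convex conical hull of $M$ in $W_\sigma$. For a special $V$-cone $\sigma$, $M_\sigma=\sigma\cap L_\sigma$ is an $R$-monoid via $\pi\mapsto v_\pi$. *)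

theory Defs
  imports
    "HOL-Analysis.Abstract_Euclidean_Space"
    "HOL-Algebra.Divisibility"
    "HOL-Algebra.Generated_Groups"
    "HOL-Algebra.Module"
    "HOL-Algebra.AbelCoset"
begin

section \<open>Categories, functors, equivalences\<close>

text \<open>Hom-sets are indexed by their source and target and need not be disjoint;
  \<open>Cmp C A B D g f\<close> is the composite of \<open>f : A \<rightarrow> B\<close> and \<open>g : B \<rightarrow> D\<close>.\<close>

record ('o, 'a) category =
  Ob :: "'o set"
  Mor :: "'o \<Rightarrow> 'o \<Rightarrow> 'a set"
  Ide :: "'o \<Rightarrow> 'a"
  Cmp :: "'o \<Rightarrow> 'o \<Rightarrow> 'o \<Rightarrow> 'a \<Rightarrow> 'a \<Rightarrow> 'a"

definition is_category :: "('o, 'a) category \<Rightarrow> bool" where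
  "is_category C \<longleftrightarrow>
    (\<forall>A\<in>Ob C. Ide C A \<in> Mor C A A) \<and>
    (\<forall>A\<in>Ob C. \<forall>B\<in>Ob C. \<forall>D\<in>Ob C. \<forall>f\<in>Mor C A B. \<forall>g\<in>Mor C B D.
       Cmp C A B D g f \<in> Mor C A D) \<and>
    (\<forall>A\<in>Ob C. \<forall>B\<in>Ob C. \<forall>f\<in>Mor C A B.
       Cmp C A A B f (Ide C A) = f \<and> Cmp C A B B (Ide C B) f = f) \<and>
    (\<forall>A\<in>Ob C. \<forall>B\<in>Ob C. \<forall>D\<in>Ob C. \<forall>E\<in>Ob C.
       \<forall>f\<in>Mor C A B. \<forall>g\<in>Mor C B D. \<forall>h\<in>Mor C D E.
       Cmp C A B E (Cmp C B D E h g) f = Cmp C A D E h (Cmp C A B D g f))"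

record ('o1, 'a1, 'o2, 'a2) cat_functor =
  omap :: "'o1 \<Rightarrow> 'o2"
  amap :: "'o1 \<Rightarrow> 'o1 \<Rightarrow> 'a1 \<Rightarrow> 'a2"

definition is_functor ::
  "('o1, 'a1) category \<Rightarrow> ('o2, 'a2) category \<Rightarrow> ('o1, 'a1, 'o2, 'a2) cat_functor \<Rightarrow> bool" where
  "is_functor C D F \<longleftrightarrow>
    is_category C \<and> is_category D \<and>
    (\<forall>A\<in>Ob C. omap F A \<in> Ob D) \<and>
    (\<forall>A\<in>Ob C. \<forall>B\<in>Ob C. \<forall>f\<in>Mor C A B. amap F A B f \<in> Mor D (omap F A) (omap F B)) \<and>
    (\<forall>A\<in>Ob C. amap F A A (Ide C A) = Ide D (omap F A)) \<and>
    (\<forall>A\<in>Ob C. \<forall>B\<in>Ob C. \<forall>E\<in>Ob C. \<forall>f\<in>Mor C A B. \<forall>g\<in>Mor C B E.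
       amap F A E (Cmp C A B E g f) =
       Cmp D (omap F A) (omap F B) (omap F E) (amap F B E g) (amap F A B f))"

definition id_functor :: "('o, 'a, 'o, 'a) cat_functor" where
  "id_functor = \<lparr>omap = (\<lambda>A. A), amap = (\<lambda>A B f. f)\<rparr>"

definition comp_functor ::
  "('o2, 'a2, 'o3, 'a3) cat_functor \<Rightarrow> ('o1, 'a1, 'o2, 'a2) cat_functor \<Rightarrow>
   ('o1, 'a1, 'o3, 'a3) cat_functor" where
  "comp_functor G F =
    \<lparr>omap = (\<lambda>A. omap G (omap F A)),
     amap = (\<lambda>A B f. amap G (omap F A) (omap F B) (amap F A B f))\<rparr>"

definition is_isomorphism :: "('o, 'a) category \<Rightarrow> 'o \<Rightarrow> 'o \<Rightarrow> 'a \<Rightarrow> bool" where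
  "is_isomorphism C A B f \<longleftrightarrow>
    f \<in> Mor C A B \<and>
    (\<exists>g\<in>Mor C B A. Cmp C A B A g f = Ide C A \<and> Cmp C B A B f g = Ide C B)"

definition is_natural_isomorphism ::
  "('o1, 'a1) category \<Rightarrow> ('o2, 'a2) category \<Rightarrow>
   ('o1, 'a1, 'o2, 'a2) cat_functor \<Rightarrow> ('o1, 'a1, 'o2, 'a2) cat_functor \<Rightarrow> ('o1 \<Rightarrow> 'a2) \<Rightarrow> bool" where
  "is_natural_isomorphism C D F G \<eta> \<longleftrightarrow>
    (\<forall>A\<in>Ob C. is_isomorphism D (omap F A) (omap G A) (\<eta> A)) \<and>
    (\<forall>A\<in>Ob C. \<forall>B\<in>Ob C. \<forall>f\<in>Mor C A B.
       Cmp D (omap F A) (omap F B) (omap G B) (\<eta> B) (amap F A B f) =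
       Cmp D (omap F A) (omap G A) (omap G B) (amap G A B f) (\<eta> A))"

definition essentially_inverse_equivalences ::
  "('o1, 'a1) category \<Rightarrow> ('o2, 'a2) category \<Rightarrow>
   ('o1, 'a1, 'o2, 'a2) cat_functor \<Rightarrow> ('o2, 'a2, 'o1, 'a1) cat_functor \<Rightarrow> bool" where
  "essentially_inverse_equivalences C D F G \<longleftrightarrow>
    is_functor C D F \<and> is_functor D C G \<and>
    (\<exists>\<eta>. is_natural_isomorphism C C id_functor (comp_functor G F) \<eta>) \<and>
    (\<exists>\<epsilon>. is_natural_isomorphism D D (comp_functor F G) id_functor \<epsilon>)"


section \<open>Commutative monoids and the Grothendieck group\<close>

text \<open>Abstract monoids use the multiplicative notation of HOL-Algebra: \<open>\<otimes>\<close>, \<open>\<one>\<close>, \<open>x [^] n\<close>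
  stand for the mathematical $+$, $0$, $n x$.\<close>

definition gp_rel :: "('a, 'c) monoid_scheme \<Rightarrow> (('a \<times> 'a) \<times> ('a \<times> 'a)) set" where
  "gp_rel M = {((a, b), (c, d)) | a b c d.
     a \<in> carrier M \<and> b \<in> carrier M \<and> c \<in> carrier M \<and> d \<in> carrier M \<and>
     (\<exists>k\<in>carrier M. a \<otimes>\<^bsub>M\<^esub> d \<otimes>\<^bsub>M\<^esub> k = c \<otimes>\<^bsub>M\<^esub> b \<otimes>\<^bsub>M\<^esub> k)}"

text \<open>The formal difference $a - b$.\<close>
definition gp_diff :: "('a, 'c) monoid_scheme \<Rightarrow> 'a \<Rightarrow> 'a \<Rightarrow> ('a \<times> 'a) set" where
  "gp_diff M a b = gp_rel M `` {(a, b)}"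

definition gp :: "('a, 'c) monoid_scheme \<Rightarrow> ('a \<times> 'a) set monoid" where
  "gp M = \<lparr>carrier = (carrier M \<times> carrier M) // gp_rel M,
     mult = (\<lambda>X Y. \<Union>(a, b)\<in>X. \<Union>(c, d)\<in>Y. gp_diff M (a \<otimes>\<^bsub>M\<^esub> c) (b \<otimes>\<^bsub>M\<^esub> d)),
     one = gp_diff M \<one>\<^bsub>M\<^esub> \<one>\<^bsub>M\<^esub>\<rparr>"

definition gp_of :: "('a, 'c) monoid_scheme \<Rightarrow> 'a \<Rightarrow> ('a \<times> 'a) set" where
  "gp_of M a = gp_diff M a \<one>\<^bsub>M\<^esub>"

definition gp_map ::
  "('a, 'c) monoid_scheme \<Rightarrow> ('b, 'd) monoid_scheme \<Rightarrow> ('a \<Rightarrow> 'b) \<Rightarrow> ('a \<times> 'a) set \<Rightarrow> ('b \<times> 'b) set" where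
  "gp_map M N f X = (\<Union>(a, b)\<in>X. gp_diff N (f a) (f b))"

text \<open>HOL-Algebra's \<open>hom\<close> does not require preservation of the unit.\<close>
definition monoid_hom :: "('a, 'c) monoid_scheme \<Rightarrow> ('b, 'd) monoid_scheme \<Rightarrow> ('a \<Rightarrow> 'b) set" where
  "monoid_hom M N = {f \<in> hom M N. f \<one>\<^bsub>M\<^esub> = \<one>\<^bsub>N\<^esub>}"

definition torsion_free_group :: "('a, 'c) monoid_scheme \<Rightarrow> bool" where
  "torsion_free_group G \<longleftrightarrow>
    (\<forall>x\<in>carrier G. \<forall>n::nat. n > 0 \<longrightarrow> x [^]\<^bsub>G\<^esub> n = \<one>\<^bsub>G\<^esub> \<longrightarrow> x = \<one>\<^bsub>G\<^esub>)"

definition saturated_monoid :: "('a, 'c) monoid_scheme \<Rightarrow> bool" where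
  "saturated_monoid M \<longleftrightarrow>
    (\<forall>X\<in>carrier (gp M). \<forall>n::nat. n > 0 \<longrightarrow>
       X [^]\<^bsub>gp M\<^esub> n \<in> gp_of M ` carrier M \<longrightarrow> X \<in> gp_of M ` carrier M)"

definition sharp_monoid :: "('a, 'c) monoid_scheme \<Rightarrow> bool" where
  "sharp_monoid M \<longleftrightarrow> Units M = {\<one>\<^bsub>M\<^esub>}"

definition divisible_monoid :: "('a, 'c) monoid_scheme \<Rightarrow> bool" where
  "divisible_monoid M \<longleftrightarrow>
    (\<forall>n::nat. n > 0 \<longrightarrow> (\<forall>x\<in>carrier M. \<exists>y\<in>carrier M. y [^]\<^bsub>M\<^esub> n = x))"

definition valuative_monoid :: "('a, 'c) monoid_scheme \<Rightarrow> bool" where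
  "valuative_monoid M \<longleftrightarrow>
    comm_monoid_cancel M \<and>
    carrier (gp M) = gp_of M ` carrier M \<union> m_inv (gp M) ` gp_of M ` carrier M"

definition gp_le :: "('a, 'c) monoid_scheme \<Rightarrow> ('a \<times> 'a) set \<Rightarrow> ('a \<times> 'a) set \<Rightarrow> bool" where
  "gp_le M X Y \<longleftrightarrow> Y \<otimes>\<^bsub>gp M\<^esub> inv\<^bsub>gp M\<^esub> X \<in> gp_of M ` carrier M"

definition ordered_embedding :: "('a, 'c) monoid_scheme \<Rightarrow> (('a \<times> 'a) set \<Rightarrow> real) \<Rightarrow> bool" where
  "ordered_embedding M \<phi> \<longleftrightarrow>
    inj_on \<phi> (carrier (gp M)) \<and>
    (\<forall>X\<in>carrier (gp M). \<forall>Y\<in>carrier (gp M). \<phi> (X \<otimes>\<^bsub>gp M\<^esub> Y) = \<phi> X + \<phi> Y) \<and>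
    (\<forall>X\<in>carrier (gp M). \<forall>Y\<in>carrier (gp M). gp_le M X Y \<longleftrightarrow> \<phi> X \<le> \<phi> Y)"

definition height_one_monoid :: "('a, 'c) monoid_scheme \<Rightarrow> bool" where
  "height_one_monoid M \<longleftrightarrow>
    carrier (gp M) \<noteq> {\<one>\<^bsub>gp M\<^esub>} \<and> (\<exists>\<phi>. ordered_embedding M \<phi>)"

text \<open>The value group $V$ and the embedding of $R$ into it.\<close>

definition value_group :: "('r, 'c) monoid_scheme \<Rightarrow> (('r \<times> 'r) set \<Rightarrow> real) \<Rightarrow> real set" where
  "value_group R \<phi> = \<phi> ` carrier (gp R)"

definition rval :: "('r, 'c) monoid_scheme \<Rightarrow> (('r \<times> 'r) set \<Rightarrow> real) \<Rightarrow> 'r \<Rightarrow> real" where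
  "rval R \<phi> r = \<phi> (gp_of R r)"


section \<open>R-toric monoids\<close>

record ('a, 'r) rmonoid = "'a monoid" +
  str_map :: "'r \<Rightarrow> 'a"

definition fin_gen_over :: "('r, 'c) monoid_scheme \<Rightarrow> ('a, 'r) rmonoid \<Rightarrow> bool" where
  "fin_gen_over R M \<longleftrightarrow>
    (\<exists>A. finite A \<and> A \<subseteq> carrier M \<and>
       (\<forall>H. submonoid H M \<longrightarrow> A \<union> str_map M ` carrier R \<subseteq> H \<longrightarrow> H = carrier M))"

definition toric_monoid :: "('r, 'c) monoid_scheme \<Rightarrow> ('a, 'r) rmonoid \<Rightarrow> bool" where
  "toric_monoid R M \<longleftrightarrow>
    str_map M \<in> monoid_hom R M \<and>
    comm_monoid_cancel M \<and>
    saturated_monoid M \<and>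
    torsion_free_group (gp M) \<and>
    fin_gen_over R M \<and>
    inj_on (str_map M) (carrier R)"

text \<open>Morphisms are extensional functions, so that equality of morphisms is equality on the carrier.\<close>
definition rmonoid_mor ::
  "('r, 'c) monoid_scheme \<Rightarrow> ('a, 'r) rmonoid \<Rightarrow> ('b, 'r) rmonoid \<Rightarrow> ('a \<Rightarrow> 'b) set" where
  "rmonoid_mor R M N = {f \<in> extensional (carrier M).
     f \<in> monoid_hom M N \<and> (\<forall>r\<in>carrier R. f (str_map M r) = str_map N r)}"

definition toric_category :: "('r, 'c) monoid_scheme \<Rightarrow> (('u, 'r) rmonoid, 'u \<Rightarrow> 'u) category" where
  "toric_category R =
    \<lparr>Ob = {M. toric_monoid R M},
     Mor = rmonoid_mor R,
     Ide = (\<lambda>M. restrict (\<lambda>x. x) (carrier M)),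
     Cmp = (\<lambda>M N P g f. compose (carrier M) g f)\<rparr>"


section \<open>Real vector spaces with an explicit carrier\<close>

text \<open>A real vector space is a \<open>module\<close> record over the ring \<open>real_ring\<close>; the ring
  components \<open>mult\<close> and \<open>one\<close> of such a record carry no information.\<close>

definition real_ring :: "real ring" where
  "real_ring = \<lparr>carrier = UNIV, mult = (*), one = 1, zero = 0, add = (+)\<rparr>"

definition real_vs :: "(real, 'w) module \<Rightarrow> bool" where
  "real_vs W \<longleftrightarrow> Module.module real_ring W"

definition linear_maps :: "(real, 'v) module \<Rightarrow> (real, 'w) module \<Rightarrow> ('v \<Rightarrow> 'w) set" where
  "linear_maps W W' = {f \<in> hom (add_monoid W) (add_monoid W').
     \<forall>c. \<forall>x\<in>carrier W. f (c \<odot>\<^bsub>W\<^esub> x) = c \<odot>\<^bsub>W'\<^esub> f x}"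

definition lin_span :: "(real, 'w) module \<Rightarrow> 'w set \<Rightarrow> 'w set" where
  "lin_span W S = {finsum W (\<lambda>s. c s \<odot>\<^bsub>W\<^esub> s) F | F c. finite F \<and> F \<subseteq> S}"

definition cone_hull :: "(real, 'w) module \<Rightarrow> 'w set \<Rightarrow> 'w set" where
  "cone_hull W S = {finsum W (\<lambda>s. c s \<odot>\<^bsub>W\<^esub> s) F | F c. finite F \<and> F \<subseteq> S \<and> (\<forall>s\<in>F. 0 \<le> c s)}"

definition finite_basis :: "(real, 'w) module \<Rightarrow> 'w set \<Rightarrow> bool" where
  "finite_basis W B \<longleftrightarrow>
    finite B \<and> B \<subseteq> carrier W \<and> lin_span W B = carrier W \<and>
    (\<forall>c. finsum W (\<lambda>b. c b \<odot>\<^bsub>W\<^esub> b) B = \<zero>\<^bsub>W\<^esub> \<longrightarrow> (\<forall>b\<in>B. c b = 0))"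

text \<open>A lattice is the $\mathbf{Z}$-span of a basis.\<close>
definition is_lattice :: "(real, 'w) module \<Rightarrow> 'w set \<Rightarrow> bool" where
  "is_lattice W L \<longleftrightarrow> (\<exists>B. finite_basis W B \<and> L = generate (add_monoid W) B)"

definition quot_vs :: "(real, 'w) module \<Rightarrow> 'w set \<Rightarrow> (real, 'w set) module" where
  "quot_vs W U =
    \<lparr>carrier = A_RCOSETS W U, mult = undefined, one = undefined,
     zero = U, add = set_add W,
     smult = (\<lambda>c X. set_add W U ((\<lambda>x. c \<odot>\<^bsub>W\<^esub> x) ` X))\<rparr>"

definition direct_sum_vs ::
  "(real, 'v) module \<Rightarrow> (real, 'w) module \<Rightarrow> (real, 'v \<times> 'w) module" where
  "direct_sum_vs W W' =
    \<lparr>carrier = carrier W \<times> carrier W', mult = undefined, one = undefined,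
     zero = (\<zero>\<^bsub>W\<^esub>, \<zero>\<^bsub>W'\<^esub>),
     add = (\<lambda>x y. (fst x \<oplus>\<^bsub>W\<^esub> fst y, snd x \<oplus>\<^bsub>W'\<^esub> snd y)),
     smult = (\<lambda>c x. (c \<odot>\<^bsub>W\<^esub> fst x, c \<odot>\<^bsub>W'\<^esub> snd x))\<rparr>"

definition real_line :: "(real, real) module" where
  "real_line = \<lparr>carrier = UNIV, mult = undefined, one = undefined,
     zero = 0, add = (+), smult = (*)\<rparr>"

text \<open>The finest topology for which all linear maps from the spaces $\mathbf{R}^n$ are continuous.
  On a finite-dimensional space this is the usual topology.\<close>

definition vs_open :: "(real, 'w) module \<Rightarrow> 'w set \<Rightarrow> bool" where
  "vs_open W U \<longleftrightarrow>
    U \<subseteq> carrier W \<and>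
    (\<forall>n. \<forall>w. w ` {..<n} \<subseteq> carrier W \<longrightarrow>
       openin (Euclidean_space n)
         {c \<in> topspace (Euclidean_space n). finsum W (\<lambda>i. c i \<odot>\<^bsub>W\<^esub> w i) {..<n} \<in> U})"

definition vs_topology :: "(real, 'w) module \<Rightarrow> 'w topology" where
  "vs_topology W = topology (vs_open W)"

lemma istopology_vs_open: "istopology (vs_open W)"
proof -
  have "vs_open W (S \<inter> T)" if "vs_open W S" "vs_open W T" for S T
    unfolding vs_open_def
  proof (intro conjI allI impI)
    show "S \<inter> T \<subseteq> carrier W"
      using that by (auto simp: vs_open_def)
    fix n :: nat and w :: "nat \<Rightarrow> 'a" assume w: "w ` {..<n} \<subseteq> carrier W"
    have "{c \<in> topspace (Euclidean_space n). finsum W (\<lambda>i. c i \<odot>\<^bsub>W\<^esub> w i) {..<n} \<in> S \<inter> T} =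
        {c \<in> topspace (Euclidean_space n). finsum W (\<lambda>i. c i \<odot>\<^bsub>W\<^esub> w i) {..<n} \<in> S} \<inter>
        {c \<in> topspace (Euclidean_space n). finsum W (\<lambda>i. c i \<odot>\<^bsub>W\<^esub> w i) {..<n} \<in> T}"
      by blast
    then show "openin (Euclidean_space n)
        {c \<in> topspace (Euclidean_space n). finsum W (\<lambda>i. c i \<odot>\<^bsub>W\<^esub> w i) {..<n} \<in> S \<inter> T}"
      using that w by (simp add: vs_open_def openin_Int)
  qed
  moreover have "vs_open W (\<Union>K)" if K: "\<forall>S\<in>K. vs_open W S" for K
    unfolding vs_open_def
  proof (intro conjI allI impI)
    show "\<Union>K \<subseteq> carrier W"
      using K by (auto simp: vs_open_def)
    fix n :: nat and w :: "nat \<Rightarrow> 'a" assume w: "w ` {..<n} \<subseteq> carrier W"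
    have "{c \<in> topspace (Euclidean_space n). finsum W (\<lambda>i. c i \<odot>\<^bsub>W\<^esub> w i) {..<n} \<in> \<Union>K} =
        (\<Union>S\<in>K. {c \<in> topspace (Euclidean_space n). finsum W (\<lambda>i. c i \<odot>\<^bsub>W\<^esub> w i) {..<n} \<in> S})"
      by blast
    then show "openin (Euclidean_space n)
        {c \<in> topspace (Euclidean_space n). finsum W (\<lambda>i. c i \<odot>\<^bsub>W\<^esub> w i) {..<n} \<in> \<Union>K}"
      using K w by (auto simp: vs_open_def intro!: openin_Union)
  qed
  ultimately show ?thesis
    by (simp add: istopology_def)
qed

lemma openin_vs_topology: "openin (vs_topology W) = vs_open W"
  by (simp add: vs_topology_def istopology_vs_open topology_inverse')


section \<open>V-lattices\<close>

text \<open>An abstract $V$-lattice is a group \<open>L\<close> with an embedding \<open>j\<close> of $V$.\<close>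
definition V_lattice :: "real set \<Rightarrow> ('a, 'c) monoid_scheme \<Rightarrow> (real \<Rightarrow> 'a) \<Rightarrow> bool" where
  "V_lattice V L j \<longleftrightarrow>
    comm_group L \<and> torsion_free_group L \<and>
    j \<in> monoid_hom \<lparr>carrier = V, mult = (+), one = 0\<rparr> L \<and> inj_on j V \<and>
    (\<exists>A. finite A \<and> A \<subseteq> carrier L \<and> generate L (A \<union> j ` V) = carrier L)"

text \<open>For a $V$-lattice in a vector space \<open>W\<close> the embedding of $V$ extends to a linear injection of
  $V_{\mathbf{R}} = \mathbf{R}$ into \<open>W\<close>. It is recorded by the image \<open>e\<close> of $1 \in V_{\mathbf{R}}$,
  so that \<open>x \<in> V\<close> is sent to \<open>x \<odot> e\<close>; note that $1$ need not belong to $V$.\<close>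
definition V_lattice_in :: "real set \<Rightarrow> (real, 'w) module \<Rightarrow> 'w set \<Rightarrow> 'w \<Rightarrow> bool" where
  "V_lattice_in V W L e \<longleftrightarrow>
    subgroup L (add_monoid W) \<and>
    e \<in> carrier W \<and> e \<noteq> \<zero>\<^bsub>W\<^esub> \<and>
    V_lattice V ((add_monoid W)\<lparr>carrier := L\<rparr>) (\<lambda>x. x \<odot>\<^bsub>W\<^esub> e) \<and>
    L \<inter> lin_span W {e} = (\<lambda>x. x \<odot>\<^bsub>W\<^esub> e) ` V \<and>
    is_lattice (quot_vs W (lin_span W {e})) ((\<lambda>l. lin_span W {e} +>\<^bsub>W\<^esub> l) ` L)"

text \<open>$L \otimes \mathbf{R}$, as the quotient of the free real vector space on \<open>L\<close> by the
  additivity relations.\<close>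

definition delta :: "'a \<Rightarrow> real \<Rightarrow> 'a \<Rightarrow> real" where
  "delta a r = (\<lambda>x. if x = a then r else 0)"

definition free_vs :: "'a set \<Rightarrow> (real, 'a \<Rightarrow> real) module" where
  "free_vs S =
    \<lparr>carrier = {f. finite {x. f x \<noteq> 0} \<and> {x. f x \<noteq> 0} \<subseteq> S}, mult = undefined, one = undefined,
     zero = (\<lambda>x. 0), add = (\<lambda>f g x. f x + g x), smult = (\<lambda>c f x. c * f x)\<rparr>"

definition tensor_relations :: "('a, 'c) monoid_scheme \<Rightarrow> ('a \<Rightarrow> real) set" where
  "tensor_relations L = lin_span (free_vs (carrier L))
     {\<lambda>x. delta (a \<otimes>\<^bsub>L\<^esub> b) 1 x - delta a 1 x - delta b 1 x | a b. a \<in> carrier L \<and> b \<in> carrier L}"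

definition tensor_real :: "('a, 'c) monoid_scheme \<Rightarrow> (real, ('a \<Rightarrow> real) set) module" where
  "tensor_real L = quot_vs (free_vs (carrier L)) (tensor_relations L)"

definition pure_tensor :: "('a, 'c) monoid_scheme \<Rightarrow> 'a \<Rightarrow> real \<Rightarrow> ('a \<Rightarrow> real) set" where
  "pure_tensor L a r = tensor_relations L +>\<^bsub>free_vs (carrier L)\<^esub> delta a r"

text \<open>$L_{\mathbf{R}} = (L \otimes \mathbf{R}) \oplus_{V \otimes \mathbf{R}} V_{\mathbf{R}}$:
  the pushout of $V \otimes \mathbf{R} \to L \otimes \mathbf{R}$ and of the multiplication map
  $V \otimes \mathbf{R} \to V_{\mathbf{R}} = \mathbf{R}$.\<close>

type_synonym 'a lr = "(('a \<Rightarrow> real) set \<times> real) set"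

definition pushout_relations ::
  "real set \<Rightarrow> ('a, 'c) monoid_scheme \<Rightarrow> (real \<Rightarrow> 'a) \<Rightarrow> (('a \<Rightarrow> real) set \<times> real) set" where
  "pushout_relations V L j = lin_span (direct_sum_vs (tensor_real L) real_line)
     {(pure_tensor L (j x) r, - (x * r)) | x r. x \<in> V}"

definition realification ::
  "real set \<Rightarrow> ('a, 'c) monoid_scheme \<Rightarrow> (real \<Rightarrow> 'a) \<Rightarrow> (real, 'a lr) module" where
  "realification V L j =
    quot_vs (direct_sum_vs (tensor_real L) real_line) (pushout_relations V L j)"

definition realification_of ::
  "real set \<Rightarrow> ('a, 'c) monoid_scheme \<Rightarrow> (real \<Rightarrow> 'a) \<Rightarrow> 'a \<Rightarrow> 'a lr" where
  "realification_of V L j l =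
    pushout_relations V L j +>\<^bsub>direct_sum_vs (tensor_real L) real_line\<^esub> (pure_tensor L l 1, 0)"

definition realification_unit ::
  "real set \<Rightarrow> ('a, 'c) monoid_scheme \<Rightarrow> (real \<Rightarrow> 'a) \<Rightarrow> 'a lr" where
  "realification_unit V L j =
    pushout_relations V L j +>\<^bsub>direct_sum_vs (tensor_real L) real_line\<^esub> (\<zero>\<^bsub>tensor_real L\<^esub>, 1)"


section \<open>Special V-cones\<close>

text \<open>The components are $W_\sigma$, $L_\sigma$, $\sigma$ and the image in $W_\sigma$ of
  $1 \in V_{\mathbf{R}}$, which gives the inclusion $V \subset L_\sigma$.\<close>

record 'w vcone =
  vspace :: "(real, 'w) module"
  lat :: "'w set"
  cset :: "'w set"
  vunit :: 'w

definition vvec :: "('r, 'c) monoid_scheme \<Rightarrow> (('r \<times> 'r) set \<Rightarrow> real) \<Rightarrow> 'w vcone \<Rightarrow> 'r \<Rightarrow> 'w" where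
  "vvec R \<phi> s r = rval R \<phi> r \<odot>\<^bsub>vspace s\<^esub> vunit s"

text \<open>A polyhedral cone with vertex at $0$ is the conical hull of a finite set; it may contain lines.\<close>
definition special_cone ::
  "('r, 'c) monoid_scheme \<Rightarrow> (('r \<times> 'r) set \<Rightarrow> real) \<Rightarrow> 'w vcone \<Rightarrow> bool" where
  "special_cone R \<phi> s \<longleftrightarrow>
    real_vs (vspace s) \<and>
    V_lattice_in (value_group R \<phi>) (vspace s) (lat s) (vunit s) \<and>
    (\<exists>A. finite A \<and> A \<subseteq> lat s \<and> cset s = cone_hull (vspace s) A) \<and>
    (vs_topology (vspace s)) interior_of (cset s) \<noteq> {} \<and>
    (\<forall>\<pi>\<in>carrier R - {\<one>\<^bsub>R\<^esub>}. vvec R \<phi> s \<pi> \<in> cset s)"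

definition cone_mor ::
  "('r, 'c) monoid_scheme \<Rightarrow> (('r \<times> 'r) set \<Rightarrow> real) \<Rightarrow> 'v vcone \<Rightarrow> 'w vcone \<Rightarrow> ('v \<Rightarrow> 'w) set" where
  "cone_mor R \<phi> s t = {f \<in> extensional (carrier (vspace s)).
     f \<in> linear_maps (vspace s) (vspace t) \<and>
     (\<forall>\<pi>\<in>carrier R - {\<one>\<^bsub>R\<^esub>}. f (vvec R \<phi> s \<pi>) = vvec R \<phi> t \<pi>) \<and>
     f ` lat s \<subseteq> lat t \<and> f ` cset s \<subseteq> cset t}"

definition cone_category ::
  "('r, 'c) monoid_scheme \<Rightarrow> (('r \<times> 'r) set \<Rightarrow> real) \<Rightarrow> ('u vcone, 'u \<Rightarrow> 'u) category" where
  "cone_category R \<phi> =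
    \<lparr>Ob = {s. special_cone R \<phi> s},
     Mor = cone_mor R \<phi>,
     Ide = (\<lambda>s. restrict (\<lambda>x. x) (carrier (vspace s))),
     Cmp = (\<lambda>s t q g f. compose (carrier (vspace s)) g f)\<rparr>"


section \<open>The two functors\<close>

definition monoid_of_cone ::
  "('r, 'c) monoid_scheme \<Rightarrow> (('r \<times> 'r) set \<Rightarrow> real) \<Rightarrow> 'w vcone \<Rightarrow> ('w, 'r) rmonoid" where
  "monoid_of_cone R \<phi> s =
    \<lparr>carrier = cset s \<inter> lat s, mult = add (vspace s), one = zero (vspace s),
     str_map = vvec R \<phi> s\<rparr>"

definition monoid_functor ::
  "('r, 'c) monoid_scheme \<Rightarrow> (('r \<times> 'r) set \<Rightarrow> real) \<Rightarrow>
   ('u vcone, 'u \<Rightarrow> 'u, ('u, 'r) rmonoid, 'u \<Rightarrow> 'u) cat_functor" where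
  "monoid_functor R \<phi> =
    \<lparr>omap = monoid_of_cone R \<phi>, amap = (\<lambda>s t f. restrict f (cset s \<inter> lat s))\<rparr>"

text \<open>The embedding of $V \cong R^{\mathrm{gp}}$ into $M^{\mathrm{gp}}$.\<close>
definition V_to_gp ::
  "('r, 'c) monoid_scheme \<Rightarrow> (('r \<times> 'r) set \<Rightarrow> real) \<Rightarrow> ('a, 'r) rmonoid \<Rightarrow> real \<Rightarrow> ('a \<times> 'a) set" where
  "V_to_gp R \<phi> M x = gp_map R M (str_map M) (inv_into (carrier (gp R)) \<phi> x)"

text \<open>The cone $\sigma_M$ in its canonical form, with underlying space
  $(M^{\mathrm{gp}})_{\mathbf{R}}$, and the map from \<open>M\<close> to it.\<close>

definition raw_cone_in ::
  "('r, 'c) monoid_scheme \<Rightarrow> (('r \<times> 'r) set \<Rightarrow> real) \<Rightarrow> ('a, 'r) rmonoid \<Rightarrow> 'a \<Rightarrow> ('a \<times> 'a) set lr" where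
  "raw_cone_in R \<phi> M m =
    realification_of (value_group R \<phi>) (gp M) (V_to_gp R \<phi> M) (gp_of M m)"

definition raw_cone ::
  "('r, 'c) monoid_scheme \<Rightarrow> (('r \<times> 'r) set \<Rightarrow> real) \<Rightarrow> ('a, 'r) rmonoid \<Rightarrow> ('a \<times> 'a) set lr vcone" where
  "raw_cone R \<phi> M =
    (let V = value_group R \<phi>; L = gp M; j = V_to_gp R \<phi> M; W = realification V L j in
     \<lparr>vspace = W,
      lat = realification_of V L j ` carrier L,
      cset = cone_hull W (raw_cone_in R \<phi> M ` carrier M),
      vunit = realification_unit V L j\<rparr>)"

text \<open>In order to compose the functors, monoids and cones must have their elements in one type,
  whereas the type of the elements of $(M^{\mathrm{gp}})_{\mathbf{R}}$ is larger than that of the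
  elements of \<open>M\<close>. The canonical cone is therefore copied along a chosen injection of its underlying space
  into the type of the elements of \<open>M\<close>; such an injection exists if that type has at least the
  cardinality of the continuum.\<close>

definition transport_vs :: "('v \<Rightarrow> 'w) \<Rightarrow> (real, 'v) module \<Rightarrow> (real, 'w) module" where
  "transport_vs h W =
    (let g = inv_into (carrier W) h in
     \<lparr>carrier = h ` carrier W, mult = undefined, one = undefined,
      zero = h \<zero>\<^bsub>W\<^esub>,
      add = (\<lambda>x y. h (g x \<oplus>\<^bsub>W\<^esub> g y)),
      smult = (\<lambda>c x. h (c \<odot>\<^bsub>W\<^esub> g x))\<rparr>)"

definition transport_cone :: "('v \<Rightarrow> 'w) \<Rightarrow> 'v vcone \<Rightarrow> 'w vcone" where
  "transport_cone h s =
    \<lparr>vspace = transport_vs h (vspace s), lat = h ` lat s, cset = h ` cset s, vunit = h (vunit s)\<rparr>"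

definition encoding ::
  "('r, 'c) monoid_scheme \<Rightarrow> (('r \<times> 'r) set \<Rightarrow> real) \<Rightarrow> ('u, 'r) rmonoid \<Rightarrow> ('u \<times> 'u) set lr \<Rightarrow> 'u" where
  "encoding R \<phi> M = (SOME h. inj_on h (carrier (vspace (raw_cone R \<phi> M))))"

definition cone_of_monoid ::
  "('r, 'c) monoid_scheme \<Rightarrow> (('r \<times> 'r) set \<Rightarrow> real) \<Rightarrow> ('u, 'r) rmonoid \<Rightarrow> 'u vcone" where
  "cone_of_monoid R \<phi> M = transport_cone (encoding R \<phi> M) (raw_cone R \<phi> M)"

definition cone_in :: "('r, 'c) monoid_scheme \<Rightarrow> (('r \<times> 'r) set \<Rightarrow> real) \<Rightarrow> ('u, 'r) rmonoid \<Rightarrow> 'u \<Rightarrow> 'u" where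
  "cone_in R \<phi> M m = encoding R \<phi> M (raw_cone_in R \<phi> M m)"

text \<open>A morphism \<open>f : M \<rightarrow> N\<close> is sent to the linear map of the ambient spaces which extends \<open>f\<close>
  and is the identity on $V_{\mathbf{R}}$.\<close>
definition cone_map ::
  "('r, 'c) monoid_scheme \<Rightarrow> (('r \<times> 'r) set \<Rightarrow> real) \<Rightarrow> ('u, 'r) rmonoid \<Rightarrow> ('u, 'r) rmonoid \<Rightarrow>
   ('u \<Rightarrow> 'u) \<Rightarrow> 'u \<Rightarrow> 'u" where
  "cone_map R \<phi> M N f =
    (let s = cone_of_monoid R \<phi> M; t = cone_of_monoid R \<phi> N in
     THE h. h \<in> extensional (carrier (vspace s)) \<and> h \<in> linear_maps (vspace s) (vspace t) \<and>
       h (vunit s) = vunit t \<and>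
       (\<forall>m\<in>carrier M. h (cone_in R \<phi> M m) = cone_in R \<phi> N (f m)))"

definition cone_functor ::
  "('r, 'c) monoid_scheme \<Rightarrow> (('r \<times> 'r) set \<Rightarrow> real) \<Rightarrow>
   (('u, 'r) rmonoid, 'u \<Rightarrow> 'u, 'u vcone, 'u \<Rightarrow> 'u) cat_functor" where
  "cone_functor R \<phi> = \<lparr>omap = cone_of_monoid R \<phi>, amap = cone_map R \<phi>\<rparr>"

end

theory Submission
  imports Defs
begin

text \<open>A \<open>V\<close>-lattice in \<open>W\<close> is \<open>V \<oplus> \<int>\<^sup>n\<close> in suitable coordinates of \<open>W = \<real>\<^bsup>1 + n\<^esup>\<close>, so every statement about
  special cones becomes linear algebra modulo the line \<open>V\<^sub>\<real>\<close>. A point of the cone is a nonnegative combination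
  of generators that are independent modulo this line, plus a point of the line (Caratheodory). If the point
  lies in the lattice, its coefficients are rational, since only finitely many tuples of fractional parts
  occur; divisibility of \<open>V\<close> then takes care of the component along the line. This gives finite
  generation of \<open>M\<^sub>\<sigma>\<close> over \<open>R\<close> (Gordan) and, by saturation, \<open>\<sigma>\<^sub>M \<inter> M\<^sup>g\<^sup>p = M\<close>.

  Since \<open>\<sigma>\<close> has interior points, \<open>M\<^sub>\<sigma>\<close> generates the lattice as a group and spans \<open>W\<close>, so
  homomorphisms \<open>M\<^sub>\<sigma> \<rightarrow> M\<^sub>\<tau>\<close> extend uniquely to morphisms of cones: the functor from cones to monoids is fully
  faithful. It is essentially surjective by \<open>M \<cong> \<sigma>\<^sub>M \<inter> M\<^sup>g\<^sup>p\<close>, and the equivalence follows formally.\<close>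

section \<open>Real vector spaces with an explicit carrier\<close>

text \<open>A nonzero divisible \<open>V\<close> is dense in the reals, so \<open>L\<close> is not
  discrete and a bounded open region contains infinitely many lattice points; finiteness can only be
  sought modulo the line. The price is the component \<open>t\<close> along the line: it may be
  negative although the point lies in the cone, but then \<open>- e\<close> lies in the cone too.
  Caratheodory's argument is therefore run with bookkeeping on the coefficient of \<open>e\<close>,
  and a negative multiple of \<open>e\<close> is found among the natural combinations of the
  generators; together with the nonnegative ray it yields all multiples of \<open>e\<close> by
  elements of \<open>V\<close>.

  Divisibility is used a second time for abstract lattices: it makes the quotient by
  \<open>V\<close> torsion-free, which gives the splitting into \<open>V\<close> and a free group.
  That the realification does not collapse the lattice cannot be seen from its presentation by
  generators and relations; it is tested with the coordinate functionals of this splitting.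

  The action of \<open>cone_functor\<close> on morphisms is a definite description; its existence
  and uniqueness are read off from full faithfulness in the other direction.\<close>

lemma real_ring_simps [simp]:
  "carrier real_ring = UNIV" "x \<otimes>\<^bsub>real_ring\<^esub> y = x * y" "\<one>\<^bsub>real_ring\<^esub> = 1"
  "\<zero>\<^bsub>real_ring\<^esub> = 0" "x \<oplus>\<^bsub>real_ring\<^esub> y = x + y"
  by (simp_all add: real_ring_def)

lemma cring_real_ring: "cring real_ring"
proof (rule cringI)
  show "abelian_group real_ring"
    by (rule abelian_groupI) (auto intro: exI[of _ "- x" for x] simp: add_eq_0_iff)
  show "Group.comm_monoid real_ring"
    by (rule comm_monoidI) auto
qed (auto simp: algebra_simps)

lemma real_vsI:
  assumes "comm_group (add_monoid W)"
    and "\<And>a x. x \<in> carrier W \<Longrightarrow> a \<odot>\<^bsub>W\<^esub> x \<in> carrier W"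
    and "\<And>a b x. x \<in> carrier W \<Longrightarrow> (a + b) \<odot>\<^bsub>W\<^esub> x = a \<odot>\<^bsub>W\<^esub> x \<oplus>\<^bsub>W\<^esub> b \<odot>\<^bsub>W\<^esub> x"
    and "\<And>a x y. x \<in> carrier W \<Longrightarrow> y \<in> carrier W \<Longrightarrow> a \<odot>\<^bsub>W\<^esub> (x \<oplus>\<^bsub>W\<^esub> y) = a \<odot>\<^bsub>W\<^esub> x \<oplus>\<^bsub>W\<^esub> a \<odot>\<^bsub>W\<^esub> y"
    and "\<And>a b x. x \<in> carrier W \<Longrightarrow> (a * b) \<odot>\<^bsub>W\<^esub> x = a \<odot>\<^bsub>W\<^esub> (b \<odot>\<^bsub>W\<^esub> x)"
    and "\<And>x. x \<in> carrier W \<Longrightarrow> 1 \<odot>\<^bsub>W\<^esub> x = x"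
  shows "real_vs W"
  unfolding real_vs_def
  by (rule moduleI) (use assms cring_real_ring in
      \<open>auto intro!: abelian_group.intro abelian_monoid.intro abelian_group_axioms.intro
        simp: comm_group.axioms\<close>)

text \<open>The family \<open>x\<close> is kept apart from the index set: \<open>x\<close> is the
  identity for the self-indexed sums in \<open>lin_span\<close> and \<open>cone_hull\<close>, but
  images \<open>\<lambda>i. f (x i)\<close> under a linear map may repeat vectors and still need an
  index.\<close>

definition lc :: "(real, 'w) module \<Rightarrow> ('i \<Rightarrow> real) \<Rightarrow> ('i \<Rightarrow> 'w) \<Rightarrow> 'i set \<Rightarrow> 'w" where
  "lc W c x F = finsum W (\<lambda>i. c i \<odot>\<^bsub>W\<^esub> x i) F"

lemma linear_mapsD:
  assumes "f \<in> linear_maps W W'"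
  shows "x \<in> carrier W \<Longrightarrow> f x \<in> carrier W'"
    and "x \<in> carrier W \<Longrightarrow> y \<in> carrier W \<Longrightarrow> f (x \<oplus>\<^bsub>W\<^esub> y) = f x \<oplus>\<^bsub>W'\<^esub> f y"
    and "x \<in> carrier W \<Longrightarrow> f (c \<odot>\<^bsub>W\<^esub> x) = c \<odot>\<^bsub>W'\<^esub> f x"
  using assms by (auto simp: linear_maps_def hom_def)

lemma linear_mapsI:
  assumes "\<And>x. x \<in> carrier W \<Longrightarrow> f x \<in> carrier W'"
    and "\<And>x y. x \<in> carrier W \<Longrightarrow> y \<in> carrier W \<Longrightarrow> f (x \<oplus>\<^bsub>W\<^esub> y) = f x \<oplus>\<^bsub>W'\<^esub> f y"
    and "\<And>c x. x \<in> carrier W \<Longrightarrow> f (c \<odot>\<^bsub>W\<^esub> x) = c \<odot>\<^bsub>W'\<^esub> f x"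
  shows "f \<in> linear_maps W W'"
  using assms by (auto simp: linear_maps_def hom_def)

locale real_space =
  fixes W :: "(real, 'w) module" (structure)
  assumes real_vs: "real_vs W"

sublocale real_space \<subseteq> module real_ring W
  using real_vs by (simp add: real_vs_def)

context real_space
begin

lemma sm_closed [simp]: "x \<in> carrier W \<Longrightarrow> a \<odot> x \<in> carrier W"
  using smult_closed by simp

lemma sm_add_left: "x \<in> carrier W \<Longrightarrow> (a + b) \<odot> x = a \<odot> x \<oplus> b \<odot> x"
  using smult_l_distr[of a b x] by simp

lemma sm_add_right: "x \<in> carrier W \<Longrightarrow> y \<in> carrier W \<Longrightarrow> a \<odot> (x \<oplus> y) = a \<odot> x \<oplus> a \<odot> y"
  using smult_r_distr[of a x y] by simp

lemma sm_sm [simp]: "x \<in> carrier W \<Longrightarrow> a \<odot> (b \<odot> x) = (a * b) \<odot> x"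
  using smult_assoc1[of a b x] by simp

lemma sm_1 [simp]: "x \<in> carrier W \<Longrightarrow> 1 \<odot> x = x"
  using smult_one[of x] by simp

lemma sm_0 [simp]: "x \<in> carrier W \<Longrightarrow> 0 \<odot> x = \<zero>"
  using smult_l_null[of x] by simp

lemma sm_zero [simp]: "a \<odot> \<zero> = \<zero>"
  using smult_r_null[of a] by simp

lemma minus_eq_sm: "x \<in> carrier W \<Longrightarrow> \<ominus> x = (- 1) \<odot> x"
  using sm_add_left[of x "- 1" 1] by (intro minus_equality) auto

lemma sm_eq_zero_iff [simp]: "x \<in> carrier W \<Longrightarrow> a \<odot> x = \<zero> \<longleftrightarrow> a = 0 \<or> x = \<zero>"
  by (metis left_inverse sm_0 sm_1 sm_sm sm_zero)

lemma sm_cancel: "x \<in> carrier W \<Longrightarrow> y \<in> carrier W \<Longrightarrow> a \<noteq> 0 \<Longrightarrow> a \<odot> x = a \<odot> y \<longleftrightarrow> x = y"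
  by (metis left_inverse sm_1 sm_sm)

lemma sm_inj: "x \<in> carrier W \<Longrightarrow> x \<noteq> \<zero> \<Longrightarrow> a \<odot> x = b \<odot> x \<longleftrightarrow> a = b"
proof
  assume x: "x \<in> carrier W" "x \<noteq> \<zero>" and eq: "a \<odot> x = b \<odot> x"
  have "(a - b) \<odot> x \<oplus> b \<odot> x = \<zero> \<oplus> b \<odot> x"
    using x eq by (simp flip: sm_add_left)
  then show "a = b" using x by (simp del: l_zero)
qed simp

declare smult_closed [rule del]

lemma lc_closed [simp]: "(\<And>i. i \<in> F \<Longrightarrow> x i \<in> carrier W) \<Longrightarrow> lc W c x F \<in> carrier W"
  unfolding lc_def by (rule finsum_closed) auto

lemma lc_empty [simp]: "lc W c x {} = \<zero>"
  by (simp add: lc_def)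

lemma lc_insert:
  "finite F \<Longrightarrow> a \<notin> F \<Longrightarrow> x a \<in> carrier W \<Longrightarrow> (\<And>i. i \<in> F \<Longrightarrow> x i \<in> carrier W) \<Longrightarrow>
    lc W c x (insert a F) = c a \<odot> x a \<oplus> lc W c x F"
  unfolding lc_def by (subst finsum_insert) auto

lemma lc_cong:
  assumes "F = G" "\<And>i. i \<in> G \<Longrightarrow> c i = d i" "\<And>i. i \<in> G \<Longrightarrow> x i = y i" "\<And>i. i \<in> G \<Longrightarrow> y i \<in> carrier W"
  shows "lc W c x F = lc W d y G"
  unfolding lc_def by (rule finsum_cong') (use assms in auto)

lemma lc_add:
  assumes "\<And>i. i \<in> F \<Longrightarrow> x i \<in> carrier W"
  shows "lc W c x F \<oplus> lc W d x F = lc W (\<lambda>i. c i + d i) x F"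
proof (cases "finite F")
  case True
  then show ?thesis using assms
  proof (induction F)
    case (insert a F)
    then have "lc W (\<lambda>i. c i + d i) x F = lc W c x F \<oplus> lc W d x F" by simp
    with insert show ?case by (simp add: lc_insert sm_add_left add.m_ac)
  qed simp
next
  case False
  then show ?thesis by (simp add: lc_def)
qed

lemma lc_sm:
  assumes "\<And>i. i \<in> F \<Longrightarrow> x i \<in> carrier W"
  shows "k \<odot> lc W c x F = lc W (\<lambda>i. k * c i) x F"
proof (cases "finite F")
  case True
  then show ?thesis using assms
    by (induction F) (auto simp: lc_insert sm_add_right)
next
  case False
  then show ?thesis by (simp add: lc_def)
qed

lemma lc_zero: "(\<And>i. i \<in> F \<Longrightarrow> c i = 0) \<Longrightarrow> (\<And>i. i \<in> F \<Longrightarrow> x i \<in> carrier W) \<Longrightarrow> lc W c x F = \<zero>"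
  unfolding lc_def by (rule add.finprod_one_eqI) auto

lemma lc_mono_neutral:
  assumes "finite G" "F \<subseteq> G" "\<And>i. i \<in> G - F \<Longrightarrow> c i = 0" "\<And>i. i \<in> G \<Longrightarrow> x i \<in> carrier W"
  shows "lc W c x F = lc W c x G"
  unfolding lc_def by (rule add.finprod_mono_neutral_cong_left) (use assms in auto)

lemma lc_extend:
  assumes "finite G" "F \<subseteq> G" "\<And>i. i \<in> G \<Longrightarrow> x i \<in> carrier W"
  shows "lc W c x F = lc W (\<lambda>i. if i \<in> F then c i else 0) x G"
  by (subst lc_mono_neutral[of G F, symmetric]) (use assms in \<open>auto intro!: lc_cong\<close>)

lemma lc_single:
  assumes "finite F" "a \<in> F" "\<And>i. i \<in> F \<Longrightarrow> x i \<in> carrier W"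
  shows "lc W (\<lambda>i. if i = a then k else 0) x F = k \<odot> x a"
proof -
  have "lc W (\<lambda>i. if i = a then k else 0) x {a} = lc W (\<lambda>i. if i = a then k else 0) x F"
    by (rule lc_mono_neutral) (use assms in auto)
  moreover have "lc W (\<lambda>i. if i = a then k else 0) x {a} = k \<odot> x a"
    using assms(2) assms(3)[of a] lc_insert[of "{}" a x] by simp
  ultimately show ?thesis by simp
qed

lemma lc_remove:
  assumes "finite F" "a \<in> F" "\<And>i. i \<in> F \<Longrightarrow> x i \<in> carrier W"
  shows "lc W c x F = c a \<odot> x a \<oplus> lc W c x (F - {a})"
  using lc_insert[of "F - {a}" a x c] assms by (auto simp: insert_absorb)

lemma lc_lc:
  assumes "finite I" "finite J" "\<And>j. j \<in> J \<Longrightarrow> y j \<in> carrier W"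
  shows "lc W c (\<lambda>i. lc W (d i) y J) I = lc W (\<lambda>j. \<Sum>i\<in>I. c i * d i j) y J"
  using assms(1)
proof (induction I)
  case empty
  then show ?case using assms by (simp add: lc_zero)
next
  case (insert a I)
  then show ?case using assms by (simp add: lc_insert lc_sm lc_add)
qed

lemma lc_reindex:
  assumes "inj_on f I" "\<And>i. i \<in> I \<Longrightarrow> x (f i) \<in> carrier W"
  shows "lc W c x (f ` I) = lc W (\<lambda>i. c (f i)) (\<lambda>i. x (f i)) I"
  unfolding lc_def by (subst finsum_reindex) (use assms in \<open>auto intro!: finsum_cong'\<close>)

lemma lin_span_closed: "S \<subseteq> carrier W \<Longrightarrow> lin_span W S \<subseteq> carrier W"
  unfolding lin_span_def by (auto intro!: finsum_closed)

text \<open>Padding the coefficients with zeros turns all of \<open>S\<close> into a common index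
  set; afterwards elements of the span can be added coefficientwise.\<close>

lemma lin_span_finite:
  assumes "finite S" "S \<subseteq> carrier W"
  shows "lin_span W S = {lc W c (\<lambda>s. s) S | c. True}"
proof (intro Set.set_eqI iffI)
  fix w assume "w \<in> lin_span W S"
  then obtain F c where F: "finite F" "F \<subseteq> S" "w = lc W c (\<lambda>s. s) F"
    unfolding lin_span_def lc_def by auto
  then have "w = lc W (\<lambda>i. if i \<in> F then c i else 0) (\<lambda>s. s) S"
    using lc_extend[of S F "\<lambda>s. s" c] assms by auto
  then show "w \<in> {lc W c (\<lambda>s. s) S | c. True}" by blast
qed (use assms in \<open>auto simp: lin_span_def lc_def\<close>)

lemma cone_hull_finite:
  assumes "finite S" "S \<subseteq> carrier W"
  shows "cone_hull W S = {lc W c (\<lambda>s. s) S | c. \<forall>s\<in>S. 0 \<le> c s}"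
proof (intro Set.set_eqI iffI)
  fix w assume "w \<in> cone_hull W S"
  then obtain F c where F: "finite F" "F \<subseteq> S" "w = lc W c (\<lambda>s. s) F" "\<forall>s\<in>F. 0 \<le> c s"
    unfolding cone_hull_def lc_def by auto
  then have "w = lc W (\<lambda>i. if i \<in> F then c i else 0) (\<lambda>s. s) S"
    using lc_extend[of S F "\<lambda>s. s" c] assms by auto
  then show "w \<in> {lc W c (\<lambda>s. s) S | c. \<forall>s\<in>S. 0 \<le> c s}" using F by fastforce
qed (use assms in \<open>auto simp: cone_hull_def lc_def\<close>)

lemma lin_span_add:
  assumes S: "S \<subseteq> carrier W" and "v \<in> lin_span W S" "w \<in> lin_span W S"
  shows "v \<oplus> w \<in> lin_span W S"
proof -
  obtain F c G d where F: "finite F" "F \<subseteq> S" "v = lc W c (\<lambda>s. s) F"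
    and G: "finite G" "G \<subseteq> S" "w = lc W d (\<lambda>s. s) G"
    using assms unfolding lin_span_def lc_def by blast
  have "v \<in> lin_span W (F \<union> G)" "w \<in> lin_span W (F \<union> G)"
    using F G unfolding lin_span_def lc_def by blast+
  then obtain a b where "v = lc W a (\<lambda>s. s) (F \<union> G)" "w = lc W b (\<lambda>s. s) (F \<union> G)"
    using F G S by (subst (asm) (1 2) lin_span_finite) auto
  then have "v \<oplus> w = lc W (\<lambda>i. a i + b i) (\<lambda>s. s) (F \<union> G)"
    using F G S by (subst lc_add[symmetric]) auto
  then show ?thesis using F G unfolding lin_span_def lc_def
    by (intro CollectI exI[of _ "F \<union> G"] exI[of _ "\<lambda>i. a i + b i"]) auto
qed

lemma lin_span_sm:
  assumes S: "S \<subseteq> carrier W" and "v \<in> lin_span W S"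
  shows "k \<odot> v \<in> lin_span W S"
proof -
  obtain F c where F: "finite F" "F \<subseteq> S" "v = lc W c (\<lambda>s. s) F"
    using assms unfolding lin_span_def lc_def by blast
  then have "k \<odot> v = lc W (\<lambda>i. k * c i) (\<lambda>s. s) F" using S by (subst lc_sm[symmetric]) auto
  then show ?thesis using F unfolding lin_span_def lc_def
    by (intro CollectI exI[of _ "F"] exI[of _ "\<lambda>i. k * c i"]) auto
qed

lemma lin_span_zero: "\<zero> \<in> lin_span W S"
  unfolding lin_span_def by (rule CollectI, rule exI[of _ "{}"]) simp

lemma lin_span_base: "S \<subseteq> carrier W \<Longrightarrow> s \<in> S \<Longrightarrow> s \<in> lin_span W S"
  unfolding lin_span_def
  by (rule CollectI, rule exI[of _ "{s}"], rule exI[of _ "\<lambda>_. 1"]) (auto simp: subset_iff)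

lemma lc_in:
  assumes "finite F" "\<zero> \<in> U" "\<And>v w. v \<in> U \<Longrightarrow> w \<in> U \<Longrightarrow> v \<oplus> w \<in> U"
    and "\<And>i. i \<in> F \<Longrightarrow> c i \<odot> x i \<in> U" "\<And>i. i \<in> F \<Longrightarrow> x i \<in> carrier W"
  shows "lc W c x F \<in> U"
  using assms(1,4,5) by (induction F) (auto simp: lc_insert assms(2,3))

text \<open>Serves as the induction rule for spans: a linear condition has to be checked on
  generators only. \<open>cone_hull_minimal\<close> plays the same role for cones.\<close>

lemma lin_span_minimal:
  assumes "S \<subseteq> U" "U \<subseteq> carrier W" "\<zero> \<in> U" "\<And>v w. v \<in> U \<Longrightarrow> w \<in> U \<Longrightarrow> v \<oplus> w \<in> U"
    "\<And>k v. v \<in> U \<Longrightarrow> k \<odot> v \<in> U"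
  shows "lin_span W S \<subseteq> U"
proof
  fix w assume "w \<in> lin_span W S"
  then obtain F c where F: "finite F" "F \<subseteq> S" "w = lc W c (\<lambda>s. s) F"
    unfolding lin_span_def lc_def by blast
  then show "w \<in> U" using assms by (auto intro!: lc_in)
qed

lemma lin_span_singleton: "v \<in> carrier W \<Longrightarrow> lin_span W {v} = {t \<odot> v | t. True}"
proof -
  assume v: "v \<in> carrier W"
  show ?thesis
    using v by (subst lin_span_finite) (auto simp: lc_insert[of "{}", simplified] intro: exI[of _ "\<lambda>_. t" for t])
qed

lemma cone_hull_subset_lin_span: "cone_hull W S \<subseteq> lin_span W S"
  unfolding cone_hull_def lin_span_def by blast

lemma cone_hull_closed: "S \<subseteq> carrier W \<Longrightarrow> cone_hull W S \<subseteq> carrier W"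
  using cone_hull_subset_lin_span lin_span_closed by blast

lemma cone_hull_add:
  assumes S: "S \<subseteq> carrier W" and "v \<in> cone_hull W S" "w \<in> cone_hull W S"
  shows "v \<oplus> w \<in> cone_hull W S"
proof -
  obtain F c G d where F: "finite F" "F \<subseteq> S" "v = lc W c (\<lambda>s. s) F" "\<forall>s\<in>F. 0 \<le> c s"
    and G: "finite G" "G \<subseteq> S" "w = lc W d (\<lambda>s. s) G" "\<forall>s\<in>G. 0 \<le> d s"
    using assms unfolding cone_hull_def lc_def by blast
  have "v \<in> cone_hull W (F \<union> G)" "w \<in> cone_hull W (F \<union> G)"
    using F G unfolding cone_hull_def lc_def by blast+
  then obtain a b where ab: "v = lc W a (\<lambda>s. s) (F \<union> G)" "w = lc W b (\<lambda>s. s) (F \<union> G)"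
    "\<forall>s\<in>F\<union>G. 0 \<le> a s" "\<forall>s\<in>F\<union>G. 0 \<le> b s"
    using F G S by (subst (asm) (1 2) cone_hull_finite) auto
  then have "v \<oplus> w = lc W (\<lambda>i. a i + b i) (\<lambda>s. s) (F \<union> G)"
    using F G S by (subst lc_add[symmetric]) auto
  moreover have "\<forall>s\<in>F\<union>G. 0 \<le> a s + b s" using ab by auto
  ultimately show ?thesis using F G unfolding cone_hull_def lc_def
    by (intro CollectI exI[of _ "F \<union> G"] exI[of _ "\<lambda>i. a i + b i"]) auto
qed

lemma cone_hull_sm:
  assumes S: "S \<subseteq> carrier W" and "v \<in> cone_hull W S" "0 \<le> k"
  shows "k \<odot> v \<in> cone_hull W S"
proof -
  obtain F c where F: "finite F" "F \<subseteq> S" "v = lc W c (\<lambda>s. s) F" "\<forall>s\<in>F. 0 \<le> c s"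
    using assms unfolding cone_hull_def lc_def by blast
  then have "k \<odot> v = lc W (\<lambda>i. k * c i) (\<lambda>s. s) F" using S by (subst lc_sm[symmetric]) auto
  then show ?thesis using F \<open>0 \<le> k\<close> unfolding cone_hull_def lc_def 
    by (intro CollectI exI[of _ "F"] exI[of _ "\<lambda>i. k * c i"]) auto
qed

lemma cone_hull_zero: "\<zero> \<in> cone_hull W S"
  unfolding cone_hull_def by (rule CollectI, rule exI[of _ "{}"]) simp

lemma cone_hull_base: "S \<subseteq> carrier W \<Longrightarrow> s \<in> S \<Longrightarrow> s \<in> cone_hull W S"
  unfolding cone_hull_def
  by (rule CollectI, rule exI[of _ "{s}"], rule exI[of _ "\<lambda>_. 1"]) (auto simp: subset_iff)

lemma cone_hull_minimal:
  assumes "S \<subseteq> U" "U \<subseteq> carrier W" "\<zero> \<in> U" "\<And>v w. v \<in> U \<Longrightarrow> w \<in> U \<Longrightarrow> v \<oplus> w \<in> U"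
    "\<And>k v. v \<in> U \<Longrightarrow> 0 \<le> k \<Longrightarrow> k \<odot> v \<in> U"
  shows "cone_hull W S \<subseteq> U"
proof
  fix w assume "w \<in> cone_hull W S"
  then obtain F c where F: "finite F" "F \<subseteq> S" "w = lc W c (\<lambda>s. s) F" "\<forall>s\<in>F. 0 \<le> c s"
    unfolding cone_hull_def lc_def by blast
  have "lc W c (\<lambda>s. s) F \<in> U"
    by (rule lc_in) (use F assms in auto)
  then show "w \<in> U" using F by simp
qed

lemma cone_hull_mono_span:
  assumes "S \<subseteq> cone_hull W T" "T \<subseteq> carrier W"
  shows "cone_hull W S \<subseteq> cone_hull W T"
  by (rule cone_hull_minimal) (use assms in \<open>auto intro: cone_hull_add cone_hull_sm cone_hull_zero dest: subsetD[OF cone_hull_closed]\<close>)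

lemma lin_span_mono_span:
  assumes "S \<subseteq> lin_span W T" "T \<subseteq> carrier W"
  shows "lin_span W S \<subseteq> lin_span W T"
  by (rule lin_span_minimal) (use assms in \<open>auto intro: lin_span_add lin_span_sm lin_span_zero dest: subsetD[OF lin_span_closed]\<close>)

end

section \<open>Linear maps and their effect on combinations, cones and spans\<close>

lemma linear_zero:
  assumes "real_space W" "real_space W'" "f \<in> linear_maps W W'"
  shows "f \<zero>\<^bsub>W\<^esub> = \<zero>\<^bsub>W'\<^esub>"
proof -
  interpret W: real_space W by fact
  interpret W': real_space W' by fact
  have "f (0 \<odot>\<^bsub>W\<^esub> \<zero>\<^bsub>W\<^esub>) = 0 \<odot>\<^bsub>W'\<^esub> f \<zero>\<^bsub>W\<^esub>"
    by (rule linear_mapsD(3)[OF assms(3)]) simp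
  moreover have "f \<zero>\<^bsub>W\<^esub> \<in> carrier W'"
    by (rule linear_mapsD(1)[OF assms(3)]) simp
  ultimately show ?thesis by simp
qed

lemma linear_lc:
  assumes "real_space W" "real_space W'" "f \<in> linear_maps W W'" "\<And>i. i \<in> F \<Longrightarrow> x i \<in> carrier W"
  shows "f (lc W c x F) = lc W' c (\<lambda>i. f (x i)) F"
proof -
  interpret W: real_space W by fact
  interpret W': real_space W' by fact
  note f = linear_mapsD[OF assms(3)] linear_zero[OF assms(1-3)]
  show ?thesis
  proof (cases "finite F")
    case True
    then show ?thesis using assms(4)
      by (induction F) (simp_all add: f W.lc_insert W'.lc_insert)
  next
    case False
    then show ?thesis by (simp add: lc_def f)
  qed
qed

lemma linear_cone_hull:
  assumes "real_space W" "real_space W'" "f \<in> linear_maps W W'" "S \<subseteq> carrier W"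
  shows "f ` cone_hull W S \<subseteq> cone_hull W' (f ` S)"
proof -
  interpret W: real_space W by fact
  interpret W': real_space W' by fact
  note f = linear_mapsD[OF assms(3)] linear_zero[OF assms(1-3)]
  have fS: "f ` S \<subseteq> carrier W'" using f assms by auto
  have "cone_hull W S \<subseteq> {w \<in> carrier W. f w \<in> cone_hull W' (f ` S)}"
    by (rule W.cone_hull_minimal)
      (use assms(4) fS in \<open>auto simp: f W'.cone_hull_zero W'.cone_hull_add W'.cone_hull_sm W'.cone_hull_base\<close>)
  then show ?thesis by auto
qed

lemma linear_lin_span:
  assumes "real_space W" "real_space W'" "f \<in> linear_maps W W'" "S \<subseteq> carrier W"
  shows "f ` lin_span W S \<subseteq> lin_span W' (f ` S)"
proof -
  interpret W: real_space W by fact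
  interpret W': real_space W' by fact
  note f = linear_mapsD[OF assms(3)] linear_zero[OF assms(1-3)]
  have fS: "f ` S \<subseteq> carrier W'" using f assms by auto
  have "lin_span W S \<subseteq> {w \<in> carrier W. f w \<in> lin_span W' (f ` S)}"
    by (rule W.lin_span_minimal)
      (use assms(4) fS in \<open>auto simp: f W'.lin_span_zero W'.lin_span_add W'.lin_span_sm W'.lin_span_base\<close>)
  then show ?thesis by auto
qed

lemma linear_eq_on_span:
  assumes "real_space W" "real_space W'" "f \<in> linear_maps W W'" "g \<in> linear_maps W W'"
    "S \<subseteq> carrier W" "\<And>s. s \<in> S \<Longrightarrow> f s = g s" "w \<in> lin_span W S"
  shows "f w = g w"
proof -
  interpret W: real_space W by fact
  interpret W': real_space W' by fact
  note f = linear_mapsD[OF assms(3)] linear_zero[OF assms(1-3)]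
  note g = linear_mapsD[OF assms(4)] linear_zero[OF assms(1,2,4)]
  have "lin_span W S \<subseteq> {w \<in> carrier W. f w = g w}"
    by (rule W.lin_span_minimal) (use assms(5,6) in \<open>auto simp: f g\<close>)
  then show ?thesis using assms by auto
qed

section \<open>Quotients and lattices\<close>

text \<open>The vector space axioms are equations and inverses exist as images of inverses, so they
  pass along any surjection compatible with the operations. This covers both quotients and the
  copies of cones along an injection.\<close>

lemma real_vs_image:
  fixes W :: "(real, 'v) module" and Q :: "(real, 'w) module"
  assumes "real_vs W" and car: "carrier Q = p ` carrier W"
    and add: "\<And>x y. x \<in> carrier W \<Longrightarrow> y \<in> carrier W \<Longrightarrow> p x \<oplus>\<^bsub>Q\<^esub> p y = p (x \<oplus>\<^bsub>W\<^esub> y)"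
    and zero: "\<zero>\<^bsub>Q\<^esub> = p \<zero>\<^bsub>W\<^esub>"
    and sm: "\<And>c x. x \<in> carrier W \<Longrightarrow> c \<odot>\<^bsub>Q\<^esub> p x = p (c \<odot>\<^bsub>W\<^esub> x)"
  shows "real_vs Q" "p \<in> linear_maps W Q"
proof -
  interpret W: real_space W by unfold_locales fact
  show "real_vs Q"
  proof (rule real_vsI)
    show "comm_group (add_monoid Q)"
    proof (rule comm_groupI)
      fix X assume "X \<in> carrier (add_monoid Q)"
      then obtain x where x: "x \<in> carrier W" "X = p x" using car by auto
      have "p (\<ominus>\<^bsub>W\<^esub> x) \<oplus>\<^bsub>Q\<^esub> p x = \<zero>\<^bsub>Q\<^esub>" using x by (simp add: add zero W.l_neg)
      then show "\<exists>y\<in>carrier (add_monoid Q). y \<otimes>\<^bsub>add_monoid Q\<^esub> X = \<one>\<^bsub>add_monoid Q\<^esub>"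
        using x car by auto
    qed (auto simp: car add zero W.a_ac)
  qed (auto simp: car add zero sm W.sm_add_left W.sm_add_right)
  show "p \<in> linear_maps W Q"
    by (rule linear_mapsI) (auto simp: car add sm)
qed

definition real_subspace :: "(real, 'w) module \<Rightarrow> 'w set \<Rightarrow> bool" where
  "real_subspace W U \<longleftrightarrow> U \<subseteq> carrier W \<and> \<zero>\<^bsub>W\<^esub> \<in> U \<and>
    (\<forall>u\<in>U. \<forall>v\<in>U. u \<oplus>\<^bsub>W\<^esub> v \<in> U) \<and> (\<forall>k. \<forall>u\<in>U. k \<odot>\<^bsub>W\<^esub> u \<in> U)"

context real_space
begin

lemma real_subspace_lin_span: "S \<subseteq> carrier W \<Longrightarrow> real_subspace W (lin_span W S)"
  unfolding real_subspace_def
  by (simp add: lin_span_closed lin_span_zero lin_span_add lin_span_sm)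

lemma sm_diff: "x \<in> carrier W \<Longrightarrow> (-1) \<odot> x \<oplus> x = \<zero>" "x \<in> carrier W \<Longrightarrow> x \<oplus> (-1) \<odot> x = \<zero>"
  by (metis minus_eq_sm l_neg, metis minus_eq_sm r_neg)

lemma coset_eq_iff:
  assumes U: "real_subspace W U" and x: "x \<in> carrier W" and y: "y \<in> carrier W"
  shows "U +> x = U +> y \<longleftrightarrow> x \<oplus> (-1) \<odot> y \<in> U"
proof
  have Uc: "\<And>u. u \<in> U \<Longrightarrow> u \<in> carrier W" using U by (auto simp: real_subspace_def)
  assume "U +> x = U +> y"
  moreover have "x \<in> U +> x"
    using U x by (auto simp: a_r_coset_def' real_subspace_def intro!: bexI[of _ \<zero>])
  ultimately obtain u where "u \<in> U" "x = u \<oplus> y" by (auto simp: a_r_coset_def')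
  then show "x \<oplus> (-1) \<odot> y \<in> U" using x y Uc by (simp add: a_assoc sm_diff)
next
  have Uc: "\<And>u. u \<in> U \<Longrightarrow> u \<in> carrier W" using U by (auto simp: real_subspace_def)
  have sub: "U +> x \<subseteq> U +> y" if "x \<oplus> (-1) \<odot> y \<in> U" "x \<in> carrier W" "y \<in> carrier W" for x y
  proof
    fix w assume "w \<in> U +> x"
    then obtain u where u: "u \<in> U" "w = u \<oplus> x" by (auto simp: a_r_coset_def')
    then have "w = (u \<oplus> (x \<oplus> (-1) \<odot> y)) \<oplus> y"
      using that Uc by (simp add: a_assoc sm_diff)
    moreover have "u \<oplus> (x \<oplus> (-1) \<odot> y) \<in> U" using U u that by (auto simp: real_subspace_def)
    ultimately show "w \<in> U +> y" by (auto simp: a_r_coset_def')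
  qed
  assume *: "x \<oplus> (-1) \<odot> y \<in> U"
  then have "(-1) \<odot> (x \<oplus> (-1) \<odot> y) \<in> U" using U by (auto simp: real_subspace_def)
  then have "y \<oplus> (-1) \<odot> x \<in> U" using x y by (simp add: sm_add_right a_comm)
  then show "U +> x = U +> y" using * sub x y by blast
qed

lemma carrier_quot_vs: "carrier (quot_vs W U) = (\<lambda>x. U +> x) ` carrier W"
  by (auto simp: quot_vs_def A_RCOSETS_def')

lemma quot_vs_add:
  assumes U: "real_subspace W U" and x: "x \<in> carrier W" and y: "y \<in> carrier W"
  shows "(U +> x) \<oplus>\<^bsub>quot_vs W U\<^esub> (U +> y) = U +> (x \<oplus> y)"
proof -
  have Uc: "\<And>u. u \<in> U \<Longrightarrow> u \<in> carrier W" using U by (auto simp: real_subspace_def)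
  have "w \<in> (U +> x) <+> (U +> y) \<longleftrightarrow> w \<in> U +> (x \<oplus> y)" for w
  proof
    assume "w \<in> (U +> x) <+> (U +> y)"
    then obtain u v where "u \<in> U" "v \<in> U" "w = (u \<oplus> x) \<oplus> (v \<oplus> y)"
      by (auto simp: a_r_coset_def' set_add_def')
    then have "w = (u \<oplus> v) \<oplus> (x \<oplus> y)" "u \<oplus> v \<in> U"
      using x y Uc U by (auto simp: add.m_ac real_subspace_def)
    then show "w \<in> U +> (x \<oplus> y)" by (auto simp: a_r_coset_def')
  next
    assume "w \<in> U +> (x \<oplus> y)"
    then obtain u where u: "u \<in> U" "w = u \<oplus> (x \<oplus> y)" by (auto simp: a_r_coset_def')
    then have "w = (u \<oplus> x) \<oplus> (\<zero> \<oplus> y)" "\<zero> \<in> U"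
      using x y Uc U by (auto simp: add.m_ac real_subspace_def)
    then show "w \<in> (U +> x) <+> (U +> y)"
      using u unfolding a_r_coset_def' set_add_def' by blast
  qed
  then show ?thesis by (auto simp: quot_vs_def)
qed

lemma quot_vs_sm:
  assumes U: "real_subspace W U" and x: "x \<in> carrier W"
  shows "c \<odot>\<^bsub>quot_vs W U\<^esub> (U +> x) = U +> (c \<odot> x)"
proof -
  have Uc: "\<And>u. u \<in> U \<Longrightarrow> u \<in> carrier W" using U by (auto simp: real_subspace_def)
  have "w \<in> U <+> (\<lambda>x. c \<odot> x) ` (U +> x) \<longleftrightarrow> w \<in> U +> (c \<odot> x)" for w
  proof
    assume "w \<in> U <+> (\<lambda>x. c \<odot> x) ` (U +> x)"
    then obtain u v where "u \<in> U" "v \<in> U" "w = u \<oplus> c \<odot> (v \<oplus> x)"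
      by (auto simp: a_r_coset_def' set_add_def')
    then have "w = (u \<oplus> c \<odot> v) \<oplus> c \<odot> x" "u \<oplus> c \<odot> v \<in> U"
      using x Uc U by (auto simp: add.m_ac real_subspace_def sm_add_right)
    then show "w \<in> U +> (c \<odot> x)" by (auto simp: a_r_coset_def')
  next
    assume "w \<in> U +> (c \<odot> x)"
    then obtain u where u: "u \<in> U" "w = u \<oplus> c \<odot> x" by (auto simp: a_r_coset_def')
    then have "w = u \<oplus> c \<odot> (\<zero> \<oplus> x)" "\<zero> \<in> U"
      using x Uc U by (auto simp: real_subspace_def)
    then show "w \<in> U <+> (\<lambda>x. c \<odot> x) ` (U +> x)"
      using u unfolding a_r_coset_def' set_add_def' by blast
  qed
  then show ?thesis by (auto simp: quot_vs_def)
qed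

lemma zero_quot_vs:
  assumes U: "real_subspace W U"
  shows "\<zero>\<^bsub>quot_vs W U\<^esub> = U +> \<zero>"
proof -
  have Uc: "\<And>u. u \<in> U \<Longrightarrow> u \<in> carrier W" using U by (auto simp: real_subspace_def)
  then show ?thesis by (auto simp: quot_vs_def a_r_coset_def')
qed

lemma real_vs_quot_vs: "real_subspace W U \<Longrightarrow> real_vs (quot_vs W U)"
  and linear_coset: "real_subspace W U \<Longrightarrow> (\<lambda>x. U +> x) \<in> linear_maps W (quot_vs W U)"
  using real_vs_image[OF real_vs carrier_quot_vs quot_vs_add zero_quot_vs quot_vs_sm] by blast+

lemma coset_zero_iff:
  assumes U: "real_subspace W U" and "x \<in> carrier W"
  shows "U +> x = \<zero>\<^bsub>quot_vs W U\<^esub> \<longleftrightarrow> x \<in> U"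
  using coset_eq_iff[OF assms, of \<zero>] assms by (simp add: zero_quot_vs)

lemma quot_vs_lift:
  fixes W' :: "(real, 'v) module"
  assumes U: "real_subspace W U" and "real_space W'" and f: "f \<in> linear_maps W W'"
    and f0: "\<And>u. u \<in> U \<Longrightarrow> f u = \<zero>\<^bsub>W'\<^esub>"
  obtains g where "g \<in> linear_maps (quot_vs W U) W'" "\<And>x. x \<in> carrier W \<Longrightarrow> g (U +> x) = f x"
proof -
  interpret W': real_space W' by fact
  have Uc: "\<And>u. u \<in> U \<Longrightarrow> u \<in> carrier W" using U by (auto simp: real_subspace_def)
  \<comment> \<open>The map \<open>f\<close> is constant on every coset, so the image of a coset is
    a singleton and no representative has to be chosen.\<close>
  define g where "g X = the_elem (f ` X)" for X
  have g: "g (U +> x) = f x" if x: "x \<in> carrier W" for x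
  proof -
    have "f ` (U +> x) = {f x}"
      using x Uc f0 U linear_mapsD[OF f]
      by (auto simp: a_r_coset_def' real_subspace_def image_iff intro!: bexI[of _ \<zero>])
    then show ?thesis by (simp add: g_def)
  qed
  have "g \<in> linear_maps (quot_vs W U) W'"
    by (rule linear_mapsI)
      (auto simp: carrier_quot_vs quot_vs_add[OF U] quot_vs_sm[OF U] g linear_mapsD[OF f])
  with g that show ?thesis by blast
qed

section \<open>Subgroups of a real space and integral combinations\<close>

lemma subgroup_of_int:
  assumes H: "subgroup H (add_monoid W)" and x: "x \<in> H"
  shows "of_int k \<odot> x \<in> H"
proof -
  have xc: "x \<in> carrier W" using subgroup.subset[OF H] x by auto
  have zero: "\<zero> \<in> H" using subgroup.one_closed[OF H] by simp
  have add: "u \<oplus> v \<in> H" if "u \<in> H" "v \<in> H" for u v using subgroup.m_closed[OF H that] by simp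
  have neg: "(-1) \<odot> u \<in> H" if "u \<in> H" for u
    using subgroup.m_inv_closed[OF H that] subgroup.subset[OF H] that minus_eq_sm[of u]
    by (auto simp: a_inv_def)
  have nat: "real n \<odot> x \<in> H" for n :: nat
    by (induction n) (use zero add x xc in \<open>auto simp: sm_add_left\<close>)
  show ?thesis
  proof (cases "k \<ge> 0")
    case True
    then show ?thesis using nat[of "nat k"] by simp
  next
    case False
    then show ?thesis using neg[OF nat[of "nat (- k)"]] xc by simp
  qed
qed

lemma subgroup_add:
  assumes H: "subgroup H (add_monoid W)" and "x \<in> H" "y \<in> H"
  shows "x \<oplus> y \<in> H"
  using subgroup.m_closed[OF assms] by simp

lemma subgroup_zero: "subgroup H (add_monoid W) \<Longrightarrow> \<zero> \<in> H"
  using subgroup.one_closed by fastforce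

lemma subgroupI_real:
  assumes "H \<subseteq> carrier W" "\<zero> \<in> H" "\<And>x y. x \<in> H \<Longrightarrow> y \<in> H \<Longrightarrow> x \<oplus> y \<in> H"
    "\<And>x. x \<in> H \<Longrightarrow> (-1) \<odot> x \<in> H"
  shows "subgroup H (add_monoid W)"
proof (rule add.subgroupI)
  fix a assume "a \<in> H"
  then show "\<ominus> a \<in> H" using assms minus_eq_sm[of a] by auto
qed (use assms in auto)

lemma lc_int_in_subgroup:
  assumes H: "subgroup H (add_monoid W)" and "finite F" "\<And>i. i \<in> F \<Longrightarrow> x i \<in> H"
  shows "lc W (\<lambda>i. of_int (m i)) x F \<in> H"
  using assms subgroup.subset[OF H]
  by (intro lc_in) (auto intro: subgroup_of_int subgroup_add subgroup_zero)

lemma generate_eq_lc: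
  assumes "finite S" "S \<subseteq> carrier W"
  shows "generate (add_monoid W) S = {lc W (\<lambda>s. of_int (m s)) (\<lambda>s. s) S | m :: 'w \<Rightarrow> int. True}" (is "_ = ?R")
proof
  have "subgroup ?R (add_monoid W)"
  proof (rule subgroupI_real)
    show "\<zero> \<in> ?R" using assms by (auto intro!: exI[of _ "\<lambda>_. 0"] lc_zero[symmetric])
    show "x \<oplus> y \<in> ?R" if xy: "x \<in> ?R" "y \<in> ?R" for x y
    proof -
      from xy obtain m n where "x = lc W (\<lambda>s. of_int (m s)) (\<lambda>s. s) S" "y = lc W (\<lambda>s. of_int (n s)) (\<lambda>s. s) S"
        by blast
      then have "x \<oplus> y = lc W (\<lambda>s. of_int (m s + n s)) (\<lambda>s. s) S"
        using assms by (simp add: lc_add subset_iff)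
      then show ?thesis by (intro CollectI exI[of _ "\<lambda>s. m s + n s"]) simp
    qed
    show "(-1) \<odot> x \<in> ?R" if x: "x \<in> ?R" for x
    proof -
      from x obtain m where "x = lc W (\<lambda>s. of_int (m s)) (\<lambda>s. s) S" by blast
      then have "(-1) \<odot> x = lc W (\<lambda>s. of_int (- m s)) (\<lambda>s. s) S"
        using assms by (simp add: lc_sm subset_iff)
      then show ?thesis by (intro CollectI exI[of _ "\<lambda>s. - m s"]) simp
    qed
  qed (use assms in \<open>auto intro!: lc_closed\<close>)
  moreover have "S \<subseteq> ?R"
  proof
    fix s assume s: "s \<in> S"
    have "lc W (\<lambda>i. of_int (if i = s then 1 else 0)) (\<lambda>s. s) S = lc W (\<lambda>i. if i = s then 1 else 0) (\<lambda>s. s) S"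
      by (rule lc_cong) (use assms in auto)
    also have "\<dots> = s" using assms s by (subst lc_single) auto
    finally show "s \<in> ?R" by (intro CollectI exI[of _ "\<lambda>i. if i = s then 1 else 0"]) simp
  qed
  ultimately show "generate (add_monoid W) S \<subseteq> ?R"
    by (intro add.generate_subgroup_incl)
  have "subgroup (generate (add_monoid W) S) (add_monoid W)"
    by (rule add.generate_is_subgroup) (use assms in auto)
  then show "?R \<subseteq> generate (add_monoid W) S"
    using assms by (auto intro!: lc_int_in_subgroup intro: generate.incl)
qed

end

text \<open>The coordinates given by \<open>e\<close> and \<open>B\<close> identify \<open>W\<close> with \<open>\<real>\<^bsup>1 + n\<^esup>\<close> and \<open>L\<close> with \<open>V \<oplus> \<int>\<^sup>n\<close>.\<close>

definition adapted_basis :: "real set \<Rightarrow> (real, 'w) module \<Rightarrow> 'w set \<Rightarrow> 'w \<Rightarrow> 'w set \<Rightarrow> bool" where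
  "adapted_basis V W L e B \<longleftrightarrow> finite B \<and> B \<subseteq> carrier W \<and> e \<in> carrier W \<and>
    (\<forall>w\<in>carrier W. \<exists>t c. w = t \<odot>\<^bsub>W\<^esub> e \<oplus>\<^bsub>W\<^esub> lc W c (\<lambda>b. b) B) \<and>
    (\<forall>t c. t \<odot>\<^bsub>W\<^esub> e \<oplus>\<^bsub>W\<^esub> lc W c (\<lambda>b. b) B = \<zero>\<^bsub>W\<^esub> \<longrightarrow> t = 0 \<and> (\<forall>b\<in>B. c b = 0)) \<and>
    L = {v \<odot>\<^bsub>W\<^esub> e \<oplus>\<^bsub>W\<^esub> lc W (\<lambda>b. of_int (m b)) (\<lambda>b. b) B | v m. v \<in> V}"

definition value_subgroup :: "real set \<Rightarrow> bool" where
  "value_subgroup V \<longleftrightarrow> 0 \<in> V \<and> (\<forall>x\<in>V. \<forall>y\<in>V. x + y \<in> V) \<and> (\<forall>x\<in>V. - x \<in> V)"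

context real_space
begin

text \<open>The lattice in the quotient by the line is free, so its basis lifts to elements of
  \<open>L\<close>. The condition that \<open>L\<close> meets the line exactly in \<open>V\<close>
  then identifies what remains of a lattice point after its integral part along \<open>B\<close> is
  removed.\<close>

lemma V_lattice_in_imp_adapted_basis:
  assumes V: "value_subgroup V" and L: "V_lattice_in V W L e"
  obtains B where "adapted_basis V W L e B"
proof -
  define U where "U = lin_span W {e}"
  define Q where "Q = quot_vs W U"
  define p where "p = (\<lambda>x. U +> x)"
  have Lsub: "subgroup L (add_monoid W)" and e: "e \<in> carrier W" "e \<noteq> \<zero>"
    and LU: "L \<inter> U = (\<lambda>x. x \<odot> e) ` V" and lat: "is_lattice Q (p ` L)"
    using L by (auto simp: V_lattice_in_def U_def Q_def p_def)
  have Lc: "\<And>l. l \<in> L \<Longrightarrow> l \<in> carrier W" using subgroup.subset[OF Lsub] by auto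
  have U: "real_subspace W U" unfolding U_def using e by (intro real_subspace_lin_span) auto
  have Ue: "U = {t \<odot> e | t. True}" unfolding U_def by (rule lin_span_singleton[OF e(1)])
  interpret Q: real_space Q using real_vs_quot_vs[OF U] by unfold_locales (simp add: Q_def)
  have p: "p \<in> linear_maps W Q" unfolding p_def Q_def by (rule linear_coset[OF U])
  note pD = linear_mapsD[OF p]
  have p0: "p x = \<zero>\<^bsub>Q\<^esub> \<longleftrightarrow> x \<in> U" if "x \<in> carrier W" for x
    unfolding p_def Q_def by (rule coset_zero_iff[OF U that])
  have plc: "p (lc W c x F) = lc Q c (\<lambda>i. p (x i)) F" if "\<And>i. i \<in> F \<Longrightarrow> x i \<in> carrier W"
    for c F and x :: "'w \<Rightarrow> 'w"
    by (rule linear_lc[OF real_space_axioms Q.real_space_axioms p that])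
  obtain B' where B': "finite_basis Q B'" "p ` L = generate (add_monoid Q) B'"
    using lat by (auto simp: is_lattice_def)
  have fB': "finite B'" "B' \<subseteq> carrier Q" "lin_span Q B' = carrier Q"
    and indB': "\<And>c. lc Q c (\<lambda>b. b) B' = \<zero>\<^bsub>Q\<^esub> \<Longrightarrow> \<forall>b\<in>B'. c b = 0"
    using B' by (auto simp: finite_basis_def lc_def)
  have "\<forall>X\<in>B'. \<exists>l\<in>L. p l = X"
  proof
    fix X assume "X \<in> B'"
    then have "X \<in> p ` L" unfolding B'(2) by (rule generate.incl)
    then show "\<exists>l\<in>L. p l = X" by auto
  qed
  then obtain r where r: "\<And>X. X \<in> B' \<Longrightarrow> r X \<in> L \<and> p (r X) = X" by metis
  define B where "B = r ` B'"
  have B: "finite B" "B \<subseteq> L" using fB' r by (auto simp: B_def)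
  then have Bc: "\<And>b. b \<in> B \<Longrightarrow> b \<in> carrier W" using Lc by auto
  have injp: "inj_on p B" using r by (auto simp: B_def inj_on_def)
  have pB: "p ` B = B'" using r by (force simp: B_def)
  have lcQ: "lc Q c (\<lambda>b. b) B' = p (lc W (\<lambda>b. c (p b)) (\<lambda>b. b) B)" for c
  proof -
    have "lc Q c (\<lambda>b. b) (p ` B) = lc Q (\<lambda>b. c (p b)) (\<lambda>b. p b) B"
      by (rule Q.lc_reindex[OF injp]) (use pD Bc in auto)
    also have "\<dots> = p (lc W (\<lambda>b. c (p b)) (\<lambda>b. b) B)" by (rule plc[symmetric]) (use Bc in auto)
    finally show ?thesis by (simp add: pB)
  qed
  have lift: "\<exists>t. w = t \<odot> e \<oplus> lc W c (\<lambda>b. b) B" if w: "w \<in> carrier W" and "p w = p (lc W c (\<lambda>b. b) B)" for w c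
  proof -
    let ?l = "lc W c (\<lambda>b. b) B"
    have l: "?l \<in> carrier W" using Bc by auto
    then have "w \<oplus> (-1) \<odot> ?l \<in> U"
      using that coset_eq_iff[OF U w l] by (auto simp: p_def)
    then obtain t where t: "w \<oplus> (-1) \<odot> ?l = t \<odot> e" by (auto simp: Ue)
    have "w = (w \<oplus> (-1) \<odot> ?l) \<oplus> ?l" using w l by (simp add: a_assoc sm_diff)
    then show ?thesis using t by auto
  qed
  have span: "\<exists>t c. w = t \<odot> e \<oplus> lc W c (\<lambda>b. b) B" if w: "w \<in> carrier W" for w
  proof -
    have "p w \<in> lin_span Q B'" using pD w fB' by auto
    then obtain c where "p w = lc Q c (\<lambda>b. b) B'" using Q.lin_span_finite[OF fB'(1,2)] by auto
    then show ?thesis using lift[OF w, of "\<lambda>b. c (p b)"] by (auto simp: lcQ)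
  qed
  have ind: "t = 0 \<and> (\<forall>b\<in>B. c b = 0)" if *: "t \<odot> e \<oplus> lc W c (\<lambda>b. b) B = \<zero>" for t c
  proof -
    define c' where "c' = (\<lambda>X. c (inv_into B p X))"
    have "lc W (\<lambda>b. c' (p b)) (\<lambda>b. b) B = lc W c (\<lambda>b. b) B"
      by (rule lc_cong) (use Bc injp in \<open>auto simp: c'_def\<close>)
    then have "lc Q c' (\<lambda>b. b) B' = p (lc W c (\<lambda>b. b) B)" by (simp add: lcQ)
    moreover have "lc W c (\<lambda>b. b) B = (-t) \<odot> e"
    proof -
      have l: "lc W c (\<lambda>b. b) B \<in> carrier W" using Bc by auto
      have "(-t) \<odot> e = (-t) \<odot> e \<oplus> (t \<odot> e \<oplus> lc W c (\<lambda>b. b) B)" using * e by simp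
      also have "\<dots> = lc W c (\<lambda>b. b) B"
        using e l by (simp add: a_assoc[symmetric] sm_add_left[symmetric])
      finally show ?thesis by simp
    qed
    ultimately have "lc Q c' (\<lambda>b. b) B' = \<zero>\<^bsub>Q\<^esub>" using p0[of "(-t) \<odot> e"] e by (auto simp: Ue)
    then have "\<forall>X\<in>B'. c' X = 0" by (rule indB')
    then have c0: "\<forall>b\<in>B. c b = 0" using injp by (auto simp: c'_def simp flip: pB)
    then have "lc W c (\<lambda>b. b) B = \<zero>" using Bc by (intro lc_zero) auto
    then have "t \<odot> e = \<zero>" using * e by simp
    then show ?thesis using e c0 by simp
  qed
  have VL: "v \<odot> e \<in> L" if "v \<in> V" for v using LU that by auto
  have Leq: "L = {v \<odot> e \<oplus> lc W (\<lambda>b. of_int (m b)) (\<lambda>b. b) B | v m. v \<in> V}" (is "_ = ?R")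
  proof
    show "?R \<subseteq> L"
    proof
      fix l assume "l \<in> ?R"
      then obtain v m where vm: "v \<in> V" "l = v \<odot> e \<oplus> lc W (\<lambda>b. of_int (m b)) (\<lambda>b. b) B"
        by auto
      have "lc W (\<lambda>b. of_int (m b)) (\<lambda>b. b) B \<in> L"
        by (rule lc_int_in_subgroup[OF Lsub B(1)]) (use B(2) in auto)
      then show "l \<in> L" using VL[OF vm(1)] vm(2) subgroup_add[OF Lsub] by simp
    qed
    show "L \<subseteq> ?R"
    proof
      fix l assume l: "l \<in> L"
      then have "p l \<in> generate (add_monoid Q) B'" using B' by blast
      then obtain m :: "_ \<Rightarrow> int" where "p l = lc Q (\<lambda>s. of_int (m s)) (\<lambda>s. s) B'"
        using Q.generate_eq_lc[OF fB'(1,2)] by auto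
      then obtain t where t: "l = t \<odot> e \<oplus> lc W (\<lambda>b. of_int (m (p b))) (\<lambda>b. b) B"
        using lift[OF Lc[OF l], of "\<lambda>b. of_int (m (p b))"] by (auto simp: lcQ)
      let ?k = "lc W (\<lambda>b. of_int (m (p b))) (\<lambda>b. b) B"
      have k: "?k \<in> L" by (rule lc_int_in_subgroup[OF Lsub B(1)]) (use B(2) in auto)
      \<comment> \<open>Subtracting the integral combination leaves a multiple of \<open>e\<close>
        that still lies in \<open>L\<close>, hence a multiple by an element of
        \<open>V\<close>.\<close>
      have "l \<oplus> (-1) \<odot> ?k \<in> L"
        using subgroup_of_int[OF Lsub k, of "-1"] l by (auto intro: subgroup_add[OF Lsub])
      also have "l \<oplus> (-1) \<odot> ?k = t \<odot> e"
        unfolding t using e Lc[OF k] by (simp add: a_assoc sm_diff)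
      finally have "t \<odot> e \<in> L \<inter> U" by (auto simp: Ue)
      then obtain v where "v \<in> V" "t \<odot> e = v \<odot> e" using LU by auto
      then show "l \<in> ?R" using t by auto
    qed
  qed
  have "adapted_basis V W L e B"
    unfolding adapted_basis_def using B Bc e span ind Leq by blast
  then show thesis by (rule that)
qed

end

section \<open>Coordinates with respect to an adapted basis\<close>

locale adapted = real_space W for W :: "(real, 'w) module" (structure) +
  fixes V :: "real set" and L :: "'w set" and e :: 'w and B :: "'w set"
  assumes V: "value_subgroup V" and adapted: "adapted_basis V W L e B"
begin

lemma finite_B: "finite B" and B_carrier: "B \<subseteq> carrier W" and e_carrier [simp]: "e \<in> carrier W"
  and span: "w \<in> carrier W \<Longrightarrow> \<exists>t c. w = t \<odot> e \<oplus> lc W c (\<lambda>b. b) B"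
  and indep: "t \<odot> e \<oplus> lc W c (\<lambda>b. b) B = \<zero> \<Longrightarrow> t = 0 \<and> (\<forall>b\<in>B. c b = 0)"
  and L_eq: "L = {v \<odot> e \<oplus> lc W (\<lambda>b. of_int (m b)) (\<lambda>b. b) B | v m. v \<in> V}"
  using adapted by (auto simp: adapted_basis_def)

lemma V_zero: "0 \<in> V" and V_add: "x \<in> V \<Longrightarrow> y \<in> V \<Longrightarrow> x + y \<in> V" and V_neg: "x \<in> V \<Longrightarrow> - x \<in> V"
  using V by (auto simp: value_subgroup_def)

lemma B_closed [simp]: "b \<in> B \<Longrightarrow> b \<in> carrier W"
  using B_carrier by auto

lemma lcB_closed [simp]: "lc W c (\<lambda>b. b) B \<in> carrier W"
  by simp

lemma L_carrier: "L \<subseteq> carrier W"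
  unfolding L_eq by auto

lemma L_closed [simp]: "l \<in> L \<Longrightarrow> l \<in> carrier W"
  using L_carrier by auto

lemma L_I: "v \<in> V \<Longrightarrow> v \<odot> e \<oplus> lc W (\<lambda>b. of_int (m b)) (\<lambda>b. b) B \<in> L"
  unfolding L_eq by (rule CollectI) auto

lemma L_E:
  assumes "l \<in> L"
  obtains v m where "v \<in> V" "l = v \<odot> e \<oplus> lc W (\<lambda>b. of_int (m b)) (\<lambda>b. b) B"
  using assms unfolding L_eq by auto

lemma e_nonzero: "e \<noteq> \<zero>"
  using indep[of 1 "\<lambda>_. 0"] lc_zero[of B "\<lambda>_. 0" "\<lambda>b. b"] by auto

lemma V_e_in_L: "v \<in> V \<Longrightarrow> v \<odot> e \<in> L"
  using L_I[of v "\<lambda>_. 0"] lc_zero[of B "\<lambda>_. 0" "\<lambda>b. b"] by simp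

lemma B_in_L: "b \<in> B \<Longrightarrow> b \<in> L"
proof -
  assume b: "b \<in> B"
  have "lc W (\<lambda>i. of_int (if i = b then 1 else 0)) (\<lambda>s. s) B = lc W (\<lambda>i. if i = b then 1 else 0) (\<lambda>s. s) B"
    by (rule lc_cong) auto
  also have "\<dots> = b" using finite_B b by (subst lc_single) auto
  finally show ?thesis using L_I[OF V_zero, of "\<lambda>i. if i = b then 1 else 0"] b by simp
qed

lemma subgroup_L: "subgroup L (add_monoid W)"
proof (rule subgroupI_real[OF L_carrier])
  show "\<zero> \<in> L" using V_e_in_L[OF V_zero] by simp
next
  fix x y assume "x \<in> L" "y \<in> L"
  then obtain v m v' m' where x: "v \<in> V" "x = v \<odot> e \<oplus> lc W (\<lambda>b. of_int (m b)) (\<lambda>b. b) B"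
    and y: "v' \<in> V" "y = v' \<odot> e \<oplus> lc W (\<lambda>b. of_int (m' b)) (\<lambda>b. b) B"
    by (metis L_E)
  have "x \<oplus> y = (v \<odot> e \<oplus> v' \<odot> e) \<oplus> (lc W (\<lambda>b. of_int (m b)) (\<lambda>b. b) B \<oplus> lc W (\<lambda>b. of_int (m' b)) (\<lambda>b. b) B)"
    by (simp add: x y add.m_ac)
  also have "\<dots> = (v + v') \<odot> e \<oplus> lc W (\<lambda>b. of_int (m b + m' b)) (\<lambda>b. b) B"
    by (simp add: lc_add sm_add_left)
  also have "\<dots> \<in> L" using x y by (intro L_I V_add)
  finally show "x \<oplus> y \<in> L" .
next
  fix x assume "x \<in> L"
  then obtain v m where x: "v \<in> V" "x = v \<odot> e \<oplus> lc W (\<lambda>b. of_int (m b)) (\<lambda>b. b) B"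
    by (metis L_E)
  have "(-1) \<odot> x = (- v) \<odot> e \<oplus> lc W (\<lambda>b. of_int (- m b)) (\<lambda>b. b) B"
    by (simp add: x lc_sm sm_add_right)
  also have "\<dots> \<in> L" using x by (intro L_I V_neg)
  finally show "(-1) \<odot> x \<in> L" .
qed

lemma unique:
  assumes "t \<odot> e \<oplus> lc W c (\<lambda>b. b) B = t' \<odot> e \<oplus> lc W c' (\<lambda>b. b) B"
  shows "t = t'" "\<And>b. b \<in> B \<Longrightarrow> c b = c' b"
proof -
  have "\<zero> = (-1) \<odot> (t \<odot> e \<oplus> lc W c (\<lambda>b. b) B) \<oplus> (t' \<odot> e \<oplus> lc W c' (\<lambda>b. b) B)"
    unfolding assms by (simp add: sm_diff)
  also have "\<dots> = ((- t) \<odot> e \<oplus> t' \<odot> e) \<oplus> (lc W (\<lambda>b. - c b) (\<lambda>b. b) B \<oplus> lc W c' (\<lambda>b. b) B)"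
    by (simp add: sm_add_right lc_sm add.m_ac)
  also have "\<dots> = (- t + t') \<odot> e \<oplus> lc W (\<lambda>b. - c b + c' b) (\<lambda>b. b) B"
    by (simp add: sm_add_left[symmetric] lc_add)
  finally show "t = t'" "\<And>b. b \<in> B \<Longrightarrow> c b = c' b"
    using indep[of "- t + t'" "\<lambda>b. - c b + c' b"] by force+
qed

lemma L_line: "t \<odot> e \<in> L \<longleftrightarrow> t \<in> V"
proof
  assume "t \<odot> e \<in> L"
  then obtain v m where "v \<in> V" "t \<odot> e = v \<odot> e \<oplus> lc W (\<lambda>b. of_int (m b)) (\<lambda>b. b) B"
    by (metis L_E)
  moreover have "t \<odot> e = t \<odot> e \<oplus> lc W (\<lambda>_. 0) (\<lambda>b. b) B" by (simp add: lc_zero)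
  ultimately show "t \<in> V" using unique(1) by metis
qed (rule V_e_in_L)

lemma pow_L: "x \<in> carrier W \<Longrightarrow> x [^]\<^bsub>(add_monoid W)\<lparr>carrier := L\<rparr>\<^esub> (n :: nat) = real n \<odot> x"
  by (induction n) (auto simp: sm_add_left a_comm)

text \<open>Needed to recognise lattices that are built rather than given: the realification only
  comes with an adapted basis, from which the defining conditions of a lattice in a vector space
  must be recovered.\<close>

lemma imp_V_lattice_in: "V_lattice_in V W L e"
proof -
  let ?LG = "(add_monoid W)\<lparr>carrier := L\<rparr>"
  have LG: "comm_group ?LG"
    using add.subgroup_imp_group[OF subgroup_L]
    by (rule group.group_comm_groupI) (simp add: a_comm)
  have tf: "torsion_free_group ?LG"
    unfolding torsion_free_group_def
  proof (intro ballI allI impI)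
    fix x and n :: nat assume x: "x \<in> carrier ?LG" "0 < n" "x [^]\<^bsub>?LG\<^esub> n = \<one>\<^bsub>?LG\<^esub>"
    then have "real n \<odot> x = \<one>\<^bsub>?LG\<^esub>" using pow_L[of x n] by (metis L_closed partial_object.select_convs(1) partial_object.surjective partial_object.update_convs(1))
    then show "x = \<one>\<^bsub>?LG\<^esub>" using x by simp
  qed
  have gen: "generate ?LG (B \<union> (\<lambda>x. x \<odot> e) ` V) = carrier ?LG"
  proof -
    let ?S = "B \<union> (\<lambda>x. x \<odot> e) ` V"
    have S: "?S \<subseteq> L" using B_in_L V_e_in_L by auto
    have eq: "generate ?LG ?S = generate (add_monoid W) ?S"
      by (rule add.generate_consistent[OF S subgroup_L])
    have sg: "subgroup (generate (add_monoid W) ?S) (add_monoid W)"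
      by (rule add.generate_is_subgroup) (use S L_carrier in auto)
    have "l \<in> generate (add_monoid W) ?S" if l: "l \<in> L" for l
    proof -
      obtain v m where vm: "v \<in> V" "l = v \<odot> e \<oplus> lc W (\<lambda>b. of_int (m b)) (\<lambda>b. b) B"
        using l by (rule L_E)
      have "v \<odot> e \<in> generate (add_monoid W) ?S" by (rule generate.incl[OF UnI2[OF imageI[OF vm(1)]]])
      moreover have "lc W (\<lambda>b. of_int (m b)) (\<lambda>b. b) B \<in> generate (add_monoid W) ?S"
        by (rule lc_int_in_subgroup[OF sg finite_B]) (rule generate.incl[OF UnI1])
      ultimately show ?thesis unfolding vm by (rule subgroup_add[OF sg])
    qed
    moreover have "generate (add_monoid W) ?S \<subseteq> L"
      by (rule add.generate_subgroup_incl[OF S subgroup_L])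
    ultimately show ?thesis unfolding eq by auto
  qed
  have "V_lattice V ?LG (\<lambda>x. x \<odot> e)"
    unfolding V_lattice_def
  proof (intro conjI)
    show "(\<lambda>x. x \<odot> e) \<in> monoid_hom \<lparr>carrier = V, mult = (+), one = 0\<rparr> ?LG"
      by (auto simp: monoid_hom_def hom_def V_e_in_L sm_add_left)
    show "inj_on (\<lambda>x. x \<odot> e) V" using sm_inj[OF e_carrier e_nonzero] by (auto simp: inj_on_def)
    show "\<exists>A. finite A \<and> A \<subseteq> carrier ?LG \<and> generate ?LG (A \<union> (\<lambda>x. x \<odot> e) ` V) = carrier ?LG"
      using finite_B B_in_L gen by (intro exI[of _ B]) auto
  qed (use LG tf in auto)
  moreover
  define U where "U = lin_span W {e}"
  define Q where "Q = quot_vs W U"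
  define p where "p = (\<lambda>x. U +> x)"
  have Ue: "U = {t \<odot> e | t. True}" unfolding U_def by (rule lin_span_singleton) simp
  have "L \<inter> U = (\<lambda>x. x \<odot> e) ` V" by (auto simp: Ue L_line V_e_in_L)
  moreover have "is_lattice Q (p ` L)"
  proof -
    have U: "real_subspace W U" unfolding U_def by (rule real_subspace_lin_span) simp
    interpret Q: real_space Q using real_vs_quot_vs[OF U] by unfold_locales (simp add: Q_def)
    have p: "p \<in> linear_maps W Q" unfolding p_def Q_def by (rule linear_coset[OF U])
    note pD = linear_mapsD[OF p]
    have p0: "p x = \<zero>\<^bsub>Q\<^esub> \<longleftrightarrow> x \<in> U" if "x \<in> carrier W" for x
      unfolding p_def Q_def by (rule coset_zero_iff[OF U that])
    have plc: "p (lc W c x F) = lc Q c (\<lambda>i. p (x i)) F" if "\<And>i. i \<in> F \<Longrightarrow> x i \<in> carrier W"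
      for c F and x :: "'w \<Rightarrow> 'w"
      by (rule linear_lc[OF real_space_axioms Q.real_space_axioms p that])
    have pe: "p (t \<odot> e \<oplus> w) = p w" if "w \<in> carrier W" for t w
    proof -
      have "p (t \<odot> e) = \<zero>\<^bsub>Q\<^esub>" using p0[of "t \<odot> e"] by (auto simp: Ue)
      then show ?thesis using that pD by simp
    qed
    have indQ: "\<forall>b\<in>B. c b = 0" if "lc Q c p B = \<zero>\<^bsub>Q\<^esub>" for c
    proof -
      have "p (lc W c (\<lambda>b. b) B) = \<zero>\<^bsub>Q\<^esub>" using that by (simp add: plc)
      then obtain t where t: "lc W c (\<lambda>b. b) B = t \<odot> e" using p0 by (auto simp: Ue)
      have "(- t) \<odot> e \<oplus> lc W c (\<lambda>b. b) B = \<zero>"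
        unfolding t by (simp add: sm_add_left[symmetric])
      then show ?thesis by (rule conjunct2[OF indep])
    qed
    have injp: "inj_on p B"
    proof (rule inj_onI, rule ccontr)
      fix b b' assume b: "b \<in> B" "b' \<in> B" "p b = p b'" "b \<noteq> b'"
      \<comment> \<open>Two basis vectors with the same image would give the relation with
        coefficients \<open>1\<close> and \<open>- 1\<close> in the quotient, against independence
        modulo the line.\<close>
      have "lc Q (\<lambda>i. (if i = b then 1 else 0) + (if i = b' then -1 else 0)) p B
          = lc Q (\<lambda>i. if i = b then 1 else 0) p B \<oplus>\<^bsub>Q\<^esub> lc Q (\<lambda>i. if i = b' then -1 else 0) p B"
        by (subst Q.lc_add) (auto simp: pD)
      also have "\<dots> = 1 \<odot>\<^bsub>Q\<^esub> p b \<oplus>\<^bsub>Q\<^esub> (- 1) \<odot>\<^bsub>Q\<^esub> p b'"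
        using b finite_B by (subst (1 2) Q.lc_single) (auto simp: pD)
      also have "\<dots> = \<zero>\<^bsub>Q\<^esub>"
        using b pD(1)[of b'] by (simp add: Q.sm_diff)
      finally show False using indQ b by fastforce
    qed
    have lcQ: "lc Q c (\<lambda>b. b) (p ` B) = p (lc W (\<lambda>b. c (p b)) (\<lambda>b. b) B)" for c
      using Q.lc_reindex[OF injp, of "\<lambda>b. b" c] by (simp add: pD plc)
    have pB: "p ` B \<subseteq> carrier Q" by (auto simp: pD)
    have fpB: "finite (p ` B)" using finite_B by simp
    have lcQ': "p (lc W c (\<lambda>b. b) B) = lc Q (\<lambda>X. c (inv_into B p X)) (\<lambda>b. b) (p ` B)" for c
    proof -
      have "lc W (\<lambda>b. c (inv_into B p (p b))) (\<lambda>b. b) B = lc W c (\<lambda>b. b) B"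
        by (rule lc_cong) (use injp in auto)
      then show ?thesis by (simp add: lcQ)
    qed
    have "finite_basis Q (p ` B)"
      unfolding finite_basis_def lc_def[symmetric]
    proof (intro conjI allI impI fpB pB)
      show "lin_span Q (p ` B) = carrier Q"
      proof (rule equalityI[OF Q.lin_span_closed[OF pB]], rule subsetI)
        fix X assume "X \<in> carrier Q"
        then obtain x where x: "x \<in> carrier W" "X = p x"
          by (auto simp: Q_def p_def carrier_quot_vs)
        then obtain t c where "x = t \<odot> e \<oplus> lc W c (\<lambda>b. b) B" using span by metis
        then have "X = p (lc W c (\<lambda>b. b) B)" using x pe by simp
        then show "X \<in> lin_span Q (p ` B)"
          using lcQ' by (auto simp: Q.lin_span_finite[OF fpB pB])
      qed
      fix c assume "lc Q c (\<lambda>b. b) (p ` B) = \<zero>\<^bsub>Q\<^esub>"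
      then have "lc Q (\<lambda>b. c (p b)) p B = \<zero>\<^bsub>Q\<^esub>" by (simp add: lcQ plc)
      then show "\<forall>b\<in>p ` B. c b = 0" using indQ by auto
    qed
    moreover have "p ` L = generate (add_monoid Q) (p ` B)"
      unfolding Q.generate_eq_lc[OF fpB pB]
    proof (intro equalityI subsetI)
      fix X assume "X \<in> p ` L"
      then obtain v m where "v \<in> V" "X = p (v \<odot> e \<oplus> lc W (\<lambda>b. of_int (m b)) (\<lambda>b. b) B)"
        by (metis L_E imageE)
      then have "X = lc Q (\<lambda>X. of_int (m (inv_into B p X))) (\<lambda>b. b) (p ` B)"
        by (simp add: pe lcQ')
      then show "X \<in> {lc Q (\<lambda>s. of_int (m s)) (\<lambda>s. s) (p ` B) |m. True}"
        by (intro CollectI exI[of _ "\<lambda>X. m (inv_into B p X)"]) simp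
    next
      fix X assume "X \<in> {lc Q (\<lambda>s. of_int (m s)) (\<lambda>s. s) (p ` B) |m. True}"
      then obtain m where "X = p (lc W (\<lambda>b. of_int (m (p b))) (\<lambda>b. b) B)" by (auto simp: lcQ)
      then have "X = p (0 \<odot> e \<oplus> lc W (\<lambda>b. of_int (m (p b))) (\<lambda>b. b) B)" by simp
      then show "X \<in> p ` L" using L_I[OF V_zero] by auto
    qed
    ultimately show ?thesis unfolding is_lattice_def by blast
  qed
  ultimately show ?thesis
    using subgroup_L e_nonzero by (simp add: V_lattice_in_def U_def Q_def p_def)
qed

end

section \<open>Special cones in terms of spanning sets\<close>

lemma openin_finite_conj:
  assumes "finite A" "\<And>a. a \<in> A \<Longrightarrow> openin X {c \<in> topspace X. P a c}"
  shows "openin X {c \<in> topspace X. \<forall>a\<in>A. P a c}"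
  using assms
proof (induction A)
  case (insert a A)
  have "{c \<in> topspace X. \<forall>a\<in>insert a A. P a c} = {c \<in> topspace X. P a c} \<inter> {c \<in> topspace X. \<forall>a\<in>A. P a c}"
    by auto
  with insert show ?case by (simp add: openin_Int)
qed auto

context real_space
begin

text \<open>The strictly positive combinations of a spanning set form an open subset. Coefficients
  over \<open>A\<close> are not unique, so openness is checked around one point at a time: one
  positive representation is fixed and perturbed along with the point.\<close>

lemma interior_cone_hull_nonempty:
  assumes A: "finite A" "A \<subseteq> carrier W" and span: "lin_span W A = carrier W"
  shows "(vs_topology W) interior_of (cone_hull W A) \<noteq> {}"
proof -
  define U where "U = {lc W c (\<lambda>a. a) A | c. \<forall>a\<in>A. 0 < c a}"
  have Ac: "\<And>a. a \<in> A \<Longrightarrow> a \<in> carrier W" using A by auto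
  have "vs_open W U"
    unfolding vs_open_def lc_def[symmetric]
  proof (intro conjI allI impI)
    show "U \<subseteq> carrier W" using Ac by (auto simp: U_def intro!: lc_closed)
    fix n :: nat and w :: "nat \<Rightarrow> 'w" assume w: "w ` {..<n} \<subseteq> carrier W"
    have "\<forall>i\<in>{..<n}. \<exists>d. w i = lc W d (\<lambda>a. a) A"
      using w span by (auto simp: lin_span_finite[OF A])
    then obtain d where d: "\<And>i. i < n \<Longrightarrow> w i = lc W (d i) (\<lambda>a. a) A" by (metis lessThan_iff)
    let ?E = "Euclidean_space n" and ?S = "{c \<in> topspace (Euclidean_space n). lc W c w {..<n} \<in> U}"
    have cw: "lc W c w {..<n} = lc W (\<lambda>a. \<Sum>i<n. c i * d i a) (\<lambda>a. a) A" for c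
    proof -
      have "lc W c w {..<n} = lc W c (\<lambda>i. lc W (d i) (\<lambda>a. a) A) {..<n}"
        by (rule lc_cong) (use d Ac in auto)
      also have "\<dots> = lc W (\<lambda>a. \<Sum>i<n. c i * d i a) (\<lambda>a. a) A"
        by (rule lc_lc) (use A Ac in auto)
      finally show ?thesis .
    qed
    have "\<exists>T. openin ?E T \<and> c \<in> T \<and> T \<subseteq> ?S" if "c \<in> ?S" for c
    proof -
      have c: "c \<in> topspace ?E" "lc W c w {..<n} \<in> U" using that by auto
      then obtain \<mu> where \<mu>: "lc W c w {..<n} = lc W \<mu> (\<lambda>a. a) A" "\<forall>a\<in>A. 0 < \<mu> a" by (auto simp: U_def)
      \<comment> \<open>When \<open>c\<close> moves to \<open>c'\<close>, the chosen coefficients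
        \<open>\<mu>\<close> move by a linear function of \<open>c' - c\<close>, through fixed
        representations \<open>d\<close> of the vectors \<open>w i\<close>; \<open>T\<close> is the
        region where they all stay positive.\<close>
      define T where "T = {c' \<in> topspace ?E. \<forall>a\<in>A. 0 < \<mu> a + (\<Sum>i<n. (c' i - c i) * d i a)}"
      have "openin ?E T"
        unfolding T_def
      proof (rule openin_finite_conj[OF A(1)])
        fix a
        have "continuous_map ?E euclideanreal (\<lambda>c'. c' i)" for i
          unfolding Euclidean_space_def
          by (rule continuous_map_from_subtopology) (rule continuous_map_product_projection, simp)
        then have "continuous_map ?E euclideanreal (\<lambda>c'. \<mu> a + (\<Sum>i<n. (c' i - c i) * d i a))"
          by (intro continuous_intros) auto
        then have "openin ?E {c' \<in> topspace ?E. \<mu> a + (\<Sum>i<n. (c' i - c i) * d i a) \<in> {0<..}}"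
          by (rule openin_continuous_map_preimage) simp
        then show "openin ?E {c' \<in> topspace ?E. 0 < \<mu> a + (\<Sum>i<n. (c' i - c i) * d i a)}" by simp
      qed
      moreover have "c \<in> T" using c \<mu> by (simp add: T_def)
      moreover have "T \<subseteq> ?S"
      proof
        fix c' assume c': "c' \<in> T"
        have "lc W c' w {..<n} = lc W c w {..<n} \<oplus> lc W (\<lambda>i. c' i - c i) w {..<n}"
          using w by (subst lc_add) auto
        also have "\<dots> = lc W (\<lambda>a. \<mu> a + (\<Sum>i<n. (c' i - c i) * d i a)) (\<lambda>a. a) A"
          unfolding \<mu>(1) cw[of "\<lambda>i. c' i - c i"] using Ac by (simp add: lc_add)
        also have "\<dots> \<in> U" using c' unfolding T_def U_def by auto
        finally show "c' \<in> ?S" using c' by (auto simp: T_def)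
      qed
      ultimately show ?thesis by blast
    qed
    then show "openin ?E ?S" by (subst openin_subopen) blast
  qed
  moreover have "U \<subseteq> cone_hull W A"
    unfolding U_def cone_hull_finite[OF A] by (auto intro: less_imp_le)
  ultimately have "U \<subseteq> (vs_topology W) interior_of (cone_hull W A)"
    by (simp add: interior_of_maximal openin_vs_topology)
  moreover have "lc W (\<lambda>_. 1) (\<lambda>a. a) A \<in> U" unfolding U_def by (intro CollectI exI[of _ "\<lambda>_. 1"]) simp
  ultimately show ?thesis by blast
qed

text \<open>From an interior point one can move a little in every direction \<open>x\<close> without
  leaving the cone; the difference of the two points is a nonzero multiple of \<open>x\<close> in
  the span.\<close>

lemma lin_span_of_interior_nonempty:
  assumes A: "A \<subseteq> carrier W" and int: "(vs_topology W) interior_of (cone_hull W A) \<noteq> {}"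
  shows "lin_span W A = carrier W"
proof (rule equalityI[OF lin_span_closed[OF A]], rule subsetI)
  fix x assume x: "x \<in> carrier W"
  obtain u where "u \<in> (vs_topology W) interior_of (cone_hull W A)" using int by blast
  then obtain U where U: "vs_open W U" "u \<in> U" "U \<subseteq> cone_hull W A"
    by (auto simp: interior_of_def openin_vs_topology)
  have u: "u \<in> carrier W" using U by (auto simp: vs_open_def)
  define w where "w i = (if i = 0 then u else x)" for i :: nat
  \<comment> \<open>The topology is tested on maps from Euclidean spaces. The curve with coordinates
    \<open>1\<close> and \<open>s\<close> traces the line \<open>u \<oplus> s \<odot> x\<close>
    under the vectors \<open>u\<close> and \<open>x\<close>; the other coordinates are zero because
    points of \<open>Euclidean_space 2\<close> vanish beyond the second coordinate.\<close>
  define \<gamma> where "\<gamma> s = (\<lambda>i::nat. if i < 2 then (if i = 0 then 1 else s) else 0)" for s :: real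
  have w: "w ` {..<2} \<subseteq> carrier W" using x u by (auto simp: w_def)
  let ?S = "{c \<in> topspace (Euclidean_space 2). lc W c w {..<2} \<in> U}"
  have "openin (Euclidean_space 2) ?S" using U(1) w by (simp add: vs_open_def lc_def)
  moreover have "continuous_map euclideanreal (Euclidean_space 2) \<gamma>"
    unfolding \<gamma>_def continuous_map_componentwise_Euclidean_space by auto
  ultimately have "openin euclideanreal {s \<in> topspace euclideanreal. \<gamma> s \<in> ?S}"
    by (intro openin_continuous_map_preimage)
  moreover have lc\<gamma>: "lc W (\<gamma> s) w {..<2} = u \<oplus> s \<odot> x" for s
    using x u by (simp add: \<gamma>_def w_def numeral_2_eq_2 lessThan_Suc lc_insert a_comm)
  have top: "\<gamma> s \<in> topspace (Euclidean_space 2)" for s by (simp add: topspace_Euclidean_space \<gamma>_def)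
  ultimately have "open {s. u \<oplus> s \<odot> x \<in> U}" by (simp add: top lc\<gamma>)
  moreover have "0 \<in> {s. u \<oplus> s \<odot> x \<in> U}" using u x U by simp
  ultimately obtain r where r: "r > 0" "ball 0 r \<subseteq> {s. u \<oplus> s \<odot> x \<in> U}"
    by (meson open_contains_ball)
  define s where "s = r / 2"
  have "s \<in> ball 0 r" using r by (simp add: s_def)
  then have s: "s \<noteq> 0" "u \<oplus> s \<odot> x \<in> U" using r(1) subsetD[OF r(2)] by (auto simp: s_def)
  have us: "u \<in> lin_span W A" "u \<oplus> s \<odot> x \<in> lin_span W A"
    using s U cone_hull_subset_lin_span by auto
  have "(-1) \<odot> u \<oplus> (u \<oplus> s \<odot> x) \<in> lin_span W A"
    by (intro lin_span_add lin_span_sm A us)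
  also have "(-1) \<odot> u \<oplus> (u \<oplus> s \<odot> x) = s \<odot> x"
    using u x by (simp add: a_assoc[symmetric] sm_diff)
  finally have "(1 / s) \<odot> (s \<odot> x) \<in> lin_span W A" by (rule lin_span_sm[OF A])
  then show "x \<in> lin_span W A" using s x by simp
qed

end

text \<open>Replaces the lattice condition and the topological condition by finite algebraic data, a
  basis \<open>B\<close> and a spanning set \<open>A\<close> of generators; from here on the
  topology does not occur.\<close>

lemma special_cone_iff:
  assumes V: "value_subgroup (value_group R \<phi>)"
  shows "special_cone R \<phi> s \<longleftrightarrow> real_vs (vspace s) \<and>
    (\<exists>B. adapted_basis (value_group R \<phi>) (vspace s) (lat s) (vunit s) B) \<and>
    (\<exists>A. finite A \<and> A \<subseteq> lat s \<and> cset s = cone_hull (vspace s) A \<and> lin_span (vspace s) A = carrier (vspace s)) \<and>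
    (\<forall>\<pi>\<in>carrier R - {\<one>\<^bsub>R\<^esub>}. vvec R \<phi> s \<pi> \<in> cset s)"
proof (cases "real_vs (vspace s)")
  case True
  then interpret real_space "vspace s" by unfold_locales
  have lat: "V_lattice_in (value_group R \<phi>) (vspace s) (lat s) (vunit s) \<longleftrightarrow>
    (\<exists>B. adapted_basis (value_group R \<phi>) (vspace s) (lat s) (vunit s) B)"
  proof
    assume "V_lattice_in (value_group R \<phi>) (vspace s) (lat s) (vunit s)"
    then show "\<exists>B. adapted_basis (value_group R \<phi>) (vspace s) (lat s) (vunit s) B"
      using V_lattice_in_imp_adapted_basis[OF V] by metis
  next
    assume "\<exists>B. adapted_basis (value_group R \<phi>) (vspace s) (lat s) (vunit s) B"
    then obtain B where "adapted_basis (value_group R \<phi>) (vspace s) (lat s) (vunit s) B" ..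
    then interpret adapted "vspace s" "value_group R \<phi>" "lat s" "vunit s" B
      using V by unfold_locales
    show "V_lattice_in (value_group R \<phi>) (vspace s) (lat s) (vunit s)" by (rule imp_V_lattice_in)
  qed
  have carr: "lat s \<subseteq> carrier (vspace s)"
    if "V_lattice_in (value_group R \<phi>) (vspace s) (lat s) (vunit s)"
    using that subgroup.subset by (fastforce simp: V_lattice_in_def)
  have "(\<exists>A. finite A \<and> A \<subseteq> lat s \<and> cset s = cone_hull (vspace s) A \<and> lin_span (vspace s) A = carrier (vspace s))
    \<longleftrightarrow> (\<exists>A. finite A \<and> A \<subseteq> lat s \<and> cset s = cone_hull (vspace s) A) \<and>
      (vs_topology (vspace s)) interior_of (cset s) \<noteq> {}"
    if "V_lattice_in (value_group R \<phi>) (vspace s) (lat s) (vunit s)"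
  proof
    assume "\<exists>A. finite A \<and> A \<subseteq> lat s \<and> cset s = cone_hull (vspace s) A \<and> lin_span (vspace s) A = carrier (vspace s)"
    then obtain A where A: "finite A" "A \<subseteq> lat s" "cset s = cone_hull (vspace s) A" "lin_span (vspace s) A = carrier (vspace s)"
      by auto
    have "A \<subseteq> carrier (vspace s)" using A carr[OF that] by auto
    then show "(\<exists>A. finite A \<and> A \<subseteq> lat s \<and> cset s = cone_hull (vspace s) A) \<and>
      (vs_topology (vspace s)) interior_of (cset s) \<noteq> {}"
      using A interior_cone_hull_nonempty[OF A(1)] by auto
  next
    assume *: "(\<exists>A. finite A \<and> A \<subseteq> lat s \<and> cset s = cone_hull (vspace s) A) \<and>
      (vs_topology (vspace s)) interior_of (cset s) \<noteq> {}"
    then obtain A where A: "finite A" "A \<subseteq> lat s" "cset s = cone_hull (vspace s) A" by auto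
    have "A \<subseteq> carrier (vspace s)" using A carr[OF that] by auto
    then have "lin_span (vspace s) A = carrier (vspace s)"
      using * A by (intro lin_span_of_interior_nonempty) auto
    then show "\<exists>A. finite A \<and> A \<subseteq> lat s \<and> cset s = cone_hull (vspace s) A \<and> lin_span (vspace s) A = carrier (vspace s)"
      using A by auto
  qed
  with True show ?thesis unfolding special_cone_def lat[symmetric] by blast
qed (simp add: special_cone_def)

section \<open>Caratheodory, rationality and Gordan\<close>

text \<open>Linear independence of the images in the quotient by the line through \<open>e\<close>,
  expressed without forming the quotient. For \<open>e = \<zero>\<close> this is ordinary
  independence.\<close>

definition indep_mod :: "(real, 'w) module \<Rightarrow> 'w \<Rightarrow> 'w set \<Rightarrow> bool" where
  "indep_mod W e F \<longleftrightarrow> (\<forall>d s. lc W d (\<lambda>a. a) F = s \<odot>\<^bsub>W\<^esub> e \<longrightarrow> (\<forall>a\<in>F. d a = 0))"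

context real_space
begin

text \<open>A relation may be negated, and the sign is used twice: some coefficient must be
  positive, so that a generator can be eliminated, and \<open>s\<close> should not be negative, so
  that elimination does not lower the coefficient of \<open>e\<close>. Both can fail to be arranged
  only if all coefficients are nonnegative and \<open>s < 0\<close>, and then the relation itself
  shows a negative multiple of \<open>e\<close> in the cone.\<close>

lemma dependent_mod_relation:
  assumes F: "F \<subseteq> carrier W" and e: "e \<in> carrier W" and dep: "\<not> indep_mod W e F"
  obtains d s a where "lc W d (\<lambda>a. a) F = s \<odot> e" "a \<in> F" "0 < d a" "s \<ge> 0 \<or> (\<forall>a\<in>F. 0 \<le> d a)"
proof -
  have Fc: "\<And>a. a \<in> F \<Longrightarrow> a \<in> carrier W" using F by auto
  obtain d s a where d: "lc W d (\<lambda>a. a) F = s \<odot> e" "a \<in> F" "d a \<noteq> 0"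
    using dep by (auto simp: indep_mod_def)
  have d': "lc W (\<lambda>a. - d a) (\<lambda>a. a) F = (- s) \<odot> e"
    using lc_sm[of F "\<lambda>a. a" "-1" d, OF Fc] d(1) e by simp
  show thesis
  proof (cases "\<exists>a\<in>F. 0 < d a")
    case True
    then obtain b where b: "b \<in> F" "0 < d b" by auto
    show thesis
    proof (cases "s \<ge> 0 \<or> (\<forall>a\<in>F. 0 \<le> d a)")
      case True
      then show thesis using that[OF d(1) b] by simp
    next
      case False
      then obtain b' where "b' \<in> F" "0 < - d b'" by (auto simp: not_le)
      then show thesis using that[OF d'] False by simp
    qed
  next
    case False
    then have "0 < - d a" "\<forall>a\<in>F. 0 \<le> - d a" using d by (auto simp: not_less order_le_less)
    then show thesis using that[OF d' d(2)] by simp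
  qed
qed

text \<open>Caratheodory's theorem modulo a line. With \<open>e = \<zero>\<close> it is the usual theorem for cones; in
  general the coefficient of \<open>e\<close> can only decrease if \<open>- e\<close> lies in the cone as well.\<close>

lemma caratheodory_mod:
  assumes "finite F" "F \<subseteq> carrier W" and e: "e \<in> carrier W" and "\<forall>a\<in>F. 0 \<le> c a"
  shows "\<exists>F' c' t'. F' \<subseteq> F \<and> (\<forall>a\<in>F'. 0 \<le> c' a) \<and> indep_mod W e F' \<and>
    lc W c (\<lambda>a. a) F \<oplus> t \<odot> e = lc W c' (\<lambda>a. a) F' \<oplus> t' \<odot> e \<and>
    (t \<le> t' \<or> (\<exists>f s. 0 < s \<and> (\<forall>a\<in>F. 0 \<le> f a) \<and> (- s) \<odot> e = lc W f (\<lambda>a. a) F))"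
  using assms(1,2,4)
proof (induction F arbitrary: c t rule: finite_psubset_induct)
  case (psubset F)
  show ?case
  proof (cases "indep_mod W e F")
    case True
    then show ?thesis using psubset.prems by (intro exI[of _ F] exI[of _ c] exI[of _ t]) auto
  next
    case False
    have Fc: "\<And>a. a \<in> F \<Longrightarrow> a \<in> carrier W" using psubset by auto
    obtain d s a where d: "lc W d (\<lambda>a. a) F = s \<odot> e" "a \<in> F" "0 < d a" "s \<ge> 0 \<or> (\<forall>a\<in>F. 0 \<le> d a)"
      using dependent_mod_relation[OF psubset.prems(1) e False] by metis
    define P where "P = {a \<in> F. 0 < d a}"
    have P: "finite P" "P \<noteq> {}" using psubset(1) d by (auto simp: P_def)
    \<comment> \<open>The largest multiple of the relation that can be subtracted without making a
      coefficient negative. Only indices with \<open>0 < d a\<close> restrict it, and at one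
      attaining the minimum the new coefficient is zero.\<close>
    define r where "r = Min ((\<lambda>a. c a / d a) ` P)"
    have "r \<in> (\<lambda>a. c a / d a) ` P" unfolding r_def using P by (intro Min_in) auto
    then obtain a1 where a1: "a1 \<in> F" "0 < d a1" "r = c a1 / d a1" by (auto simp: P_def)
    have rmin: "r \<le> c a / d a" if "a \<in> F" "0 < d a" for a
      unfolding r_def using P that by (intro Min_le) (auto simp: P_def)
    have r0: "0 \<le> r" using a1 psubset.prems by simp
    define c1 where "c1 a = c a - r * d a" for a
    have c1: "0 \<le> c1 a" if "a \<in> F" for a
    proof (cases "0 < d a")
      case True
      then show ?thesis using rmin[OF that True] by (simp add: c1_def field_simps)
    next
      case False
      then have "r * d a \<le> 0" using r0 by (simp add: mult_nonneg_nonpos)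
      moreover have "0 \<le> c a" using psubset.prems that by auto
      ultimately show ?thesis by (simp add: c1_def)
    qed
    have c1a1: "c1 a1 = 0" using a1 by (simp add: c1_def)
    have "lc W c (\<lambda>a. a) F = lc W (\<lambda>a. c1 a + r * d a) (\<lambda>a. a) F" by (simp add: c1_def)
    also have "\<dots> = lc W c1 (\<lambda>a. a) F \<oplus> r \<odot> lc W d (\<lambda>a. a) F"
      using Fc by (simp add: lc_add lc_sm)
    also have "lc W c1 (\<lambda>a. a) F = lc W c1 (\<lambda>a. a) (F - {a1})"
      by (rule lc_mono_neutral[symmetric]) (use psubset(1) Fc c1a1 in auto)
    finally have eq: "lc W c (\<lambda>a. a) F \<oplus> t \<odot> e = lc W c1 (\<lambda>a. a) (F - {a1}) \<oplus> (t + r * s) \<odot> e"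
      using e lc_closed[of "F - {a1}" "\<lambda>a. a" c1] Fc unfolding d(1)
      by (simp add: a_assoc sm_add_left a_comm[of "t \<odot> e"])
    have "F - {a1} \<subset> F" using a1 by auto
    moreover have "F - {a1} \<subseteq> carrier W" "\<forall>a\<in>F - {a1}. 0 \<le> c1 a" using Fc c1 by auto
    ultimately have "\<exists>F' c' t'. F' \<subseteq> F - {a1} \<and> (\<forall>a\<in>F'. 0 \<le> c' a) \<and> indep_mod W e F' \<and>
        lc W c1 (\<lambda>a. a) (F - {a1}) \<oplus> (t + r * s) \<odot> e = lc W c' (\<lambda>a. a) F' \<oplus> t' \<odot> e \<and>
        (t + r * s \<le> t' \<or> (\<exists>f s. 0 < s \<and> (\<forall>a\<in>F-{a1}. 0 \<le> f a) \<and> (- s) \<odot> e = lc W f (\<lambda>a. a) (F - {a1})))"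
      by (rule psubset.IH)
    then obtain F' c' t' where
      IH: "F' \<subseteq> F - {a1}" "\<forall>a\<in>F'. 0 \<le> c' a" "indep_mod W e F'"
        "lc W c1 (\<lambda>a. a) (F - {a1}) \<oplus> (t + r * s) \<odot> e = lc W c' (\<lambda>a. a) F' \<oplus> t' \<odot> e"
        "t + r * s \<le> t' \<or> (\<exists>f s. 0 < s \<and> (\<forall>a\<in>F-{a1}. 0 \<le> f a) \<and> (- s) \<odot> e = lc W f (\<lambda>a. a) (F - {a1}))"
      by (elim exE conjE) (rule that)
    \<comment> \<open>The coefficient of \<open>e\<close> can drop for two reasons. Either this
      elimination used \<open>s < 0\<close>, and then \<open>d\<close> is nonnegative and represents
      a negative multiple of \<open>e\<close>, or the smaller set already provides such a
      representation, which is extended by zero.\<close>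
    have "t \<le> t' \<or> (\<exists>f s. 0 < s \<and> (\<forall>a\<in>F. 0 \<le> f a) \<and> (- s) \<odot> e = lc W f (\<lambda>a. a) F)"
    proof (cases "t + r * s \<le> t'")
      case True
      show ?thesis
      proof (cases "s \<ge> 0")
        case True
        then have "0 \<le> r * s" using r0 by simp
        with \<open>t + r * s \<le> t'\<close> show ?thesis by linarith
      next
        case False
        then show ?thesis using d by (intro disjI2 exI[of _ d] exI[of _ "- s"]) auto
      qed
    next
      case False
      then obtain f s' where f: "0 < s'" "\<forall>a\<in>F-{a1}. 0 \<le> f a" "(- s') \<odot> e = lc W f (\<lambda>a. a) (F - {a1})"
        using IH by auto
      have "lc W f (\<lambda>a. a) (F - {a1}) = lc W (\<lambda>a. if a \<in> F - {a1} then f a else 0) (\<lambda>a. a) F"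
        by (rule lc_extend) (use psubset(1) Fc in auto)
      then show ?thesis using f
        by (intro disjI2 exI[of _ "\<lambda>a. if a \<in> F - {a1} then f a else 0"] exI[of _ s']) auto
    qed
    then show ?thesis using IH eq
      by (intro exI[of _ F'] exI[of _ c'] exI[of _ t']) auto
  qed
qed

lemma lc_add_vec:
  assumes "\<And>i. i \<in> F \<Longrightarrow> x i \<in> carrier W" "\<And>i. i \<in> F \<Longrightarrow> y i \<in> carrier W"
  shows "lc W c (\<lambda>i. x i \<oplus> y i) F = lc W c x F \<oplus> lc W c y F"
proof (cases "finite F")
  case True
  then show ?thesis using assms
    by (induction F) (simp_all add: lc_insert sm_add_right add.m_ac)
next
  case False
  then show ?thesis by (simp add: lc_def)
qed

lemma lc_sm_const:
  assumes "finite F" "e \<in> carrier W"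
  shows "lc W c (\<lambda>i. v i \<odot> e) F = (\<Sum>i\<in>F. c i * v i) \<odot> e"
  using assms(1) by (induction F) (use assms(2) in \<open>simp_all add: lc_insert sm_add_left\<close>)

lemma lc_nat_in:
  assumes "finite F" "\<zero> \<in> P" "\<And>v w. v \<in> P \<Longrightarrow> w \<in> P \<Longrightarrow> v \<oplus> w \<in> P"
    and "\<And>i. i \<in> F \<Longrightarrow> x i \<in> P" "\<And>i. i \<in> F \<Longrightarrow> x i \<in> carrier W"
  shows "lc W (\<lambda>i. real (n i)) x F \<in> P"
proof (rule lc_in[OF assms(1-3) _ assms(5)])
  fix i assume i: "i \<in> F"
  have "real k \<odot> x i \<in> P" for k
    by (induction k) (use i assms in \<open>auto simp: sm_add_left\<close>)
  then show "real (n i) \<odot> x i \<in> P" .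
qed

end

text \<open>Divisibility enters as closure of \<open>V\<close> under division by positive integers
  inside the reals, so it applies to a real \<open>t\<close> not yet known to lie in
  \<open>V\<close>.\<close>

locale adapted_div = adapted W V L e B
  for W :: "(real, 'w) module" (structure) and V L e B +
  assumes V_div: "0 < (n :: nat) \<Longrightarrow> real n * x \<in> V \<Longrightarrow> x \<in> V"
begin

lemma L_add: "x \<in> L \<Longrightarrow> y \<in> L \<Longrightarrow> x \<oplus> y \<in> L"
  by (rule subgroup_add[OF subgroup_L])

lemma L_int: "x \<in> L \<Longrightarrow> of_int k \<odot> x \<in> L"
  by (rule subgroup_of_int[OF subgroup_L])

lemma L_diff: "x \<in> L \<Longrightarrow> y \<in> L \<Longrightarrow> x \<oplus> (-1) \<odot> y \<in> L"
  using L_add[OF _ L_int[of y "-1"]] by simp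

lemma L_lc_int: "finite F \<Longrightarrow> F \<subseteq> L \<Longrightarrow> lc W (\<lambda>a. of_int (m a)) (\<lambda>a. a) F \<in> L"
  by (rule lc_int_in_subgroup[OF subgroup_L]) auto

text \<open>The lattice points of the half-open parallelotope on \<open>F\<close>, the finite set of
  the classical Gordan argument, recorded by their coefficients and taken only modulo the line,
  hence the arbitrary real \<open>t\<close>.\<close>

definition frac_coeffs :: "'w set \<Rightarrow> ('w \<Rightarrow> real) set" where
  "frac_coeffs F = {q \<in> F \<rightarrow>\<^sub>E {0..<1}. \<exists>t. lc W q (\<lambda>a. a) F \<oplus> t \<odot> e \<in> L}"

text \<open>Modulo the line the coordinates along \<open>B\<close> of such a point are integers.
  They are bounded because the coefficients lie between \<open>0\<close> and \<open>1\<close>, and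
  they determine the coefficients because \<open>F\<close> is independent modulo the line.\<close>

lemma finite_frac_coeffs:
  assumes F: "finite F" "F \<subseteq> L" "indep_mod W e F"
  shows "finite (frac_coeffs F)"
proof -
  have "\<forall>a\<in>F. \<exists>v m. a = v \<odot> e \<oplus> lc W (\<lambda>b. of_int (m b)) (\<lambda>b. b) B"
    using F by (metis L_E subsetD)
  then obtain v and m :: "'w \<Rightarrow> 'w \<Rightarrow> int" where vm: "\<And>a. a \<in> F \<Longrightarrow> a = v a \<odot> e \<oplus> lc W (\<lambda>b. of_int (m a b)) (\<lambda>b. b) B"
    by metis
  \<comment> \<open>The coordinates along \<open>B\<close> of the combination of \<open>F\<close>
    with coefficients \<open>q\<close>; the coordinate along \<open>e\<close> is split off in
    \<open>lcq\<close>.\<close>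
  define \<kappa> where "\<kappa> q b = (\<Sum>a\<in>F. q a * of_int (m a b))" for q :: "'w \<Rightarrow> real" and b
  have lcq: "lc W q (\<lambda>a. a) F = (\<Sum>a\<in>F. q a * v a) \<odot> e \<oplus> lc W (\<kappa> q) (\<lambda>b. b) B" for q
  proof -
    have "lc W q (\<lambda>a. a) F = lc W q (\<lambda>a. v a \<odot> e \<oplus> lc W (\<lambda>b. of_int (m a b)) (\<lambda>b. b) B) F"
      by (rule lc_cong[OF refl refl vm]) auto
    also have "\<dots> = lc W q (\<lambda>a. v a \<odot> e) F \<oplus> lc W q (\<lambda>a. lc W (\<lambda>b. of_int (m a b)) (\<lambda>b. b) B) F"
      by (rule lc_add_vec) auto
    finally show ?thesis
      using F(1) finite_B by (simp add: lc_sm_const lc_lc \<kappa>_def[abs_def])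
  qed
  \<comment> \<open>A crude bound: summing over \<open>b\<close> as well makes one number serve for
    every coordinate.\<close>
  define K where "K = (\<Sum>a\<in>F. \<Sum>b\<in>B. \<bar>m a b\<bar>)"
  define k where "k q = restrict (\<kappa> q) B" for q
  have "k ` frac_coeffs F \<subseteq> B \<rightarrow>\<^sub>E (of_int ` {-K..K})"
  proof (rule image_subsetI, rule PiE_I)
    fix q b assume q: "q \<in> frac_coeffs F" and b: "b \<in> B"
    then obtain t where "lc W q (\<lambda>a. a) F \<oplus> t \<odot> e \<in> L" by (auto simp: frac_coeffs_def)
    then obtain w n where "w \<in> V" "lc W q (\<lambda>a. a) F \<oplus> t \<odot> e = w \<odot> e \<oplus> lc W (\<lambda>b. of_int (n b)) (\<lambda>b. b) B"
      by (rule L_E)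
    moreover have "lc W q (\<lambda>a. a) F \<oplus> t \<odot> e = ((\<Sum>a\<in>F. q a * v a) + t) \<odot> e \<oplus> lc W (\<kappa> q) (\<lambda>b. b) B"
      by (simp add: lcq sm_add_left add.m_ac)
    ultimately have "((\<Sum>a\<in>F. q a * v a) + t) \<odot> e \<oplus> lc W (\<kappa> q) (\<lambda>b. b) B
        = w \<odot> e \<oplus> lc W (\<lambda>b. of_int (n b)) (\<lambda>b. b) B" by simp
    then have \<kappa>: "\<kappa> q b = of_int (n b)" using b by (rule unique(2))
    have "\<bar>\<kappa> q b\<bar> \<le> (\<Sum>a\<in>F. \<bar>q a * of_int (m a b)\<bar>)" unfolding \<kappa>_def by (rule sum_abs)
    also have "\<dots> \<le> (\<Sum>a\<in>F. \<Sum>b\<in>B. \<bar>of_int (m a b)\<bar>)"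
    proof (rule sum_mono)
      fix a assume a: "a \<in> F"
      have "0 \<le> q a" "q a < 1" using q a by (auto simp: frac_coeffs_def PiE_iff)
      then have "\<bar>q a * of_int (m a b)\<bar> \<le> \<bar>of_int (m a b) :: real\<bar>"
        by (simp add: abs_mult mult_left_le_one_le)
      also have "\<dots> \<le> (\<Sum>b\<in>B. \<bar>of_int (m a b)\<bar>)"
        using b finite_B by (intro member_le_sum) auto
      finally show "\<bar>q a * of_int (m a b)\<bar> \<le> (\<Sum>b\<in>B. \<bar>of_int (m a b)\<bar>)" .
    qed
    also have "\<dots> = of_int K" by (simp add: K_def)
    finally have "\<bar>n b\<bar> \<le> K" unfolding \<kappa> by linarith
    then show "k q b \<in> of_int ` {-K..K}" using b by (auto simp: k_def \<kappa> abs_le_iff intro!: imageI)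
  qed (auto simp: k_def)
  moreover have "finite (B \<rightarrow>\<^sub>E (of_int ` {-K..K} :: real set))"
    using finite_B by (intro finite_PiE) auto
  ultimately have "finite (k ` frac_coeffs F)" by (rule finite_subset)
  moreover have "inj_on k (frac_coeffs F)"
  proof (rule inj_onI)
    fix q q' assume q: "q \<in> frac_coeffs F" "q' \<in> frac_coeffs F" "k q = k q'"
    have \<kappa>: "\<kappa> q b = \<kappa> q' b" if "b \<in> B" for b
      using fun_cong[OF q(3), of b] that by (simp add: k_def)
    \<comment> \<open>With equal coordinates along \<open>B\<close> the two combinations differ by a
      multiple of \<open>e\<close>, so independence modulo the line applies to the difference of the
      tuples.\<close>
    have "lc W (\<kappa> (\<lambda>a. q a - q' a)) (\<lambda>b. b) B = \<zero>"
      by (rule lc_zero) (use \<kappa> in \<open>auto simp: \<kappa>_def left_diff_distrib sum_subtractf\<close>)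
    then have "lc W (\<lambda>a. q a - q' a) (\<lambda>a. a) F = (\<Sum>a\<in>F. (q a - q' a) * v a) \<odot> e"
      by (simp add: lcq)
    then have "\<forall>a\<in>F. q a - q' a = 0" using F(3) unfolding indep_mod_def by blast
    moreover have "q \<in> extensional F" "q' \<in> extensional F" using q by (auto simp: frac_coeffs_def PiE_iff)
    ultimately show "q = q'" by (intro extensionalityI) auto
  qed
  ultimately show ?thesis by (rule finite_imageD)
qed

text \<open>Dropping integer parts subtracts an integral combination of \<open>F\<close>, which lies
  in the lattice. The component \<open>t\<close> is unchanged; Gordan's lemma relies on
  this.\<close>

lemma frac_in_frac_coeffs:
  assumes F: "finite F" "F \<subseteq> L" and x: "lc W c (\<lambda>a. a) F \<oplus> t \<odot> e \<in> L"
  shows "restrict (\<lambda>a. frac (c a)) F \<in> frac_coeffs F"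
    "lc W (restrict (\<lambda>a. frac (c a)) F) (\<lambda>a. a) F \<oplus> t \<odot> e \<in> L"
proof -
  have Fc: "\<And>a. a \<in> F \<Longrightarrow> a \<in> carrier W" using F by auto
  have "lc W (restrict (\<lambda>a. frac (c a)) F) (\<lambda>a. a) F = lc W (\<lambda>a. c a + (-1) * of_int \<lfloor>c a\<rfloor>) (\<lambda>a. a) F"
    by (rule lc_cong) (use Fc in \<open>auto simp: frac_def\<close>)
  also have "\<dots> = lc W c (\<lambda>a. a) F \<oplus> (-1) \<odot> lc W (\<lambda>a. of_int \<lfloor>c a\<rfloor>) (\<lambda>a. a) F"
    using Fc by (subst lc_sm) (auto simp: lc_add)
  finally have "lc W (restrict (\<lambda>a. frac (c a)) F) (\<lambda>a. a) F \<oplus> t \<odot> e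
      = (lc W c (\<lambda>a. a) F \<oplus> t \<odot> e) \<oplus> (-1) \<odot> lc W (\<lambda>a. of_int \<lfloor>c a\<rfloor>) (\<lambda>a. a) F"
    using Fc by (simp add: add.m_ac)
  also have "\<dots> \<in> L" by (rule L_diff[OF x L_lc_int[OF F]])
  finally show "lc W (restrict (\<lambda>a. frac (c a)) F) (\<lambda>a. a) F \<oplus> t \<odot> e \<in> L" .
  then show "restrict (\<lambda>a. frac (c a)) F \<in> frac_coeffs F"
    by (auto simp: frac_coeffs_def frac_lt_1)
qed

text \<open>Two multiples of \<open>c\<close> have the same fractional parts, by the pigeonhole principle.\<close>

lemma rational_coeffs:
  assumes F: "finite F" "F \<subseteq> L" "indep_mod W e F" and x: "lc W c (\<lambda>a. a) F \<oplus> t \<odot> e \<in> L"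
  obtains N :: nat and n :: "'w \<Rightarrow> int" where "0 < N" "\<And>a. a \<in> F \<Longrightarrow> real N * c a = of_int (n a)" "t \<in> V"
proof -
  have Fc: "\<And>a. a \<in> F \<Longrightarrow> a \<in> carrier W" using F by auto
  define f where "f k = restrict (\<lambda>a. frac (real k * c a)) F" for k :: nat
  have "f k \<in> frac_coeffs F" for k
  proof -
    have "lc W (\<lambda>a. real k * c a) (\<lambda>a. a) F \<oplus> (real k * t) \<odot> e = of_int (int k) \<odot> (lc W c (\<lambda>a. a) F \<oplus> t \<odot> e)"
      using Fc by (simp add: sm_add_right lc_sm)
    also have "\<dots> \<in> L" by (rule L_int[OF x])
    finally show ?thesis unfolding f_def by (rule frac_in_frac_coeffs(1)[OF F(1,2)])
  qed
  \<comment> \<open>The multiples of the given point are lattice points as well, so the fractional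
    parts of all multiples of \<open>c\<close> lie in one finite set.\<close>
  then have "finite (range f)" by (intro finite_subset[OF _ finite_frac_coeffs[OF F]]) auto
  then have "\<not> inj f" using finite_imageD[of f UNIV] by auto
  then obtain i j where ij: "f i = f j" "i < j"
    unfolding inj_def by (metis (no_types) linorder_neqE_nat)
  define n where "n a = \<lfloor>real j * c a\<rfloor> - \<lfloor>real i * c a\<rfloor>" for a
  have n: "real (j - i) * c a = of_int (n a)" if "a \<in> F" for a
  proof -
    have "frac (real i * c a) = frac (real j * c a)" using fun_cong[OF ij(1), of a] that by (simp add: f_def)
    then show ?thesis using ij(2) by (simp add: n_def frac_def of_nat_diff algebra_simps)
  qed
  \<comment> \<open>Once the multiple \<open>j - i\<close> has made the coefficients integral, that
    part can be subtracted inside the lattice. Only \<open>real (j - i) * t\<close> times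
    \<open>e\<close> is left, so this number lies in \<open>V\<close>, and divisibility gives
    \<open>t\<close> itself.\<close>
  have "of_int (int (j - i)) \<odot> (lc W c (\<lambda>a. a) F \<oplus> t \<odot> e) \<oplus> (-1) \<odot> lc W (\<lambda>a. of_int (n a)) (\<lambda>a. a) F \<in> L"
    by (rule L_diff[OF L_int[OF x] L_lc_int[OF F(1,2)]])
  also have "of_int (int (j - i)) \<odot> (lc W c (\<lambda>a. a) F \<oplus> t \<odot> e)
      = lc W (\<lambda>a. real (j - i) * c a) (\<lambda>a. a) F \<oplus> (real (j - i) * t) \<odot> e"
    using Fc by (simp add: sm_add_right lc_sm del: of_nat_diff)
  also have "lc W (\<lambda>a. real (j - i) * c a) (\<lambda>a. a) F = lc W (\<lambda>a. of_int (n a)) (\<lambda>a. a) F"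
    by (rule lc_cong) (use n Fc in auto)
  also have "lc W (\<lambda>a. of_int (n a)) (\<lambda>a. a) F \<oplus> (real (j - i) * t) \<odot> e \<oplus> (-1) \<odot> lc W (\<lambda>a. of_int (n a)) (\<lambda>a. a) F
      = (real (j - i) * t) \<odot> e \<oplus> (lc W (\<lambda>a. of_int (n a)) (\<lambda>a. a) F \<oplus> (-1) \<odot> lc W (\<lambda>a. of_int (n a)) (\<lambda>a. a) F)"
    using Fc by (simp add: add.m_ac del: of_nat_diff)
  also have "\<dots> = (real (j - i) * t) \<odot> e" using Fc by (simp add: sm_diff del: of_nat_diff)
  finally have "t \<in> V" using L_line V_div[of "j - i" t] ij by simp
  then show thesis using that[of "j - i" n] n ij by simp
qed

text \<open>Real coefficients have to be turned into natural ones, but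
  \<open>rational_coeffs\<close> does not apply to a representation of \<open>- e\<close>, since its
  generators are dependent modulo the line. One generator \<open>a0\<close> is therefore moved to
  the other side: \<open>- a0\<close> is a lattice point expressed through the remaining generators,
  which are independent modulo \<open>e\<close>, and a multiple of \<open>e\<close>.\<close>

lemma negative_in_monoid:
  assumes A: "finite A" "A \<subseteq> L" and neg: "(-1) \<odot> e \<in> cone_hull W A"
  obtains v n where "v \<in> V" "0 < v" "(- v) \<odot> e = lc W (\<lambda>a. real (n a)) (\<lambda>a. a) A"
proof -
  have Ac: "\<And>a. a \<in> A \<Longrightarrow> a \<in> carrier W" using A by auto
  obtain c where c: "(-1) \<odot> e = lc W c (\<lambda>a. a) A" "\<forall>a\<in>A. 0 \<le> c a"
    using neg A L_carrier by (auto simp: cone_hull_finite subset_trans)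
  \<comment> \<open>Caratheodory is applied with the zero vector in place of \<open>e\<close>, that
    is, for ordinary independence.\<close>
  obtain F d where F: "F \<subseteq> A" "\<forall>a\<in>F. 0 \<le> d a" "indep_mod W \<zero> F" "(-1) \<odot> e = lc W d (\<lambda>a. a) F"
    using caratheodory_mod[OF A(1) _ zero_closed c(2), of 0] A L_carrier Ac c(1) lc_closed[of _ "\<lambda>a. a"]
    by (auto simp: subset_iff)
  have fin: "finite F" using F A finite_subset by blast
  have Fc: "\<And>a. a \<in> F \<Longrightarrow> a \<in> carrier W" using F Ac by auto
  have "\<exists>a\<in>F. d a \<noteq> 0"
  proof (rule ccontr)
    assume "\<not> (\<exists>a\<in>F. d a \<noteq> 0)"
    then have "(-1) \<odot> e = \<zero>" unfolding F(4) using Fc by (intro lc_zero) auto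
    then show False using e_nonzero by simp
  qed
  then obtain a0 where a0: "a0 \<in> F" "0 < d a0" using F(2) by force
  let ?G = "F - {a0}"
  have Gc: "\<And>a. a \<in> ?G \<Longrightarrow> a \<in> carrier W" using Fc by auto
  have e_eq: "(-1) \<odot> e = d a0 \<odot> a0 \<oplus> lc W d (\<lambda>a. a) ?G"
    unfolding F(4) by (rule lc_remove[OF fin a0(1) Fc])
  \<comment> \<open>If the remaining generators combine to \<open>s \<odot> e\<close>, adding
    \<open>s\<close> times the representation of \<open>- e\<close> gives an ordinary relation on
    \<open>F\<close>. Its coefficient at \<open>a0\<close> is \<open>s * d a0\<close>, so
    \<open>s = 0\<close>, and then all other coefficients vanish.\<close>
  have ind: "indep_mod W e ?G"
    unfolding indep_mod_def
  proof (intro allI impI)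
    fix f s assume f: "lc W f (\<lambda>a. a) ?G = s \<odot> e"
    define f0 where "f0 a = (if a = a0 then 0 else f a)" for a
    have "lc W f0 (\<lambda>a. a) F = lc W f0 (\<lambda>a. a) ?G"
      by (rule lc_mono_neutral[symmetric]) (use fin Fc in \<open>auto simp: f0_def\<close>)
    also have "\<dots> = lc W f (\<lambda>a. a) ?G"
      by (rule lc_cong) (use Fc in \<open>auto simp: f0_def\<close>)
    finally have "lc W f0 (\<lambda>a. a) F = s \<odot> e" unfolding f .
    moreover have "lc W (\<lambda>a. f0 a + s * d a) (\<lambda>a. a) F = lc W f0 (\<lambda>a. a) F \<oplus> s \<odot> lc W d (\<lambda>a. a) F"
      using Fc by (simp add: lc_add lc_sm)
    ultimately have "lc W (\<lambda>a. f0 a + s * d a) (\<lambda>a. a) F = s \<odot> e \<oplus> s \<odot> ((-1) \<odot> e)"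
      by (simp only: F(4))
    also have "\<dots> = 0 \<odot> \<zero>" by (simp add: sm_add_left[symmetric])
    finally have z: "\<forall>a\<in>F. f0 a + s * d a = 0" using F(3) unfolding indep_mod_def by blast
    have s: "s = 0" using bspec[OF z a0(1)] a0(2) by (simp add: f0_def)
    show "\<forall>a\<in>?G. f a = 0"
    proof
      fix a assume "a \<in> ?G"
      then show "f a = 0" using bspec[OF z, of a] s by (simp add: f0_def)
    qed
  qed
  have Lm: "(-1) \<odot> a0 \<in> L" using L_int[of a0 "-1"] a0 F A by auto
  \<comment> \<open>The representation of \<open>- e\<close>, divided by \<open>d a0\<close> and
    solved for \<open>- a0\<close>.\<close>
  have eq: "lc W (\<lambda>a. d a / d a0) (\<lambda>a. a) ?G \<oplus> (1 / d a0) \<odot> e = (-1) \<odot> a0"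
  proof -
    have lG: "lc W (\<lambda>a. d a / d a0) (\<lambda>a. a) ?G \<in> carrier W" by (rule lc_closed[OF Gc])
    have "(1 / d a0) \<odot> ((-1) \<odot> e) = a0 \<oplus> lc W (\<lambda>a. d a / d a0) (\<lambda>a. a) ?G"
      unfolding e_eq using a0 Gc Fc[OF a0(1)] lc_closed[of ?G "\<lambda>a. a" d, OF Gc]
        lc_sm[of ?G "\<lambda>a. a" "1 / d a0" d, OF Gc]
      by (subst sm_add_right) auto
    then have "(-1) \<odot> (a0 \<oplus> lc W (\<lambda>a. d a / d a0) (\<lambda>a. a) ?G) = (-1) \<odot> ((1 / d a0) \<odot> ((-1) \<odot> e))"
      by simp
    then have *: "(1 / d a0) \<odot> e = (-1) \<odot> a0 \<oplus> (-1) \<odot> lc W (\<lambda>a. d a / d a0) (\<lambda>a. a) ?G"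
      using a0 Fc[OF a0(1)] lG by (simp add: sm_add_right)
    show ?thesis unfolding * using a0 Fc[OF a0(1)] lG
      by (simp add: add.m_lcomm[of "lc W (\<lambda>a. d a / d a0) (\<lambda>a. a) ?G"] sm_diff)
  qed
  obtain N :: nat and k where N: "0 < N" "\<And>a. a \<in> ?G \<Longrightarrow> real N * (d a / d a0) = of_int (k a)" "1 / d a0 \<in> V"
  proof (rule rational_coeffs[of ?G "\<lambda>a. d a / d a0" "1 / d a0"])
    show "lc W (\<lambda>a. d a / d a0) (\<lambda>a. a) ?G \<oplus> (1 / d a0) \<odot> e \<in> L" unfolding eq by (rule Lm)
  qed (use fin F A ind in auto)
  \<comment> \<open>The number \<open>N\<close> clears the denominators of the quotients
    \<open>d a / d a0\<close>. The quotient at \<open>a0\<close> is \<open>1\<close>, which explains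
    the value \<open>N\<close> there; generators outside \<open>F\<close> are padded with
    \<open>0\<close>.\<close>
  define n where "n a = (if a = a0 then N else if a \<in> F then nat (k a) else 0)" for a
  have k0: "0 \<le> k a" if "a \<in> ?G" for a
  proof -
    have "0 \<le> real N * (d a / d a0)" using F(2) a0 that by auto
    then show ?thesis using N(2)[OF that] by simp
  qed
  define v where "v = real N * (1 / d a0)"
  have v0: "0 < v" using N a0 by (simp add: v_def)
  have "(- v) \<odot> e = real N \<odot> ((1 / d a0) \<odot> ((-1) \<odot> e))" by (simp add: v_def)
  also have "\<dots> = lc W (\<lambda>a. real N * (d a / d a0)) (\<lambda>a. a) F"
    unfolding F(4) using Fc by (simp add: lc_sm field_simps)
  also have "\<dots> = lc W (\<lambda>a. real (n a)) (\<lambda>a. a) F"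
    by (rule lc_cong) (use Fc N(2) k0 a0 in \<open>auto simp: n_def\<close>)
  also have "\<dots> = lc W (\<lambda>a. real (n a)) (\<lambda>a. a) A"
    by (rule lc_mono_neutral) (use A F Ac a0 in \<open>auto simp: n_def\<close>)
  finally have eqv: "(- v) \<odot> e = lc W (\<lambda>a. real (n a)) (\<lambda>a. a) A" .
  also have "\<dots> \<in> L" using L_lc_int[OF A, of "\<lambda>a. int (n a)"] by simp
  finally have "- v \<in> V" using L_line by simp
  then have "v \<in> V" using V_neg[of "- v"] by simp
  then show thesis using v0 eqv by (rule that)
qed

end

context adapted_div
begin

text \<open>The set \<open>P\<close> stands for a submonoid that contains the generators of the cone
  and the image of \<open>R\<close>. The point is the last conclusion, that \<open>P\<close>
  contains the component along the line even for negative \<open>t\<close>: by Caratheodory such a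
  \<open>t\<close> occurs only if \<open>- e\<close> lies in the cone, and then
  \<open>negative_in_monoid\<close> provides an element of \<open>P\<close> on the opposite
  ray.\<close>

lemma cone_decomposition:
  assumes A: "finite A" "A \<subseteq> L"
    and P: "\<zero> \<in> P" "\<And>x y. x \<in> P \<Longrightarrow> y \<in> P \<Longrightarrow> x \<oplus> y \<in> P" "A \<subseteq> P" "\<And>v. v \<in> V \<Longrightarrow> 0 \<le> v \<Longrightarrow> v \<odot> e \<in> P"
    and x: "x \<in> cone_hull W A" "x \<in> L"
  obtains F c t where "F \<subseteq> A" "indep_mod W e F" "\<forall>a\<in>F. 0 \<le> c a" "x = lc W c (\<lambda>a. a) F \<oplus> t \<odot> e"
    "t \<in> V" "t \<odot> e \<in> P"
proof -
  have Ac: "\<And>a. a \<in> A \<Longrightarrow> a \<in> carrier W" using A by auto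
  have AW: "A \<subseteq> carrier W" using Ac by auto
  obtain c where c: "x = lc W c (\<lambda>a. a) A" "\<forall>a\<in>A. 0 \<le> c a"
    using x(1) unfolding cone_hull_finite[OF A(1) AW] by auto
  have "\<exists>F c' t'. F \<subseteq> A \<and> (\<forall>a\<in>F. 0 \<le> c' a) \<and> indep_mod W e F \<and>
    lc W c (\<lambda>a. a) A \<oplus> 0 \<odot> e = lc W c' (\<lambda>a. a) F \<oplus> t' \<odot> e \<and>
    (0 \<le> t' \<or> (\<exists>f s. 0 < s \<and> (\<forall>a\<in>A. 0 \<le> f a) \<and> (- s) \<odot> e = lc W f (\<lambda>a. a) A))"
    by (rule caratheodory_mod[OF A(1) AW e_carrier c(2)])
  then obtain F c' t' where F: "F \<subseteq> A" "\<forall>a\<in>F. 0 \<le> c' a" "indep_mod W e F"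
    "lc W c (\<lambda>a. a) A \<oplus> 0 \<odot> e = lc W c' (\<lambda>a. a) F \<oplus> t' \<odot> e"
    "0 \<le> t' \<or> (\<exists>f s. 0 < s \<and> (\<forall>a\<in>A. 0 \<le> f a) \<and> (- s) \<odot> e = lc W f (\<lambda>a. a) A)"
    by (elim exE conjE) (rule that)
  have xF: "x = lc W c' (\<lambda>a. a) F \<oplus> t' \<odot> e"
    using F(4) c Ac lc_closed[of A "\<lambda>a. a" c] by simp
  have fin: "finite F" and FL: "F \<subseteq> L" using F A finite_subset by auto
  have xL: "lc W c' (\<lambda>a. a) F \<oplus> t' \<odot> e \<in> L" using x(2) unfolding xF .
  have t': "t' \<in> V" by (rule rational_coeffs[OF fin FL F(3) xL])
  have "t' \<odot> e \<in> P"
  proof (cases "0 \<le> t'")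
    case True
    then show ?thesis using P(4) t' by simp
  next
    case False
    then obtain f s where f: "0 < s" "\<forall>a\<in>A. 0 \<le> f a" "(- s) \<odot> e = lc W f (\<lambda>a. a) A" using F(5) by auto
    have "(- s) \<odot> e \<in> cone_hull W A" unfolding cone_hull_finite[OF A(1) AW] using f by auto
    then have "(1 / s) \<odot> ((- s) \<odot> e) \<in> cone_hull W A" by (rule cone_hull_sm[OF AW]) (use f(1) in simp)
    then have "(-1) \<odot> e \<in> cone_hull W A" using f(1) by simp
    then obtain v n where v: "v \<in> V" "0 < v" "(- v) \<odot> e = lc W (\<lambda>a. real (n a)) (\<lambda>a. a) A"
      by (rule negative_in_monoid[OF A])
    have vP: "(- v) \<odot> e \<in> P" unfolding v(3)
      by (rule lc_nat_in[OF A(1) P(1,2)]) (use P(3) Ac in auto)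
    have kP: "real k \<odot> ((- v) \<odot> e) \<in> P \<and> real k * v \<in> V" for k :: nat
    proof (induction k)
      case 0
      then show ?case using P(1) V_zero by simp
    next
      case (Suc k)
      have "real (Suc k) \<odot> ((- v) \<odot> e) = (- v) \<odot> e \<oplus> real k \<odot> ((- v) \<odot> e)"
        by (simp add: sm_add_left[symmetric] algebra_simps)
      moreover have "real (Suc k) * v = v + real k * v" by (simp add: algebra_simps)
      ultimately show ?case using Suc P(2)[OF vP] V_add[OF v(1)] by presburger
    qed
    \<comment> \<open>The vector \<open>t' \<odot> e\<close> is split into
      \<open>(t' + real k * v) \<odot> e\<close>, which lies on the nonnegative ray for large
      \<open>k\<close>, and \<open>k\<close> copies of \<open>(- v) \<odot> e\<close>.\<close>
    obtain k :: nat where "- t' / v < real k" using reals_Archimedean2[of "- t' / v"] by auto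
    then have k: "0 \<le> t' + real k * v" using v by (simp add: field_simps)
    have "(t' + real k * v) \<odot> e \<in> P" using P(4)[OF V_add[OF t' conjunct2[OF kP]] k] .
    then have "(t' + real k * v) \<odot> e \<oplus> real k \<odot> ((- v) \<odot> e) \<in> P" using P(2) kP by blast
    then show ?thesis by (simp add: sm_add_left[symmetric])
  qed
  then show thesis using that[OF F(1,3,2) xF t'] by simp
qed

text \<open>Clearing denominators makes the coefficients natural numbers, and the component along
  the line is already in \<open>P\<close>. Without a normality property of \<open>P\<close> only a
  multiple of \<open>x\<close> is reached; saturation removes the factor later.\<close>

lemma multiple_in_monoid:
  assumes A: "finite A" "A \<subseteq> L"
    and P: "\<zero> \<in> P" "\<And>x y. x \<in> P \<Longrightarrow> y \<in> P \<Longrightarrow> x \<oplus> y \<in> P" "A \<subseteq> P" "\<And>v. v \<in> V \<Longrightarrow> 0 \<le> v \<Longrightarrow> v \<odot> e \<in> P"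
    and x: "x \<in> cone_hull W A" "x \<in> L"
  shows "\<exists>N::nat. 0 < N \<and> real N \<odot> x \<in> P"
proof -
  obtain F c t where F: "F \<subseteq> A" "indep_mod W e F" "\<forall>a\<in>F. 0 \<le> c a" and xF: "x = lc W c (\<lambda>a. a) F \<oplus> t \<odot> e"
    and t: "t \<in> V" "t \<odot> e \<in> P"
    using cone_decomposition[OF assms] .
  have fin: "finite F" and FL: "F \<subseteq> L" using F A finite_subset by auto
  have Fc: "\<And>a. a \<in> F \<Longrightarrow> a \<in> carrier W" using FL by auto
  have xL: "lc W c (\<lambda>a. a) F \<oplus> t \<odot> e \<in> L" using x(2) unfolding xF .
  obtain N :: nat and n where N: "0 < N" "\<And>a. a \<in> F \<Longrightarrow> real N * c a = of_int (n a)" "t \<in> V"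
    by (rule rational_coeffs[OF fin FL F(2) xL]) (rule that)
  have n0: "0 \<le> n a" if "a \<in> F" for a
  proof -
    have "0 \<le> real N * c a" using F(3) that by simp
    then show ?thesis using N(2)[OF that] by simp
  qed
  have "lc W (\<lambda>a. real N * c a) (\<lambda>a. a) F = lc W (\<lambda>a. real (nat (n a))) (\<lambda>a. a) F"
    by (rule lc_cong) (use N(2) n0 Fc in auto)
  also have "\<dots> \<in> P" by (rule lc_nat_in[OF fin P(1,2)]) (use P(3) F(1) Fc in auto)
  finally have 1: "lc W (\<lambda>a. real N * c a) (\<lambda>a. a) F \<in> P" .
  have 2: "real k \<odot> (t \<odot> e) \<in> P" for k :: nat
  proof (induction k)
    case (Suc k)
    have "real (Suc k) \<odot> (t \<odot> e) = t \<odot> e \<oplus> real k \<odot> (t \<odot> e)"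
      by (simp add: sm_add_left[symmetric] algebra_simps)
    then show ?case using P(2)[OF t(2) Suc] by simp
  qed (simp add: P(1))
  have "real N \<odot> x = lc W (\<lambda>a. real N * c a) (\<lambda>a. a) F \<oplus> real N \<odot> (t \<odot> e)"
    unfolding xF using Fc by (simp add: sm_add_right lc_sm)
  then show ?thesis using 1 2 P(2) N(1) by auto
qed

text \<open>Gordan's lemma over \<open>V\<close>: besides the generators of the cone one needs the lattice points whose
  coefficients with respect to an independent subset are fractional parts.\<close>

lemma gordan:
  assumes A: "finite A" "A \<subseteq> L"
  obtains Y where "finite Y" "Y \<subseteq> cone_hull W A \<inter> L"
    "\<And>P. \<zero> \<in> P \<Longrightarrow> (\<And>x y. x \<in> P \<Longrightarrow> y \<in> P \<Longrightarrow> x \<oplus> y \<in> P) \<Longrightarrow> Y \<subseteq> P \<Longrightarrow>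
      (\<And>v. v \<in> V \<Longrightarrow> 0 \<le> v \<Longrightarrow> v \<odot> e \<in> P) \<Longrightarrow> cone_hull W A \<inter> L \<subseteq> P"
proof -
  have AW: "A \<subseteq> carrier W" using A L_carrier by auto
  define Z where "Z = (\<Union>F\<in>{F. F \<subseteq> A \<and> indep_mod W e F}. (\<lambda>q. lc W q (\<lambda>a. a) F) ` frac_coeffs F)"
  \<comment> \<open>Points of \<open>Z\<close> come from tuples for which some real multiple of
    \<open>e\<close> completes them to a lattice point, so they need not be lattice points
    themselves; those in the lattice and in the cone are kept.\<close>
  define Y where "Y = A \<union> (Z \<inter> (cone_hull W A \<inter> L))"
  have "finite Z"
    unfolding Z_def
  proof (rule finite_UN_I)
    show "finite {F. F \<subseteq> A \<and> indep_mod W e F}" using A(1) by simp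
    fix F assume F: "F \<in> {F. F \<subseteq> A \<and> indep_mod W e F}"
    then have "finite F" using A(1) finite_subset by auto
    then have "finite (frac_coeffs F)" by (rule finite_frac_coeffs) (use F A in auto)
    then show "finite ((\<lambda>q. lc W q (\<lambda>a. a) F) ` frac_coeffs F)" by simp
  qed
  then have "finite Y" using A by (simp add: Y_def)
  moreover have "Y \<subseteq> cone_hull W A \<inter> L" using A cone_hull_base[OF AW] by (auto simp: Y_def)
  moreover have "cone_hull W A \<inter> L \<subseteq> P"
    if P: "\<zero> \<in> P" "\<And>x y. x \<in> P \<Longrightarrow> y \<in> P \<Longrightarrow> x \<oplus> y \<in> P" "Y \<subseteq> P" "\<And>v. v \<in> V \<Longrightarrow> 0 \<le> v \<Longrightarrow> v \<odot> e \<in> P" for P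
  proof
    fix x assume "x \<in> cone_hull W A \<inter> L"
    then have x: "x \<in> cone_hull W A" "x \<in> L" by auto
    have AP: "A \<subseteq> P" using P(3) by (auto simp: Y_def)
    obtain F c t where F: "F \<subseteq> A" "indep_mod W e F" "\<forall>a\<in>F. 0 \<le> c a" and xF: "x = lc W c (\<lambda>a. a) F \<oplus> t \<odot> e"
      and t: "t \<in> V" "t \<odot> e \<in> P"
      using cone_decomposition[OF A P(1,2) AP P(4) x] .
    have fin: "finite F" and FL: "F \<subseteq> L" using F A finite_subset by auto
    have Fc: "\<And>a. a \<in> F \<Longrightarrow> a \<in> carrier W" using FL by auto
    define q where "q = restrict (\<lambda>a. frac (c a)) F"
    define y where "y = lc W q (\<lambda>a. a) F"
    have xL: "lc W c (\<lambda>a. a) F \<oplus> t \<odot> e \<in> L" using x(2) unfolding xF .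
    have q: "q \<in> frac_coeffs F" "y \<oplus> t \<odot> e \<in> L"
      using frac_in_frac_coeffs[OF fin FL xL] by (auto simp: q_def y_def)
    have yc: "y \<in> carrier W" unfolding y_def by (rule lc_closed[OF Fc])
    \<comment> \<open>Since \<open>t\<close> lies in \<open>V\<close>, the component along the line
      can be removed inside the lattice, so \<open>y\<close> is one of the points kept in
      \<open>Y\<close>.\<close>
    have "(y \<oplus> t \<odot> e) \<oplus> (-1) \<odot> (t \<odot> e) \<in> L" by (rule L_diff[OF q(2) V_e_in_L[OF t(1)]])
    then have "y \<in> L" using yc by (simp add: a_assoc sm_add_left[symmetric])
    moreover have "y \<in> cone_hull W F"
      unfolding y_def cone_hull_finite[OF fin subset_trans[OF FL L_carrier]]
      by (rule CollectI, rule exI[of _ q]) (simp add: q_def)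
    then have "y \<in> cone_hull W A"
      using cone_hull_mono_span[of F A] cone_hull_base[OF AW] F(1) AW by auto
    moreover have "y \<in> Z" unfolding Z_def y_def by (rule UN_I[of F]) (use F(1,2) q(1) in auto)
    ultimately have "y \<in> P" using P(3) by (auto simp: Y_def)
    \<comment> \<open>Each coefficient is its fractional part plus its floor. The fractional parts
      give \<open>y\<close>, and the floors are natural numbers because the coefficients are
      nonnegative.\<close>
    have "lc W c (\<lambda>a. a) F = lc W (\<lambda>a. q a + real (nat \<lfloor>c a\<rfloor>)) (\<lambda>a. a) F"
      by (rule lc_cong) (use F(3) Fc in \<open>auto simp: q_def frac_def\<close>)
    also have "\<dots> = y \<oplus> lc W (\<lambda>a. real (nat \<lfloor>c a\<rfloor>)) (\<lambda>a. a) F"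
      unfolding y_def by (rule lc_add[symmetric, OF Fc])
    also have "\<dots> \<in> P"
      by (rule P(2)[OF \<open>y \<in> P\<close>], rule lc_nat_in[OF fin P(1,2)]) (use AP F(1) Fc in auto)
    finally show "x \<in> P" unfolding xF by (rule P(2)[OF _ t(2)])
  qed
  ultimately show thesis by (rule that)
qed

end

section \<open>The Grothendieck group\<close>

context comm_monoid_cancel
begin

lemma equiv_gp_rel: "equiv (carrier G \<times> carrier G) (gp_rel G)"
proof (rule equivI)
  show "gp_rel G \<subseteq> (carrier G \<times> carrier G) \<times> (carrier G \<times> carrier G)" by (auto simp: gp_rel_def)
  show "refl_on (carrier G \<times> carrier G) (gp_rel G)"
    by (auto simp: refl_on_def gp_rel_def intro: one_closed)
  show "sym (gp_rel G)" by (auto simp: sym_def gp_rel_def) (metis)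
  show "trans (gp_rel G)"
  proof (rule transI)
    fix x y z assume "(x, y) \<in> gp_rel G" "(y, z) \<in> gp_rel G"
    then obtain a b c d f g k k' where *: "x = (a, b)" "y = (c, d)" "z = (f, g)"
      and c: "a \<in> carrier G" "b \<in> carrier G" "c \<in> carrier G" "d \<in> carrier G" "f \<in> carrier G" "g \<in> carrier G"
        "k \<in> carrier G" "k' \<in> carrier G"
      and eq: "a \<otimes> d \<otimes> k = c \<otimes> b \<otimes> k" "c \<otimes> g \<otimes> k' = f \<otimes> d \<otimes> k'"
      by (auto simp: gp_rel_def)
    have eq': "a \<otimes> d = c \<otimes> b" "c \<otimes> g = f \<otimes> d"
      using eq c r_cancel[of "a \<otimes> d" k "c \<otimes> b"] r_cancel[of "c \<otimes> g" k' "f \<otimes> d"] by auto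
    have "d \<otimes> (a \<otimes> g) = (a \<otimes> d) \<otimes> g" using c by (simp add: m_ac)
    also have "\<dots> = b \<otimes> (c \<otimes> g)" unfolding eq'(1) using c by (simp add: m_ac)
    also have "\<dots> = d \<otimes> (f \<otimes> b)" unfolding eq'(2) using c by (simp add: m_ac)
    finally have "a \<otimes> g = f \<otimes> b" using c l_cancel[of d "a \<otimes> g" "f \<otimes> b"] by simp
    then show "(x, z) \<in> gp_rel G" using * c by (auto simp: gp_rel_def)
  qed
qed

lemma gp_diff_eq_iff:
  assumes "a \<in> carrier G" "b \<in> carrier G" "c \<in> carrier G" "d \<in> carrier G"
  shows "gp_diff G a b = gp_diff G c d \<longleftrightarrow> a \<otimes> d = c \<otimes> b"
proof -
  have "gp_diff G a b = gp_diff G c d \<longleftrightarrow> ((a, b), (c, d)) \<in> gp_rel G"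
    unfolding gp_diff_def using equiv_gp_rel by (rule eq_equiv_class_iff) (use assms in auto)
  also have "\<dots> \<longleftrightarrow> a \<otimes> d = c \<otimes> b"
    using assms r_cancel[of "a \<otimes> d" _ "c \<otimes> b"] by (auto simp: gp_rel_def)
  finally show ?thesis .
qed

lemma gp_diff_mem_iff:
  assumes "a \<in> carrier G" "b \<in> carrier G"
  shows "(c, d) \<in> gp_diff G a b \<longleftrightarrow> c \<in> carrier G \<and> d \<in> carrier G \<and> gp_diff G a b = gp_diff G c d"
proof
  assume "(c, d) \<in> gp_diff G a b"
  then have r: "((a, b), (c, d)) \<in> gp_rel G" by (auto simp: gp_diff_def)
  then show "c \<in> carrier G \<and> d \<in> carrier G \<and> gp_diff G a b = gp_diff G c d"
    using equiv_class_eq[OF equiv_gp_rel r] by (auto simp: gp_diff_def gp_rel_def)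
next
  assume *: "c \<in> carrier G \<and> d \<in> carrier G \<and> gp_diff G a b = gp_diff G c d"
  then have "(c, d) \<in> gp_diff G c d"
    unfolding gp_diff_def by (intro equiv_class_self[OF equiv_gp_rel]) auto
  with * show "(c, d) \<in> gp_diff G a b" by simp
qed

lemma carrier_gp: "carrier (gp G) = {gp_diff G a b | a b. a \<in> carrier G \<and> b \<in> carrier G}"
  by (auto simp: gp_def quotient_def gp_diff_def)

lemma gp_diff_closed [simp]: "a \<in> carrier G \<Longrightarrow> b \<in> carrier G \<Longrightarrow> gp_diff G a b \<in> carrier (gp G)"
  by (auto simp: carrier_gp)

lemma gp_E:
  assumes "X \<in> carrier (gp G)"
  obtains a b where "a \<in> carrier G" "b \<in> carrier G" "X = gp_diff G a b"
  using assms by (auto simp: carrier_gp)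

lemma one_gp: "\<one>\<^bsub>gp G\<^esub> = gp_diff G \<one> \<one>"
  by (simp add: gp_def)

lemma gp_mult:
  assumes "a \<in> carrier G" "b \<in> carrier G" "c \<in> carrier G" "d \<in> carrier G"
  shows "gp_diff G a b \<otimes>\<^bsub>gp G\<^esub> gp_diff G c d = gp_diff G (a \<otimes> c) (b \<otimes> d)"
proof -
  \<comment> \<open>Independence of representatives: the unions in the definition of the product
    then range over one constant value.\<close>
  have "gp_diff G (a' \<otimes> c') (b' \<otimes> d') = gp_diff G (a \<otimes> c) (b \<otimes> d)"
    if "(a', b') \<in> gp_diff G a b" "(c', d') \<in> gp_diff G c d" for a' b' c' d'
  proof -
    from that assms have c: "a' \<in> carrier G" "b' \<in> carrier G" "c' \<in> carrier G" "d' \<in> carrier G"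
      and eq: "a \<otimes> b' = a' \<otimes> b" "c \<otimes> d' = c' \<otimes> d"
      by (auto simp: gp_diff_mem_iff gp_diff_eq_iff)
    have "(a' \<otimes> c') \<otimes> (b \<otimes> d) = (a' \<otimes> b) \<otimes> (c' \<otimes> d)" using assms c by (simp add: m_ac)
    also have "\<dots> = (a \<otimes> c) \<otimes> (b' \<otimes> d')" unfolding eq[symmetric] using assms c by (simp add: m_ac)
    finally show ?thesis using assms c by (simp add: gp_diff_eq_iff)
  qed
  note const = this
  have ne: "gp_diff G a b \<noteq> {}" "gp_diff G c d \<noteq> {}"
    using gp_diff_mem_iff[of a b a b] gp_diff_mem_iff[of c d c d] assms by fast+
  have "(\<Union>(a', b')\<in>gp_diff G a b. \<Union>(c', d')\<in>gp_diff G c d. gp_diff G (a' \<otimes> c') (b' \<otimes> d'))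
      = gp_diff G (a \<otimes> c) (b \<otimes> d)"
  proof (rule SUP_eq_const[OF ne(1)])
    fix x assume x: "x \<in> gp_diff G a b"
    obtain a' b' where x': "x = (a', b')" by (cases x)
    have "(\<Union>(c', d')\<in>gp_diff G c d. gp_diff G (a' \<otimes> c') (b' \<otimes> d')) = gp_diff G (a \<otimes> c) (b \<otimes> d)"
    proof (rule SUP_eq_const[OF ne(2)])
      fix y assume y: "y \<in> gp_diff G c d"
      obtain c' d' where y': "y = (c', d')" by (cases y)
      show "(case y of (c', d') \<Rightarrow> gp_diff G (a' \<otimes> c') (b' \<otimes> d')) = gp_diff G (a \<otimes> c) (b \<otimes> d)"
        unfolding y' prod.case by (rule const) (use x y x' y' in auto)
    qed
    then show "(case x of (a', b') \<Rightarrow> \<Union>(c', d')\<in>gp_diff G c d. gp_diff G (a' \<otimes> c') (b' \<otimes> d')) = gp_diff G (a \<otimes> c) (b \<otimes> d)"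
      unfolding x' prod.case .
  qed
  then show ?thesis by (simp add: gp_def)
qed

lemma comm_group_gp: "comm_group (gp G)"
proof (rule comm_groupI)
  fix X assume "X \<in> carrier (gp G)"
  then obtain a b where ab: "a \<in> carrier G" "b \<in> carrier G" "X = gp_diff G a b" by (rule gp_E)
  then have "gp_diff G b a \<otimes>\<^bsub>gp G\<^esub> X = \<one>\<^bsub>gp G\<^esub>" by (simp add: gp_mult one_gp gp_diff_eq_iff m_comm)
  then show "\<exists>Y\<in>carrier (gp G). Y \<otimes>\<^bsub>gp G\<^esub> X = \<one>\<^bsub>gp G\<^esub>" using ab by (intro bexI[of _ "gp_diff G b a"]) auto
  show "\<one>\<^bsub>gp G\<^esub> \<otimes>\<^bsub>gp G\<^esub> X = X" using ab by (simp add: gp_mult one_gp)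
next
  fix X Y assume "X \<in> carrier (gp G)" "Y \<in> carrier (gp G)"
  then obtain a b c d where *: "a \<in> carrier G" "b \<in> carrier G" "X = gp_diff G a b"
     "c \<in> carrier G" "d \<in> carrier G" "Y = gp_diff G c d" by (elim gp_E)
  then show "X \<otimes>\<^bsub>gp G\<^esub> Y \<in> carrier (gp G)" by (simp add: gp_mult)
  show "X \<otimes>\<^bsub>gp G\<^esub> Y = Y \<otimes>\<^bsub>gp G\<^esub> X" using * by (simp add: gp_mult m_comm)
  fix Z assume "Z \<in> carrier (gp G)"
  then obtain f g where "f \<in> carrier G" "g \<in> carrier G" "Z = gp_diff G f g" by (elim gp_E)
  with * show "X \<otimes>\<^bsub>gp G\<^esub> Y \<otimes>\<^bsub>gp G\<^esub> Z = X \<otimes>\<^bsub>gp G\<^esub> (Y \<otimes>\<^bsub>gp G\<^esub> Z)" by (simp add: gp_mult m_assoc)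
qed (simp add: one_gp)

lemma gp_inv:
  assumes "a \<in> carrier G" "b \<in> carrier G"
  shows "inv\<^bsub>gp G\<^esub> (gp_diff G a b) = gp_diff G b a"
proof -
  interpret gp: comm_group "gp G" by (rule comm_group_gp)
  show ?thesis
    by (rule gp.inv_equality) (use assms in \<open>simp_all add: gp_mult one_gp gp_diff_eq_iff m_comm\<close>)
qed

lemma gp_of_closed [simp]: "a \<in> carrier G \<Longrightarrow> gp_of G a \<in> carrier (gp G)"
  by (simp add: gp_of_def)

lemma gp_of_mult: "a \<in> carrier G \<Longrightarrow> b \<in> carrier G \<Longrightarrow> gp_of G (a \<otimes> b) = gp_of G a \<otimes>\<^bsub>gp G\<^esub> gp_of G b"
  by (simp add: gp_of_def gp_mult)

lemma gp_of_one: "gp_of G \<one> = \<one>\<^bsub>gp G\<^esub>"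
  by (simp add: gp_of_def one_gp)

lemma gp_of_eq_iff: "a \<in> carrier G \<Longrightarrow> b \<in> carrier G \<Longrightarrow> gp_of G a = gp_of G b \<longleftrightarrow> a = b"
  by (simp add: gp_of_def gp_diff_eq_iff)

lemma gp_diff_conv_gp_of:
  "a \<in> carrier G \<Longrightarrow> b \<in> carrier G \<Longrightarrow> gp_diff G a b = gp_of G a \<otimes>\<^bsub>gp G\<^esub> inv\<^bsub>gp G\<^esub> gp_of G b"
  by (simp add: gp_of_def gp_inv gp_mult)

end

lemma monoid_homD:
  assumes "f \<in> monoid_hom M N"
  shows "x \<in> carrier M \<Longrightarrow> f x \<in> carrier N"
    and "x \<in> carrier M \<Longrightarrow> y \<in> carrier M \<Longrightarrow> f (x \<otimes>\<^bsub>M\<^esub> y) = f x \<otimes>\<^bsub>N\<^esub> f y"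
    and "f \<one>\<^bsub>M\<^esub> = \<one>\<^bsub>N\<^esub>"
  using assms by (auto simp: monoid_hom_def hom_def)

lemma gp_map_gp_diff:
  assumes M: "comm_monoid_cancel M" and N: "comm_monoid_cancel N" and f: "f \<in> monoid_hom M N"
    and a: "a \<in> carrier M" and b: "b \<in> carrier M"
  shows "gp_map M N f (gp_diff M a b) = gp_diff N (f a) (f b)"
proof -
  interpret M: comm_monoid_cancel M by fact
  interpret N: comm_monoid_cancel N by fact
  note f = monoid_homD[OF f]
  have "gp_diff N (f c) (f d) = gp_diff N (f a) (f b)" if "(c, d) \<in> gp_diff M a b" for c d
  proof -
    from that a b have c: "c \<in> carrier M" "d \<in> carrier M" "a \<otimes>\<^bsub>M\<^esub> d = c \<otimes>\<^bsub>M\<^esub> b"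
      by (auto simp: M.gp_diff_mem_iff M.gp_diff_eq_iff)
    have "f c \<otimes>\<^bsub>N\<^esub> f b = f a \<otimes>\<^bsub>N\<^esub> f d" using c a b by (simp flip: f(2))
    then show ?thesis using c a b f by (simp add: N.gp_diff_eq_iff)
  qed
  note const = this
  have ne: "gp_diff M a b \<noteq> {}" using M.gp_diff_mem_iff[of a b a b] a b by fast
  show ?thesis
    unfolding gp_map_def
  proof (rule SUP_eq_const[OF ne])
    fix x assume x: "x \<in> gp_diff M a b"
    obtain c d where x': "x = (c, d)" by (cases x)
    show "(case x of (c, d) \<Rightarrow> gp_diff N (f c) (f d)) = gp_diff N (f a) (f b)"
      unfolding x' prod.case by (rule const) (use x x' in auto)
  qed
qed

lemma (in comm_monoid_cancel) gp_diff_pow: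
  "a \<in> carrier G \<Longrightarrow> b \<in> carrier G \<Longrightarrow> gp_diff G a b [^]\<^bsub>gp G\<^esub> (n::nat) = gp_diff G (a [^] n) (b [^] n)"
  by (induction n) (auto simp: gp_mult one_gp)

section \<open>The monoid of a special cone\<close>

locale valued =
  fixes R :: "('r, 'c) monoid_scheme" and \<phi> :: "('r \<times> 'r) set \<Rightarrow> real"
  assumes valuative: "valuative_monoid R" and divisible: "divisible_monoid R"
    and height_one: "height_one_monoid R" and embedding: "ordered_embedding R \<phi>"

sublocale valued \<subseteq> R: comm_monoid_cancel R
  using valuative by (simp add: valuative_monoid_def)

sublocale valued \<subseteq> gpR: comm_group "gp R"
  by (rule R.comm_group_gp)

context valued
begin

lemma phi_mult: "X \<in> carrier (gp R) \<Longrightarrow> Y \<in> carrier (gp R) \<Longrightarrow> \<phi> (X \<otimes>\<^bsub>gp R\<^esub> Y) = \<phi> X + \<phi> Y"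
  and phi_inj: "inj_on \<phi> (carrier (gp R))"
  and phi_le: "X \<in> carrier (gp R) \<Longrightarrow> Y \<in> carrier (gp R) \<Longrightarrow> gp_le R X Y \<longleftrightarrow> \<phi> X \<le> \<phi> Y"
  using embedding by (auto simp: ordered_embedding_def)

lemma phi_one: "\<phi> \<one>\<^bsub>gp R\<^esub> = 0"
  using phi_mult[of "\<one>\<^bsub>gp R\<^esub>" "\<one>\<^bsub>gp R\<^esub>"] by simp

lemma phi_inv: "X \<in> carrier (gp R) \<Longrightarrow> \<phi> (inv\<^bsub>gp R\<^esub> X) = - \<phi> X"
  using phi_mult[of "inv\<^bsub>gp R\<^esub> X" X] phi_one by simp

lemma value_subgroup: "value_subgroup (value_group R \<phi>)"
  unfolding value_subgroup_def value_group_def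
proof (intro conjI ballI)
  show "0 \<in> \<phi> ` carrier (gp R)" using phi_one by (metis gpR.one_closed imageI)
  show "x + y \<in> \<phi> ` carrier (gp R)" if "x \<in> \<phi> ` carrier (gp R)" "y \<in> \<phi> ` carrier (gp R)" for x y
    using that by (auto simp flip: phi_mult)
  show "- x \<in> \<phi> ` carrier (gp R)" if "x \<in> \<phi> ` carrier (gp R)" for x
    using that by (auto simp flip: phi_inv)
qed

lemma rval_mult: "r \<in> carrier R \<Longrightarrow> s \<in> carrier R \<Longrightarrow> rval R \<phi> (r \<otimes>\<^bsub>R\<^esub> s) = rval R \<phi> r + rval R \<phi> s"
  by (simp add: rval_def R.gp_of_mult phi_mult)

lemma rval_one [simp]: "rval R \<phi> \<one>\<^bsub>R\<^esub> = 0"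
  by (simp add: rval_def R.gp_of_one phi_one)

lemma rval_pow: "r \<in> carrier R \<Longrightarrow> rval R \<phi> (r [^]\<^bsub>R\<^esub> (n::nat)) = real n * rval R \<phi> r"
  by (induction n) (auto simp: rval_mult algebra_simps)

lemma rval_in_V: "r \<in> carrier R \<Longrightarrow> rval R \<phi> r \<in> value_group R \<phi>"
  by (simp add: rval_def value_group_def)

lemma rval_nonneg: "r \<in> carrier R \<Longrightarrow> 0 \<le> rval R \<phi> r"
  using phi_le[of "\<one>\<^bsub>gp R\<^esub>" "gp_of R r"] by (simp add: rval_def gp_le_def phi_one)

lemma rval_inj: "inj_on (rval R \<phi>) (carrier R)"
proof (rule inj_onI)
  fix r s assume rs: "r \<in> carrier R" "s \<in> carrier R" "rval R \<phi> r = rval R \<phi> s"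
  then have "gp_of R r = gp_of R s" using phi_inj by (auto simp: rval_def inj_on_def)
  then show "r = s" using rs by (simp add: R.gp_of_eq_iff)
qed

text \<open>This is the identity of \<open>R\<close> with the nonnegative part of \<open>V\<close>:
  the embedding reflects the order, and an element of the group is nonnegative exactly if it comes
  from \<open>R\<close>.\<close>

lemma rval_surj:
  assumes "v \<in> value_group R \<phi>" "0 \<le> v"
  obtains r where "r \<in> carrier R" "v = rval R \<phi> r"
proof -
  obtain X where X: "X \<in> carrier (gp R)" "v = \<phi> X" using assms by (auto simp: value_group_def)
  then have "gp_le R \<one>\<^bsub>gp R\<^esub> X" using assms by (simp add: phi_le phi_one)
  then have "X \<in> gp_of R ` carrier R" using X by (simp add: gp_le_def)
  then show thesis using that X by (auto simp: rval_def)
qed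

text \<open>Divisibility is known for \<open>R\<close> only, so negative elements are treated
  through their opposites.\<close>

lemma V_div:
  assumes n: "0 < (n::nat)" and "real n * x \<in> value_group R \<phi>"
  shows "x \<in> value_group R \<phi>"
proof -
  have pos: "x \<in> value_group R \<phi>" if x: "real n * x \<in> value_group R \<phi>" "0 \<le> x" for x
  proof -
    obtain r where r: "r \<in> carrier R" "real n * x = rval R \<phi> r" using rval_surj[OF x(1)] x(2) by auto
    then obtain y where y: "y \<in> carrier R" "y [^]\<^bsub>R\<^esub> n = r" using divisible n by (auto simp: divisible_monoid_def)
    then have "x = rval R \<phi> y" using r n rval_pow[OF y(1), of n] by auto
    then show ?thesis using rval_in_V y by simp
  qed
  show ?thesis
  proof (cases "0 \<le> x")
    case True
    then show ?thesis using pos assms by simp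
  next
    case False
    have neg: "- y \<in> value_group R \<phi>" if "y \<in> value_group R \<phi>" for y
      using value_subgroup that unfolding value_subgroup_def by simp
    have "- (real n * x) \<in> value_group R \<phi>" by (rule neg) fact
    then have "- x \<in> value_group R \<phi>" using False pos[of "- x"] by simp
    then show ?thesis using neg[of "- x"] by simp
  qed
qed

text \<open>Height one gives a nonzero value, and its absolute value comes from \<open>R\<close>.
  Since \<open>1\<close> need not lie in \<open>V\<close>, such an element is what links the vectors
  of the lattice on the line to the unit vector \<open>vunit\<close>.\<close>

lemma rval_pos: obtains r where "r \<in> carrier R" "0 < rval R \<phi> r"
proof -
  obtain X where X: "X \<in> carrier (gp R)" "X \<noteq> \<one>\<^bsub>gp R\<^esub>"
    using height_one gpR.one_closed unfolding height_one_monoid_def by auto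
  have "\<phi> X \<noteq> 0"
  proof
    assume "\<phi> X = 0"
    then have "X = \<one>\<^bsub>gp R\<^esub>" using phi_inj X(1) gpR.one_closed by (intro inj_onD[OF phi_inj]) (simp_all add: phi_one)
    with X(2) show False ..
  qed
  moreover have V: "\<phi> X \<in> value_group R \<phi>" "- \<phi> X \<in> value_group R \<phi>"
    using X value_subgroup by (simp_all add: value_group_def value_subgroup_def)
  ultimately have "\<bar>\<phi> X\<bar> \<in> value_group R \<phi>" "0 < \<bar>\<phi> X\<bar>"
    by (simp_all add: abs_if)
  then obtain r where "r \<in> carrier R" "\<bar>\<phi> X\<bar> = rval R \<phi> r" using rval_surj[of "\<bar>\<phi> X\<bar>"] by auto
  then show thesis using that \<open>0 < \<bar>\<phi> X\<bar>\<close> by simp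
qed

lemma not_one_of_rval_pos: "0 < rval R \<phi> r \<Longrightarrow> r \<noteq> \<one>\<^bsub>R\<^esub>"
  by auto

end

text \<open>The witnesses of \<open>special_cone_iff\<close> become parameters, so that the
  generators \<open>A\<close> and the coordinates \<open>B\<close> stay the same throughout all
  statements about one cone.\<close>

locale cone_data = valued R \<phi> + adapted_div "vspace s" "value_group R \<phi>" "lat s" "vunit s" B
  for R :: "('r, 'c) monoid_scheme" and \<phi> and s :: "'w vcone" and B +
  fixes A
  assumes finite_A: "finite A" and A_lat: "A \<subseteq> lat s" and cset_eq: "cset s = cone_hull (vspace s) A"
    and span_A: "lin_span (vspace s) A = carrier (vspace s)"
    and vvec_cset: "\<pi> \<in> carrier R \<Longrightarrow> \<pi> \<noteq> \<one>\<^bsub>R\<^esub> \<Longrightarrow> vvec R \<phi> s \<pi> \<in> cset s"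

lemma (in valued) special_cone_iff_cone_data:
  "special_cone R \<phi> s \<longleftrightarrow> (\<exists>B A. cone_data R \<phi> s B A)"
proof
  assume "special_cone R \<phi> s"
  then obtain B A where *: "real_vs (vspace s)" "adapted_basis (value_group R \<phi>) (vspace s) (lat s) (vunit s) B"
    "finite A" "A \<subseteq> lat s" "cset s = cone_hull (vspace s) A" "lin_span (vspace s) A = carrier (vspace s)"
    "\<forall>\<pi>\<in>carrier R - {\<one>\<^bsub>R\<^esub>}. vvec R \<phi> s \<pi> \<in> cset s"
    unfolding special_cone_iff[OF value_subgroup] by auto
  have "cone_data R \<phi> s B A"
    by unfold_locales (use * value_subgroup V_div in auto)
  then show "\<exists>B A. cone_data R \<phi> s B A" by auto
next
  assume "\<exists>B A. cone_data R \<phi> s B A"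
  then obtain B A where "cone_data R \<phi> s B A" by auto
  then interpret s: cone_data R \<phi> s B A .
  show "special_cone R \<phi> s"
    unfolding special_cone_iff[OF value_subgroup]
    using s.real_vs s.adapted s.finite_A s.A_lat s.cset_eq s.span_A s.vvec_cset by blast
qed

context cone_data
begin

abbreviation "M \<equiv> monoid_of_cone R \<phi> s"

lemma M_simps [simp]:
  "carrier M = cset s \<inter> lat s" "mult M = add (vspace s)" "one M = zero (vspace s)"
  "str_map M = vvec R \<phi> s"
  by (auto simp: monoid_of_cone_def)

lemma A_carrier: "A \<subseteq> carrier (vspace s)"
  using A_lat L_carrier by auto

lemma cset_carrier: "cset s \<subseteq> carrier (vspace s)"
  unfolding cset_eq by (rule cone_hull_closed[OF A_carrier])

lemma cset_add: "x \<in> cset s \<Longrightarrow> y \<in> cset s \<Longrightarrow> x \<oplus>\<^bsub>vspace s\<^esub> y \<in> cset s"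
  unfolding cset_eq by (rule cone_hull_add[OF A_carrier])

lemma cset_sm: "x \<in> cset s \<Longrightarrow> 0 \<le> k \<Longrightarrow> k \<odot>\<^bsub>vspace s\<^esub> x \<in> cset s"
  unfolding cset_eq by (rule cone_hull_sm[OF A_carrier])

lemma cset_zero: "\<zero>\<^bsub>vspace s\<^esub> \<in> cset s"
  unfolding cset_eq by (rule cone_hull_zero)

lemma A_cset: "A \<subseteq> cset s"
  unfolding cset_eq using cone_hull_base[OF A_carrier] by auto

lemma lat_zero: "\<zero>\<^bsub>vspace s\<^esub> \<in> lat s"
  by (rule subgroup_zero[OF subgroup_L])

lemma vvec_in_M: "r \<in> carrier R \<Longrightarrow> vvec R \<phi> s r \<in> cset s \<inter> lat s"
  using vvec_cset[of r] cset_zero V_e_in_L[OF rval_in_V]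
  by (cases "r = \<one>\<^bsub>R\<^esub>") (auto simp: vvec_def lat_zero)

lemma ray_in_M: "v \<in> value_group R \<phi> \<Longrightarrow> 0 \<le> v \<Longrightarrow> v \<odot>\<^bsub>vspace s\<^esub> vunit s \<in> vvec R \<phi> s ` carrier R"
  by (erule rval_surj) (auto simp: vvec_def)

lemma comm_monoid_cancel_M: "comm_monoid_cancel M"
proof (rule comm_monoid_cancelI)
  show "Group.comm_monoid M"
    by (rule comm_monoidI) (auto simp: cset_add L_add cset_zero lat_zero add.m_ac)
  fix a b c assume "a \<in> carrier M" "b \<in> carrier M" "c \<in> carrier M" "a \<otimes>\<^bsub>M\<^esub> c = b \<otimes>\<^bsub>M\<^esub> c"
  then show "a = b" by simp
qed

lemma pow_M: "x \<in> carrier M \<Longrightarrow> x [^]\<^bsub>M\<^esub> (n::nat) = real n \<odot>\<^bsub>vspace s\<^esub> x"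
  by (induction n) (auto simp: sm_add_left a_comm)

lemma vvec_hom: "vvec R \<phi> s \<in> monoid_hom R M"
  using vvec_in_M by (auto simp: monoid_hom_def hom_def vvec_def rval_mult sm_add_left)

lemma inj_vvec: "inj_on (vvec R \<phi> s) (carrier R)"
  using rval_inj sm_inj[OF e_carrier e_nonzero] by (auto simp: inj_on_def vvec_def)

text \<open>A formal difference with a multiple in the monoid is a lattice vector because the
  lattice is a group, and lies in the cone because cones are stable under multiplication by
  \<open>1 / real n\<close>.\<close>

lemma saturated_M: "saturated_monoid M"
  unfolding saturated_monoid_def
proof (intro ballI allI impI)
  interpret M: comm_monoid_cancel M by (rule comm_monoid_cancel_M)
  fix X and n :: nat assume X: "X \<in> carrier (gp M)" and n: "0 < n" and Xn: "X [^]\<^bsub>gp M\<^esub> n \<in> gp_of M ` carrier M"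
  obtain a b where ab: "a \<in> carrier M" "b \<in> carrier M" "X = gp_diff M a b" using X by (rule M.gp_E)
  obtain c where c: "c \<in> carrier M" "X [^]\<^bsub>gp M\<^esub> n = gp_of M c" using Xn by auto
  have ac: "a \<in> carrier (vspace s)" "b \<in> carrier (vspace s)" "c \<in> carrier (vspace s)" using ab c by auto
  have "gp_diff M (a [^]\<^bsub>M\<^esub> n) (b [^]\<^bsub>M\<^esub> n) = gp_diff M c \<one>\<^bsub>M\<^esub>"
    using c(2) ab unfolding gp_of_def by (simp add: M.gp_diff_pow)
  then have "a [^]\<^bsub>M\<^esub> n \<otimes>\<^bsub>M\<^esub> \<one>\<^bsub>M\<^esub> = c \<otimes>\<^bsub>M\<^esub> b [^]\<^bsub>M\<^esub> n"
    by (subst (asm) M.gp_diff_eq_iff) (use ab(1,2) c(1) M.nat_pow_closed M.one_closed in blast)+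
  then have "a [^]\<^bsub>M\<^esub> n = c \<otimes>\<^bsub>M\<^esub> b [^]\<^bsub>M\<^esub> n" using M.r_one[OF M.nat_pow_closed[OF ab(1)]] by metis
  then have eq: "real n \<odot>\<^bsub>vspace s\<^esub> a = c \<oplus>\<^bsub>vspace s\<^esub> real n \<odot>\<^bsub>vspace s\<^esub> b"
    unfolding pow_M[OF ab(1)] pow_M[OF ab(2)] by simp
  define x where "x = a \<oplus>\<^bsub>vspace s\<^esub> (-1) \<odot>\<^bsub>vspace s\<^esub> b"
  have xb: "a = x \<oplus>\<^bsub>vspace s\<^esub> b" using ac by (simp add: x_def a_assoc sm_diff)
  have xL: "x \<in> lat s" unfolding x_def by (rule L_diff) (use ab in auto)
  have "real n \<odot>\<^bsub>vspace s\<^esub> x = real n \<odot>\<^bsub>vspace s\<^esub> a \<oplus>\<^bsub>vspace s\<^esub> (-1) \<odot>\<^bsub>vspace s\<^esub> (real n \<odot>\<^bsub>vspace s\<^esub> b)"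
    using ac by (simp add: x_def sm_add_right)
  also have "\<dots> = c" unfolding eq using ac by (simp add: a_assoc sm_add_left[symmetric])
  finally have "x = (1 / real n) \<odot>\<^bsub>vspace s\<^esub> c" using xL n by auto
  also have "\<dots> \<in> cset s" by (rule cset_sm) (use c in auto)
  finally have xM: "x \<in> carrier M" using xL by simp
  have "X = gp_of M x"
    unfolding gp_of_def ab(3) using xM ab(1,2)
    by (subst M.gp_diff_eq_iff) (auto simp: xb[symmetric] cset_zero lat_zero)
  then show "X \<in> gp_of M ` carrier M" using xM by auto
qed

lemma torsion_free_M: "torsion_free_group (gp M)"
  unfolding torsion_free_group_def
proof (intro ballI allI impI)
  interpret M: comm_monoid_cancel M by (rule comm_monoid_cancel_M)
  fix X and n :: nat assume X: "X \<in> carrier (gp M)" and n: "0 < n" and Xn: "X [^]\<^bsub>gp M\<^esub> n = \<one>\<^bsub>gp M\<^esub>"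
  obtain a b where ab: "a \<in> carrier M" "b \<in> carrier M" "X = gp_diff M a b" using X by (rule M.gp_E)
  have "gp_diff M (a [^]\<^bsub>M\<^esub> n) (b [^]\<^bsub>M\<^esub> n) = gp_diff M \<one>\<^bsub>M\<^esub> \<one>\<^bsub>M\<^esub>"
    using Xn ab M.one_gp by (simp add: M.gp_diff_pow)
  then have "a [^]\<^bsub>M\<^esub> n \<otimes>\<^bsub>M\<^esub> \<one>\<^bsub>M\<^esub> = \<one>\<^bsub>M\<^esub> \<otimes>\<^bsub>M\<^esub> b [^]\<^bsub>M\<^esub> n"
    by (subst (asm) M.gp_diff_eq_iff) (use ab(1,2) M.nat_pow_closed M.one_closed in blast)+
  then have "a [^]\<^bsub>M\<^esub> n = b [^]\<^bsub>M\<^esub> n"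
    using M.r_one[OF M.nat_pow_closed[OF ab(1)]] M.l_one[OF M.nat_pow_closed[OF ab(2)]] by metis
  then have "real n \<odot>\<^bsub>vspace s\<^esub> a = real n \<odot>\<^bsub>vspace s\<^esub> b"
    unfolding pow_M[OF ab(1)] pow_M[OF ab(2)] .
  then have "a = b" using n ab sm_cancel[of a b "real n"] by simp
  then show "X = \<one>\<^bsub>gp M\<^esub>" using ab(1,2) unfolding ab(3) M.one_gp
    by (subst M.gp_diff_eq_iff) (auto simp: cset_zero lat_zero)
qed

text \<open>The set \<open>P\<close> in Gordan's lemma becomes a submonoid that contains the image
  of \<open>R\<close>; this image is the whole ray of nonnegative multiples of the unit by elements
  of \<open>V\<close>.\<close>

lemma fin_gen_M: "fin_gen_over R M"
proof -
  obtain Y where Y: "finite Y" "Y \<subseteq> cset s \<inter> lat s"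
    "\<And>P. \<zero>\<^bsub>vspace s\<^esub> \<in> P \<Longrightarrow> (\<And>x y. x \<in> P \<Longrightarrow> y \<in> P \<Longrightarrow> x \<oplus>\<^bsub>vspace s\<^esub> y \<in> P) \<Longrightarrow> Y \<subseteq> P \<Longrightarrow>
      (\<And>v. v \<in> value_group R \<phi> \<Longrightarrow> 0 \<le> v \<Longrightarrow> v \<odot>\<^bsub>vspace s\<^esub> vunit s \<in> P) \<Longrightarrow> cset s \<inter> lat s \<subseteq> P"
    unfolding cset_eq using gordan[OF finite_A A_lat] by metis
  have "H = carrier M" if H: "submonoid H M" "Y \<union> str_map M ` carrier R \<subseteq> H" for H
  proof
    show "H \<subseteq> carrier M" using submonoid.subset[OF H(1)] .
    have "cset s \<inter> lat s \<subseteq> H"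
    proof (rule Y(3))
      show "\<zero>\<^bsub>vspace s\<^esub> \<in> H" using submonoid.one_closed[OF H(1)] by simp
      show "x \<oplus>\<^bsub>vspace s\<^esub> y \<in> H" if "x \<in> H" "y \<in> H" for x y
        using submonoid.m_closed[OF H(1) that] by simp
      show "v \<odot>\<^bsub>vspace s\<^esub> vunit s \<in> H" if "v \<in> value_group R \<phi>" "0 \<le> v" for v
        using ray_in_M[OF that] H(2) by auto
    qed (use H(2) in auto)
    then show "carrier M \<subseteq> H" by simp
  qed
  then show ?thesis unfolding fin_gen_over_def using Y(1,2) by (intro exI[of _ Y]) auto
qed

lemma toric_M: "toric_monoid R M"
  using vvec_hom comm_monoid_cancel_M saturated_M torsion_free_M fin_gen_M inj_vvec
  by (simp add: toric_monoid_def)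

end

lemma (in valued) toric_monoid_of_cone: "special_cone R \<phi> s \<Longrightarrow> toric_monoid R (monoid_of_cone R \<phi> s)"
  unfolding special_cone_iff_cone_data using cone_data.toric_M by blast

section \<open>Extension of homomorphisms to linear maps\<close>

lemma (in adapted) linear_extension:
  fixes W' :: "(real, 'v) module"
  assumes "real_space W'" and e': "e' \<in> carrier W'" and G: "\<And>b. b \<in> B \<Longrightarrow> G b \<in> carrier W'"
  obtains h where "h \<in> linear_maps W W'"
    "\<And>t c. h (t \<odot> e \<oplus> lc W c (\<lambda>b. b) B) = t \<odot>\<^bsub>W'\<^esub> e' \<oplus>\<^bsub>W'\<^esub> lc W' c G B"
proof -
  interpret W': real_space W' by fact
  \<comment> \<open>Coordinates are read off by choice; by uniqueness of coordinates the result does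
    not depend on the choice, up to values of the coefficients outside \<open>B\<close>.\<close>
  define h where "h w = (let p = SOME p. w = fst p \<odot> e \<oplus> lc W (snd p) (\<lambda>b. b) B
    in fst p \<odot>\<^bsub>W'\<^esub> e' \<oplus>\<^bsub>W'\<^esub> lc W' (snd p) G B)" for w
  have h: "h (t \<odot> e \<oplus> lc W c (\<lambda>b. b) B) = t \<odot>\<^bsub>W'\<^esub> e' \<oplus>\<^bsub>W'\<^esub> lc W' c G B" for t c
  proof -
    define p where "p = (SOME p. t \<odot> e \<oplus> lc W c (\<lambda>b. b) B = fst p \<odot> e \<oplus> lc W (snd p) (\<lambda>b. b) B)"
    have p: "t \<odot> e \<oplus> lc W c (\<lambda>b. b) B = fst p \<odot> e \<oplus> lc W (snd p) (\<lambda>b. b) B"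
      unfolding p_def by (rule someI[of _ "(t, c)"]) simp
    have "lc W' c G B = lc W' (snd p) G B"
      by (rule W'.lc_cong) (use unique(2)[OF p] G in auto)
    moreover have "h (t \<odot> e \<oplus> lc W c (\<lambda>b. b) B) = fst p \<odot>\<^bsub>W'\<^esub> e' \<oplus>\<^bsub>W'\<^esub> lc W' (snd p) G B"
      by (simp only: h_def p_def Let_def)
    ultimately show ?thesis using unique(1)[OF p] by simp
  qed
  have "h \<in> linear_maps W W'"
  proof (rule linear_mapsI)
    fix x assume "x \<in> carrier W"
    then obtain t c where x: "x = t \<odot> e \<oplus> lc W c (\<lambda>b. b) B" using span by meson
    show "h x \<in> carrier W'" unfolding x h using e' G by simp
    show "h (k \<odot> x) = k \<odot>\<^bsub>W'\<^esub> h x" for k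
    proof -
      have "k \<odot> x = (k * t) \<odot> e \<oplus> lc W (\<lambda>b. k * c b) (\<lambda>b. b) B"
        unfolding x by (simp add: sm_add_right lc_sm)
      then have "h (k \<odot> x) = (k * t) \<odot>\<^bsub>W'\<^esub> e' \<oplus>\<^bsub>W'\<^esub> lc W' (\<lambda>b. k * c b) G B" by (simp add: h)
      also have "\<dots> = k \<odot>\<^bsub>W'\<^esub> h x" unfolding x h using e' G by (simp add: W'.sm_add_right W'.lc_sm)
      finally show ?thesis .
    qed
    fix y assume "y \<in> carrier W"
    then obtain t' c' where y: "y = t' \<odot> e \<oplus> lc W c' (\<lambda>b. b) B" using span by meson
    have "x \<oplus> y = (t \<odot> e \<oplus> t' \<odot> e) \<oplus> (lc W c (\<lambda>b. b) B \<oplus> lc W c' (\<lambda>b. b) B)"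
      unfolding x y by (simp add: add.m_ac)
    also have "\<dots> = (t + t') \<odot> e \<oplus> lc W (\<lambda>b. c b + c' b) (\<lambda>b. b) B"
      by (simp add: sm_add_left lc_add)
    finally have "h (x \<oplus> y) = (t + t') \<odot>\<^bsub>W'\<^esub> e' \<oplus>\<^bsub>W'\<^esub> lc W' (\<lambda>b. c b + c' b) G B"
      by (simp add: h)
    also have "\<dots> = (t \<odot>\<^bsub>W'\<^esub> e' \<oplus>\<^bsub>W'\<^esub> t' \<odot>\<^bsub>W'\<^esub> e') \<oplus>\<^bsub>W'\<^esub> (lc W' c G B \<oplus>\<^bsub>W'\<^esub> lc W' c' G B)"
      using e' G by (simp add: W'.sm_add_left W'.lc_add)
    also have "\<dots> = h x \<oplus>\<^bsub>W'\<^esub> h y"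
      unfolding x y h using e' G by (simp add: W'.add.m_ac)
    finally show "h (x \<oplus> y) = h x \<oplus>\<^bsub>W'\<^esub> h y" .
  qed
  then show thesis using h by (rule that)
qed

lemma (in real_space) additive_lc_int:
  fixes W' :: "(real, 'v) module"
  assumes "real_space W'" and L: "subgroup L (add_monoid W)"
    and Gc: "\<And>x. x \<in> L \<Longrightarrow> G x \<in> carrier W'"
    and G: "\<And>x y. x \<in> L \<Longrightarrow> y \<in> L \<Longrightarrow> G (x \<oplus> y) = G x \<oplus>\<^bsub>W'\<^esub> G y"
    and F: "finite F" "F \<subseteq> L"
  shows "G (lc W (\<lambda>b. of_int (m b)) (\<lambda>b. b) F) = lc W' (\<lambda>b. of_int (m b)) G F"
proof -
  interpret W': real_space W' by fact
  have Lc: "\<And>x. x \<in> L \<Longrightarrow> x \<in> carrier W" using subgroup.subset[OF L] by auto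
  have G0: "G \<zero> = \<zero>\<^bsub>W'\<^esub>"
    using G[of \<zero> \<zero>] subgroup_zero[OF L] Gc[of \<zero>] by simp
  have neg: "G ((-1) \<odot> x) = (-1) \<odot>\<^bsub>W'\<^esub> G x" if x: "x \<in> L" for x
  proof -
    have nx: "(-1) \<odot> x \<in> L" using subgroup_of_int[OF L x, of "-1"] by simp
    have "G ((-1) \<odot> x) \<oplus>\<^bsub>W'\<^esub> G x = \<zero>\<^bsub>W'\<^esub>"
      using G[OF nx x] G0 Lc[OF x] by (simp add: sm_diff)
    then have "\<ominus>\<^bsub>W'\<^esub> G x = G ((-1) \<odot> x)" using Gc x nx by (intro W'.minus_equality) auto
    then show ?thesis using Gc x by (simp add: W'.minus_eq_sm)
  qed
  have nat: "G (real n \<odot> x) = real n \<odot>\<^bsub>W'\<^esub> G x" if x: "x \<in> L" for x n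
  proof (induction n)
    case (Suc n)
    have nx: "real n \<odot> x \<in> L" using subgroup_of_int[OF L x, of "int n"] by simp
    have "real (Suc n) \<odot> x = x \<oplus> real n \<odot> x" using Lc[OF x] sm_add_left[of x 1 "real n"] by simp
    then have "G (real (Suc n) \<odot> x) = G x \<oplus>\<^bsub>W'\<^esub> real n \<odot>\<^bsub>W'\<^esub> G x" using G[OF x nx] Suc by simp
    also have "\<dots> = real (Suc n) \<odot>\<^bsub>W'\<^esub> G x" using Gc[OF x] W'.sm_add_left[of "G x" 1 "real n"] by simp
    finally show ?case .
  qed (use x Lc Gc G0 in simp)
  have int: "G (of_int k \<odot> x) = of_int k \<odot>\<^bsub>W'\<^esub> G x" if x: "x \<in> L" for x k
  proof (cases "0 \<le> k")
    case True
    then show ?thesis using nat[OF x, of "nat k"] by simp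
  next
    case False
    have "G ((-1) \<odot> (of_int (- k) \<odot> x)) = (-1) \<odot>\<^bsub>W'\<^esub> G (of_int (- k) \<odot> x)"
      by (rule neg[OF subgroup_of_int[OF L x]])
    also have "G (of_int (- k) \<odot> x) = of_int (- k) \<odot>\<^bsub>W'\<^esub> G x"
      using nat[OF x, of "nat (- k)"] False by simp
    finally show ?thesis using Lc[OF x] Gc[OF x] by simp
  qed
  show ?thesis using F
  proof (induction F)
    case (insert a F)
    then have F: "\<And>b. b \<in> insert a F \<Longrightarrow> b \<in> L" by auto
    have "lc W (\<lambda>b. of_int (m b)) (\<lambda>b. b) (insert a F) = of_int (m a) \<odot> a \<oplus> lc W (\<lambda>b. of_int (m b)) (\<lambda>b. b) F"
      by (rule lc_insert) (use insert F Lc in auto)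
    also have "G \<dots> = G (of_int (m a) \<odot> a) \<oplus>\<^bsub>W'\<^esub> G (lc W (\<lambda>b. of_int (m b)) (\<lambda>b. b) F)"
      by (rule G) (use insert F in \<open>auto intro!: subgroup_of_int[OF L] lc_int_in_subgroup[OF L]\<close>)
    also have "\<dots> = of_int (m a) \<odot>\<^bsub>W'\<^esub> G a \<oplus>\<^bsub>W'\<^esub> lc W' (\<lambda>b. of_int (m b)) G F"
      using insert int[of a] by simp
    also have "\<dots> = lc W' (\<lambda>b. of_int (m b)) G (insert a F)"
      by (rule W'.lc_insert[symmetric]) (use insert F Gc in auto)
    finally show ?case .
  qed (simp add: G0)
qed

context cone_data
begin

text \<open>The lattice is the group generated by the monoid. This needs the spanning property of
  \<open>A\<close>, that is, the interior points of the cone: any vector enters the cone after a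
  large integral combination of the generators is added.\<close>

lemma lat_diff:
  assumes "l \<in> lat s"
  obtains x y where "x \<in> cset s \<inter> lat s" "y \<in> cset s \<inter> lat s" "x = l \<oplus>\<^bsub>vspace s\<^esub> y"
proof -
  have Ac: "\<And>a. a \<in> A \<Longrightarrow> a \<in> carrier (vspace s)" using A_carrier by auto
  have "l \<in> lin_span (vspace s) A" using assms span_A by simp
  then obtain c where c: "l = lc (vspace s) c (\<lambda>a. a) A"
    unfolding lin_span_finite[OF finite_A A_carrier] by auto
  \<comment> \<open>Only real coefficients of \<open>l\<close> are available. Rounding up their
    absolute values gives integers that keep \<open>y\<close> in the lattice and make all
    coefficients of the sum nonnegative.\<close>
  define n where "n a = \<lceil>\<bar>c a\<bar>\<rceil>" for a
  have n: "\<bar>c a\<bar> \<le> of_int (n a)" for a by (simp add: n_def)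
  define y where "y = lc (vspace s) (\<lambda>a. of_int (n a)) (\<lambda>a. a) A"
  have nn: "0 \<le> real_of_int (n a)" for a using n[of a] by linarith
  have y: "y \<in> cset s" "y \<in> lat s"
    using L_lc_int[OF finite_A A_lat] nn
    by (auto simp: y_def cset_eq cone_hull_finite[OF finite_A A_carrier])
  have "l \<oplus>\<^bsub>vspace s\<^esub> y = lc (vspace s) (\<lambda>a. c a + of_int (n a)) (\<lambda>a. a) A"
    unfolding c y_def by (rule lc_add) (rule Ac)
  moreover have "0 \<le> c a + of_int (n a)" for a using n[of a] by linarith
  ultimately have "l \<oplus>\<^bsub>vspace s\<^esub> y \<in> cset s"
    by (auto simp: cset_eq cone_hull_finite[OF finite_A A_carrier])
  moreover have "l \<oplus>\<^bsub>vspace s\<^esub> y \<in> lat s" using assms y by (simp add: L_add)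
  ultimately show thesis using that[of "l \<oplus>\<^bsub>vspace s\<^esub> y" y] y by auto
qed

text \<open>Passes from the monoid to the lattice by differences, and from the lattice to the space
  through the adapted basis. An additive map on \<open>V\<close> need not be linear over the reals,
  so the values on the line have to be prescribed; this is what compatibility with the structure
  maps provides.\<close>

lemma extension:
  fixes W' :: "(real, 'v) module"
  assumes "real_space W'" and e': "e' \<in> carrier W'" and gc: "\<And>m. m \<in> carrier M \<Longrightarrow> g m \<in> carrier W'"
    and g: "\<And>x y. x \<in> carrier M \<Longrightarrow> y \<in> carrier M \<Longrightarrow> g (x \<oplus>\<^bsub>vspace s\<^esub> y) = g x \<oplus>\<^bsub>W'\<^esub> g y"
    and gr: "\<And>r. r \<in> carrier R \<Longrightarrow> g (vvec R \<phi> s r) = rval R \<phi> r \<odot>\<^bsub>W'\<^esub> e'"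
  obtains h where "h \<in> linear_maps (vspace s) W'" "h (vunit s) = e'" "\<And>m. m \<in> carrier M \<Longrightarrow> h m = g m"
proof -
  interpret W': real_space W' by fact
  note [simp] = gc[simplified]
  have g': "g (x \<oplus>\<^bsub>vspace s\<^esub> y) = g x \<oplus>\<^bsub>W'\<^esub> g y" if "x \<in> cset s" "x \<in> lat s" "y \<in> cset s" "y \<in> lat s" for x y
    using g[of x y] that by simp
  define P where "P l p \<longleftrightarrow> fst p \<in> cset s \<inter> lat s \<and> snd p \<in> cset s \<inter> lat s \<and> fst p = l \<oplus>\<^bsub>vspace s\<^esub> snd p" for l p
  \<comment> \<open>The extension to the lattice: \<open>l\<close> is written as a difference of two
    monoid elements. Any two such differences give the same value, because cross sums of their terms
    agree in the monoid.\<close>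
  define G where "G l = (let p = SOME p. P l p in g (fst p) \<oplus>\<^bsub>W'\<^esub> (-1) \<odot>\<^bsub>W'\<^esub> g (snd p))" for l
  have G: "G l \<oplus>\<^bsub>W'\<^esub> g y = g x \<and> G l \<in> carrier W'"
    if l: "l \<in> lat s" and x: "x \<in> cset s" "x \<in> lat s" and y: "y \<in> cset s" "y \<in> lat s" and eq: "x = l \<oplus>\<^bsub>vspace s\<^esub> y"
    for l x y
  proof -
    define p where "p = (SOME p. P l p)"
    have "P l p" unfolding p_def by (rule someI[of _ "(x, y)"]) (use x y eq in \<open>simp add: P_def\<close>)
    then obtain a b where p: "p = (a, b)" and a: "a \<in> cset s" "a \<in> lat s" and b: "b \<in> cset s" "b \<in> lat s"
      and ab: "a = l \<oplus>\<^bsub>vspace s\<^esub> b" by (cases p) (auto simp: P_def)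
    have Gl: "G l = g a \<oplus>\<^bsub>W'\<^esub> (-1) \<odot>\<^bsub>W'\<^esub> g b" by (simp add: G_def p flip: p_def)
    have "a \<oplus>\<^bsub>vspace s\<^esub> y = x \<oplus>\<^bsub>vspace s\<^esub> b" unfolding ab eq using l b y by (simp add: add.m_ac)
    then have gay: "g a \<oplus>\<^bsub>W'\<^esub> g y = g x \<oplus>\<^bsub>W'\<^esub> g b" using g'[of a y] g'[of x b] x y a b by simp
    have "G l \<oplus>\<^bsub>W'\<^esub> g y = (g a \<oplus>\<^bsub>W'\<^esub> g y) \<oplus>\<^bsub>W'\<^esub> (-1) \<odot>\<^bsub>W'\<^esub> g b"
      unfolding Gl using x y a b by (simp add: W'.add.m_ac)
    also have "\<dots> = g x" unfolding gay using x y a b by (simp add: W'.a_assoc W'.sm_diff)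
    finally show ?thesis unfolding Gl using a b by simp
  qed
  have Gc: "G l \<in> carrier W'" if l: "l \<in> lat s" for l
  proof -
    obtain x y where "x \<in> cset s \<inter> lat s" "y \<in> cset s \<inter> lat s" "x = l \<oplus>\<^bsub>vspace s\<^esub> y"
      by (rule lat_diff[OF l])
    then show ?thesis using G[OF l, of x y] by auto
  qed
  have Gadd: "G (k \<oplus>\<^bsub>vspace s\<^esub> l) = G k \<oplus>\<^bsub>W'\<^esub> G l" if kl: "k \<in> lat s" "l \<in> lat s" for k l
  proof -
    obtain x y where x: "x \<in> cset s \<inter> lat s" "y \<in> cset s \<inter> lat s" "x = k \<oplus>\<^bsub>vspace s\<^esub> y"
      by (rule lat_diff[OF kl(1)])
    obtain x' y' where x': "x' \<in> cset s \<inter> lat s" "y' \<in> cset s \<inter> lat s" "x' = l \<oplus>\<^bsub>vspace s\<^esub> y'"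
      by (rule lat_diff[OF kl(2)])
    have eq: "x \<oplus>\<^bsub>vspace s\<^esub> x' = (k \<oplus>\<^bsub>vspace s\<^esub> l) \<oplus>\<^bsub>vspace s\<^esub> (y \<oplus>\<^bsub>vspace s\<^esub> y')"
      unfolding x(3) x'(3) using kl x(2) x'(2) by (simp add: add.m_ac)
    have 1: "G (k \<oplus>\<^bsub>vspace s\<^esub> l) \<oplus>\<^bsub>W'\<^esub> g (y \<oplus>\<^bsub>vspace s\<^esub> y') = g (x \<oplus>\<^bsub>vspace s\<^esub> x')"
      using G[OF _ _ _ _ _ eq] x(1,2) x'(1,2) kl by (simp add: cset_add L_add)
    have 2: "G k \<oplus>\<^bsub>W'\<^esub> g y = g x" "G l \<oplus>\<^bsub>W'\<^esub> g y' = g x'"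
      using G[OF kl(1) _ _ _ _ x(3)] G[OF kl(2) _ _ _ _ x'(3)] x(1,2) x'(1,2) by auto
    have c: "G (k \<oplus>\<^bsub>vspace s\<^esub> l) \<in> carrier W'" "G k \<in> carrier W'" "G l \<in> carrier W'"
      "g y \<in> carrier W'" "g y' \<in> carrier W'"
      using Gc kl L_add x x' by auto
    have "G (k \<oplus>\<^bsub>vspace s\<^esub> l) \<oplus>\<^bsub>W'\<^esub> (g y \<oplus>\<^bsub>W'\<^esub> g y') = (G k \<oplus>\<^bsub>W'\<^esub> g y) \<oplus>\<^bsub>W'\<^esub> (G l \<oplus>\<^bsub>W'\<^esub> g y')"
      using 1 x(1,2) x'(1,2) unfolding 2 by (simp add: g')
    also have "\<dots> = (G k \<oplus>\<^bsub>W'\<^esub> G l) \<oplus>\<^bsub>W'\<^esub> (g y \<oplus>\<^bsub>W'\<^esub> g y')" using c by (simp add: W'.add.m_ac)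
    finally show ?thesis using c by simp
  qed
  have g0: "g \<zero>\<^bsub>vspace s\<^esub> = \<zero>\<^bsub>W'\<^esub>"
    using g'[of "\<zero>\<^bsub>vspace s\<^esub>" "\<zero>\<^bsub>vspace s\<^esub>"] gc[of "\<zero>\<^bsub>vspace s\<^esub>"] cset_zero lat_zero by simp
  have GM: "G m = g m" if "m \<in> cset s" "m \<in> lat s" for m
    using G[of m m "\<zero>\<^bsub>vspace s\<^esub>"] that cset_zero lat_zero g0 by auto
  \<comment> \<open>So far \<open>G\<close> is merely additive. On nonnegative \<open>v\<close> its
    value is prescribed, since \<open>v\<close> is the value of an element of \<open>R\<close>;
    negative \<open>v\<close> follow by additivity.\<close>
  have Ge: "G (v \<odot>\<^bsub>vspace s\<^esub> vunit s) = v \<odot>\<^bsub>W'\<^esub> e'" if v: "v \<in> value_group R \<phi>" for v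
  proof -
    have pos: "G (v \<odot>\<^bsub>vspace s\<^esub> vunit s) = v \<odot>\<^bsub>W'\<^esub> e'" if v: "v \<in> value_group R \<phi>" "0 \<le> v" for v
    proof -
      obtain r where r: "r \<in> carrier R" "v = rval R \<phi> r" by (rule rval_surj[OF v])
      then show ?thesis using GM gr vvec_in_M[of r] by (simp add: vvec_def)
    qed
    show ?thesis
    proof (cases "0 \<le> v")
      case True
      then show ?thesis by (rule pos[OF v])
    next
      case False
      have v': "- v \<in> value_group R \<phi>" using V_neg[OF v] .
      have "G (v \<odot>\<^bsub>vspace s\<^esub> vunit s) \<oplus>\<^bsub>W'\<^esub> G ((- v) \<odot>\<^bsub>vspace s\<^esub> vunit s) = G \<zero>\<^bsub>vspace s\<^esub>"
        by (subst Gadd[symmetric]) (use V_e_in_L v v' in \<open>simp_all add: sm_add_left[symmetric]\<close>)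
      then have "G (v \<odot>\<^bsub>vspace s\<^esub> vunit s) \<oplus>\<^bsub>W'\<^esub> (- v) \<odot>\<^bsub>W'\<^esub> e' = \<zero>\<^bsub>W'\<^esub>"
        using pos[OF v'] False GM[of "\<zero>\<^bsub>vspace s\<^esub>"] cset_zero lat_zero g0 by simp
      moreover have "v \<odot>\<^bsub>W'\<^esub> e' \<oplus>\<^bsub>W'\<^esub> (- v) \<odot>\<^bsub>W'\<^esub> e' = \<zero>\<^bsub>W'\<^esub>" using e' by (simp flip: W'.sm_add_left)
      ultimately have "G (v \<odot>\<^bsub>vspace s\<^esub> vunit s) \<oplus>\<^bsub>W'\<^esub> (- v) \<odot>\<^bsub>W'\<^esub> e' = v \<odot>\<^bsub>W'\<^esub> e' \<oplus>\<^bsub>W'\<^esub> (- v) \<odot>\<^bsub>W'\<^esub> e'"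
        by simp
      then show ?thesis
        using Gc[OF V_e_in_L[OF v]] e' by (subst (asm) W'.add.right_cancel) auto
    qed
  qed
  obtain h where h: "h \<in> linear_maps (vspace s) W'"
    "\<And>t c. h (t \<odot>\<^bsub>vspace s\<^esub> vunit s \<oplus>\<^bsub>vspace s\<^esub> lc (vspace s) c (\<lambda>b. b) B) = t \<odot>\<^bsub>W'\<^esub> e' \<oplus>\<^bsub>W'\<^esub> lc W' c G B"
    by (rule linear_extension[OF assms(1) e', of G]) (use Gc B_in_L in auto)
  have hG: "h l = G l" if l: "l \<in> lat s" for l
  proof -
    obtain v m where vm: "v \<in> value_group R \<phi>"
      "l = v \<odot>\<^bsub>vspace s\<^esub> vunit s \<oplus>\<^bsub>vspace s\<^esub> lc (vspace s) (\<lambda>b. of_int (m b)) (\<lambda>b. b) B"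
      using l by (rule L_E)
    have BL: "B \<subseteq> lat s" using B_in_L by auto
    have "G l = G (v \<odot>\<^bsub>vspace s\<^esub> vunit s) \<oplus>\<^bsub>W'\<^esub> G (lc (vspace s) (\<lambda>b. of_int (m b)) (\<lambda>b. b) B)"
      unfolding vm(2) by (rule Gadd[OF V_e_in_L[OF vm(1)] L_lc_int[OF finite_B BL]])
    also have "\<dots> = h l" unfolding vm(2) h(2)
      using Ge[OF vm(1)] additive_lc_int[OF assms(1) subgroup_L Gc Gadd finite_B BL, of m] by simp
    finally show ?thesis by simp
  qed
  have "h (vunit s) = e'"
  proof -
    have "vunit s = 1 \<odot>\<^bsub>vspace s\<^esub> vunit s \<oplus>\<^bsub>vspace s\<^esub> lc (vspace s) (\<lambda>_. 0) (\<lambda>b. b) B"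
      by (simp add: lc_zero)
    then have "h (vunit s) = 1 \<odot>\<^bsub>W'\<^esub> e' \<oplus>\<^bsub>W'\<^esub> lc W' (\<lambda>_. 0) G B" using h(2)[of 1 "\<lambda>_. 0"] by simp
    then show ?thesis using e' Gc B_in_L by (simp add: W'.lc_zero)
  qed
  then show thesis using that h(1) hG GM by simp
qed

lemma linear_eq_on_M:
  fixes W' :: "(real, 'v) module"
  assumes "real_space W'" "f \<in> linear_maps (vspace s) W'" "h \<in> linear_maps (vspace s) W'"
    "\<And>m. m \<in> carrier M \<Longrightarrow> f m = h m" "w \<in> carrier (vspace s)"
  shows "f w = h w"
  by (rule linear_eq_on_span[OF real_space_axioms assms(1-3) A_carrier _ assms(5)[folded span_A]])
    (use assms(4) A_lat A_cset in auto)

lemma cset_eq_cone_hull_M: "cset s = cone_hull (vspace s) (carrier M)"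
proof
  have c: "carrier M \<subseteq> carrier (vspace s)" by auto
  show "cset s \<subseteq> cone_hull (vspace s) (carrier M)"
    unfolding cset_eq by (rule cone_hull_mono_span[OF _ c], rule subsetI, rule cone_hull_base[OF c])
      (use A_lat A_cset in \<open>auto simp: cset_eq\<close>)
  show "cone_hull (vspace s) (carrier M) \<subseteq> cset s"
    by (rule cone_hull_minimal) (use cset_carrier cset_zero cset_add cset_sm in auto)
qed

end

section \<open>Morphisms of cones against homomorphisms of monoids\<close>

text \<open>The definition of a morphism speaks of the vectors attached to elements of
  \<open>R\<close> only. One element of positive value suffices: dividing by its value gives the
  unit.\<close>

lemma (in valued) cone_mor_vunit:
  assumes "cone_data R \<phi> s B A" "cone_data R \<phi> t B' A'" "f \<in> cone_mor R \<phi> s t"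
  shows "f (vunit s) = vunit t"
proof -
  interpret s: cone_data R \<phi> s B A by fact
  interpret t: cone_data R \<phi> t B' A' by fact
  have f: "f \<in> linear_maps (vspace s) (vspace t)"
    "\<And>r. r \<in> carrier R \<Longrightarrow> r \<noteq> \<one>\<^bsub>R\<^esub> \<Longrightarrow> f (vvec R \<phi> s r) = vvec R \<phi> t r"
    using assms(3) by (auto simp: cone_mor_def)
  obtain r where r: "r \<in> carrier R" "0 < rval R \<phi> r" by (rule rval_pos)
  have "rval R \<phi> r \<odot>\<^bsub>vspace t\<^esub> f (vunit s) = rval R \<phi> r \<odot>\<^bsub>vspace t\<^esub> vunit t"
    using f(2)[OF r(1)] r not_one_of_rval_pos linear_mapsD(3)[OF f(1)] by (simp add: vvec_def)
  then show ?thesis using r linear_mapsD(1)[OF f(1)] by (simp add: t.sm_cancel)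
qed

text \<open>The monoid generates the lattice as a group and the cone as a convex cone, so a linear
  map that respects the monoids respects both.\<close>

lemma (in valued) cone_mor_iff:
  assumes "cone_data R \<phi> s B A" "cone_data R \<phi> t B' A'"
  shows "f \<in> cone_mor R \<phi> s t \<longleftrightarrow> f \<in> extensional (carrier (vspace s)) \<and>
    f \<in> linear_maps (vspace s) (vspace t) \<and> f (vunit s) = vunit t \<and>
    (\<forall>m\<in>cset s \<inter> lat s. f m \<in> cset t \<inter> lat t)"
proof -
  interpret s: cone_data R \<phi> s B A by fact
  interpret t: cone_data R \<phi> t B' A' by fact
  show ?thesis
  proof
    assume "f \<in> cone_mor R \<phi> s t"
    then show "f \<in> extensional (carrier (vspace s)) \<and>
      f \<in> linear_maps (vspace s) (vspace t) \<and> f (vunit s) = vunit t \<and>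
      (\<forall>m\<in>cset s \<inter> lat s. f m \<in> cset t \<inter> lat t)"
      using cone_mor_vunit[OF assms] by (auto simp: cone_mor_def)
  next
    assume *: "f \<in> extensional (carrier (vspace s)) \<and>
      f \<in> linear_maps (vspace s) (vspace t) \<and> f (vunit s) = vunit t \<and>
      (\<forall>m\<in>cset s \<inter> lat s. f m \<in> cset t \<inter> lat t)"
    then have f: "f \<in> linear_maps (vspace s) (vspace t)" "f (vunit s) = vunit t"
      "\<And>m. m \<in> carrier s.M \<Longrightarrow> f m \<in> carrier t.M" by auto
    note fD = linear_mapsD[OF f(1)]
    have "f l \<in> lat t" if l: "l \<in> lat s" for l
    proof -
      obtain x y where xy: "x \<in> cset s \<inter> lat s" "y \<in> cset s \<inter> lat s" "x = l \<oplus>\<^bsub>vspace s\<^esub> y"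
        by (rule s.lat_diff[OF l])
      have fxy: "f x \<in> lat t" "f y \<in> lat t" using f(3) xy by auto
      have "f x = f l \<oplus>\<^bsub>vspace t\<^esub> f y" unfolding xy(3) by (rule fD(2)) (use l xy in auto)
      then have "f l = f x \<oplus>\<^bsub>vspace t\<^esub> (-1) \<odot>\<^bsub>vspace t\<^esub> f y"
        using fD(1)[of l] fD(1)[of y] l xy(2) by (simp add: t.a_assoc t.sm_diff)
      also have "\<dots> \<in> lat t" by (rule t.L_diff[OF fxy])
      finally show ?thesis .
    qed
    moreover have "f ` cset s \<subseteq> cset t"
    proof -
      have "f ` cset s \<subseteq> cone_hull (vspace t) (f ` carrier s.M)"
        unfolding s.cset_eq_cone_hull_M
        by (rule linear_cone_hull[OF s.real_space_axioms t.real_space_axioms f(1)]) auto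
      also have "\<dots> \<subseteq> cset t"
        by (rule t.cone_hull_minimal) (use f(3) t.cset_carrier t.cset_zero t.cset_add t.cset_sm in auto)
      finally show ?thesis .
    qed
    moreover have "f (vvec R \<phi> s r) = vvec R \<phi> t r" if "r \<in> carrier R" for r
      using fD(3) f(2) by (simp add: vvec_def)
    ultimately show "f \<in> cone_mor R \<phi> s t" using * by (auto simp: cone_mor_def)
  qed
qed

lemma (in valued) restrict_cone_mor:
  assumes "cone_data R \<phi> s B A" "cone_data R \<phi> t B' A'" "f \<in> cone_mor R \<phi> s t"
  shows "restrict f (cset s \<inter> lat s) \<in> rmonoid_mor R (monoid_of_cone R \<phi> s) (monoid_of_cone R \<phi> t)"
proof -
  interpret s: cone_data R \<phi> s B A by fact
  interpret t: cone_data R \<phi> t B' A' by fact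
  have f: "f \<in> linear_maps (vspace s) (vspace t)" "f (vunit s) = vunit t"
    "\<And>m. m \<in> cset s \<inter> lat s \<Longrightarrow> f m \<in> cset t \<inter> lat t"
    using assms(3) unfolding cone_mor_iff[OF assms(1,2)] by auto
  have f0: "f \<zero>\<^bsub>vspace s\<^esub> = \<zero>\<^bsub>vspace t\<^esub>"
    by (rule linear_zero[OF s.real_space_axioms t.real_space_axioms f(1)])
  show ?thesis
    using f(3) linear_mapsD(2,3)[OF f(1)] f(2) f0 s.vvec_in_M
    by (auto simp: rmonoid_mor_def monoid_hom_def hom_def s.cset_add s.L_add s.cset_zero s.lat_zero vvec_def)
qed

text \<open>Fullness of the functor from cones to monoids. The linear map is cut down to the carrier
  because morphisms are extensional.\<close>

lemma (in valued) cone_mor_extends: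
  assumes "cone_data R \<phi> s B A" "cone_data R \<phi> t B' A'"
    and g: "g \<in> rmonoid_mor R (monoid_of_cone R \<phi> s) (monoid_of_cone R \<phi> t)"
  obtains f where "f \<in> cone_mor R \<phi> s t" "\<And>m. m \<in> cset s \<inter> lat s \<Longrightarrow> f m = g m"
proof -
  interpret s: cone_data R \<phi> s B A by fact
  interpret t: cone_data R \<phi> t B' A' by fact
  have gh: "g \<in> monoid_hom s.M t.M" "\<And>r. r \<in> carrier R \<Longrightarrow> g (vvec R \<phi> s r) = vvec R \<phi> t r"
    using g by (auto simp: rmonoid_mor_def)
  note gD = monoid_homD[OF gh(1)]
  obtain h where h: "h \<in> linear_maps (vspace s) (vspace t)" "h (vunit s) = vunit t"
    "\<And>m. m \<in> carrier s.M \<Longrightarrow> h m = g m"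
    by (rule s.extension[OF t.real_space_axioms, of "vunit t" g])
      (use gD gh(2) t.cset_carrier in \<open>auto simp: vvec_def\<close>)
  define f where "f = restrict h (carrier (vspace s))"
  have "f \<in> cone_mor R \<phi> s t"
    unfolding cone_mor_iff[OF assms(1,2)]
  proof (intro conjI)
    show "f \<in> linear_maps (vspace s) (vspace t)"
      by (rule linear_mapsI) (use linear_mapsD[OF h(1)] in \<open>auto simp: f_def\<close>)
    show "\<forall>m\<in>cset s \<inter> lat s. f m \<in> cset t \<inter> lat t" using h(3) gD(1) by (auto simp: f_def)
  qed (auto simp: f_def h)
  then show thesis by (rule that) (use h(3) in \<open>auto simp: f_def\<close>)
qed

text \<open>Faithfulness of the same functor: the monoid spans the ambient space.\<close>

lemma (in valued) cone_mor_eqI: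
  assumes "cone_data R \<phi> s B A" "cone_data R \<phi> t B' A'"
    and f: "f \<in> cone_mor R \<phi> s t" and g: "g \<in> cone_mor R \<phi> s t"
    and eq: "\<And>m. m \<in> cset s \<inter> lat s \<Longrightarrow> f m = g m"
  shows "f = g"
proof -
  interpret s: cone_data R \<phi> s B A by fact
  interpret t: cone_data R \<phi> t B' A' by fact
  show ?thesis
  proof (rule extensionalityI)
    show "f \<in> extensional (carrier (vspace s))" "g \<in> extensional (carrier (vspace s))"
      using f g by (auto simp: cone_mor_def)
    fix w assume "w \<in> carrier (vspace s)"
    then show "f w = g w"
      by (rule s.linear_eq_on_M[OF t.real_space_axioms, rotated 3]) (use f g eq in \<open>auto simp: cone_mor_def\<close>)
  qed
qed

section \<open>Bases over a pure subgroup\<close>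

context comm_group
begin

text \<open>A family rather than a set of generators: the base changes below may turn one generator
  into a copy of another, and the index keeps the two apart.\<close>

definition icomb :: "('i \<Rightarrow> 'a) \<Rightarrow> ('i \<Rightarrow> int) \<Rightarrow> 'i set \<Rightarrow> 'a" where
  "icomb x m I = finprod G (\<lambda>i. x i [^] m i) I"

lemma icomb_closed [simp]: "(\<And>i. i \<in> I \<Longrightarrow> x i \<in> carrier G) \<Longrightarrow> icomb x m I \<in> carrier G"
  unfolding icomb_def by (rule finprod_closed) auto

lemma icomb_insert:
  "finite I \<Longrightarrow> i \<notin> I \<Longrightarrow> (\<And>k. k \<in> insert i I \<Longrightarrow> x k \<in> carrier G) \<Longrightarrow>
    icomb x m (insert i I) = x i [^] m i \<otimes> icomb x m I"
  unfolding icomb_def by (subst finprod_insert) auto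

lemma icomb_empty [simp]: "icomb x m {} = \<one>"
  by (simp add: icomb_def)

lemma icomb_remove:
  "finite I \<Longrightarrow> i \<in> I \<Longrightarrow> (\<And>k. k \<in> I \<Longrightarrow> x k \<in> carrier G) \<Longrightarrow>
    icomb x m I = x i [^] m i \<otimes> icomb x m (I - {i})"
  using icomb_insert[of "I - {i}" i x m] by (auto simp: insert_absorb)

lemma icomb_cong:
  assumes "\<And>i. i \<in> I \<Longrightarrow> x i = y i" "\<And>i. i \<in> I \<Longrightarrow> m i = n i" "\<And>i. i \<in> I \<Longrightarrow> y i \<in> carrier G"
  shows "icomb x m I = icomb y n I"
  unfolding icomb_def by (rule finprod_cong') (use assms in auto)

lemma icomb_add:
  assumes "\<And>i. i \<in> I \<Longrightarrow> x i \<in> carrier G"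
  shows "icomb x m I \<otimes> icomb x n I = icomb x (\<lambda>i. m i + n i) I"
proof (cases "finite I")
  case True
  then show ?thesis using assms
  proof (induction I)
    case (insert i I)
    have IH: "icomb x (\<lambda>i. m i + n i) I = icomb x m I \<otimes> icomb x n I" using insert by simp
    have c: "x i \<in> carrier G" "icomb x m I \<in> carrier G" "icomb x n I \<in> carrier G" using insert.prems by auto
    have ins: "icomb x k (insert i I) = x i [^] k i \<otimes> icomb x k I" for k
      by (rule icomb_insert[OF insert.hyps]) (rule insert.prems)
    show ?case unfolding ins IH using c by (simp add: int_pow_mult m_ac)
  qed simp
next
  case False
  then show ?thesis by (simp add: icomb_def)
qed

lemma icomb_neg:
  assumes "\<And>i. i \<in> I \<Longrightarrow> x i \<in> carrier G"
  shows "inv icomb x m I = icomb x (\<lambda>i. - m i) I"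
proof (rule inv_equality)
  show "icomb x (\<lambda>i. - m i) I \<otimes> icomb x m I = \<one>"
    using assms by (simp add: icomb_add) (simp add: icomb_def)
qed (use assms in auto)

text \<open>The elementary base change, in additive notation: \<open>m i x i + m k x k\<close>
  equals \<open>(m i - \<epsilon> m k) x i + m k (x k + \<epsilon> x i)\<close>. It holds for every
  tuple \<open>m\<close>, so the same change of generators preserves the relation at hand and the
  spanning property.\<close>

lemma icomb_exchange:
  assumes I: "finite I" "i \<in> I" "k \<in> I" "i \<noteq> k" and x: "\<And>i. i \<in> I \<Longrightarrow> x i \<in> carrier G"
  shows "icomb (x(k := x k \<otimes> x i [^] (\<epsilon>::int))) (m(i := m i - \<epsilon> * m k)) I = icomb x m I"
proof -
  let ?J = "I - {i} - {k}" and ?x' = "x(k := x k \<otimes> x i [^] \<epsilon>)" and ?m' = "m(i := m i - \<epsilon> * m k)"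
  have x': "\<And>l. l \<in> I \<Longrightarrow> ?x' l \<in> carrier G" using I x by auto
  have J: "icomb ?x' ?m' ?J = icomb x m ?J" by (rule icomb_cong) (use x in auto)
  have xik: "x i \<in> carrier G" "x k \<in> carrier G" using x I by auto
  have c: "icomb x m ?J \<in> carrier G" by (rule icomb_closed) (use x in auto)
  have "icomb ?x' ?m' I = ?x' i [^] ?m' i \<otimes> icomb ?x' ?m' (I - {i})"
    by (rule icomb_remove[OF I(1,2) x'])
  also have "icomb ?x' ?m' (I - {i}) = ?x' k [^] ?m' k \<otimes> icomb ?x' ?m' ?J"
    by (rule icomb_remove) (use I in simp, use I in simp, rule x', simp)
  also have "?x' i [^] ?m' i \<otimes> (?x' k [^] ?m' k \<otimes> icomb ?x' ?m' ?J)
      = x i [^] (m i - \<epsilon> * m k) \<otimes> ((x k \<otimes> x i [^] \<epsilon>) [^] m k \<otimes> icomb x m ?J)"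
    unfolding J using I(4) by simp
  also have "\<dots> = (x i [^] (m i - \<epsilon> * m k) \<otimes> x i [^] (\<epsilon> * m k)) \<otimes> (x k [^] m k \<otimes> icomb x m ?J)"
    using xik c by (simp add: int_pow_distrib int_pow_pow m_ac)
  also have "x i [^] (m i - \<epsilon> * m k) \<otimes> x i [^] (\<epsilon> * m k) = x i [^] m i"
    using xik by (simp flip: int_pow_mult)
  also have "x k [^] m k \<otimes> icomb x m ?J = icomb x m (I - {i})"
    by (rule icomb_remove[symmetric]) (use I x in auto)
  also have "x i [^] m i \<otimes> icomb x m (I - {i}) = icomb x m I"
    by (rule icomb_remove[symmetric, OF I(1,2) x])
  finally show ?thesis .
qed

definition spans_over :: "'a set \<Rightarrow> ('i \<Rightarrow> 'a) \<Rightarrow> 'i set \<Rightarrow> bool" where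
  "spans_over J x I \<longleftrightarrow> (\<forall>l\<in>carrier G. \<exists>z\<in>J. \<exists>m. l = z \<otimes> icomb x m I)"

text \<open>A relation between generators is shortened by the Euclidean algorithm until it involves only one
  generator; that generator then lies in \<open>J\<close> and can be dropped.\<close>

lemma basis_over_pure_subgroup:
  fixes x :: "'i \<Rightarrow> 'a"
  assumes J: "subgroup J G" and pure: "\<And>x k. x \<in> carrier G \<Longrightarrow> k \<noteq> (0::int) \<Longrightarrow> x [^] k \<in> J \<Longrightarrow> x \<in> J"
    and "finite I" "\<And>i. i \<in> I \<Longrightarrow> x i \<in> carrier G" "spans_over J x I"
  shows "\<exists>I' (x' :: 'i \<Rightarrow> 'a). finite I' \<and> (\<forall>i\<in>I'. x' i \<in> carrier G) \<and> spans_over J x' I' \<and>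
    (\<forall>m. icomb x' m I' \<in> J \<longrightarrow> (\<forall>i\<in>I'. m i = 0))"
  using assms(3-5)
proof (induction "card I" arbitrary: I x rule: less_induct)
  case (less I x)
  show ?case
  proof (cases "\<exists>m. icomb x m I \<in> J \<and> (\<exists>i\<in>I. m i \<noteq> 0)")
    case False
    then show ?thesis using less.prems by (intro exI[of _ I] exI[of _ x]) auto
  next
    case True
    then obtain m where m: "icomb x m I \<in> J" "\<exists>i\<in>I. m i \<noteq> 0" by (elim exE conjE)
    \<comment> \<open>Two nested inductions: the outer one drops generators, the inner one reduces
      the sum of the absolute values of the coefficients of one relation.\<close>
    show ?thesis using less.prems(2,3) m
    proof (induction "nat (\<Sum>i\<in>I. \<bar>m i\<bar>)" arbitrary: x m rule: less_induct)
      case inner: (less m x)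
      note x = inner.prems(1) and sp = inner.prems(2) and mJ = inner.prems(3)
      obtain k where k: "k \<in> I" "m k \<noteq> 0" using inner.prems(4) by auto
      show ?case
      proof (cases "\<exists>i\<in>I. i \<noteq> k \<and> m i \<noteq> 0")
        case False
        \<comment> \<open>A relation with a single nonzero coefficient says that a nonzero multiple
          of \<open>x k\<close> lies in \<open>J\<close>. By purity so does \<open>x k\<close>,
          whose contribution is then absorbed into the \<open>J\<close> component.\<close>
        have "icomb x m (I - {k}) = icomb x (\<lambda>_. 0) (I - {k})"
          by (rule icomb_cong) (use False x in auto)
        also have "\<dots> = \<one>" by (simp add: icomb_def)
        finally have "icomb x m I = x k [^] m k"
          using icomb_remove[OF less.prems(1) k(1), of x m, OF x] x[OF k(1)] by simp
        then have xk: "x k \<in> J" using mJ pure[OF x[OF k(1)] k(2)] by simp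
        have "card (I - {k}) < card I" using less.prems(1) k(1) by (rule card_Diff1_less)
        moreover have "spans_over J x (I - {k})"
          unfolding spans_over_def
        proof
          fix l assume "l \<in> carrier G"
          then obtain z n where z: "z \<in> J" "l = z \<otimes> icomb x n I" using sp by (auto simp: spans_over_def)
          have "x k [^] n k \<in> J" using xk by (rule subgroup_int_pow_closed[OF J])
          then have "z \<otimes> x k [^] n k \<in> J" using z(1) by (intro subgroup.m_closed[OF J])
          moreover have "icomb x n (I - {k}) \<in> carrier G" by (rule icomb_closed) (use x in auto)
          then have "l = (z \<otimes> x k [^] n k) \<otimes> icomb x n (I - {k})"
            using z subgroup.subset[OF J] x[OF k(1)] icomb_remove[OF less.prems(1) k(1), of x n, OF x]
            by (auto simp: m_assoc)
          ultimately show "\<exists>z\<in>J. \<exists>m. l = z \<otimes> icomb x m (I - {k})" by blast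
        qed
        ultimately show ?thesis using less.hyps[of "I - {k}" x] less.prems(1) x by auto
      next
        case True
        then obtain i0 where i0: "i0 \<in> I" "i0 \<noteq> k" "m i0 \<noteq> 0" by auto
        obtain i k where ik: "i \<in> I" "k \<in> I" "i \<noteq> k" "m i \<noteq> 0" "m k \<noteq> 0" "\<bar>m k\<bar> \<le> \<bar>m i\<bar>"
        proof (cases "\<bar>m k\<bar> \<le> \<bar>m i0\<bar>")
          case True
          then show thesis using that[of i0 k] i0 k by simp
        next
          case False
          then show thesis using that[of k i0] i0 k by simp
        qed
        \<comment> \<open>With this sign the larger coefficient loses the absolute value of the
          smaller one. The coefficient at \<open>k\<close> is untouched, so the relation stays
          nontrivial.\<close>
        define \<epsilon> where "\<epsilon> = sgn (m i) * sgn (m k)"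
        define x' where "x' = x(k := x k \<otimes> x i [^] \<epsilon>)"
        define m' where "m' = m(i := m i - \<epsilon> * m k)"
        have less_abs: "\<bar>m' i\<bar> < \<bar>m i\<bar>"
          using ik(4-6) by (auto simp: m'_def \<epsilon>_def sgn_if)
        have "(\<Sum>l\<in>I. \<bar>m' l\<bar>) < (\<Sum>l\<in>I. \<bar>m l\<bar>)"
          by (rule sum_strict_mono_ex1) (use less.prems(1) ik less_abs in \<open>auto simp: m'_def\<close>)
        moreover have "0 \<le> (\<Sum>l\<in>I. \<bar>m' l\<bar>)" by (intro sum_nonneg) auto
        ultimately have lt: "nat (\<Sum>l\<in>I. \<bar>m' l\<bar>) < nat (\<Sum>l\<in>I. \<bar>m l\<bar>)" by linarith
        have x': "\<And>l. l \<in> I \<Longrightarrow> x' l \<in> carrier G" using x ik by (auto simp: x'_def)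
        have ex: "icomb x' (n(i := n i - \<epsilon> * n k)) I = icomb x n I" for n
          unfolding x'_def by (rule icomb_exchange[OF less.prems(1) ik(1-3) x])
        have "spans_over J x' I"
          unfolding spans_over_def
        proof
          fix l assume "l \<in> carrier G"
          then obtain z n where "z \<in> J" "l = z \<otimes> icomb x n I" using sp by (auto simp: spans_over_def)
          then show "\<exists>z\<in>J. \<exists>m. l = z \<otimes> icomb x' m I" using ex[of n] by metis
        qed
        moreover have "icomb x' m' I \<in> J" using mJ ex[of m] by (simp add: m'_def)
        moreover have "\<exists>i\<in>I. m' i \<noteq> 0" using ik by (intro bexI[of _ k]) (auto simp: m'_def)
        ultimately show ?thesis using inner.hyps[OF lt x'] by simp
      qed
    qed
  qed
qed

lemma spans_over_if_generates:
  assumes J: "subgroup J G" and A: "A \<subseteq> carrier G" "finite I" "x ` I = A"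
    and gen: "generate G (A \<union> J) = carrier G"
  shows "spans_over J x I"
proof -
  define H where "H = {z \<otimes> icomb x m I | z m. z \<in> J}"
  have x: "\<And>i. i \<in> I \<Longrightarrow> x i \<in> carrier G" using A by auto
  have Jc: "\<And>z. z \<in> J \<Longrightarrow> z \<in> carrier G" using subgroup.subset[OF J] by auto
  note J' = subgroup.m_closed[OF J] subgroup.one_closed[OF J] subgroup.m_inv_closed[OF J]
  have one: "icomb x (\<lambda>_. 0) I = \<one>" by (simp add: icomb_def)
  have "subgroup H G"
  proof (rule subgroupI)
    show "H \<subseteq> carrier G" using x Jc by (auto simp: H_def)
    show "H \<noteq> {}" using J' by (auto simp: H_def)
    fix a assume "a \<in> H"
    then obtain z m where a: "z \<in> J" "a = z \<otimes> icomb x m I" by (auto simp: H_def)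
    have "inv a = inv z \<otimes> icomb x (\<lambda>i. - m i) I"
      using a x Jc icomb_neg[of I x m] by (simp add: inv_mult)
    then show "inv a \<in> H" using a J' by (auto simp: H_def)
    fix b assume "b \<in> H"
    then obtain w n where b: "w \<in> J" "b = w \<otimes> icomb x n I" by (auto simp: H_def)
    have "a \<otimes> b = (z \<otimes> w) \<otimes> (icomb x m I \<otimes> icomb x n I)"
      using a b x Jc by (simp add: m_ac)
    also have "\<dots> = (z \<otimes> w) \<otimes> icomb x (\<lambda>i. m i + n i) I" using x by (simp add: icomb_add)
    finally show "a \<otimes> b \<in> H" using a b J' by (auto simp: H_def)
  qed
  moreover have "A \<union> J \<subseteq> H"
  proof
    fix a assume "a \<in> A \<union> J"
    then show "a \<in> H"
    proof
      assume "a \<in> J"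
      then have "a = a \<otimes> icomb x (\<lambda>_. 0) I" using Jc by (simp add: one)
      then show "a \<in> H" using \<open>a \<in> J\<close> unfolding H_def by blast
    next
      assume "a \<in> A"
      then obtain i where i: "i \<in> I" "a = x i" using A by auto
      have "icomb x (\<lambda>k. if k = i then 1 else 0) (I - {i}) = icomb x (\<lambda>_. 0) (I - {i})"
        by (rule icomb_cong) (use x in auto)
      also have "\<dots> = \<one>" by (simp add: icomb_def)
      finally have "icomb x (\<lambda>k. if k = i then 1 else 0) I = a"
        using icomb_remove[OF A(2) i(1), of x "\<lambda>k. if k = i then 1 else 0", OF x] i x[OF i(1)] by simp
      then have "a = \<one> \<otimes> icomb x (\<lambda>k. if k = i then 1 else 0) I" using x i by simp
      then show "a \<in> H" using J'(2) unfolding H_def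
        by (intro CollectI exI[of _ \<one>] exI[of _ "\<lambda>k. if k = i then 1 else 0"]) simp
    qed
  qed
  ultimately have "carrier G \<subseteq> H" using generate_subgroup_incl gen by metis
  then show ?thesis unfolding spans_over_def H_def by blast
qed

end

section \<open>Realification\<close>

lemma real_vs_real_line: "real_vs real_line"
proof (rule real_vsI)
  show "comm_group (add_monoid real_line)"
    by (rule comm_groupI) (auto simp: real_line_def intro: exI[of _ "- x" for x])
qed (auto simp: real_line_def algebra_simps)

lemma real_line_simps [simp]:
  "carrier real_line = UNIV" "x \<oplus>\<^bsub>real_line\<^esub> y = x + y" "\<zero>\<^bsub>real_line\<^esub> = 0" "c \<odot>\<^bsub>real_line\<^esub> x = c * x"
  by (auto simp: real_line_def)

lemma real_vs_free_vs: "real_vs (free_vs S)"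
proof (rule real_vsI)
  have fin: "finite {x. f x + g x \<noteq> 0}" if "finite {x. f x \<noteq> 0}" "finite {x. g x \<noteq> 0}"
    for f g :: "'a \<Rightarrow> real"
    by (rule finite_subset[OF _ finite_UnI[OF that]]) auto
  show "comm_group (add_monoid (free_vs S))"
  proof (rule comm_groupI)
    fix f assume "f \<in> carrier (add_monoid (free_vs S))"
    then show "\<exists>g\<in>carrier (add_monoid (free_vs S)). g \<otimes>\<^bsub>add_monoid (free_vs S)\<^esub> f = \<one>\<^bsub>add_monoid (free_vs S)\<^esub>"
      by (intro bexI[of _ "\<lambda>x. - f x"]) (auto simp: free_vs_def)
  next
    fix f g assume "f \<in> carrier (add_monoid (free_vs S))" "g \<in> carrier (add_monoid (free_vs S))"
    then show "f \<otimes>\<^bsub>add_monoid (free_vs S)\<^esub> g \<in> carrier (add_monoid (free_vs S))"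
      using fin[of f g] by (force simp: free_vs_def)
  qed (auto simp: free_vs_def add_ac)
next
  fix a :: real and f assume "f \<in> carrier (free_vs S)"
  then have "finite {x. f x \<noteq> 0}" "{x. f x \<noteq> 0} \<subseteq> S" by (auto simp: free_vs_def)
  moreover have "{x. a * f x \<noteq> 0} \<subseteq> {x. f x \<noteq> 0}" by auto
  ultimately have "finite {x. a * f x \<noteq> 0}" "{x. a * f x \<noteq> 0} \<subseteq> S" by (auto intro: finite_subset)
  then show "a \<odot>\<^bsub>free_vs S\<^esub> f \<in> carrier (free_vs S)" by (auto simp: free_vs_def)
qed (auto simp: free_vs_def algebra_simps)

lemma free_vs_simps:
  "\<zero>\<^bsub>free_vs S\<^esub> = (\<lambda>x. 0)" "f \<oplus>\<^bsub>free_vs S\<^esub> g = (\<lambda>x. f x + g x)" "c \<odot>\<^bsub>free_vs S\<^esub> f = (\<lambda>x. c * f x)"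
  by (auto simp: free_vs_def)

lemma delta_carrier: "a \<in> S \<Longrightarrow> delta a r \<in> carrier (free_vs S)"
  by (auto simp: free_vs_def delta_def)

lemma delta_sm: "c \<odot>\<^bsub>free_vs S\<^esub> delta a r = delta a (c * r)"
  by (auto simp: free_vs_simps delta_def)

text \<open>Functionals suffice in this chain of universal properties, since their purpose is to
  separate vectors of the realification.\<close>

lemma free_vs_functional:
  fixes g :: "'a \<Rightarrow> real"
  obtains k where "k \<in> linear_maps (free_vs S) real_line" "\<And>a r. k (delta a r) = r * g a"
proof -
  define k where "k f = (\<Sum>a | f a \<noteq> 0. f a * g a)" for f :: "'a \<Rightarrow> real"
  have k: "k f = (\<Sum>a\<in>A. f a * g a)" if "finite A" "{a. f a \<noteq> 0} \<subseteq> A" for f A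
    unfolding k_def by (rule sum.mono_neutral_left) (use that in auto)
  have "k \<in> linear_maps (free_vs S) real_line"
  proof (rule linear_mapsI)
    fix f h assume "f \<in> carrier (free_vs S)" "h \<in> carrier (free_vs S)"
    then have fin: "finite ({a. f a \<noteq> 0} \<union> {a. h a \<noteq> 0})" by (auto simp: free_vs_def)
    show "k (f \<oplus>\<^bsub>free_vs S\<^esub> h) = k f \<oplus>\<^bsub>real_line\<^esub> k h"
      using fin by (subst (1 2 3) k[OF fin]) (auto simp: free_vs_simps algebra_simps sum.distrib)
  next
    fix c f assume "f \<in> carrier (free_vs S)"
    then have fin: "finite {a. f a \<noteq> 0}" by (auto simp: free_vs_def)
    show "k (c \<odot>\<^bsub>free_vs S\<^esub> f) = c \<odot>\<^bsub>real_line\<^esub> k f"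
      by (subst (1 2) k[OF fin]) (auto simp: free_vs_simps sum_distrib_left mult.assoc)
  qed simp
  moreover have "k (delta a r) = r * g a" for a r
    by (subst k[of "{a}"]) (auto simp: delta_def)
  ultimately show thesis by (rule that)
qed

lemma real_vs_direct_sum:
  fixes W :: "(real, 'v) module" and W' :: "(real, 'w) module"
  assumes "real_vs W" "real_vs W'"
  shows "real_vs (direct_sum_vs W W')"
proof -
  interpret W: real_space W by unfold_locales fact
  interpret W': real_space W' by unfold_locales fact
  show ?thesis
  proof (rule real_vsI)
    show "comm_group (add_monoid (direct_sum_vs W W'))"
    proof (rule comm_groupI)
      fix x assume "x \<in> carrier (add_monoid (direct_sum_vs W W'))"
      then show "\<exists>y\<in>carrier (add_monoid (direct_sum_vs W W')).
        y \<otimes>\<^bsub>add_monoid (direct_sum_vs W W')\<^esub> x = \<one>\<^bsub>add_monoid (direct_sum_vs W W')\<^esub>"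
        by (intro bexI[of _ "((-1) \<odot>\<^bsub>W\<^esub> fst x, (-1) \<odot>\<^bsub>W'\<^esub> snd x)"])
          (auto simp: direct_sum_vs_def W.sm_diff W'.sm_diff)
    qed (auto simp: direct_sum_vs_def W.add.m_ac W'.add.m_ac)
  qed (auto simp: direct_sum_vs_def W.sm_add_left W'.sm_add_left W.sm_add_right W'.sm_add_right)
qed

lemma linear_zero_on_span:
  fixes W :: "(real, 'v) module" and W' :: "(real, 'w) module"
  assumes "real_space W" "real_space W'" and f: "f \<in> linear_maps W W'" and S: "S \<subseteq> carrier W"
    and f0: "\<And>s. s \<in> S \<Longrightarrow> f s = \<zero>\<^bsub>W'\<^esub>" and w: "w \<in> lin_span W S"
  shows "f w = \<zero>\<^bsub>W'\<^esub>"
proof -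
  interpret W: real_space W by fact
  interpret W': real_space W' by fact
  have "lin_span W S \<subseteq> {w \<in> carrier W. f w = \<zero>\<^bsub>W'\<^esub>}"
    by (rule W.lin_span_minimal)
      (use S in \<open>auto simp: f0 linear_mapsD[OF f] linear_zero[OF assms(1-3)]\<close>)
  then show ?thesis using w by auto
qed

context comm_group
begin

lemma real_space_free: "real_space (free_vs (carrier G))"
  by unfold_locales (rule real_vs_free_vs)

lemma relations_carrier:
  "{\<lambda>x. delta (a \<otimes> b) 1 x - delta a 1 x - delta b 1 x | a b. a \<in> carrier G \<and> b \<in> carrier G}
    \<subseteq> carrier (free_vs (carrier G))"
proof (safe)
  interpret F: real_space "free_vs (carrier G)" by (rule real_space_free)
  fix a b assume ab: "a \<in> carrier G" "b \<in> carrier G"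
  have "delta (a \<otimes> b) 1 \<oplus>\<^bsub>free_vs (carrier G)\<^esub> ((-1) \<odot>\<^bsub>free_vs (carrier G)\<^esub> delta a 1
      \<oplus>\<^bsub>free_vs (carrier G)\<^esub> (-1) \<odot>\<^bsub>free_vs (carrier G)\<^esub> delta b 1) \<in> carrier (free_vs (carrier G))"
    using ab delta_carrier[of _ "carrier G"] by (intro F.a_closed F.sm_closed) auto
  then show "(\<lambda>x. delta (a \<otimes> b) 1 x - delta a 1 x - delta b 1 x) \<in> carrier (free_vs (carrier G))"
    by (simp add: free_vs_simps algebra_simps)
qed

lemma subspace_tensor_relations: "real_subspace (free_vs (carrier G)) (tensor_relations G)"
  unfolding tensor_relations_def by (rule real_space.real_subspace_lin_span[OF real_space_free relations_carrier])

lemma real_vs_tensor: "real_vs (tensor_real G)"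
  unfolding tensor_real_def
  by (rule real_space.real_vs_quot_vs[OF real_space_free subspace_tensor_relations])

lemma pure_tensor_carrier [simp]: "a \<in> carrier G \<Longrightarrow> pure_tensor G a r \<in> carrier (tensor_real G)"
  unfolding tensor_real_def pure_tensor_def real_space.carrier_quot_vs[OF real_space_free]
  by (intro imageI delta_carrier)

lemma pure_tensor_sm:
  "a \<in> carrier G \<Longrightarrow> k \<odot>\<^bsub>tensor_real G\<^esub> pure_tensor G a r = pure_tensor G a (k * r)"
  unfolding tensor_real_def pure_tensor_def
  by (subst real_space.quot_vs_sm[OF real_space_free subspace_tensor_relations])
    (simp_all add: delta_carrier delta_sm)

lemma pure_tensor_mult:
  assumes "a \<in> carrier G" "b \<in> carrier G"
  shows "pure_tensor G (a \<otimes> b) 1 = pure_tensor G a 1 \<oplus>\<^bsub>tensor_real G\<^esub> pure_tensor G b 1"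
proof -
  interpret F: real_space "free_vs (carrier G)" by (rule real_space_free)
  have d: "delta (a \<otimes> b) 1 \<in> carrier (free_vs (carrier G))" "delta a 1 \<in> carrier (free_vs (carrier G))"
    "delta b 1 \<in> carrier (free_vs (carrier G))"
    using assms by (auto intro!: delta_carrier)
  have "delta (a \<otimes> b) 1 \<oplus>\<^bsub>free_vs (carrier G)\<^esub> (-1) \<odot>\<^bsub>free_vs (carrier G)\<^esub>
      (delta a 1 \<oplus>\<^bsub>free_vs (carrier G)\<^esub> delta b 1) = (\<lambda>x. delta (a \<otimes> b) 1 x - delta a 1 x - delta b 1 x)"
    by (simp add: free_vs_simps algebra_simps)
  also have "\<dots> \<in> tensor_relations G"
    unfolding tensor_relations_def by (rule F.lin_span_base[OF relations_carrier]) (use assms in blast)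
  finally have "tensor_relations G +>\<^bsub>free_vs (carrier G)\<^esub> delta (a \<otimes> b) 1
      = tensor_relations G +>\<^bsub>free_vs (carrier G)\<^esub> (delta a 1 \<oplus>\<^bsub>free_vs (carrier G)\<^esub> delta b 1)"
    using d by (subst F.coset_eq_iff[OF subspace_tensor_relations]) auto
  then show ?thesis
    unfolding pure_tensor_def tensor_real_def using d by (simp add: F.quot_vs_add[OF subspace_tensor_relations])
qed

lemma tensor_functional:
  fixes g :: "'a \<Rightarrow> real"
  assumes g: "\<And>a b. a \<in> carrier G \<Longrightarrow> b \<in> carrier G \<Longrightarrow> g (a \<otimes> b) = g a + g b"
  obtains k where "k \<in> linear_maps (tensor_real G) real_line"
    "\<And>a r. a \<in> carrier G \<Longrightarrow> k (pure_tensor G a r) = r * g a"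
proof -
  interpret F: real_space "free_vs (carrier G)" by (rule real_space_free)
  interpret Ln: real_space real_line by unfold_locales (rule real_vs_real_line)
  obtain k where k: "k \<in> linear_maps (free_vs (carrier G)) real_line" "\<And>a r. k (delta a r) = r * g a"
    by (rule free_vs_functional[of "carrier G" g]) (rule that)
  have "k u = 0" if u: "u \<in> tensor_relations G" for u
  proof -
    have "k u = \<zero>\<^bsub>real_line\<^esub>"
    proof (rule linear_zero_on_span[OF F.real_space_axioms Ln.real_space_axioms k(1) relations_carrier _ u[unfolded tensor_relations_def]])
      fix f assume "f \<in> {\<lambda>x. delta (a \<otimes> b) 1 x - delta a 1 x - delta b 1 x | a b. a \<in> carrier G \<and> b \<in> carrier G}"
      then obtain a b where ab: "a \<in> carrier G" "b \<in> carrier G"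
        and f: "f = delta (a \<otimes> b) 1 \<oplus>\<^bsub>free_vs (carrier G)\<^esub> ((-1) \<odot>\<^bsub>free_vs (carrier G)\<^esub> delta a 1
          \<oplus>\<^bsub>free_vs (carrier G)\<^esub> (-1) \<odot>\<^bsub>free_vs (carrier G)\<^esub> delta b 1)"
        by (auto simp: free_vs_simps algebra_simps)
      have d: "delta (a \<otimes> b) 1 \<in> carrier (free_vs (carrier G))" "delta a 1 \<in> carrier (free_vs (carrier G))"
        "delta b 1 \<in> carrier (free_vs (carrier G))"
        using ab by (auto intro!: delta_carrier)
      show "k f = \<zero>\<^bsub>real_line\<^esub>"
        unfolding f using d ab by (simp add: linear_mapsD[OF k(1)] k(2) g)
    qed
    then show ?thesis by simp
  qed
  then obtain k' where "k' \<in> linear_maps (tensor_real G) real_line"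
    "\<And>x. x \<in> carrier (free_vs (carrier G)) \<Longrightarrow> k' (tensor_relations G +>\<^bsub>free_vs (carrier G)\<^esub> x) = k x"
    unfolding tensor_real_def
    using F.quot_vs_lift[OF subspace_tensor_relations Ln.real_space_axioms k(1)] by auto
  then show thesis using that[of k'] k(2) by (simp add: pure_tensor_def delta_carrier)
qed

lemma tensor_span:
  "lin_span (tensor_real G) ((\<lambda>a. pure_tensor G a 1) ` carrier G) = carrier (tensor_real G)"
proof -
  interpret F: real_space "free_vs (carrier G)" by (rule real_space_free)
  interpret T: real_space "tensor_real G" by unfold_locales (rule real_vs_tensor)
  let ?S = "(\<lambda>a. pure_tensor G a 1) ` carrier G" and ?p = "\<lambda>f. tensor_relations G +>\<^bsub>free_vs (carrier G)\<^esub> f"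
  have S: "?S \<subseteq> carrier (tensor_real G)" by auto
  have p: "?p \<in> linear_maps (free_vs (carrier G)) (tensor_real G)"
    unfolding tensor_real_def by (rule F.linear_coset[OF subspace_tensor_relations])
  have "?p f \<in> lin_span (tensor_real G) ?S" if "finite A" "f \<in> carrier (free_vs (carrier G))" "{a. f a \<noteq> 0} \<subseteq> A" for f A
    using that
  proof (induction A arbitrary: f)
    case empty
    then have "f = \<zero>\<^bsub>free_vs (carrier G)\<^esub>" by (auto simp: free_vs_simps)
    then have "?p f = \<zero>\<^bsub>tensor_real G\<^esub>"
      using linear_zero[OF F.real_space_axioms T.real_space_axioms p] by simp
    then show ?case using T.lin_span_zero by simp
  next
    case (insert a A)
    show ?case
    proof (cases "f a = 0")
      case True
      have "{a. f a \<noteq> 0} \<subseteq> A" using insert.prems(2) True by auto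
      then show ?thesis by (rule insert.IH[OF insert.prems(1)])
    next
      case False
      then have a: "a \<in> carrier G" using insert.prems(1) by (auto simp: free_vs_def)
      define g where "g = f \<oplus>\<^bsub>free_vs (carrier G)\<^esub> (-1) \<odot>\<^bsub>free_vs (carrier G)\<^esub> delta a (f a)"
      have g: "g \<in> carrier (free_vs (carrier G))"
        unfolding g_def using insert.prems delta_carrier[OF a] by (intro F.a_closed F.sm_closed) auto
      have "{a. g a \<noteq> 0} \<subseteq> A" using insert.prems by (auto simp: g_def free_vs_simps delta_def)
      then have "?p g \<in> lin_span (tensor_real G) ?S" by (rule insert.IH[OF g])
      moreover have "pure_tensor G a (f a) \<in> lin_span (tensor_real G) ?S"
        using T.lin_span_sm[OF S T.lin_span_base[OF S, of "pure_tensor G a 1"], of "f a"] a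
        by (simp add: pure_tensor_sm)
      moreover have "?p f = ?p g \<oplus>\<^bsub>tensor_real G\<^esub> pure_tensor G a (f a)"
      proof -
        have "f = g \<oplus>\<^bsub>free_vs (carrier G)\<^esub> delta a (f a)" by (auto simp: g_def free_vs_simps)
        then have "?p f = ?p (g \<oplus>\<^bsub>free_vs (carrier G)\<^esub> delta a (f a))" by simp
        also have "\<dots> = ?p g \<oplus>\<^bsub>tensor_real G\<^esub> ?p (delta a (f a))"
          by (rule linear_mapsD(2)[OF p g delta_carrier[OF a]])
        finally show ?thesis by (simp add: pure_tensor_def)
      qed
      ultimately show ?thesis using T.lin_span_add[OF S] by simp
    qed
  qed
  moreover have "finite {a. f a \<noteq> 0}" if "f \<in> carrier (free_vs (carrier G))" for f
    using that by (auto simp: free_vs_def)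
  ultimately have "carrier (tensor_real G) \<subseteq> lin_span (tensor_real G) ?S"
    by (auto simp: tensor_real_def F.carrier_quot_vs)
  then show ?thesis using T.lin_span_closed[OF S] by auto
qed

end

section \<open>The realification of an abstract lattice\<close>

locale lattice_group = comm_group L for L :: "('a, 'c) monoid_scheme" (structure) +
  fixes V :: "real set" and j :: "real \<Rightarrow> 'a"
  assumes torsion_free: "torsion_free_group L" and V: "value_subgroup V"
    and V_div: "0 < (n :: nat) \<Longrightarrow> real n * x \<in> V \<Longrightarrow> x \<in> V"
    and j_closed [simp]: "v \<in> V \<Longrightarrow> j v \<in> carrier L"
    and j_add: "v \<in> V \<Longrightarrow> w \<in> V \<Longrightarrow> j (v + w) = j v \<otimes> j w"
    and j_inj: "inj_on j V"
    and fin_gen: "\<exists>A. finite A \<and> A \<subseteq> carrier L \<and> generate L (A \<union> j ` V) = carrier L"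
begin

abbreviation "T \<equiv> tensor_real L"
abbreviation "D \<equiv> direct_sum_vs (tensor_real L) real_line"
abbreviation "LR \<equiv> realification V L j"
abbreviation "\<rho> \<equiv> realification_of V L j"
abbreviation "u \<equiv> realification_unit V L j"

lemma V_simps: "0 \<in> V" "v \<in> V \<Longrightarrow> w \<in> V \<Longrightarrow> v + w \<in> V" "v \<in> V \<Longrightarrow> - v \<in> V"
  using V by (auto simp: value_subgroup_def)

lemma real_space_D: "real_space D"
  by unfold_locales (rule real_vs_direct_sum[OF real_vs_tensor real_vs_real_line])

lemma real_space_T: "real_space T"
  by unfold_locales (rule real_vs_tensor)

lemma D_simps [simp]:
  "carrier D = carrier T \<times> UNIV" "\<zero>\<^bsub>D\<^esub> = (\<zero>\<^bsub>T\<^esub>, 0)"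
  "(X, r) \<oplus>\<^bsub>D\<^esub> (Y, s) = (X \<oplus>\<^bsub>T\<^esub> Y, r + s)" "c \<odot>\<^bsub>D\<^esub> (X, r) = (c \<odot>\<^bsub>T\<^esub> X, c * r)"
  by (auto simp: direct_sum_vs_def)

lemma pushout_carrier: "{(pure_tensor L (j x) r, - (x * r)) | x r. x \<in> V} \<subseteq> carrier D"
  by auto

lemma subspace_pushout: "real_subspace D (pushout_relations V L j)"
  unfolding pushout_relations_def by (rule real_space.real_subspace_lin_span[OF real_space_D pushout_carrier])

lemma real_vs_LR: "real_vs LR"
  unfolding realification_def by (rule real_space.real_vs_quot_vs[OF real_space_D subspace_pushout])

sublocale LR: real_space LR
  by unfold_locales (rule real_vs_LR)

lemma coset_linear: "(\<lambda>x. pushout_relations V L j +>\<^bsub>D\<^esub> x) \<in> linear_maps D LR"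
  unfolding realification_def by (rule real_space.linear_coset[OF real_space_D subspace_pushout])

lemma \<rho>_closed [simp]: "l \<in> carrier L \<Longrightarrow> \<rho> l \<in> carrier LR"
  unfolding realification_of_def by (rule linear_mapsD(1)[OF coset_linear]) simp

lemma u_closed [simp]: "u \<in> carrier LR"
proof -
  interpret T: real_space T by (rule real_space_T)
  show ?thesis unfolding realification_unit_def by (rule linear_mapsD(1)[OF coset_linear]) simp
qed

lemma \<rho>_mult: "a \<in> carrier L \<Longrightarrow> b \<in> carrier L \<Longrightarrow> \<rho> (a \<otimes> b) = \<rho> a \<oplus>\<^bsub>LR\<^esub> \<rho> b"
  unfolding realification_of_def
  by (subst linear_mapsD(2)[OF coset_linear, symmetric]) (auto simp: pure_tensor_mult)

lemma \<rho>_j: "v \<in> V \<Longrightarrow> \<rho> (j v) = v \<odot>\<^bsub>LR\<^esub> u"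
proof -
  assume v: "v \<in> V"
  interpret T: real_space T by (rule real_space_T)
  interpret D: real_space D by (rule real_space_D)
  \<comment> \<open>The defining relation of the pushout for \<open>x = v\<close> and
    \<open>r = 1\<close>.\<close>
  have "(pure_tensor L (j v) 1, 0) \<oplus>\<^bsub>D\<^esub> (-1) \<odot>\<^bsub>D\<^esub> (\<zero>\<^bsub>T\<^esub>, v) = (pure_tensor L (j v) 1, - (v * 1))"
    using v by simp
  also have "\<dots> \<in> pushout_relations V L j"
    unfolding pushout_relations_def by (rule D.lin_span_base[OF pushout_carrier]) (use v in blast)
  finally have "\<rho> (j v) = pushout_relations V L j +>\<^bsub>D\<^esub> (\<zero>\<^bsub>T\<^esub>, v)"
    unfolding realification_of_def using v by (subst D.coset_eq_iff[OF subspace_pushout]) auto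
  also have "(\<zero>\<^bsub>T\<^esub>, v) = v \<odot>\<^bsub>D\<^esub> (\<zero>\<^bsub>T\<^esub>, 1)" by simp
  also have "pushout_relations V L j +>\<^bsub>D\<^esub> (v \<odot>\<^bsub>D\<^esub> (\<zero>\<^bsub>T\<^esub>, 1)) = v \<odot>\<^bsub>LR\<^esub> u"
    unfolding realification_unit_def by (rule linear_mapsD(3)[OF coset_linear]) simp
  finally show ?thesis .
qed

text \<open>The universal property of the pushout with target the real line: an additive function on
  \<open>L\<close> and a slope \<open>s\<close> on the line, which agree on \<open>V\<close>. This
  is the source of all proofs that vectors of the realification are nonzero or distinct.\<close>

lemma LR_functional:
  fixes g :: "'a \<Rightarrow> real"
  assumes g: "\<And>a b. a \<in> carrier L \<Longrightarrow> b \<in> carrier L \<Longrightarrow> g (a \<otimes> b) = g a + g b"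
    and gj: "\<And>v. v \<in> V \<Longrightarrow> g (j v) = v * s"
  obtains k where "k \<in> linear_maps LR real_line" "\<And>a. a \<in> carrier L \<Longrightarrow> k (\<rho> a) = g a" "k u = s"
proof -
  interpret T: real_space T by (rule real_space_T)
  interpret D: real_space D by (rule real_space_D)
  interpret Ln: real_space real_line by unfold_locales (rule real_vs_real_line)
  obtain k where k: "k \<in> linear_maps T real_line" "\<And>a r. a \<in> carrier L \<Longrightarrow> k (pure_tensor L a r) = r * g a"
    using tensor_functional[OF g] by auto
  have k0: "k \<zero>\<^bsub>T\<^esub> = 0" using linear_zero[OF T.real_space_axioms Ln.real_space_axioms k(1)] by simp
  define h where "h = (\<lambda>(X, r). k X + r * s)"
  have h: "h \<in> linear_maps D real_line"
    by (rule linear_mapsI) (auto simp: h_def linear_mapsD[OF k(1)] algebra_simps)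
  have h0: "h x = \<zero>\<^bsub>real_line\<^esub>" if x: "x \<in> pushout_relations V L j" for x
    by (rule linear_zero_on_span[OF D.real_space_axioms Ln.real_space_axioms h pushout_carrier _ x[unfolded pushout_relations_def]])
      (auto simp: h_def k(2) gj)
  obtain h' where "h' \<in> linear_maps LR real_line"
    "\<And>x. x \<in> carrier D \<Longrightarrow> h' (pushout_relations V L j +>\<^bsub>D\<^esub> x) = h x"
    unfolding realification_def
    by (rule D.quot_vs_lift[OF subspace_pushout Ln.real_space_axioms h]) (erule h0, rule that, simp_all add: realification_def)
  then show thesis using that[of h'] k(2) k0
    by (simp add: realification_of_def realification_unit_def h_def)
qed

text \<open>The unit is listed separately because this locale allows \<open>V\<close> to be zero, in
  which case the image of the lattice does not reach the line.\<close>

lemma LR_span: "lin_span LR (insert u (\<rho> ` carrier L)) = carrier LR"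
proof -
  interpret T: real_space T by (rule real_space_T)
  interpret D: real_space D by (rule real_space_D)
  let ?S = "insert u (\<rho> ` carrier L)" and ?q = "\<lambda>x. pushout_relations V L j +>\<^bsub>D\<^esub> x"
  have S: "?S \<subseteq> carrier LR" by auto
  note q = linear_mapsD[OF coset_linear]
  have i: "(\<lambda>X. ?q (X, 0)) \<in> linear_maps T LR"
    by (rule linear_mapsI) (auto simp: q(1) simp flip: q(2,3))
  have "(\<lambda>X. ?q (X, 0)) ` carrier T \<subseteq> lin_span LR ((\<lambda>X. ?q (X, 0)) ` (\<lambda>a. pure_tensor L a 1) ` carrier L)"
    by (subst tensor_span[symmetric]) (rule linear_lin_span[OF T.real_space_axioms LR.real_space_axioms i], auto)
  also have "\<dots> = lin_span LR (\<rho> ` carrier L)" by (simp add: image_image realification_of_def)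
  also have "\<dots> \<subseteq> lin_span LR ?S"
    by (rule LR.lin_span_mono_span[OF _ S]) (use LR.lin_span_base[OF S] in auto)
  finally have 1: "?q (X, 0) \<in> lin_span LR ?S" if "X \<in> carrier T" for X using that by auto
  have "x \<in> lin_span LR ?S" if x: "x \<in> carrier LR" for x
  proof -
    obtain X r where X: "X \<in> carrier T" "x = ?q (X, r)"
      using x by (auto simp: realification_def D.carrier_quot_vs)
    have "(X, r) = (X, 0) \<oplus>\<^bsub>D\<^esub> r \<odot>\<^bsub>D\<^esub> (\<zero>\<^bsub>T\<^esub>, 1)" using X by simp
    then have "x = ?q ((X, 0) \<oplus>\<^bsub>D\<^esub> r \<odot>\<^bsub>D\<^esub> (\<zero>\<^bsub>T\<^esub>, 1))" using X by simp
    also have "\<dots> = ?q (X, 0) \<oplus>\<^bsub>LR\<^esub> ?q (r \<odot>\<^bsub>D\<^esub> (\<zero>\<^bsub>T\<^esub>, 1))" by (rule q(2)) (use X in auto)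
    also have "?q (r \<odot>\<^bsub>D\<^esub> (\<zero>\<^bsub>T\<^esub>, 1)) = r \<odot>\<^bsub>LR\<^esub> u"
      unfolding realification_unit_def by (rule q(3)) simp
    also have "?q (X, 0) \<oplus>\<^bsub>LR\<^esub> r \<odot>\<^bsub>LR\<^esub> u \<in> lin_span LR ?S"
      by (intro LR.lin_span_add[OF S] 1 X(1) LR.lin_span_sm[OF S] LR.lin_span_base[OF S]) simp
    finally show ?thesis .
  qed
  then show ?thesis using LR.lin_span_closed[OF S] by auto
qed

end

lemma lc_real_line: "finite I \<Longrightarrow> lc real_line c f I = (\<Sum>i\<in>I. c i * f i)"
proof -
  interpret Ln: real_space real_line by unfold_locales (rule real_vs_real_line)
  show "finite I \<Longrightarrow> lc real_line c f I = (\<Sum>i\<in>I. c i * f i)"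
    by (induction I rule: finite_induct) (simp_all add: Ln.lc_insert)
qed

context lattice_group
begin

lemma j_zero: "j 0 = \<one>"
  using j_add[of 0 0] V_simps(1) j_closed[of 0] by simp

lemma j_neg: "v \<in> V \<Longrightarrow> j (- v) = inv j v"
  using j_add[of "- v" v] V_simps(3)[of v] j_zero by (intro inv_equality[symmetric]) auto

lemma j_pow: "v \<in> V \<Longrightarrow> real n * v \<in> V \<and> j v [^] (n::nat) = j (real n * v)"
proof (induction n)
  case (Suc n)
  have "real (Suc n) * v = real n * v + v" by (simp add: algebra_simps)
  then show ?case using Suc V_simps(2)[of "real n * v" v] j_add[of "real n * v" v] by simp
qed (simp add: j_zero V_simps)

lemma subgroup_J: "subgroup (j ` V) L"
proof (rule subgroupI)
  show "j ` V \<noteq> {}" using V_simps(1) by auto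
  show "inv a \<in> j ` V" if "a \<in> j ` V" for a using that V_simps(3) by (auto simp flip: j_neg)
  show "a \<otimes> b \<in> j ` V" if "a \<in> j ` V" "b \<in> j ` V" for a b
    using that V_simps(2) by (auto simp flip: j_add)
qed auto

text \<open>The quotient by \<open>V\<close> is torsion-free: if a multiple of \<open>x\<close> is
  the image of \<open>v\<close>, then \<open>x\<close> and the image of \<open>v / real n\<close>
  have the same multiple, so their difference is torsion and vanishes.\<close>

lemma pure_J_nat:
  assumes x: "x \<in> carrier L" and n: "0 < (n::nat)" and xn: "x [^] n \<in> j ` V"
  shows "x \<in> j ` V"
proof -
  obtain v where v: "v \<in> V" "x [^] n = j v" using xn by auto
  define w where "w = v / real n"
  have nw: "real n * w = v" using n by (simp add: w_def)
  have w: "w \<in> V" using V_div[OF n] v nw by simp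
  have "(x \<otimes> inv j w) [^] n = x [^] n \<otimes> inv (j w [^] n)"
    using x w by (simp add: nat_pow_distrib nat_pow_inv)
  also have "\<dots> = \<one>" using j_pow[OF w, of n] v nw by simp
  finally have "x \<otimes> inv j w = \<one>" using torsion_free n x w by (auto simp: torsion_free_group_def)
  then have "x = j w" using x w by (metis inv_closed inv_equality inv_inv j_closed)
  then show ?thesis using w by simp
qed

lemma pure_J:
  assumes x: "x \<in> carrier L" and k: "k \<noteq> (0::int)" and xk: "x [^] k \<in> j ` V"
  shows "x \<in> j ` V"
proof (cases "0 < k")
  case True
  then show ?thesis using pure_J_nat[OF x, of "nat k"] xk by (simp add: int_pow_int[symmetric])
next
  case False
  have "inv (x [^] k) \<in> j ` V" using subgroup.m_inv_closed[OF subgroup_J xk] .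
  then have "x [^] (- k) \<in> j ` V" using x by (simp add: int_pow_neg)
  then show ?thesis using pure_J_nat[OF x, of "nat (- k)"] False k by (simp add: int_pow_int[symmetric])
qed

lemma lattice_basis:
  obtains I :: "nat set" and x where "finite I" "\<And>i. i \<in> I \<Longrightarrow> x i \<in> carrier L" "spans_over (j ` V) x I"
    "\<And>m. icomb x m I \<in> j ` V \<Longrightarrow> \<forall>i\<in>I. m i = 0"
proof -
  obtain A where A: "finite A" "A \<subseteq> carrier L" "generate L (A \<union> j ` V) = carrier L" using fin_gen by auto
  obtain n and f :: "nat \<Rightarrow> 'a" where f: "A = f ` {i. i < n}" using A(1) finite_imp_nat_seg_image_inj_on[of A] by auto
  have sp: "spans_over (j ` V) f {i. i < n}"
    by (rule spans_over_if_generates[OF subgroup_J A(2) _ f[symmetric] A(3)]) simp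
  have "\<exists>I (x :: nat \<Rightarrow> 'a). finite I \<and> (\<forall>i\<in>I. x i \<in> carrier L) \<and> spans_over (j ` V) x I \<and>
    (\<forall>m. icomb x m I \<in> j ` V \<longrightarrow> (\<forall>i\<in>I. m i = 0))"
    by (rule basis_over_pure_subgroup[OF subgroup_J pure_J _ _ sp]) (use A f in auto)
  then show thesis using that by auto
qed

lemma \<rho>_one: "\<rho> \<one> = \<zero>\<^bsub>LR\<^esub>"
  using \<rho>_mult[of \<one> \<one>] \<rho>_closed[of \<one>] by simp

lemma \<rho>_int_pow: "a \<in> carrier L \<Longrightarrow> \<rho> (a [^] (k::int)) = of_int k \<odot>\<^bsub>LR\<^esub> \<rho> a"
proof -
  assume a: "a \<in> carrier L"
  have nat: "\<rho> (a [^] (n::nat)) = real n \<odot>\<^bsub>LR\<^esub> \<rho> a" for n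
    by (induction n) (use a in \<open>simp_all add: \<rho>_one \<rho>_mult LR.sm_add_left LR.a_comm\<close>)
  show ?thesis
  proof (cases "0 \<le> k")
    case True
    then show ?thesis using nat[of "nat k"] by (simp add: int_pow_int[symmetric])
  next
    case False
    define b where "b = a [^] nat (- k)"
    have b: "b \<in> carrier L" using a by (simp add: b_def)
    have ak: "a [^] k = inv b"
      using False a int_pow_neg_int[of a "nat (- k)"] by (simp add: b_def)
    have "\<rho> (inv b) \<oplus>\<^bsub>LR\<^esub> \<rho> b = \<zero>\<^bsub>LR\<^esub>" using b by (simp add: \<rho>_one flip: \<rho>_mult)
    moreover have "\<rho> b = of_int (- k) \<odot>\<^bsub>LR\<^esub> \<rho> a" unfolding b_def using nat[of "nat (- k)"] False by simp
    moreover have "of_int k \<odot>\<^bsub>LR\<^esub> \<rho> a \<oplus>\<^bsub>LR\<^esub> of_int (- k) \<odot>\<^bsub>LR\<^esub> \<rho> a = \<zero>\<^bsub>LR\<^esub>"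
      using a by (simp flip: LR.sm_add_left)
    ultimately have "\<rho> (inv b) \<oplus>\<^bsub>LR\<^esub> of_int (- k) \<odot>\<^bsub>LR\<^esub> \<rho> a = of_int k \<odot>\<^bsub>LR\<^esub> \<rho> a \<oplus>\<^bsub>LR\<^esub> of_int (- k) \<odot>\<^bsub>LR\<^esub> \<rho> a"
      by simp
    then show ?thesis unfolding ak using a b by (subst (asm) LR.add.right_cancel) auto
  qed
qed

lemma \<rho>_icomb:
  assumes "finite I" "\<And>i. i \<in> I \<Longrightarrow> x i \<in> carrier L"
  shows "\<rho> (icomb x m I) = lc LR (\<lambda>i. of_int (m i)) (\<lambda>i. \<rho> (x i)) I"
  using assms
proof (induction I)
  case (insert i I)
  have "icomb x m (insert i I) = x i [^] m i \<otimes> icomb x m I" by (rule icomb_insert) (use insert in auto)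
  moreover have "lc LR (\<lambda>i. of_int (m i)) (\<lambda>i. \<rho> (x i)) (insert i I)
      = of_int (m i) \<odot>\<^bsub>LR\<^esub> \<rho> (x i) \<oplus>\<^bsub>LR\<^esub> lc LR (\<lambda>i. of_int (m i)) (\<lambda>i. \<rho> (x i)) I"
    by (rule LR.lc_insert) (use insert in auto)
  moreover have "icomb x m I \<in> carrier L" by (rule icomb_closed) (use insert in auto)
  ultimately show ?case using insert by (simp add: \<rho>_mult \<rho>_int_pow)
qed (simp add: \<rho>_one)

text \<open>The splitting of the lattice gives additive coordinates \<open>\<kappa>0\<close> with
  values in \<open>V\<close> and \<open>\<kappa>\<close> with integer values. They extend to
  functionals \<open>k0\<close> and \<open>k\<close> on the realification that are dual to the unit
  and to the images of the basis. Duality gives independence and injectivity at once.\<close>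

lemma adapted_basis_LR: "\<exists>B. adapted_basis V LR (\<rho> ` carrier L) u B"
  and inj_\<rho>: "inj_on \<rho> (carrier L)"
proof -
  interpret Ln: real_space real_line by unfold_locales (rule real_vs_real_line)
  obtain I :: "nat set" and x where I: "finite I" "\<And>i. i \<in> I \<Longrightarrow> x i \<in> carrier L" "spans_over (j ` V) x I"
    "\<And>m. icomb x m I \<in> j ` V \<Longrightarrow> \<forall>i\<in>I. m i = 0"
    by (rule lattice_basis) (rule that)
  have ic [simp]: "icomb x m I \<in> carrier L" for m using I(2) by simp
  have uniq: "v = w \<and> (\<forall>i\<in>I. m i = n i)"
    if vw: "v \<in> V" "w \<in> V" and eq: "j v \<otimes> icomb x m I = j w \<otimes> icomb x n I" for v w m n
  proof -
    \<comment> \<open>The integral parts of two representations differ by an element of the image of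
      \<open>V\<close>; the basis property forces this difference of coefficients to be zero, and
      \<open>j\<close> is injective on the rest.\<close>
    have "icomb x (\<lambda>i. m i + - n i) I = icomb x m I \<otimes> inv icomb x n I"
      using I(2) icomb_neg[of I x n] icomb_add[of I x m "\<lambda>i. - n i"] by simp
    also have "\<dots> = inv j v \<otimes> (j v \<otimes> icomb x m I) \<otimes> inv icomb x n I"
      using vw by (simp add: m_assoc[symmetric])
    also have "\<dots> = inv j v \<otimes> j w" unfolding eq using vw by (simp add: m_assoc)
    also have "\<dots> = j (- v + w)" using vw j_add[OF V_simps(3)[OF vw(1)] vw(2)] j_neg[OF vw(1)] by simp
    finally have "icomb x (\<lambda>i. m i + - n i) I = j (- v + w)" .
    then have "icomb x (\<lambda>i. m i + - n i) I \<in> j ` V"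
      using imageI[OF V_simps(2)[OF V_simps(3)[OF vw(1)] vw(2)], of j] by (simp only:)
    then have mn: "\<forall>i\<in>I. m i + - n i = 0" by (rule I(4))
    have "icomb x m I = icomb x n I" by (rule icomb_cong) (use mn I(2) in auto)
    then have "j v = j w" using eq vw by simp
    then show ?thesis using mn vw j_inj by (auto dest: inj_onD)
  qed
  have "\<forall>l\<in>carrier L. \<exists>v m. v \<in> V \<and> l = j v \<otimes> icomb x m I"
  proof
    fix l assume "l \<in> carrier L"
    then show "\<exists>v m. v \<in> V \<and> l = j v \<otimes> icomb x m I" using I(3) by (force simp: spans_over_def)
  qed
  then obtain \<kappa>0 where "\<forall>l\<in>carrier L. \<exists>m. \<kappa>0 l \<in> V \<and> l = j (\<kappa>0 l) \<otimes> icomb x m I"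
    by (rule bchoice[THEN exE])
  then obtain \<kappa> where "\<forall>l\<in>carrier L. \<kappa>0 l \<in> V \<and> l = j (\<kappa>0 l) \<otimes> icomb x (\<kappa> l) I"
    by (rule bchoice[THEN exE])
  then have \<kappa>: "\<And>l. l \<in> carrier L \<Longrightarrow> \<kappa>0 l \<in> V \<and> l = j (\<kappa>0 l) \<otimes> icomb x (\<kappa> l) I" by (rule bspec)
  have \<kappa>_eq: "\<kappa>0 (j v \<otimes> icomb x m I) = v" "\<And>i. i \<in> I \<Longrightarrow> \<kappa> (j v \<otimes> icomb x m I) i = m i" if v: "v \<in> V" for v m
  proof -
    have l: "j v \<otimes> icomb x m I \<in> carrier L" using v by simp
    have "v = \<kappa>0 (j v \<otimes> icomb x m I) \<and> (\<forall>i\<in>I. m i = \<kappa> (j v \<otimes> icomb x m I) i)"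
      by (rule uniq[OF v conjunct1[OF \<kappa>[OF l]] conjunct2[OF \<kappa>[OF l]]])
    then show "\<kappa>0 (j v \<otimes> icomb x m I) = v" "\<And>i. i \<in> I \<Longrightarrow> \<kappa> (j v \<otimes> icomb x m I) i = m i" by auto
  qed
  have \<kappa>_mult: "\<kappa>0 (a \<otimes> b) = \<kappa>0 a + \<kappa>0 b" "\<And>i. i \<in> I \<Longrightarrow> \<kappa> (a \<otimes> b) i = \<kappa> a i + \<kappa> b i"
    if ab: "a \<in> carrier L" "b \<in> carrier L" for a b
  proof -
    have v: "\<kappa>0 a \<in> V" "\<kappa>0 b \<in> V" using \<kappa> ab by auto
    have "a \<otimes> b = (j (\<kappa>0 a) \<otimes> icomb x (\<kappa> a) I) \<otimes> (j (\<kappa>0 b) \<otimes> icomb x (\<kappa> b) I)"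
      using \<kappa>[OF ab(1)] \<kappa>[OF ab(2)] by simp
    also have "\<dots> = (j (\<kappa>0 a) \<otimes> j (\<kappa>0 b)) \<otimes> (icomb x (\<kappa> a) I \<otimes> icomb x (\<kappa> b) I)"
      using v by (simp add: m_ac)
    also have "\<dots> = j (\<kappa>0 a + \<kappa>0 b) \<otimes> icomb x (\<lambda>i. \<kappa> a i + \<kappa> b i) I"
      using v I(2) by (simp add: j_add icomb_add)
    finally have eq: "a \<otimes> b = j (\<kappa>0 a + \<kappa>0 b) \<otimes> icomb x (\<lambda>i. \<kappa> a i + \<kappa> b i) I" .
    show "\<kappa>0 (a \<otimes> b) = \<kappa>0 a + \<kappa>0 b" "\<And>i. i \<in> I \<Longrightarrow> \<kappa> (a \<otimes> b) i = \<kappa> a i + \<kappa> b i"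
      unfolding eq using \<kappa>_eq[OF V_simps(2)[OF v]] by auto
  qed
  have one: "icomb x (\<lambda>_. 0) I = \<one>" by (simp add: icomb_def)
  have \<kappa>_j: "\<kappa>0 (j v) = v" "\<And>i. i \<in> I \<Longrightarrow> \<kappa> (j v) i = 0" if v: "v \<in> V" for v
    using \<kappa>_eq(1)[OF v, of "\<lambda>_. 0"] \<kappa>_eq(2)[OF v, of _ "\<lambda>_. 0"] v by (simp_all add: one)
  have xi: "x i = j 0 \<otimes> icomb x (\<lambda>k. if k = i then 1 else 0) I" if i: "i \<in> I" for i
  proof -
    have "icomb x (\<lambda>k. if k = i then 1 else 0) (I - {i}) = icomb x (\<lambda>_. 0) (I - {i})"
      by (rule icomb_cong) (use I in auto)
    also have "\<dots> = \<one>" by (simp add: icomb_def)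
    finally show ?thesis
      using icomb_remove[OF I(1) i, of x "\<lambda>k. if k = i then 1 else 0", OF I(2)] I(2)[OF i] by (simp add: j_zero)
  qed
  have \<kappa>_x: "\<kappa>0 (x i) = 0" "\<And>k. k \<in> I \<Longrightarrow> \<kappa> (x i) k = (if k = i then 1 else 0)" if i: "i \<in> I" for i
    using \<kappa>_eq(1)[OF V_simps(1), of "\<lambda>k. if k = i then 1 else 0"]
      \<kappa>_eq(2)[OF V_simps(1), of _ "\<lambda>k. if k = i then 1 else 0"] unfolding xi[OF i, symmetric] by auto
  \<comment> \<open>On \<open>V\<close> the coordinate \<open>\<kappa>0\<close> is the inclusion
    into the reals, so the slope is \<open>1\<close>; the integer coordinates vanish there and take
    slope \<open>0\<close>.\<close>
  obtain k0 where k0: "k0 \<in> linear_maps LR real_line" "\<And>a. a \<in> carrier L \<Longrightarrow> k0 (\<rho> a) = \<kappa>0 a" "k0 u = 1"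
    by (rule LR_functional[of \<kappa>0 1]) (use \<kappa>_mult \<kappa>_j that in auto)
  have "\<forall>i\<in>I. \<exists>k. k \<in> linear_maps LR real_line \<and> (\<forall>a\<in>carrier L. k (\<rho> a) = of_int (\<kappa> a i)) \<and> k u = 0"
  proof
    fix i assume i: "i \<in> I"
    obtain k where "k \<in> linear_maps LR real_line" "\<And>a. a \<in> carrier L \<Longrightarrow> k (\<rho> a) = of_int (\<kappa> a i)" "k u = 0"
      by (rule LR_functional[of "\<lambda>a. of_int (\<kappa> a i)" 0]) (use \<kappa>_mult \<kappa>_j i that in auto)
    then show "\<exists>k. k \<in> linear_maps LR real_line \<and> (\<forall>a\<in>carrier L. k (\<rho> a) = of_int (\<kappa> a i)) \<and> k u = 0" by blast
  qed
  then obtain k where "\<forall>i\<in>I. k i \<in> linear_maps LR real_line \<and> (\<forall>a\<in>carrier L. k i (\<rho> a) = of_int (\<kappa> a i)) \<and> k i u = 0"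
    by (rule bchoice[THEN exE])
  then have k: "\<And>i. i \<in> I \<Longrightarrow> k i \<in> linear_maps LR real_line"
    "\<And>i a. i \<in> I \<Longrightarrow> a \<in> carrier L \<Longrightarrow> k i (\<rho> a) = of_int (\<kappa> a i)" "\<And>i. i \<in> I \<Longrightarrow> k i u = 0"
    by auto
  show "inj_on \<rho> (carrier L)"
  proof (rule inj_onI)
    fix a b assume ab: "a \<in> carrier L" "b \<in> carrier L" "\<rho> a = \<rho> b"
    have "\<kappa>0 a = \<kappa>0 b" using k0(2)[OF ab(1)] k0(2)[OF ab(2)] ab(3) by simp
    moreover have "icomb x (\<kappa> a) I = icomb x (\<kappa> b) I"
    proof (rule icomb_cong)
      fix i assume i: "i \<in> I"
      show "\<kappa> a i = \<kappa> b i" using k(2)[OF i ab(1)] k(2)[OF i ab(2)] ab(3) by simp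
    qed (use I(2) in auto)
    ultimately have "j (\<kappa>0 a) \<otimes> icomb x (\<kappa> a) I = j (\<kappa>0 b) \<otimes> icomb x (\<kappa> b) I" by simp
    then show "a = b" unfolding conjunct2[OF \<kappa>[OF ab(1)], symmetric] conjunct2[OF \<kappa>[OF ab(2)], symmetric] .
  qed
  define \<beta> where "\<beta> i = \<rho> (x i)" for i
  have \<beta>c [simp]: "i \<in> I \<Longrightarrow> \<beta> i \<in> carrier LR" for i using I(2) by (simp add: \<beta>_def)
  have k0\<beta>: "k0 (\<beta> i) = 0" if "i \<in> I" for i using k0(2)[OF I(2)[OF that]] \<kappa>_x(1)[OF that] by (simp add: \<beta>_def)
  have k\<beta>: "k i (\<beta> i') = (if i = i' then 1 else 0)" if "i \<in> I" "i' \<in> I" for i i'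
    using k(2)[OF that(1) I(2)[OF that(2)]] \<kappa>_x(2)[OF that(2,1)] by (simp add: \<beta>_def)
  have inj: "inj_on \<beta> I"
  proof (rule inj_onI)
    fix i i' assume "i \<in> I" "i' \<in> I" "\<beta> i = \<beta> i'"
    then show "i = i'" using k\<beta>[of i i'] k\<beta>[of i i] by (auto split: if_splits)
  qed
  define B where "B = \<beta> ` I"
  have B: "finite B" "B \<subseteq> carrier LR" using I(1) by (auto simp: B_def)
  have lcB: "lc LR c (\<lambda>b. b) B = lc LR (\<lambda>i. c (\<beta> i)) \<beta> I" for c
    unfolding B_def by (rule LR.lc_reindex[OF inj]) simp
  have k0lc: "k0 (lc LR c \<beta> I) = 0" for c
  proof -
    have "k0 (lc LR c \<beta> I) = lc real_line c (\<lambda>i. k0 (\<beta> i)) I"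
      by (rule linear_lc[OF LR.real_space_axioms Ln.real_space_axioms k0(1)]) simp
    then show ?thesis using I(1) by (simp add: lc_real_line k0\<beta>)
  qed
  have klc: "k i (lc LR c \<beta> I) = c i" if i: "i \<in> I" for i c
  proof -
    have "k i (lc LR c \<beta> I) = lc real_line c (\<lambda>l. k i (\<beta> l)) I"
      by (rule linear_lc[OF LR.real_space_axioms Ln.real_space_axioms k(1)[OF i]]) simp
    also have "\<dots> = (\<Sum>l\<in>I. c l * k i (\<beta> l))" using I(1) by (rule lc_real_line)
    also have "\<dots> = (\<Sum>l\<in>I. if l = i then c l else 0)"
      by (rule sum.cong) (use k\<beta> i in auto)
    finally show ?thesis using I(1) i by (simp add: sum.delta)
  qed
  have lcI [simp]: "lc LR c \<beta> I \<in> carrier LR" for c by (rule LR.lc_closed) simp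
  have ind: "t = 0 \<and> (\<forall>b\<in>B. c b = 0)" if eq: "t \<odot>\<^bsub>LR\<^esub> u \<oplus>\<^bsub>LR\<^esub> lc LR c (\<lambda>b. b) B = \<zero>\<^bsub>LR\<^esub>" for t c
  proof -
    let ?c = "\<lambda>i. c (\<beta> i)"
    have eq': "t \<odot>\<^bsub>LR\<^esub> u \<oplus>\<^bsub>LR\<^esub> lc LR ?c \<beta> I = \<zero>\<^bsub>LR\<^esub>" using eq unfolding lcB .
    have "k0 (t \<odot>\<^bsub>LR\<^esub> u \<oplus>\<^bsub>LR\<^esub> lc LR ?c \<beta> I) = t * 1 + 0"
      by (simp add: linear_mapsD[OF k0(1)] k0(3) k0lc)
    then have "t = 0" unfolding eq' using linear_zero[OF LR.real_space_axioms Ln.real_space_axioms k0(1)] by simp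
    moreover have "c (\<beta> i) = 0" if i: "i \<in> I" for i
    proof -
      have "k i (t \<odot>\<^bsub>LR\<^esub> u \<oplus>\<^bsub>LR\<^esub> lc LR ?c \<beta> I) = t * 0 + ?c i"
        by (simp add: linear_mapsD[OF k(1)[OF i]] k(3)[OF i] klc[OF i])
      then show ?thesis unfolding eq' using linear_zero[OF LR.real_space_axioms Ln.real_space_axioms k(1)[OF i]] by simp
    qed
    ultimately show ?thesis by (auto simp: B_def)
  qed
  have \<rho>l: "\<rho> (j v \<otimes> icomb x m I) = v \<odot>\<^bsub>LR\<^esub> u \<oplus>\<^bsub>LR\<^esub> lc LR (\<lambda>i. of_int (m i)) \<beta> I" if v: "v \<in> V" for v m
    using v \<rho>_icomb[OF I(1), of x m, OF I(2)] by (simp add: \<rho>_mult \<rho>_j \<beta>_def[abs_def])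
  have lcI': "lc LR c \<beta> I = lc LR (\<lambda>b. c (inv_into I \<beta> b)) (\<lambda>b. b) B" for c
    unfolding lcB by (rule LR.lc_cong) (use inj in auto)
  have span: "\<exists>t c. w = t \<odot>\<^bsub>LR\<^esub> u \<oplus>\<^bsub>LR\<^esub> lc LR c (\<lambda>b. b) B" if w: "w \<in> carrier LR" for w
  proof -
    have uB: "u \<notin> B" using k0(3) k0\<beta> by (auto simp: B_def)
    have S: "insert u B \<subseteq> carrier LR" using B by auto
    have "insert u (\<rho> ` carrier L) \<subseteq> lin_span LR (insert u B)"
    proof -
      have "\<rho> l \<in> lin_span LR (insert u B)" if l: "l \<in> carrier L" for l
      proof -
        have "\<rho> l = \<rho> (j (\<kappa>0 l) \<otimes> icomb x (\<kappa> l) I)" using \<kappa>[OF l] by simp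
        also have "\<dots> = \<kappa>0 l \<odot>\<^bsub>LR\<^esub> u \<oplus>\<^bsub>LR\<^esub> lc LR (\<lambda>i. of_int (\<kappa> l i)) \<beta> I" using \<kappa>[OF l] by (intro \<rho>l) simp
        also have "\<dots> \<in> lin_span LR (insert u B)"
        proof (rule LR.lin_span_add[OF S])
          show "\<kappa>0 l \<odot>\<^bsub>LR\<^esub> u \<in> lin_span LR (insert u B)" by (intro LR.lin_span_sm[OF S] LR.lin_span_base[OF S]) simp
          show "lc LR (\<lambda>i. of_int (\<kappa> l i)) \<beta> I \<in> lin_span LR (insert u B)"
            by (rule LR.lc_in[OF I(1) LR.lin_span_zero LR.lin_span_add[OF S]])
              (assumption, assumption, rule LR.lin_span_sm[OF S], rule LR.lin_span_base[OF S], simp add: B_def, simp)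
        qed
        finally show ?thesis .
      qed
      then show ?thesis using LR.lin_span_base[OF S, of u] by auto
    qed
    then have "lin_span LR (insert u (\<rho> ` carrier L)) \<subseteq> lin_span LR (insert u B)"
      by (rule LR.lin_span_mono_span[OF _ S])
    then have "w \<in> lin_span LR (insert u B)" using w unfolding LR_span by (rule subsetD)
    moreover have "finite (insert u B)" using B(1) by simp
    ultimately obtain c where "w = lc LR c (\<lambda>b. b) (insert u B)"
      using LR.lin_span_finite[OF _ S] by auto
    also have "\<dots> = c u \<odot>\<^bsub>LR\<^esub> u \<oplus>\<^bsub>LR\<^esub> lc LR c (\<lambda>b. b) B"
      by (rule LR.lc_insert) (use B uB in auto)
    finally show ?thesis by (intro exI)
  qed
  have Leq: "\<rho> ` carrier L = {v \<odot>\<^bsub>LR\<^esub> u \<oplus>\<^bsub>LR\<^esub> lc LR (\<lambda>b. of_int (m b)) (\<lambda>b. b) B | v m. v \<in> V}" (is "_ = ?R")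
  proof (intro equalityI subsetI)
    fix w assume "w \<in> \<rho> ` carrier L"
    then obtain l where l: "l \<in> carrier L" "w = \<rho> l" by auto
    then have "w = \<rho> (j (\<kappa>0 l) \<otimes> icomb x (\<kappa> l) I)" using \<kappa>[OF l(1)] by simp
    also have "\<dots> = \<kappa>0 l \<odot>\<^bsub>LR\<^esub> u \<oplus>\<^bsub>LR\<^esub> lc LR (\<lambda>i. of_int (\<kappa> l i)) \<beta> I" using \<kappa>[OF l(1)] by (intro \<rho>l) simp
    also have "\<dots> = \<kappa>0 l \<odot>\<^bsub>LR\<^esub> u \<oplus>\<^bsub>LR\<^esub> lc LR (\<lambda>b. of_int (\<kappa> l (inv_into I \<beta> b))) (\<lambda>b. b) B" unfolding lcI' ..
    finally show "w \<in> ?R" using \<kappa>[OF l(1)]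
      by (intro CollectI exI[of _ "\<kappa>0 l"] exI[of _ "\<lambda>b. \<kappa> l (inv_into I \<beta> b)"]) simp
  next
    fix w assume "w \<in> ?R"
    then obtain v m where vm: "v \<in> V" "w = v \<odot>\<^bsub>LR\<^esub> u \<oplus>\<^bsub>LR\<^esub> lc LR (\<lambda>b. of_int (m b)) (\<lambda>b. b) B" by auto
    have "w = \<rho> (j v \<otimes> icomb x (\<lambda>i. m (\<beta> i)) I)" unfolding vm(2) lcB using \<rho>l[OF vm(1)] by simp
    then show "w \<in> \<rho> ` carrier L" using vm(1) by simp
  qed
  have "adapted_basis V LR (\<rho> ` carrier L) u B"
    unfolding adapted_basis_def using B span ind Leq u_closed by simp
  then show "\<exists>B. adapted_basis V LR (\<rho> ` carrier L) u B" by (rule exI)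
qed

end

section \<open>The cone of a toric monoid\<close>

lemma inj_real_pair: "\<exists>f :: real \<times> real \<Rightarrow> real. inj f"
proof -
  have "(card_of ((UNIV :: real set) \<times> (UNIV :: real set)), card_of (UNIV :: real set)) \<in> ordIso"
    by (rule card_of_Times_same_infinite) (simp add: infinite_UNIV_char_0)
  then have "(card_of ((UNIV :: real set) \<times> (UNIV :: real set)), card_of (UNIV :: real set)) \<in> ordLeq"
    by (rule ordIso_imp_ordLeq)
  then have "\<exists>f :: real \<times> real \<Rightarrow> real. inj_on f (UNIV \<times> UNIV) \<and> f ` (UNIV \<times> UNIV) \<subseteq> UNIV"
    by (subst card_of_ordLeq)
  then show ?thesis by simp
qed

text \<open>A finite-dimensional space has at most as many points as the real line: each further
  generator adds one real coefficient, and pairs of reals are coded by reals. This bounds the room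
  that the encoding of a cone needs.\<close>

lemma (in real_space) lin_span_inj_real:
  assumes "finite S" "S \<subseteq> carrier W"
  shows "\<exists>f :: 'w \<Rightarrow> real. inj_on f (lin_span W S)"
  using assms
proof (induction S)
  case empty
  have "lin_span W {} = {\<zero>}" by (simp add: lin_span_finite)
  then show ?case by auto
next
  case (insert a S)
  then obtain f :: "'w \<Rightarrow> real" where f: "inj_on f (lin_span W S)" by auto
  obtain p :: "real \<times> real \<Rightarrow> real" where p: "inj p" using inj_real_pair by auto
  have a: "a \<in> carrier W" and S: "S \<subseteq> carrier W" using insert by auto
  have "\<forall>w\<in>lin_span W (insert a S). \<exists>k s. s \<in> lin_span W S \<and> w = k \<odot> a \<oplus> s"
  proof
    fix w assume "w \<in> lin_span W (insert a S)"
    then obtain c where "w = lc W c (\<lambda>s. s) (insert a S)"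
      using insert by (subst (asm) lin_span_finite) auto
    also have "\<dots> = c a \<odot> a \<oplus> lc W c (\<lambda>s. s) S" by (rule lc_insert) (use insert in auto)
    finally show "\<exists>k s. s \<in> lin_span W S \<and> w = k \<odot> a \<oplus> s"
      using insert(1) S lin_span_finite[of S] by auto
  qed
  then obtain k where "\<forall>w\<in>lin_span W (insert a S). \<exists>s. s \<in> lin_span W S \<and> w = k w \<odot> a \<oplus> s"
    by (rule bchoice[THEN exE])
  then obtain s where s: "\<forall>w\<in>lin_span W (insert a S). s w \<in> lin_span W S \<and> w = k w \<odot> a \<oplus> s w"
    by (rule bchoice[THEN exE])
  have "inj_on (\<lambda>w. p (k w, f (s w))) (lin_span W (insert a S))"
  proof (rule inj_onI)
    fix v w assume v: "v \<in> lin_span W (insert a S)" and w: "w \<in> lin_span W (insert a S)"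
      and eq: "p (k v, f (s v)) = p (k w, f (s w))"
    have "(k v, f (s v)) = (k w, f (s w))" using p eq by (rule injD)
    then have "k v = k w" "f (s v) = f (s w)" by auto
    moreover have "s v = s w"
      using inj_onD[OF f, of "s v" "s w"] s v w \<open>f (s v) = f (s w)\<close> by blast
    ultimately have "k v \<odot> a \<oplus> s v = k w \<odot> a \<oplus> s w" by simp
    then show "v = w" unfolding conjunct2[OF bspec[OF s v], symmetric] conjunct2[OF bspec[OF s w], symmetric] .
  qed
  then show ?case by blast
qed

text \<open>All conditions on a cone are expressed by sums and coefficients, so a linear bijection
  of the ambient spaces carries them over, witnesses included.\<close>

lemma (in valued) cone_data_image:
  fixes s :: "'v vcone" and t :: "'w vcone"
  assumes s: "cone_data R \<phi> s B A" and t: "real_vs (vspace t)"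
    and f: "f \<in> linear_maps (vspace s) (vspace t)" and inj: "inj_on f (carrier (vspace s))"
    and car: "carrier (vspace t) = f ` carrier (vspace s)" and lat: "lat t = f ` lat s"
    and cset: "cset t = f ` cset s" and unit: "vunit t = f (vunit s)"
  shows "cone_data R \<phi> t (f ` B) (f ` A)"
proof -
  interpret s: cone_data R \<phi> s B A by fact
  interpret t: real_space "vspace t" by unfold_locales fact
  note fD = linear_mapsD[OF f]
  have f0: "f \<zero>\<^bsub>vspace s\<^esub> = \<zero>\<^bsub>vspace t\<^esub>" by (rule linear_zero[OF s.real_space_axioms t.real_space_axioms f])
  have flc: "f (lc (vspace s) c x F) = lc (vspace t) c (\<lambda>i. f (x i)) F"
    if "\<And>i. i \<in> F \<Longrightarrow> x i \<in> carrier (vspace s)" for c F and x :: "'v \<Rightarrow> 'v"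
    by (rule linear_lc[OF s.real_space_axioms t.real_space_axioms f that])
  have injB: "inj_on f B" using inj s.B_carrier by (rule inj_on_subset)
  have lcB: "lc (vspace t) c (\<lambda>b. b) (f ` B) = f (lc (vspace s) (\<lambda>b. c (f b)) (\<lambda>b. b) B)" for c
  proof -
    have "lc (vspace t) c (\<lambda>b. b) (f ` B) = lc (vspace t) (\<lambda>b. c (f b)) (\<lambda>b. f b) B"
      by (rule t.lc_reindex[OF injB]) (use fD in auto)
    also have "\<dots> = f (lc (vspace s) (\<lambda>b. c (f b)) (\<lambda>b. b) B)"
      by (rule flc[symmetric]) auto
    finally show ?thesis .
  qed
  have lcB': "f (lc (vspace s) c (\<lambda>b. b) B) = lc (vspace t) (\<lambda>b. c (inv_into B f b)) (\<lambda>b. b) (f ` B)" for c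
  proof -
    have "lc (vspace s) (\<lambda>b. c (inv_into B f (f b))) (\<lambda>b. b) B = lc (vspace s) c (\<lambda>b. b) B"
      by (rule s.lc_cong) (use injB in auto)
    then show ?thesis by (simp add: lcB)
  qed
  have fcomb: "f (k \<odot>\<^bsub>vspace s\<^esub> vunit s \<oplus>\<^bsub>vspace s\<^esub> lc (vspace s) c (\<lambda>b. b) B)
      = k \<odot>\<^bsub>vspace t\<^esub> vunit t \<oplus>\<^bsub>vspace t\<^esub> f (lc (vspace s) c (\<lambda>b. b) B)" for k c
    by (simp add: fD unit)
  have basis: "adapted_basis (value_group R \<phi>) (vspace t) (lat t) (vunit t) (f ` B)"
    unfolding adapted_basis_def
  proof (intro conjI ballI allI impI)
    show "finite (f ` B)" "f ` B \<subseteq> carrier (vspace t)" "vunit t \<in> carrier (vspace t)"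
      using s.finite_B s.B_carrier by (auto simp: unit fD)
    fix w assume "w \<in> carrier (vspace t)"
    then obtain x where x: "x \<in> carrier (vspace s)" "w = f x" using car by auto
    obtain k c where "x = k \<odot>\<^bsub>vspace s\<^esub> vunit s \<oplus>\<^bsub>vspace s\<^esub> lc (vspace s) c (\<lambda>b. b) B"
      using s.span[OF x(1)] by auto
    then have "w = k \<odot>\<^bsub>vspace t\<^esub> vunit t \<oplus>\<^bsub>vspace t\<^esub> lc (vspace t) (\<lambda>b. c (inv_into B f b)) (\<lambda>b. b) (f ` B)"
      by (simp only: x(2) fcomb lcB')
    then show "\<exists>k c. w = k \<odot>\<^bsub>vspace t\<^esub> vunit t \<oplus>\<^bsub>vspace t\<^esub> lc (vspace t) c (\<lambda>b. b) (f ` B)" by (intro exI)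
  next
    fix k c assume "k \<odot>\<^bsub>vspace t\<^esub> vunit t \<oplus>\<^bsub>vspace t\<^esub> lc (vspace t) c (\<lambda>b. b) (f ` B) = \<zero>\<^bsub>vspace t\<^esub>"
    then have "f (k \<odot>\<^bsub>vspace s\<^esub> vunit s \<oplus>\<^bsub>vspace s\<^esub> lc (vspace s) (\<lambda>b. c (f b)) (\<lambda>b. b) B) = f \<zero>\<^bsub>vspace s\<^esub>"
      by (simp only: fcomb lcB f0)
    then have "k \<odot>\<^bsub>vspace s\<^esub> vunit s \<oplus>\<^bsub>vspace s\<^esub> lc (vspace s) (\<lambda>b. c (f b)) (\<lambda>b. b) B = \<zero>\<^bsub>vspace s\<^esub>"
      by (rule inj_onD[OF inj]) simp_all
    then show "k = 0" "\<And>b. b \<in> f ` B \<Longrightarrow> c b = 0" using s.indep by auto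
  next
    show "lat t = {v \<odot>\<^bsub>vspace t\<^esub> vunit t \<oplus>\<^bsub>vspace t\<^esub> lc (vspace t) (\<lambda>b. of_int (m b)) (\<lambda>b. b) (f ` B) | v m. v \<in> value_group R \<phi>}" (is "_ = ?R")
    proof (intro equalityI subsetI)
      fix w assume "w \<in> lat t"
      then obtain l where l: "l \<in> lat s" "w = f l" using lat by auto
      obtain v m where vm: "v \<in> value_group R \<phi>"
        "l = v \<odot>\<^bsub>vspace s\<^esub> vunit s \<oplus>\<^bsub>vspace s\<^esub> lc (vspace s) (\<lambda>b. of_int (m b)) (\<lambda>b. b) B"
        using l(1) by (rule s.L_E)
      have "w = v \<odot>\<^bsub>vspace t\<^esub> vunit t \<oplus>\<^bsub>vspace t\<^esub> lc (vspace t) (\<lambda>b. of_int (m (inv_into B f b))) (\<lambda>b. b) (f ` B)"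
        by (simp only: l(2) vm(2) fcomb lcB')
      then show "w \<in> ?R" using vm(1) by (intro CollectI exI[of _ v] exI[of _ "\<lambda>b. m (inv_into B f b)"]) simp
    next
      fix w assume "w \<in> ?R"
      then obtain v m where vm: "v \<in> value_group R \<phi>"
        "w = v \<odot>\<^bsub>vspace t\<^esub> vunit t \<oplus>\<^bsub>vspace t\<^esub> lc (vspace t) (\<lambda>b. of_int (m b)) (\<lambda>b. b) (f ` B)" by auto
      have "w = f (v \<odot>\<^bsub>vspace s\<^esub> vunit s \<oplus>\<^bsub>vspace s\<^esub> lc (vspace s) (\<lambda>b. of_int (m (f b))) (\<lambda>b. b) B)"
        by (simp only: vm(2) fcomb lcB)
      then show "w \<in> lat t" unfolding lat using s.L_I[OF vm(1)] by (rule image_eqI)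
    qed
  qed
  \<comment> \<open>The inverse is linear too, and it provides the reverse inclusion between the
    hulls.\<close>
  define g where "g = inv_into (carrier (vspace s)) f"
  have gf: "g (f x) = x" if "x \<in> carrier (vspace s)" for x
    unfolding g_def by (rule inv_into_f_f[OF inj that])
  have g: "g \<in> linear_maps (vspace t) (vspace s)"
    by (rule linear_mapsI) (auto simp: car gf simp flip: fD(2,3))
  have fA: "f ` A \<subseteq> carrier (vspace t)" using s.A_carrier fD by auto
  have gA: "g ` f ` A = A" using gf s.A_carrier by (force simp: image_image)
  have hull: "f ` cone_hull (vspace s) A = cone_hull (vspace t) (f ` A)"
  proof
    show "f ` cone_hull (vspace s) A \<subseteq> cone_hull (vspace t) (f ` A)"
      by (rule linear_cone_hull[OF s.real_space_axioms t.real_space_axioms f s.A_carrier])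
    have gh: "g ` cone_hull (vspace t) (f ` A) \<subseteq> cone_hull (vspace s) A"
      using linear_cone_hull[OF t.real_space_axioms s.real_space_axioms g fA] unfolding gA .
    show "cone_hull (vspace t) (f ` A) \<subseteq> f ` cone_hull (vspace s) A"
    proof
      fix y assume y: "y \<in> cone_hull (vspace t) (f ` A)"
      then obtain x where x: "x \<in> carrier (vspace s)" "y = f x" using t.cone_hull_closed[OF fA] car by auto
      have "x \<in> cone_hull (vspace s) A" using gh y gf[OF x(1)] x(2) by auto
      then show "y \<in> f ` cone_hull (vspace s) A" using x by auto
    qed
  qed
  have span: "lin_span (vspace t) (f ` A) = carrier (vspace t)"
    using linear_lin_span[OF s.real_space_axioms t.real_space_axioms f s.A_carrier] t.lin_span_closed[OF fA]
    by (auto simp: s.span_A car)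
  show ?thesis
  proof unfold_locales
    show "value_subgroup (value_group R \<phi>)" by (rule value_subgroup)
    show "adapted_basis (value_group R \<phi>) (vspace t) (lat t) (vunit t) (f ` B)" by (rule basis)
    show "x \<in> value_group R \<phi>" if "0 < n" "real n * x \<in> value_group R \<phi>" for n x using that by (rule V_div)
    show "finite (f ` A)" using s.finite_A by simp
    show "f ` A \<subseteq> lat t" using s.A_lat lat by auto
    show "cset t = cone_hull (vspace t) (f ` A)" unfolding cset s.cset_eq hull ..
    show "lin_span (vspace t) (f ` A) = carrier (vspace t)" by (rule span)
    show "vvec R \<phi> t \<pi> \<in> cset t" if "\<pi> \<in> carrier R" "\<pi> \<noteq> \<one>\<^bsub>R\<^esub>" for \<pi>
    proof -
      have "vvec R \<phi> t \<pi> = f (vvec R \<phi> s \<pi>)" by (simp add: vvec_def unit fD)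
      then show ?thesis using s.vvec_cset[OF that] by (simp add: cset)
    qed
  qed
qed

lemma (in valued) cone_data_transport:
  fixes s :: "'v vcone" and h :: "'v \<Rightarrow> 'w"
  assumes s: "cone_data R \<phi> s B A" and inj: "inj_on h (carrier (vspace s))"
  shows "cone_data R \<phi> (transport_cone h s) (h ` B) (h ` A)"
    "h \<in> linear_maps (vspace s) (vspace (transport_cone h s))"
proof -
  interpret s: cone_data R \<phi> s B A by fact
  let ?t = "transport_cone h s"
  note simps = transport_cone_def transport_vs_def Let_def
  have inv: "inv_into (carrier (vspace s)) h (h x) = x" if "x \<in> carrier (vspace s)" for x
    by (rule inv_into_f_f[OF inj that])
  have car: "carrier (vspace ?t) = h ` carrier (vspace s)" and zero: "\<zero>\<^bsub>vspace ?t\<^esub> = h \<zero>\<^bsub>vspace s\<^esub>"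
    by (simp_all add: simps)
  have add: "h x \<oplus>\<^bsub>vspace ?t\<^esub> h y = h (x \<oplus>\<^bsub>vspace s\<^esub> y)"
    if "x \<in> carrier (vspace s)" "y \<in> carrier (vspace s)" for x y
    unfolding simps using that by (simp add: inv)
  have sm: "c \<odot>\<^bsub>vspace ?t\<^esub> h x = h (c \<odot>\<^bsub>vspace s\<^esub> x)" if "x \<in> carrier (vspace s)" for c x
  proof -
    have "c \<odot>\<^bsub>vspace ?t\<^esub> h x = h (c \<odot>\<^bsub>vspace s\<^esub> inv_into (carrier (vspace s)) h (h x))" by (simp add: simps)
    then show ?thesis unfolding inv[OF that] .
  qed
  note 1 = real_vs_image(1)[OF s.real_vs car add zero sm] and 2 = real_vs_image(2)[OF s.real_vs car add zero sm]
  show "cone_data R \<phi> ?t (h ` B) (h ` A)"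
    by (rule cone_data_image[OF s 1 2 inj]) (simp_all add: simps)
  show "h \<in> linear_maps (vspace s) (vspace ?t)" by (rule 2)
qed

section \<open>The canonical cone of a toric monoid\<close>

locale toric = valued R \<phi> for R :: "('r, 'c) monoid_scheme" and \<phi> +
  fixes M :: "('a, 'r) rmonoid"
  assumes toric: "toric_monoid R M"
begin

lemma str_hom: "str_map M \<in> monoid_hom R M"
  and cancel: "comm_monoid_cancel M" and saturated: "saturated_monoid M"
  and torsion_free: "torsion_free_group (gp M)" and fin_gen_M: "fin_gen_over R M"
  and str_inj: "inj_on (str_map M) (carrier R)"
  using toric by (auto simp: toric_monoid_def)

sublocale M: comm_monoid_cancel M
  by (rule cancel)

abbreviation "jM \<equiv> V_to_gp R \<phi> M"

lemma jM_phi: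
  assumes "a \<in> carrier R" "b \<in> carrier R"
  shows "jM (\<phi> (gp_diff R a b)) = gp_diff M (str_map M a) (str_map M b)"
proof -
  have "inv_into (carrier (gp R)) \<phi> (\<phi> (gp_diff R a b)) = gp_diff R a b"
    by (rule inv_into_f_f[OF phi_inj]) (use assms in simp)
  then show ?thesis
    using gp_map_gp_diff[OF R.comm_monoid_cancel_axioms cancel str_hom assms] by (simp add: V_to_gp_def)
qed

lemma V_E:
  assumes "v \<in> value_group R \<phi>"
  obtains a b where "a \<in> carrier R" "b \<in> carrier R" "v = \<phi> (gp_diff R a b)"
proof -
  obtain X where X: "X \<in> carrier (gp R)" "v = \<phi> X" using assms by (auto simp: value_group_def)
  obtain a b where "a \<in> carrier R" "b \<in> carrier R" "X = gp_diff R a b" using X(1) by (rule R.gp_E)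
  then show thesis using that X(2) by simp
qed

lemma jM_rval: "r \<in> carrier R \<Longrightarrow> jM (rval R \<phi> r) = gp_of M (str_map M r)"
  using jM_phi[of r "\<one>\<^bsub>R\<^esub>"] monoid_homD(3)[OF str_hom] by (simp add: rval_def gp_of_def)

text \<open>Finite generation over \<open>R\<close> in the form of an induction rule: a property
  closed under addition holds on the monoid once it holds for the generators and the image of
  \<open>R\<close>.\<close>

lemma submonoid_eq_carrier:
  assumes "submonoid H M" "A \<subseteq> H" "str_map M ` carrier R \<subseteq> H"
    "\<And>H. submonoid H M \<Longrightarrow> A \<union> str_map M ` carrier R \<subseteq> H \<Longrightarrow> H = carrier M"
  shows "m \<in> carrier M \<Longrightarrow> m \<in> H"
  using assms(4)[OF assms(1)] assms(2,3) by auto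

lemma lattice_group_gp: "lattice_group (gp M) (value_group R \<phi>) jM"
proof -
  interpret L: comm_group "gp M" by (rule M.comm_group_gp)
  note str = monoid_homD[OF str_hom]
  show ?thesis
  proof unfold_locales
    show "torsion_free_group (gp M)" by (rule torsion_free)
    show "value_subgroup (value_group R \<phi>)" by (rule value_subgroup)
    show "x \<in> value_group R \<phi>" if "0 < n" "real n * x \<in> value_group R \<phi>" for n x using that by (rule V_div)
    show "jM v \<in> carrier (gp M)" if "v \<in> value_group R \<phi>" for v
      using that by (rule V_E) (simp add: jM_phi str)
    show "jM (v + w) = jM v \<otimes>\<^bsub>gp M\<^esub> jM w" if v: "v \<in> value_group R \<phi>" and w: "w \<in> value_group R \<phi>" for v w
    proof -
      obtain a b where a: "a \<in> carrier R" "b \<in> carrier R" "v = \<phi> (gp_diff R a b)" using v by (rule V_E)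
      obtain c d where c: "c \<in> carrier R" "d \<in> carrier R" "w = \<phi> (gp_diff R c d)" using w by (rule V_E)
      have "v + w = \<phi> (gp_diff R (a \<otimes>\<^bsub>R\<^esub> c) (b \<otimes>\<^bsub>R\<^esub> d))"
        using a c by (simp add: R.gp_mult flip: phi_mult)
      then show ?thesis using a c by (simp add: jM_phi str M.gp_mult)
    qed
    show "inj_on jM (value_group R \<phi>)"
    proof (rule inj_onI)
      fix v w assume v: "v \<in> value_group R \<phi>" and w: "w \<in> value_group R \<phi>" and eq: "jM v = jM w"
      obtain a b where a: "a \<in> carrier R" "b \<in> carrier R" "v = \<phi> (gp_diff R a b)" using v by (rule V_E)
      obtain c d where c: "c \<in> carrier R" "d \<in> carrier R" "w = \<phi> (gp_diff R c d)" using w by (rule V_E)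
      have "str_map M (a \<otimes>\<^bsub>R\<^esub> d) = str_map M (c \<otimes>\<^bsub>R\<^esub> b)"
        using eq a c str by (simp add: jM_phi M.gp_diff_eq_iff)
      then have "a \<otimes>\<^bsub>R\<^esub> d = c \<otimes>\<^bsub>R\<^esub> b" using a c by (intro inj_onD[OF str_inj]) auto
      then have "gp_diff R a b = gp_diff R c d" using a c by (simp add: R.gp_diff_eq_iff)
      then show "v = w" using a c by simp
    qed
    obtain A where A: "finite A" "A \<subseteq> carrier M"
      "\<And>H. submonoid H M \<Longrightarrow> A \<union> str_map M ` carrier R \<subseteq> H \<Longrightarrow> H = carrier M"
      using fin_gen_M by (auto simp: fin_gen_over_def)
    let ?S = "gp_of M ` A \<union> jM ` value_group R \<phi>"
    have S: "?S \<subseteq> carrier (gp M)"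
      using A(2) \<open>\<And>v. v \<in> value_group R \<phi> \<Longrightarrow> jM v \<in> carrier (gp M)\<close> by auto
    \<comment> \<open>Generators of the monoid over \<open>R\<close> generate its group over
      \<open>V\<close>: the elements whose class lies in the generated subgroup form a submonoid,
      and classes of elements of \<open>R\<close> are values of \<open>jM\<close>.\<close>
    define H where "H = {m \<in> carrier M. gp_of M m \<in> generate (gp M) ?S}"
    have "submonoid H M"
      by (rule submonoid.intro)
        (auto simp: H_def M.gp_of_mult M.gp_of_one intro: generate.one generate.eng)
    moreover have "A \<subseteq> H" using A(2) by (auto simp: H_def intro: generate.incl)
    moreover have "str_map M ` carrier R \<subseteq> H"
      using str rval_in_V by (auto simp: H_def jM_rval[symmetric] intro!: generate.incl)
    ultimately have H: "m \<in> H" if "m \<in> carrier M" for m using submonoid_eq_carrier A(3) that by metis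
    have "X \<in> generate (gp M) ?S" if X: "X \<in> carrier (gp M)" for X
    proof -
      obtain a b where ab: "a \<in> carrier M" "b \<in> carrier M" "X = gp_diff M a b" using X by (rule M.gp_E)
      have "gp_of M a \<in> generate (gp M) ?S" "gp_of M b \<in> generate (gp M) ?S" using H ab by (auto simp: H_def)
      then show ?thesis unfolding ab(3) M.gp_diff_conv_gp_of[OF ab(1,2)]
        by (intro generate.eng L.generate_m_inv_closed[OF S])
    qed
    then have "generate (gp M) ?S = carrier (gp M)" using L.generate_incl[OF S] by auto
    then show "\<exists>A. finite A \<and> A \<subseteq> carrier (gp M) \<and> generate (gp M) (A \<union> jM ` value_group R \<phi>) = carrier (gp M)"
      using A S by (intro exI[of _ "gp_of M ` A"]) auto
  qed
qed

sublocale G: lattice_group "gp M" "value_group R \<phi>" jM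
  by (rule lattice_group_gp)

abbreviation "\<iota> \<equiv> raw_cone_in R \<phi> M"
abbreviation "raw \<equiv> raw_cone R \<phi> M"

lemma raw_simps [simp]:
  "vspace raw = G.LR" "lat raw = G.\<rho> ` carrier (gp M)" "cset raw = cone_hull G.LR (\<iota> ` carrier M)"
  "vunit raw = G.u"
  by (simp_all add: raw_cone_def Let_def)

lemma \<iota>_closed [simp]: "m \<in> carrier M \<Longrightarrow> \<iota> m \<in> carrier G.LR"
  by (simp add: raw_cone_in_def)

lemma \<iota>_mult: "m \<in> carrier M \<Longrightarrow> n \<in> carrier M \<Longrightarrow> \<iota> (m \<otimes>\<^bsub>M\<^esub> n) = \<iota> m \<oplus>\<^bsub>G.LR\<^esub> \<iota> n"
  by (simp add: raw_cone_in_def M.gp_of_mult G.\<rho>_mult)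

lemma \<iota>_one: "\<iota> \<one>\<^bsub>M\<^esub> = \<zero>\<^bsub>G.LR\<^esub>"
  by (simp add: raw_cone_in_def M.gp_of_one G.\<rho>_one)

lemma \<iota>_str: "r \<in> carrier R \<Longrightarrow> \<iota> (str_map M r) = rval R \<phi> r \<odot>\<^bsub>G.LR\<^esub> G.u"
  by (simp add: raw_cone_in_def G.\<rho>_j rval_in_V flip: jM_rval)

lemma inj_\<iota>: "inj_on \<iota> (carrier M)"
proof (rule inj_onI)
  fix m n assume mn: "m \<in> carrier M" "n \<in> carrier M" "\<iota> m = \<iota> n"
  then have "gp_of M m = gp_of M n" using inj_onD[OF G.inj_\<rho>, of "gp_of M m" "gp_of M n"] by (simp add: raw_cone_in_def)
  then show "m = n" using mn by (simp add: M.gp_of_eq_iff)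
qed

lemma raw_cone_data: obtains B A where "cone_data R \<phi> raw B A" "A \<subseteq> \<iota> ` carrier M"
proof -
  note str = monoid_homD[OF str_hom]
  obtain A0 where A0: "finite A0" "A0 \<subseteq> carrier M"
    "\<And>H. submonoid H M \<Longrightarrow> A0 \<union> str_map M ` carrier R \<subseteq> H \<Longrightarrow> H = carrier M"
    using fin_gen_M by (auto simp: fin_gen_over_def)
  obtain r where r: "r \<in> carrier R" "0 < rval R \<phi> r" by (rule rval_pos)
  \<comment> \<open>The monoid is finitely generated only over \<open>R\<close>, whereas the cone
    needs finitely many generators. The image of \<open>R\<close> lies on a single ray, and one
    element of positive value spans that ray with real coefficients.\<close>
  define A where "A = insert (\<iota> (str_map M r)) (\<iota> ` A0)"
  have A: "finite A" "A \<subseteq> \<iota> ` carrier M" using A0 str r by (auto simp: A_def)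
  have Ac: "A \<subseteq> carrier G.LR" using A by auto
  have ray: "v \<odot>\<^bsub>G.LR\<^esub> G.u \<in> cone_hull G.LR A" if "0 \<le> v" for v
  proof -
    have "v \<odot>\<^bsub>G.LR\<^esub> G.u = (v / rval R \<phi> r) \<odot>\<^bsub>G.LR\<^esub> \<iota> (str_map M r)"
      using r by (simp add: \<iota>_str)
    also have "\<dots> \<in> cone_hull G.LR A"
      using r that by (intro G.LR.cone_hull_sm[OF Ac] G.LR.cone_hull_base[OF Ac]) (auto simp: A_def)
    finally show ?thesis .
  qed
  define H where "H = {m \<in> carrier M. \<iota> m \<in> cone_hull G.LR A}"
  have "submonoid H M"
    by (rule submonoid.intro)
      (auto simp: H_def \<iota>_mult \<iota>_one G.LR.cone_hull_zero intro: G.LR.cone_hull_add[OF Ac])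
  moreover have "A0 \<subseteq> H" using A0(2) G.LR.cone_hull_base[OF Ac] by (auto simp: H_def A_def)
  moreover have "str_map M ` carrier R \<subseteq> H"
    using str ray rval_nonneg by (auto simp: H_def \<iota>_str)
  ultimately have "m \<in> H" if "m \<in> carrier M" for m using submonoid_eq_carrier A0(3) that by metis
  then have H: "\<iota> m \<in> cone_hull G.LR A" if "m \<in> carrier M" for m using that by (simp add: H_def)
  have hull: "cone_hull G.LR (\<iota> ` carrier M) = cone_hull G.LR A"
  proof
    show "cone_hull G.LR (\<iota> ` carrier M) \<subseteq> cone_hull G.LR A"
      by (rule G.LR.cone_hull_mono_span[OF _ Ac]) (use H in auto)
    have c: "\<iota> ` carrier M \<subseteq> carrier G.LR" by auto
    show "cone_hull G.LR A \<subseteq> cone_hull G.LR (\<iota> ` carrier M)"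
      by (rule G.LR.cone_hull_mono_span[OF _ c]) (use A(2) G.LR.cone_hull_base[OF c] in auto)
  qed
  have span: "lin_span G.LR A = carrier G.LR"
  proof -
    have \<iota>s: "\<iota> m \<in> lin_span G.LR A" if "m \<in> carrier M" for m
      using H[OF that] G.LR.cone_hull_subset_lin_span by blast
    have "G.\<rho> X \<in> lin_span G.LR A" if X: "X \<in> carrier (gp M)" for X
    proof -
      obtain a b where ab: "a \<in> carrier M" "b \<in> carrier M" "X = gp_diff M a b" using X by (rule M.gp_E)
      have "X \<otimes>\<^bsub>gp M\<^esub> gp_of M b = gp_of M a"
        using ab by (simp add: gp_of_def M.gp_mult M.gp_diff_eq_iff M.m_comm)
      \<comment> \<open>Every class is a difference of two monoid elements, whose images are already
        in the span.\<close>
      then have eq: "G.\<rho> X \<oplus>\<^bsub>G.LR\<^esub> \<iota> b = \<iota> a"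
        using X ab unfolding raw_cone_in_def by (simp flip: G.\<rho>_mult)
      have "G.\<rho> X = (G.\<rho> X \<oplus>\<^bsub>G.LR\<^esub> \<iota> b) \<oplus>\<^bsub>G.LR\<^esub> (-1) \<odot>\<^bsub>G.LR\<^esub> \<iota> b"
        using G.\<rho>_closed[OF X] \<iota>_closed[OF ab(2)] by (simp add: G.LR.a_assoc G.LR.sm_diff)
      also have "\<dots> = \<iota> a \<oplus>\<^bsub>G.LR\<^esub> (-1) \<odot>\<^bsub>G.LR\<^esub> \<iota> b" unfolding eq ..
      also have "\<dots> \<in> lin_span G.LR A"
        by (intro G.LR.lin_span_add[OF Ac] G.LR.lin_span_sm[OF Ac] \<iota>s ab)
      finally show ?thesis .
    qed
    moreover have "G.u \<in> lin_span G.LR A"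
      using ray[of 1] G.LR.cone_hull_subset_lin_span[of A] by auto
    ultimately have "insert G.u (G.\<rho> ` carrier (gp M)) \<subseteq> lin_span G.LR A" by auto
    then have "lin_span G.LR (insert G.u (G.\<rho> ` carrier (gp M))) \<subseteq> lin_span G.LR A"
      by (rule G.LR.lin_span_mono_span[OF _ Ac])
    then show ?thesis unfolding G.LR_span using G.LR.lin_span_closed[OF Ac] by (rule equalityI[rotated])
  qed
  obtain B where B: "adapted_basis (value_group R \<phi>) G.LR (G.\<rho> ` carrier (gp M)) G.u B"
    using G.adapted_basis_LR by (rule exE)
  have "cone_data R \<phi> raw B A"
  proof unfold_locales
    show "real_vs (vspace raw)" unfolding raw_simps by (rule G.real_vs_LR)
    show "value_subgroup (value_group R \<phi>)" by (rule value_subgroup)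
    show "adapted_basis (value_group R \<phi>) (vspace raw) (lat raw) (vunit raw) B" unfolding raw_simps by (rule B)
    show "x \<in> value_group R \<phi>" if "0 < n" "real n * x \<in> value_group R \<phi>" for n x using that by (rule V_div)
    show "finite A" by (rule A)
    show "A \<subseteq> lat raw" using A(2) by (auto simp: raw_cone_in_def)
    show "cset raw = cone_hull (vspace raw) A" unfolding raw_simps by (rule hull)
    show "lin_span (vspace raw) A = carrier (vspace raw)" unfolding raw_simps by (rule span)
    show "vvec R \<phi> raw \<pi> \<in> cset raw" if "\<pi> \<in> carrier R" for \<pi>
      unfolding vvec_def raw_simps hull by (rule ray[OF rval_nonneg[OF that]])
  qed
  then show thesis using A(2) by (rule that)
qed

text \<open>This is where saturation of \<open>M\<close> enters.\<close>

lemma \<iota>_image: "\<iota> ` carrier M = cset raw \<inter> lat raw"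
proof
  have c: "\<iota> ` carrier M \<subseteq> carrier G.LR" by auto
  show "\<iota> ` carrier M \<subseteq> cset raw \<inter> lat raw"
    using G.LR.cone_hull_base[OF c] by (auto simp: raw_cone_in_def)
  obtain B A where BA: "cone_data R \<phi> raw B A" "A \<subseteq> \<iota> ` carrier M" by (rule raw_cone_data)
  interpret s: cone_data R \<phi> raw B A by (rule BA(1))
  show "cset raw \<inter> lat raw \<subseteq> \<iota> ` carrier M"
  proof
    fix x assume x: "x \<in> cset raw \<inter> lat raw"
    \<comment> \<open>The image of the monoid takes the role of \<open>P\<close>; the multiple found
      here is divided by \<open>N\<close> through saturation in the group, where the multiple can be
      compared because the lattice embeds.\<close>
    have "\<exists>N::nat. 0 < N \<and> real N \<odot>\<^bsub>vspace raw\<^esub> x \<in> \<iota> ` carrier M"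
    proof (rule s.multiple_in_monoid[OF s.finite_A s.A_lat])
      show "\<zero>\<^bsub>vspace raw\<^esub> \<in> \<iota> ` carrier M" using \<iota>_one by (auto intro!: image_eqI[of _ _ "\<one>\<^bsub>M\<^esub>"])
      show "x \<oplus>\<^bsub>vspace raw\<^esub> y \<in> \<iota> ` carrier M" if "x \<in> \<iota> ` carrier M" "y \<in> \<iota> ` carrier M" for x y
        using that by (auto simp flip: \<iota>_mult)
      show "A \<subseteq> \<iota> ` carrier M" by (rule BA(2))
      show "v \<odot>\<^bsub>vspace raw\<^esub> vunit raw \<in> \<iota> ` carrier M" if v: "v \<in> value_group R \<phi>" "0 \<le> v" for v
      proof -
        obtain r where r: "r \<in> carrier R" "v = rval R \<phi> r" using v by (rule rval_surj)
        then show ?thesis using monoid_homD(1)[OF str_hom r(1)] by (simp flip: \<iota>_str)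
      qed
    qed (use x s.cset_eq in auto)
    then obtain N :: nat and m where N: "0 < N" "m \<in> carrier M" "real N \<odot>\<^bsub>G.LR\<^esub> x = \<iota> m" by auto
    obtain X where X: "X \<in> carrier (gp M)" "x = G.\<rho> X" using x by auto
    have XN: "X [^]\<^bsub>gp M\<^esub> N \<in> carrier (gp M)" using X(1) by simp
    have "G.\<rho> (X [^]\<^bsub>gp M\<^esub> N) = G.\<rho> (gp_of M m)"
      using G.\<rho>_int_pow[OF X(1), of "int N"] N(3) X(2) by (simp add: int_pow_int raw_cone_in_def)
    then have "X [^]\<^bsub>gp M\<^esub> N = gp_of M m" using XN N(2) by (intro inj_onD[OF G.inj_\<rho>]) auto
    then have "X \<in> gp_of M ` carrier M" using saturated X(1) N by (auto simp: saturated_monoid_def)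
    then show "x \<in> \<iota> ` carrier M" using X(2) by (auto simp: raw_cone_in_def)
  qed
qed

end

section \<open>The equivalence\<close>

lemma is_categoryD:
  assumes "is_category C"
  shows "A \<in> Ob C \<Longrightarrow> Ide C A \<in> Mor C A A"
    and "A \<in> Ob C \<Longrightarrow> B \<in> Ob C \<Longrightarrow> D \<in> Ob C \<Longrightarrow> f \<in> Mor C A B \<Longrightarrow> g \<in> Mor C B D \<Longrightarrow> Cmp C A B D g f \<in> Mor C A D"
    and "A \<in> Ob C \<Longrightarrow> B \<in> Ob C \<Longrightarrow> f \<in> Mor C A B \<Longrightarrow> Cmp C A A B f (Ide C A) = f"
    and "A \<in> Ob C \<Longrightarrow> B \<in> Ob C \<Longrightarrow> f \<in> Mor C A B \<Longrightarrow> Cmp C A B B (Ide C B) f = f"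
    and "A \<in> Ob C \<Longrightarrow> B \<in> Ob C \<Longrightarrow> D \<in> Ob C \<Longrightarrow> E \<in> Ob C \<Longrightarrow> f \<in> Mor C A B \<Longrightarrow> g \<in> Mor C B D \<Longrightarrow> h \<in> Mor C D E \<Longrightarrow>
      Cmp C A B E (Cmp C B D E h g) f = Cmp C A D E h (Cmp C A B D g f)"
  using assms unfolding is_category_def by simp_all

lemma is_functorD:
  assumes "is_functor C D F"
  shows "is_category C" "is_category D" "A \<in> Ob C \<Longrightarrow> omap F A \<in> Ob D"
    and "A \<in> Ob C \<Longrightarrow> B \<in> Ob C \<Longrightarrow> f \<in> Mor C A B \<Longrightarrow> amap F A B f \<in> Mor D (omap F A) (omap F B)"
    and "A \<in> Ob C \<Longrightarrow> amap F A A (Ide C A) = Ide D (omap F A)"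
    and "A \<in> Ob C \<Longrightarrow> B \<in> Ob C \<Longrightarrow> E \<in> Ob C \<Longrightarrow> f \<in> Mor C A B \<Longrightarrow> g \<in> Mor C B E \<Longrightarrow>
       amap F A E (Cmp C A B E g f) =
       Cmp D (omap F A) (omap F B) (omap F E) (amap F B E g) (amap F A B f)"
  using assms unfolding is_functor_def by simp_all

lemma isomorphism_cancel:
  assumes C: "is_category C" and ob: "A \<in> Ob C" "B \<in> Ob C" "D \<in> Ob C" and e: "is_isomorphism C A B e"
    and g: "g \<in> Mor C B D" and h: "h \<in> Mor C B D" and eq: "Cmp C A B D g e = Cmp C A B D h e"
  shows "g = h"
proof -
  note cat = is_categoryD[OF C]
  obtain e' where e': "e \<in> Mor C A B" "e' \<in> Mor C B A" "Cmp C B A B e e' = Ide C B"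
    using e by (auto simp: is_isomorphism_def)
  have *: "k = Cmp C B A D (Cmp C A B D k e) e'" if k: "k \<in> Mor C B D" for k
  proof -
    have "Cmp C B A D (Cmp C A B D k e) e' = Cmp C B B D k (Cmp C B A B e e')"
      by (rule cat(5)[OF ob(2,1,2,3) e'(2,1) k])
    also have "\<dots> = k" unfolding e'(3) by (rule cat(3)[OF ob(2,3) k])
    finally show ?thesis by simp
  qed
  show ?thesis by (subst *[OF g], subst *[OF h], subst eq) (rule refl)
qed

text \<open>Functoriality of \<open>F\<close> is a consequence: naturality determines the image
  under \<open>G\<close> of every morphism \<open>amap F A B f\<close> once the isomorphism
  \<open>\<eta>\<close> is cancelled, and faithfulness lifts the resulting equations. The counit at
  \<open>A\<close> is the preimage under \<open>G\<close> of the inverse of \<open>\<eta>\<close> at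
  the object \<open>omap G A\<close>.\<close>

lemma equivalence_of_fully_faithful:
  assumes C: "is_category C" and G: "is_functor D C G"
    and full: "\<And>A B g. A \<in> Ob D \<Longrightarrow> B \<in> Ob D \<Longrightarrow> g \<in> Mor C (omap G A) (omap G B) \<Longrightarrow> \<exists>f\<in>Mor D A B. amap G A B f = g"
    and faithful: "\<And>A B f f'. A \<in> Ob D \<Longrightarrow> B \<in> Ob D \<Longrightarrow> f \<in> Mor D A B \<Longrightarrow> f' \<in> Mor D A B \<Longrightarrow>
      amap G A B f = amap G A B f' \<Longrightarrow> f = f'"
    and Fo: "\<And>A. A \<in> Ob C \<Longrightarrow> omap F A \<in> Ob D"
    and Fa: "\<And>A B f. A \<in> Ob C \<Longrightarrow> B \<in> Ob C \<Longrightarrow> f \<in> Mor C A B \<Longrightarrow> amap F A B f \<in> Mor D (omap F A) (omap F B)"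
    and \<eta>: "\<And>A. A \<in> Ob C \<Longrightarrow> is_isomorphism C A (omap G (omap F A)) (\<eta> A)"
    and nat: "\<And>A B f. A \<in> Ob C \<Longrightarrow> B \<in> Ob C \<Longrightarrow> f \<in> Mor C A B \<Longrightarrow>
      Cmp C A B (omap G (omap F B)) (\<eta> B) f =
      Cmp C A (omap G (omap F A)) (omap G (omap F B)) (amap G (omap F A) (omap F B) (amap F A B f)) (\<eta> A)"
  shows "essentially_inverse_equivalences C D F G"
proof -
  note catC = is_categoryD[OF C]
  note GD = is_functorD[OF G]
  note catD = is_categoryD[OF GD(1)]
  let ?G = "omap G" and ?F = "omap F"
  have \<eta>m: "\<eta> A \<in> Mor C A (?G (?F A))" if "A \<in> Ob C" for A
    using \<eta>[OF that] by (simp add: is_isomorphism_def)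
  have F: "is_functor C D F"
    unfolding is_functor_def
  proof (intro conjI ballI)
    show "is_category C" "is_category D" by (rule C, rule GD(1))
    fix A assume A: "A \<in> Ob C"
    show FA: "?F A \<in> Ob D" by (rule Fo[OF A])
    have GFA: "?G (?F A) \<in> Ob C" by (rule GD(3)[OF FA])
    \<comment> \<open>After applying \<open>G\<close> and composing with \<open>\<eta> A\<close>,
      both sides become \<open>\<eta> A\<close>.\<close>
    show "amap F A A (Ide C A) = Ide D (?F A)"
    proof (rule faithful[OF FA FA])
      show 1: "amap F A A (Ide C A) \<in> Mor D (?F A) (?F A)" by (rule Fa[OF A A catC(1)[OF A]])
      show 2: "Ide D (?F A) \<in> Mor D (?F A) (?F A)" by (rule catD(1)[OF FA])
      show "amap G (?F A) (?F A) (amap F A A (Ide C A)) = amap G (?F A) (?F A) (Ide D (?F A))"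
      proof (rule isomorphism_cancel[OF C A GFA GFA \<eta>[OF A] GD(4)[OF FA FA 1] GD(4)[OF FA FA 2]])
        have "Cmp C A (?G (?F A)) (?G (?F A)) (amap G (?F A) (?F A) (amap F A A (Ide C A))) (\<eta> A) = Cmp C A A (?G (?F A)) (\<eta> A) (Ide C A)"
          by (rule nat[symmetric, OF A A catC(1)[OF A]])
        also have "\<dots> = \<eta> A" by (rule catC(3)[OF A GFA \<eta>m[OF A]])
        also have "\<dots> = Cmp C A (?G (?F A)) (?G (?F A)) (Ide C (?G (?F A))) (\<eta> A)"
          by (rule catC(4)[symmetric, OF A GFA \<eta>m[OF A]])
        also have "Ide C (?G (?F A)) = amap G (?F A) (?F A) (Ide D (?F A))" by (rule GD(5)[symmetric, OF FA])
        finally show "Cmp C A (?G (?F A)) (?G (?F A)) (amap G (?F A) (?F A) (amap F A A (Ide C A))) (\<eta> A) =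
          Cmp C A (?G (?F A)) (?G (?F A)) (amap G (?F A) (?F A) (Ide D (?F A))) (\<eta> A)" .
      qed
    qed
  next
    fix A B f assume "A \<in> Ob C" "B \<in> Ob C" "f \<in> Mor C A B"
    then show "amap F A B f \<in> Mor D (?F A) (?F B)" by (rule Fa)
  next
    fix A B E f g assume A: "A \<in> Ob C" and B: "B \<in> Ob C" and E: "E \<in> Ob C"
      and f: "f \<in> Mor C A B" and g: "g \<in> Mor C B E"
    note FA = Fo[OF A] and FB = Fo[OF B] and FE = Fo[OF E]
    note GFA = GD(3)[OF FA] and GFB = GD(3)[OF FB] and GFE = GD(3)[OF FE]
    note gf = catC(2)[OF A B E f g]
    note Ff = Fa[OF A B f] and Fg = Fa[OF B E g] and Fgf = Fa[OF A E gf]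
    note FgFf = catD(2)[OF FA FB FE Ff Fg]
    show "amap F A E (Cmp C A B E g f) = Cmp D (?F A) (?F B) (?F E) (amap F B E g) (amap F A B f)"
    proof (rule faithful[OF FA FE Fgf FgFf], rule isomorphism_cancel[OF C A GFA GFE \<eta>[OF A] GD(4)[OF FA FE Fgf] GD(4)[OF FA FE FgFf]])
      let ?Gf = "amap G (?F A) (?F B) (amap F A B f)" and ?Gg = "amap G (?F B) (?F E) (amap F B E g)"
      have Gf: "?Gf \<in> Mor C (?G (?F A)) (?G (?F B))" by (rule GD(4)[OF FA FB Ff])
      have Gg: "?Gg \<in> Mor C (?G (?F B)) (?G (?F E))" by (rule GD(4)[OF FB FE Fg])
      have "Cmp C A (?G (?F A)) (?G (?F E)) (amap G (?F A) (?F E) (amap F A E (Cmp C A B E g f))) (\<eta> A)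
          = Cmp C A E (?G (?F E)) (\<eta> E) (Cmp C A B E g f)"
        by (rule nat[symmetric, OF A E gf])
      also have "\<dots> = Cmp C A B (?G (?F E)) (Cmp C B E (?G (?F E)) (\<eta> E) g) f"
        by (rule catC(5)[symmetric, OF A B E GFE f g \<eta>m[OF E]])
      also have "\<dots> = Cmp C A B (?G (?F E)) (Cmp C B (?G (?F B)) (?G (?F E)) ?Gg (\<eta> B)) f"
        unfolding nat[OF B E g] ..
      also have "\<dots> = Cmp C A (?G (?F B)) (?G (?F E)) ?Gg (Cmp C A B (?G (?F B)) (\<eta> B) f)"
        by (rule catC(5)[OF A B GFB GFE f \<eta>m[OF B] Gg])
      also have "\<dots> = Cmp C A (?G (?F B)) (?G (?F E)) ?Gg (Cmp C A (?G (?F A)) (?G (?F B)) ?Gf (\<eta> A))"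
        unfolding nat[OF A B f] ..
      also have "\<dots> = Cmp C A (?G (?F A)) (?G (?F E)) (Cmp C (?G (?F A)) (?G (?F B)) (?G (?F E)) ?Gg ?Gf) (\<eta> A)"
        by (rule catC(5)[symmetric, OF A GFA GFB GFE \<eta>m[OF A] Gf Gg])
      also have "Cmp C (?G (?F A)) (?G (?F B)) (?G (?F E)) ?Gg ?Gf
          = amap G (?F A) (?F E) (Cmp D (?F A) (?F B) (?F E) (amap F B E g) (amap F A B f))"
        by (rule GD(6)[symmetric, OF FA FB FE Ff Fg])
      finally show "Cmp C A (?G (?F A)) (?G (?F E)) (amap G (?F A) (?F E) (amap F A E (Cmp C A B E g f))) (\<eta> A)
        = Cmp C A (?G (?F A)) (?G (?F E)) (amap G (?F A) (?F E) (Cmp D (?F A) (?F B) (?F E) (amap F B E g) (amap F A B f))) (\<eta> A)" .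
    qed
  qed
  have "is_natural_isomorphism C C id_functor (comp_functor G F) \<eta>"
    unfolding is_natural_isomorphism_def id_functor_def comp_functor_def using \<eta> nat by simp
  moreover have "\<exists>\<epsilon>. is_natural_isomorphism D D (comp_functor F G) id_functor \<epsilon>"
  proof -
    \<comment> \<open>Here \<open>\<theta>\<close> is the inverse of the unit at the object
      \<open>omap G A\<close>, and fullness lifts it to a morphism \<open>\<epsilon>\<close>, the
      component of the counit.\<close>
    have "\<exists>\<theta> \<epsilon>. \<theta> \<in> Mor C (?G (?F (?G A))) (?G A) \<and>
        Cmp C (?G A) (?G (?F (?G A))) (?G A) \<theta> (\<eta> (?G A)) = Ide C (?G A) \<and>
        Cmp C (?G (?F (?G A))) (?G A) (?G (?F (?G A))) (\<eta> (?G A)) \<theta> = Ide C (?G (?F (?G A))) \<and>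
        \<epsilon> \<in> Mor D (?F (?G A)) A \<and> amap G (?F (?G A)) A \<epsilon> = \<theta>" if A: "A \<in> Ob D" for A
    proof -
      have GA: "?G A \<in> Ob C" by (rule GD(3)[OF A])
      have FGA: "?F (?G A) \<in> Ob D" by (rule Fo[OF GA])
      obtain \<theta> where \<theta>: "\<theta> \<in> Mor C (?G (?F (?G A))) (?G A)"
        "Cmp C (?G A) (?G (?F (?G A))) (?G A) \<theta> (\<eta> (?G A)) = Ide C (?G A)"
        "Cmp C (?G (?F (?G A))) (?G A) (?G (?F (?G A))) (\<eta> (?G A)) \<theta> = Ide C (?G (?F (?G A)))"
        using \<eta>[OF GA] unfolding is_isomorphism_def by auto
      obtain \<epsilon> where "\<epsilon> \<in> Mor D (?F (?G A)) A" "amap G (?F (?G A)) A \<epsilon> = \<theta>"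
        using full[OF FGA A \<theta>(1)] by auto
      then show ?thesis using \<theta> by (intro exI[of _ \<theta>] exI[of _ \<epsilon>]) simp
    qed
    then obtain \<theta> \<epsilon> where \<theta>: "\<And>A. A \<in> Ob D \<Longrightarrow> \<theta> A \<in> Mor C (?G (?F (?G A))) (?G A)"
      "\<And>A. A \<in> Ob D \<Longrightarrow> Cmp C (?G A) (?G (?F (?G A))) (?G A) (\<theta> A) (\<eta> (?G A)) = Ide C (?G A)"
      "\<And>A. A \<in> Ob D \<Longrightarrow> Cmp C (?G (?F (?G A))) (?G A) (?G (?F (?G A))) (\<eta> (?G A)) (\<theta> A) = Ide C (?G (?F (?G A)))"
      and \<epsilon>: "\<And>A. A \<in> Ob D \<Longrightarrow> \<epsilon> A \<in> Mor D (?F (?G A)) A" "\<And>A. A \<in> Ob D \<Longrightarrow> amap G (?F (?G A)) A (\<epsilon> A) = \<theta> A"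
      by metis
    have "is_natural_isomorphism D D (comp_functor F G) id_functor \<epsilon>"
      unfolding is_natural_isomorphism_def id_functor_def comp_functor_def
    proof (simp, intro conjI ballI)
      fix A assume A: "A \<in> Ob D"
      have GA: "?G A \<in> Ob C" by (rule GD(3)[OF A])
      have FGA: "?F (?G A) \<in> Ob D" by (rule Fo[OF GA])
      \<comment> \<open>The inverse of the counit is a lift of the unit itself; both composites are
        identities because their images under \<open>G\<close> are.\<close>
      obtain d where d: "d \<in> Mor D A (?F (?G A))" "amap G A (?F (?G A)) d = \<eta> (?G A)"
        using full[OF A FGA \<eta>m[OF GA]] by auto
      have 1: "Cmp D (?F (?G A)) A (?F (?G A)) d (\<epsilon> A) = Ide D (?F (?G A))"
        by (rule faithful[OF FGA FGA catD(2)[OF FGA A FGA \<epsilon>(1)[OF A] d(1)] catD(1)[OF FGA]])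
          (simp add: GD(6)[OF FGA A FGA \<epsilon>(1)[OF A] d(1)] GD(5)[OF FGA] d(2) \<epsilon>(2)[OF A] \<theta>(3)[OF A])
      have 2: "Cmp D A (?F (?G A)) A (\<epsilon> A) d = Ide D A"
        by (rule faithful[OF A A catD(2)[OF A FGA A d(1) \<epsilon>(1)[OF A]] catD(1)[OF A]])
          (simp add: GD(6)[OF A FGA A d(1) \<epsilon>(1)[OF A]] GD(5)[OF A] d(2) \<epsilon>(2)[OF A] \<theta>(2)[OF A])
      show "is_isomorphism D (?F (?G A)) A (\<epsilon> A)"
        unfolding is_isomorphism_def using 1 2 d(1) \<epsilon>(1)[OF A] by auto
    next
      fix A B f assume A: "A \<in> Ob D" and B: "B \<in> Ob D" and f: "f \<in> Mor D A B"
      note GA = GD(3)[OF A] and GB = GD(3)[OF B]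
      note FGA = Fo[OF GA] and FGB = Fo[OF GB]
      note GFGA = GD(3)[OF FGA] and GFGB = GD(3)[OF FGB]
      note Gf = GD(4)[OF A B f]
      note FGf = Fa[OF GA GB Gf]
      note GFGf = GD(4)[OF FGA FGB FGf]
      let ?k = "amap G (?F (?G A)) (?F (?G B)) (amap F (?G A) (?G B) (amap G A B f))"
      note \<theta>A = \<theta>(1)[OF A] and \<theta>B = \<theta>(1)[OF B]
      show "Cmp D (?F (?G A)) (?F (?G B)) B (\<epsilon> B) (amap F (?G A) (?G B) (amap G A B f)) = Cmp D (?F (?G A)) A B f (\<epsilon> A)"
      proof (rule faithful[OF FGA B catD(2)[OF FGA FGB B FGf \<epsilon>(1)[OF B]] catD(2)[OF FGA A B \<epsilon>(1)[OF A] f]])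
        have kB: "Cmp C (?G (?F (?G A))) (?G (?F (?G B))) (?G B) (\<theta> B) ?k \<in> Mor C (?G (?F (?G A))) (?G B)"
          by (rule catC(2)[OF GFGA GFGB GB GFGf \<theta>B])
        have fA: "Cmp C (?G (?F (?G A))) (?G A) (?G B) (amap G A B f) (\<theta> A) \<in> Mor C (?G (?F (?G A))) (?G B)"
          by (rule catC(2)[OF GFGA GA GB \<theta>A Gf])
        \<comment> \<open>The inverse of a natural isomorphism is natural; precomposing with the
          unit at \<open>A\<close> reduces the square for \<open>\<theta>\<close> to that for
          \<open>\<eta>\<close>.\<close>
        have "Cmp C (?G (?F (?G A))) (?G (?F (?G B))) (?G B) (\<theta> B) ?k
            = Cmp C (?G (?F (?G A))) (?G A) (?G B) (amap G A B f) (\<theta> A)"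
        proof (rule isomorphism_cancel[OF C GA GFGA GB \<eta>[OF GA] kB fA])
          have "Cmp C (?G A) (?G (?F (?G A))) (?G B) (Cmp C (?G (?F (?G A))) (?G (?F (?G B))) (?G B) (\<theta> B) ?k) (\<eta> (?G A))
              = Cmp C (?G A) (?G (?F (?G B))) (?G B) (\<theta> B) (Cmp C (?G A) (?G (?F (?G A))) (?G (?F (?G B))) ?k (\<eta> (?G A)))"
            by (rule catC(5)[OF GA GFGA GFGB GB \<eta>m[OF GA] GFGf \<theta>B])
          also have "\<dots> = Cmp C (?G A) (?G (?F (?G B))) (?G B) (\<theta> B) (Cmp C (?G A) (?G B) (?G (?F (?G B))) (\<eta> (?G B)) (amap G A B f))"
            unfolding nat[OF GA GB Gf] ..
          also have "\<dots> = Cmp C (?G A) (?G B) (?G B) (Cmp C (?G B) (?G (?F (?G B))) (?G B) (\<theta> B) (\<eta> (?G B))) (amap G A B f)"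
            by (rule catC(5)[symmetric, OF GA GB GFGB GB Gf \<eta>m[OF GB] \<theta>B])
          also have "\<dots> = amap G A B f" unfolding \<theta>(2)[OF B] by (rule catC(4)[OF GA GB Gf])
          also have "\<dots> = Cmp C (?G A) (?G A) (?G B) (amap G A B f) (Cmp C (?G A) (?G (?F (?G A))) (?G A) (\<theta> A) (\<eta> (?G A)))"
            unfolding \<theta>(2)[OF A] by (rule catC(3)[symmetric, OF GA GB Gf])
          also have "\<dots> = Cmp C (?G A) (?G (?F (?G A))) (?G B) (Cmp C (?G (?F (?G A))) (?G A) (?G B) (amap G A B f) (\<theta> A)) (\<eta> (?G A))"
            by (rule catC(5)[symmetric, OF GA GFGA GA GB \<eta>m[OF GA] \<theta>A Gf])
          finally show "Cmp C (?G A) (?G (?F (?G A))) (?G B) (Cmp C (?G (?F (?G A))) (?G (?F (?G B))) (?G B) (\<theta> B) ?k) (\<eta> (?G A))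
            = Cmp C (?G A) (?G (?F (?G A))) (?G B) (Cmp C (?G (?F (?G A))) (?G A) (?G B) (amap G A B f) (\<theta> A)) (\<eta> (?G A))" .
        qed
        then show "amap G (?F (?G A)) B (Cmp D (?F (?G A)) (?F (?G B)) B (\<epsilon> B) (amap F (?G A) (?G B) (amap G A B f)))
          = amap G (?F (?G A)) B (Cmp D (?F (?G A)) A B f (\<epsilon> A))"
          by (simp add: GD(6)[OF FGA FGB B FGf \<epsilon>(1)[OF B]] GD(6)[OF FGA A B \<epsilon>(1)[OF A] f] \<epsilon>(2)[OF A] \<epsilon>(2)[OF B])
      qed
    qed
    then show ?thesis by (rule exI[of _ \<epsilon>])
  qed
  ultimately show ?thesis unfolding essentially_inverse_equivalences_def using F G by blast
qed

section \<open>The two categories and the functor from cones to monoids\<close>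

lemma toric_category_simps [simp]:
  "Ob (toric_category R) = {M. toric_monoid R M}" "Mor (toric_category R) = rmonoid_mor R"
  "Ide (toric_category R) M = restrict (\<lambda>x. x) (carrier M)"
  "Cmp (toric_category R) M N P g f = compose (carrier M) g f"
  by (simp_all add: toric_category_def)

lemma cone_category_simps [simp]:
  "Ob (cone_category R \<phi>) = {s. special_cone R \<phi> s}" "Mor (cone_category R \<phi>) = cone_mor R \<phi>"
  "Ide (cone_category R \<phi>) s = restrict (\<lambda>x. x) (carrier (vspace s))"
  "Cmp (cone_category R \<phi>) s t q g f = compose (carrier (vspace s)) g f"
  by (simp_all add: cone_category_def)

lemma rmonoid_morD:
  assumes "f \<in> rmonoid_mor R M N"
  shows "f \<in> extensional (carrier M)" "f \<in> carrier M \<rightarrow> carrier N" "f \<in> monoid_hom M N"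
    "\<And>r. r \<in> carrier R \<Longrightarrow> f (str_map M r) = str_map N r"
  using assms by (auto simp: rmonoid_mor_def monoid_hom_def hom_def)

lemma toric_monoidD:
  assumes "toric_monoid R M"
  shows "comm_monoid_cancel M" "\<And>r. r \<in> carrier R \<Longrightarrow> str_map M r \<in> carrier M"
    "\<one>\<^bsub>M\<^esub> \<in> carrier M" "\<And>x y. x \<in> carrier M \<Longrightarrow> y \<in> carrier M \<Longrightarrow> x \<otimes>\<^bsub>M\<^esub> y \<in> carrier M"
proof -
  show M: "comm_monoid_cancel M" using assms by (simp add: toric_monoid_def)
  interpret comm_monoid_cancel M by (rule M)
  show "\<one>\<^bsub>M\<^esub> \<in> carrier M" "\<And>x y. x \<in> carrier M \<Longrightarrow> y \<in> carrier M \<Longrightarrow> x \<otimes>\<^bsub>M\<^esub> y \<in> carrier M" by auto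
  show "\<And>r. r \<in> carrier R \<Longrightarrow> str_map M r \<in> carrier M"
    using assms by (auto simp: toric_monoid_def monoid_hom_def hom_def)
qed

lemma is_category_toric: "is_category (toric_category R)"
  unfolding is_category_def toric_category_simps mem_Collect_eq
proof (intro conjI ballI)
  fix M assume "M \<in> {M. toric_monoid R M}"
  then have M: "toric_monoid R M" by simp
  show "restrict (\<lambda>x. x) (carrier M) \<in> rmonoid_mor R M M"
    using toric_monoidD[OF M] by (auto simp: rmonoid_mor_def monoid_hom_def hom_def)
next
  fix M N P f g assume "M \<in> {M. toric_monoid R M}"
    and f: "f \<in> rmonoid_mor R M N" and g: "g \<in> rmonoid_mor R N P"
  then have M: "toric_monoid R M" by simp
  note f = rmonoid_morD[OF f] and g = rmonoid_morD[OF g]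
  show "compose (carrier M) g f \<in> rmonoid_mor R M P"
    using toric_monoidD[OF M] f(2,4) g(4) monoid_homD[OF f(3)] monoid_homD[OF g(3)]
    by (auto simp: rmonoid_mor_def monoid_hom_def hom_def compose_def)
next
  fix M N f assume "f \<in> rmonoid_mor R M N"
  note f = rmonoid_morD[OF this]
  show "compose (carrier M) f (restrict (\<lambda>x. x) (carrier M)) = f" by (rule compose_Id[OF f(2,1)])
  show "compose (carrier M) (restrict (\<lambda>x. x) (carrier N)) f = f" by (rule Id_compose[OF f(2,1)])
next
  fix M N P Q f g h assume f: "f \<in> rmonoid_mor R M N"
  show "compose (carrier M) (compose (carrier N) h g) f = compose (carrier M) h (compose (carrier M) g f)"
    by (rule compose_assoc[symmetric, OF rmonoid_morD(2)[OF f]])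
qed

lemma toric_isomorphism:
  assumes M: "toric_monoid R M" and N: "toric_monoid R N" and f: "f \<in> rmonoid_mor R M N"
    and bij: "bij_betw f (carrier M) (carrier N)"
  shows "is_isomorphism (toric_category R) M N f"
proof -
  define g where "g = restrict (inv_into (carrier M) f) (carrier N)"
  note f' = rmonoid_morD[OF f]
  note fh = monoid_homD[OF f'(3)]
  have gf: "g (f x) = x" if "x \<in> carrier M" for x
    using bij that by (simp add: g_def bij_betw_inv_into_left bij_betwE)
  have fg: "f (g y) = y" "g y \<in> carrier M" if "y \<in> carrier N" for y
    using bij that by (auto simp: g_def bij_betw_inv_into_right bij_betw_def inv_into_into)
  have gmult: "g (x \<otimes>\<^bsub>N\<^esub> y) = g x \<otimes>\<^bsub>M\<^esub> g y" if x: "x \<in> carrier N" and y: "y \<in> carrier N" for x y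
  proof -
    have "g (f (g x \<otimes>\<^bsub>M\<^esub> g y)) = g x \<otimes>\<^bsub>M\<^esub> g y" by (rule gf[OF toric_monoidD(4)[OF M fg(2)[OF x] fg(2)[OF y]]])
    then show ?thesis using fh(2)[OF fg(2)[OF x] fg(2)[OF y]] fg(1)[OF x] fg(1)[OF y] by simp
  qed
  have gone: "g \<one>\<^bsub>N\<^esub> = \<one>\<^bsub>M\<^esub>" using gf[OF toric_monoidD(3)[OF M]] fh(3) by simp
  have gstr: "g (str_map N r) = str_map M r" if r: "r \<in> carrier R" for r
    using gf[OF toric_monoidD(2)[OF M r]] f'(4)[OF r] by simp
  have "g \<in> rmonoid_mor R N M"
    using fg(2) gmult gone gstr by (auto simp: rmonoid_mor_def monoid_hom_def hom_def g_def)
  moreover have "compose (carrier M) g f = restrict (\<lambda>x. x) (carrier M)"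
    by (auto simp: compose_def gf fun_eq_iff)
  moreover have "compose (carrier N) f g = restrict (\<lambda>x. x) (carrier N)"
    by (auto simp: compose_def fg fun_eq_iff)
  ultimately show ?thesis using f unfolding is_isomorphism_def by (intro conjI bexI[of _ g]) simp_all
qed

lemma cone_morD:
  assumes "f \<in> cone_mor R \<phi> s t"
  shows "f \<in> extensional (carrier (vspace s))" "f \<in> carrier (vspace s) \<rightarrow> carrier (vspace t)"
    "f \<in> linear_maps (vspace s) (vspace t)"
  using assms linear_mapsD(1) by (auto simp: cone_mor_def)

context valued
begin

lemma special_coneE:
  assumes "special_cone R \<phi> s"
  obtains B A where "cone_data R \<phi> s B A"
proof -
  have "\<exists>B A. cone_data R \<phi> s B A" using assms by (simp only: special_cone_iff_cone_data)
  then show thesis by (elim exE) (rule that)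
qed

lemma is_category_cone: "is_category (cone_category R \<phi> :: ('u vcone, 'u \<Rightarrow> 'u) category)"
  unfolding is_category_def cone_category_simps mem_Collect_eq
proof (intro conjI ballI)
  fix s :: "'u vcone" assume "s \<in> {s. special_cone R \<phi> s}"
  then obtain B A where s: "cone_data R \<phi> s B A" using special_coneE by blast
  then interpret s: cone_data R \<phi> s B A .
  show "restrict (\<lambda>x. x) (carrier (vspace s)) \<in> cone_mor R \<phi> s s"
    unfolding cone_mor_iff[OF s s] by (auto intro!: linear_mapsI)
next
  fix s t q :: "'u vcone" and f g
  assume "s \<in> {s. special_cone R \<phi> s}" "t \<in> {s. special_cone R \<phi> s}" "q \<in> {s. special_cone R \<phi> s}"
    and f: "f \<in> cone_mor R \<phi> s t" and g: "g \<in> cone_mor R \<phi> t q"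
  then obtain B A B' A' B'' A'' where s: "cone_data R \<phi> s B A" and t: "cone_data R \<phi> t B' A'" and q: "cone_data R \<phi> q B'' A''"
    by (auto elim!: special_coneE)
  interpret s: cone_data R \<phi> s B A by (rule s)
  have f': "f \<in> linear_maps (vspace s) (vspace t)" "f (vunit s) = vunit t"
    "\<And>m. m \<in> cset s \<inter> lat s \<Longrightarrow> f m \<in> cset t \<inter> lat t"
    using f unfolding cone_mor_iff[OF s t] by auto
  have g': "g \<in> linear_maps (vspace t) (vspace q)" "g (vunit t) = vunit q"
    "\<And>m. m \<in> cset t \<inter> lat t \<Longrightarrow> g m \<in> cset q \<inter> lat q"
    using g unfolding cone_mor_iff[OF t q] by auto
  show "compose (carrier (vspace s)) g f \<in> cone_mor R \<phi> s q"
    unfolding cone_mor_iff[OF s q]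
  proof (intro conjI ballI)
    show "compose (carrier (vspace s)) g f \<in> linear_maps (vspace s) (vspace q)"
      by (rule linear_mapsI) (auto simp: compose_def linear_mapsD[OF f'(1)] linear_mapsD[OF g'(1)])
    fix m assume m: "m \<in> cset s \<inter> lat s"
    then show "compose (carrier (vspace s)) g f m \<in> cset q \<inter> lat q"
      using g'(3)[OF f'(3)[OF m]] by (simp add: compose_def)
  qed (simp_all add: compose_def f'(2) g'(2))
next
  fix s t :: "'u vcone" and f assume "f \<in> cone_mor R \<phi> s t"
  note f = cone_morD[OF this]
  show "compose (carrier (vspace s)) f (restrict (\<lambda>x. x) (carrier (vspace s))) = f" by (rule compose_Id[OF f(2,1)])
  show "compose (carrier (vspace s)) (restrict (\<lambda>x. x) (carrier (vspace t))) f = f" by (rule Id_compose[OF f(2,1)])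
next
  fix s t q p :: "'u vcone" and f g h assume f: "f \<in> cone_mor R \<phi> s t"
  show "compose (carrier (vspace s)) (compose (carrier (vspace t)) h g) f
      = compose (carrier (vspace s)) h (compose (carrier (vspace s)) g f)"
    by (rule compose_assoc[symmetric, OF cone_morD(2)[OF f]])
qed

lemma is_functor_monoid:
  "is_functor (cone_category R \<phi> :: ('u vcone, 'u \<Rightarrow> 'u) category) (toric_category R) (monoid_functor R \<phi>)"
  unfolding is_functor_def cone_category_simps toric_category_simps monoid_functor_def cat_functor.simps
proof (intro conjI ballI)
  show "is_category (cone_category R \<phi> :: ('u vcone, 'u \<Rightarrow> 'u) category)" "is_category (toric_category R)"
    by (rule is_category_cone, rule is_category_toric)
  fix s :: "'u vcone" assume "s \<in> {s. special_cone R \<phi> s}"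
  then show "monoid_of_cone R \<phi> s \<in> {M. toric_monoid R M}" using toric_monoid_of_cone by simp
  obtain B A where s: "cone_data R \<phi> s B A" using \<open>s \<in> _\<close> special_coneE by blast
  then interpret s: cone_data R \<phi> s B A .
  show "restrict (restrict (\<lambda>x. x) (carrier (vspace s))) (cset s \<inter> lat s) = restrict (\<lambda>x. x) (carrier (monoid_of_cone R \<phi> s))"
    by (auto simp: fun_eq_iff)
next
  fix s t :: "'u vcone" and f assume "s \<in> {s. special_cone R \<phi> s}" "t \<in> {s. special_cone R \<phi> s}"
    and f: "f \<in> cone_mor R \<phi> s t"
  then obtain B A B' A' where s: "cone_data R \<phi> s B A" and t: "cone_data R \<phi> t B' A'"
    by (auto elim!: special_coneE)
  show "restrict f (cset s \<inter> lat s) \<in> rmonoid_mor R (monoid_of_cone R \<phi> s) (monoid_of_cone R \<phi> t)"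
    by (rule restrict_cone_mor[OF s t f])
next
  fix s t q :: "'u vcone" and f g
  assume "s \<in> {s. special_cone R \<phi> s}" "t \<in> {s. special_cone R \<phi> s}"
    and f: "f \<in> cone_mor R \<phi> s t"
  then obtain B A B' A' where s: "cone_data R \<phi> s B A" and t: "cone_data R \<phi> t B' A'"
    by (auto elim!: special_coneE)
  interpret s: cone_data R \<phi> s B A by (rule s)
  have "\<And>m. m \<in> cset s \<inter> lat s \<Longrightarrow> f m \<in> cset t \<inter> lat t" using f unfolding cone_mor_iff[OF s t] by auto
  then show "restrict (compose (carrier (vspace s)) g f) (cset s \<inter> lat s)
    = compose (carrier (monoid_of_cone R \<phi> s)) (restrict g (cset t \<inter> lat t)) (restrict f (cset s \<inter> lat s))"
    by (auto simp: fun_eq_iff compose_def)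
qed

end

section \<open>The unit of the equivalence\<close>

locale toric_universe = toric R \<phi> M for R :: "('r, 'c) monoid_scheme" and \<phi> and M :: "('u, 'r) rmonoid" +
  assumes universe: "\<exists>h :: real \<Rightarrow> 'u. inj h"
begin

abbreviation "enc \<equiv> encoding R \<phi> M"
abbreviation "\<sigma> \<equiv> cone_of_monoid R \<phi> M"
abbreviation "\<eta> \<equiv> restrict (cone_in R \<phi> M) (carrier M)"

text \<open>The ambient space injects into the reals by its finite generating set, and the reals
  inject into the universe. Hence the choice in \<open>encoding\<close> picks an actual
  injection.\<close>

lemma inj_enc: "inj_on enc (carrier (vspace raw))"
proof -
  obtain B A where "cone_data R \<phi> raw B A" by (rule raw_cone_data)
  then interpret s: cone_data R \<phi> raw B A .
  obtain f :: "_ \<Rightarrow> real" where f: "inj_on f (carrier (vspace raw))"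
    using s.lin_span_inj_real[OF s.finite_A s.A_carrier] unfolding s.span_A by (rule exE)
  obtain i :: "real \<Rightarrow> 'u" where i: "inj i" using universe by auto
  have "inj_on (i \<circ> f) (carrier (vspace raw))"
    by (rule comp_inj_on[OF f inj_on_subset[OF i]]) simp
  then show ?thesis unfolding encoding_def
    by (rule someI[where P = "\<lambda>h. inj_on h (carrier (vspace raw))"])
qed

lemma \<sigma>_data: obtains B A where "cone_data R \<phi> \<sigma> B A"
proof -
  obtain B A where s: "cone_data R \<phi> raw B A" by (rule raw_cone_data)
  show thesis using that cone_data_transport(1)[OF s inj_enc] by (simp add: cone_of_monoid_def)
qed

lemma enc_linear: "enc \<in> linear_maps (vspace raw) (vspace \<sigma>)"
proof -
  obtain B A where s: "cone_data R \<phi> raw B A" by (rule raw_cone_data)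
  show ?thesis using cone_data_transport(2)[OF s inj_enc] by (simp add: cone_of_monoid_def)
qed

lemma \<sigma>_simps: "cset \<sigma> = enc ` cset raw" "lat \<sigma> = enc ` lat raw" "vunit \<sigma> = enc (vunit raw)"
  by (simp_all add: cone_of_monoid_def transport_cone_def)

lemma cone_in_image: "cone_in R \<phi> M ` carrier M = cset \<sigma> \<inter> lat \<sigma>"
proof -
  obtain B A where s: "cone_data R \<phi> raw B A" by (rule raw_cone_data)
  interpret s: cone_data R \<phi> raw B A by (rule s)
  have "cset \<sigma> \<inter> lat \<sigma> = enc ` (cset raw \<inter> lat raw)"
    unfolding \<sigma>_simps by (rule inj_on_image_Int[symmetric, OF inj_enc s.cset_carrier s.L_carrier])
  also have "\<dots> = enc ` \<iota> ` carrier M" unfolding \<iota>_image ..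
  finally show ?thesis by (simp add: image_image cone_in_def)
qed

lemma inj_cone_in: "inj_on (cone_in R \<phi> M) (carrier M)"
proof (rule inj_onI)
  fix m n assume mn: "m \<in> carrier M" "n \<in> carrier M" "cone_in R \<phi> M m = cone_in R \<phi> M n"
  then have "\<iota> m = \<iota> n" by (intro inj_onD[OF inj_enc]) (auto simp: cone_in_def)
  then show "m = n" using mn by (intro inj_onD[OF inj_\<iota>])
qed

lemma \<eta>_mor: "\<eta> \<in> rmonoid_mor R M (monoid_of_cone R \<phi> \<sigma>)"
proof -
  obtain B A where s: "cone_data R \<phi> raw B A" by (rule raw_cone_data)
  interpret s: cone_data R \<phi> raw B A by (rule s)
  obtain B' A' where t: "cone_data R \<phi> \<sigma> B' A'" by (rule \<sigma>_data)
  interpret t: cone_data R \<phi> \<sigma> B' A' by (rule t)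
  note lin = linear_mapsD[OF enc_linear]
  have 1: "cone_in R \<phi> M m \<in> cset \<sigma> \<inter> lat \<sigma>" if "m \<in> carrier M" for m using cone_in_image that by auto
  have 2: "cone_in R \<phi> M (m \<otimes>\<^bsub>M\<^esub> n) = cone_in R \<phi> M m \<oplus>\<^bsub>vspace \<sigma>\<^esub> cone_in R \<phi> M n"
    if "m \<in> carrier M" "n \<in> carrier M" for m n
    using that lin(2)[of "\<iota> m" "\<iota> n"] by (simp add: cone_in_def \<iota>_mult)
  have 3: "cone_in R \<phi> M \<one>\<^bsub>M\<^esub> = \<zero>\<^bsub>vspace \<sigma>\<^esub>"
    using linear_zero[OF s.real_space_axioms t.real_space_axioms enc_linear] by (simp add: cone_in_def \<iota>_one)
  have 4: "cone_in R \<phi> M (str_map M r) = vvec R \<phi> \<sigma> r" if "r \<in> carrier R" for r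
    using that lin(3)[of "vunit raw"] by (simp add: cone_in_def \<iota>_str vvec_def \<sigma>_simps(3))
  show ?thesis
    using 1 2 3 4 monoid_homD(1)[OF str_hom] by (auto simp: rmonoid_mor_def monoid_hom_def hom_def)
qed

lemma toric_\<sigma>: "toric_monoid R (monoid_of_cone R \<phi> \<sigma>)"
  by (rule \<sigma>_data) (rule cone_data.toric_M)

lemma \<eta>_iso: "is_isomorphism (toric_category R) M (monoid_of_cone R \<phi> \<sigma>) \<eta>"
proof (rule toric_isomorphism[OF toric toric_\<sigma> \<eta>_mor])
  show "bij_betw \<eta> (carrier M) (carrier (monoid_of_cone R \<phi> \<sigma>))"
    using inj_cone_in cone_in_image by (simp add: bij_betw_def monoid_of_cone_def)
qed

end

text \<open>The description in \<open>cone_map\<close> asks for a linear map compatible with the two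
  units \<open>\<eta>\<close>. Fullness, applied to \<open>f\<close> conjugated by these
  isomorphisms, provides one; faithfulness makes it unique.\<close>

lemma (in valued) cone_map:
  fixes M N :: "('u, 'r) rmonoid"
  assumes M: "toric_monoid R M" and N: "toric_monoid R N" and f: "f \<in> rmonoid_mor R M N"
    and universe: "\<exists>h :: real \<Rightarrow> 'u. inj h"
  shows "cone_map R \<phi> M N f \<in> cone_mor R \<phi> (cone_of_monoid R \<phi> M) (cone_of_monoid R \<phi> N)"
    "\<And>m. m \<in> carrier M \<Longrightarrow> cone_map R \<phi> M N f (cone_in R \<phi> M m) = cone_in R \<phi> N (f m)"
proof -
  interpret M: toric_universe R \<phi> M by unfold_locales (rule M, rule universe)
  interpret N: toric_universe R \<phi> N by unfold_locales (rule N, rule universe)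
  obtain B A where s: "cone_data R \<phi> M.\<sigma> B A" by (rule M.\<sigma>_data)
  obtain B' A' where t: "cone_data R \<phi> N.\<sigma> B' A'" by (rule N.\<sigma>_data)
  note cat = is_categoryD[OF is_category_toric[of R], simplified]
  let ?GM = "monoid_of_cone R \<phi> M.\<sigma>" and ?GN = "monoid_of_cone R \<phi> N.\<sigma>"
  \<comment> \<open>The inverse of the unit of \<open>M\<close>, so that the composite through
    \<open>f\<close> starts at the monoid of the copied cone.\<close>
  obtain \<theta> where \<theta>: "\<theta> \<in> rmonoid_mor R ?GM M" "compose (carrier M) \<theta> M.\<eta> = restrict (\<lambda>x. x) (carrier M)"
    using M.\<eta>_iso by (auto simp: is_isomorphism_def)
  have "compose (carrier ?GM) N.\<eta> (compose (carrier ?GM) f \<theta>) \<in> rmonoid_mor R ?GM ?GN"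
    by (intro cat(2)[OF M.toric_\<sigma> N N.toric_\<sigma> _ N.\<eta>_mor] cat(2)[OF M.toric_\<sigma> M N \<theta>(1) f])
  then obtain h where h: "h \<in> cone_mor R \<phi> M.\<sigma> N.\<sigma>"
    "\<And>x. x \<in> cset M.\<sigma> \<inter> lat M.\<sigma> \<Longrightarrow> h x = compose (carrier ?GM) N.\<eta> (compose (carrier ?GM) f \<theta>) x"
    using cone_mor_extends[OF s t] by blast
  have car: "carrier ?GM = cset M.\<sigma> \<inter> lat M.\<sigma>" by (simp add: monoid_of_cone_def)
  have in\<sigma>: "cone_in R \<phi> M m \<in> cset M.\<sigma> \<inter> lat M.\<sigma>" if "m \<in> carrier M" for m
    using M.cone_in_image that by auto
  have h2: "h (cone_in R \<phi> M m) = cone_in R \<phi> N (f m)" if m: "m \<in> carrier M" for m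
  proof -
    have "\<theta> (cone_in R \<phi> M m) = m" using fun_cong[OF \<theta>(2), of m] m by (simp add: compose_def)
    then show ?thesis using h(2)[OF in\<sigma>[OF m]] in\<sigma>[OF m] m rmonoid_morD(2)[OF f]
      by (auto simp: compose_def car)
  qed
  define P where "P = (\<lambda>h. h \<in> extensional (carrier (vspace M.\<sigma>)) \<and> h \<in> linear_maps (vspace M.\<sigma>) (vspace N.\<sigma>) \<and>
    h (vunit M.\<sigma>) = vunit N.\<sigma> \<and> (\<forall>m\<in>carrier M. h (cone_in R \<phi> M m) = cone_in R \<phi> N (f m)))"
  \<comment> \<open>The description does not mention the cones and lattices. Compatibility with
    \<open>cone_in\<close> supplies these conditions, since the image of \<open>cone_in\<close> is
    exactly the monoid of the cone.\<close>
  have P: "P k \<longleftrightarrow> k \<in> cone_mor R \<phi> M.\<sigma> N.\<sigma> \<and> (\<forall>m\<in>carrier M. k (cone_in R \<phi> M m) = cone_in R \<phi> N (f m))" for k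
  proof -
    have "\<forall>x\<in>cset M.\<sigma> \<inter> lat M.\<sigma>. k x \<in> cset N.\<sigma> \<inter> lat N.\<sigma>"
      if "\<forall>m\<in>carrier M. k (cone_in R \<phi> M m) = cone_in R \<phi> N (f m)"
      using that rmonoid_morD(2)[OF f] unfolding M.cone_in_image[symmetric] N.cone_in_image[symmetric] by auto
    then show ?thesis unfolding P_def cone_mor_iff[OF s t] by blast
  qed
  have Ph: "P h" using h(1) h2 P by simp
  have "(THE h. P h) = h"
  proof (rule the_equality[of P, OF Ph])
    fix k assume "P k"
    then show "k = h"
      unfolding P
    proof (elim conjE)
      assume k: "k \<in> cone_mor R \<phi> M.\<sigma> N.\<sigma>" "\<forall>m\<in>carrier M. k (cone_in R \<phi> M m) = cone_in R \<phi> N (f m)"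
      show "k = h"
        by (rule cone_mor_eqI[OF s t k(1) h(1)]) (use k(2) h2 in \<open>auto simp flip: M.cone_in_image\<close>)
    qed
  qed
  then have "cone_map R \<phi> M N f = h" by (simp add: cone_map_def Let_def P_def)
  then show "cone_map R \<phi> M N f \<in> cone_mor R \<phi> M.\<sigma> N.\<sigma>"
    "\<And>m. m \<in> carrier M \<Longrightarrow> cone_map R \<phi> M N f (cone_in R \<phi> M m) = cone_in R \<phi> N (f m)"
    using h(1) h2 by auto
qed

lemma (in valued) equivalence:
  assumes universe: "\<exists>h :: real \<Rightarrow> 'u. inj h"
  shows "essentially_inverse_equivalences
    (toric_category R :: (('u, 'r) rmonoid, 'u \<Rightarrow> 'u) category)
    (cone_category R \<phi> :: ('u vcone, 'u \<Rightarrow> 'u) category)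
    (cone_functor R \<phi>) (monoid_functor R \<phi>)"
proof (rule equivalence_of_fully_faithful[where \<eta> = "\<lambda>M. restrict (cone_in R \<phi> M) (carrier M)"])
  show "is_category (toric_category R :: (('u, 'r) rmonoid, 'u \<Rightarrow> 'u) category)" by (rule is_category_toric)
  show "is_functor (cone_category R \<phi> :: ('u vcone, 'u \<Rightarrow> 'u) category) (toric_category R) (monoid_functor R \<phi>)"
    by (rule is_functor_monoid)
next
  fix s t :: "'u vcone" and g
  assume "s \<in> Ob (cone_category R \<phi>)" "t \<in> Ob (cone_category R \<phi>)"
    and g: "g \<in> Mor (toric_category R) (omap (monoid_functor R \<phi>) s) (omap (monoid_functor R \<phi>) t)"
  then obtain B A B' A' where s: "cone_data R \<phi> s B A" and t: "cone_data R \<phi> t B' A'"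
    by (auto elim!: special_coneE)
  have g': "g \<in> rmonoid_mor R (monoid_of_cone R \<phi> s) (monoid_of_cone R \<phi> t)" using g by (simp add: monoid_functor_def)
  obtain f where f: "f \<in> cone_mor R \<phi> s t" "\<And>m. m \<in> cset s \<inter> lat s \<Longrightarrow> f m = g m"
    by (rule cone_mor_extends[OF s t g']) (rule that)
  have "g \<in> extensional (cset s \<inter> lat s)" using rmonoid_morD(1)[OF g'] by (simp add: monoid_of_cone_def)
  then have "restrict f (cset s \<inter> lat s) = g" using f(2) by (intro extensionalityI[of _ "cset s \<inter> lat s"]) auto
  then show "\<exists>f\<in>Mor (cone_category R \<phi>) s t. amap (monoid_functor R \<phi>) s t f = g"
    using f(1) by (auto simp: monoid_functor_def)
next
  fix s t :: "'u vcone" and f f'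
  assume "s \<in> Ob (cone_category R \<phi>)" "t \<in> Ob (cone_category R \<phi>)"
    and f: "f \<in> Mor (cone_category R \<phi>) s t" "f' \<in> Mor (cone_category R \<phi>) s t"
    and eq: "amap (monoid_functor R \<phi>) s t f = amap (monoid_functor R \<phi>) s t f'"
  then obtain B A B' A' where s: "cone_data R \<phi> s B A" and t: "cone_data R \<phi> t B' A'"
    by (auto elim!: special_coneE)
  have eq': "restrict f (cset s \<inter> lat s) = restrict f' (cset s \<inter> lat s)" using eq by (simp add: monoid_functor_def)
  show "f = f'"
  proof (rule cone_mor_eqI[OF s t])
    show "f m = f' m" if "m \<in> cset s \<inter> lat s" for m using fun_cong[OF eq', of m] that by simp
  qed (use f in auto)
next
  fix M :: "('u, 'r) rmonoid" assume "M \<in> Ob (toric_category R)"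
  then interpret M: toric_universe R \<phi> M by unfold_locales (simp, rule universe)
  obtain B A where "cone_data R \<phi> M.\<sigma> B A" by (rule M.\<sigma>_data)
  then have "special_cone R \<phi> M.\<sigma>" unfolding special_cone_iff_cone_data by (intro exI)
  then show "omap (cone_functor R \<phi>) M \<in> Ob (cone_category R \<phi>)"
    by (simp add: cone_functor_def)
  show "is_isomorphism (toric_category R) M (omap (monoid_functor R \<phi>) (omap (cone_functor R \<phi>) M)) (restrict (cone_in R \<phi> M) (carrier M))"
    using M.\<eta>_iso by (simp add: cone_functor_def monoid_functor_def)
next
  fix M N :: "('u, 'r) rmonoid" and f
  assume "M \<in> Ob (toric_category R)" "N \<in> Ob (toric_category R)" "f \<in> Mor (toric_category R) M N"
  then have M: "toric_monoid R M" and N: "toric_monoid R N" and f: "f \<in> rmonoid_mor R M N" by auto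
  interpret M: toric_universe R \<phi> M by unfold_locales (rule M, rule universe)
  note map = cone_map[OF M N f universe]
  show "amap (cone_functor R \<phi>) M N f \<in> Mor (cone_category R \<phi>) (omap (cone_functor R \<phi>) M) (omap (cone_functor R \<phi>) N)"
    using map(1) by (simp add: cone_functor_def)
  have "cone_in R \<phi> M m \<in> cset M.\<sigma> \<inter> lat M.\<sigma>" if "m \<in> carrier M" for m
    using M.cone_in_image that by auto
  then show "Cmp (toric_category R) M N (omap (monoid_functor R \<phi>) (omap (cone_functor R \<phi>) N)) (restrict (cone_in R \<phi> N) (carrier N)) f =
    Cmp (toric_category R) M (omap (monoid_functor R \<phi>) (omap (cone_functor R \<phi>) M))
      (omap (monoid_functor R \<phi>) (omap (cone_functor R \<phi>) N))
      (amap (monoid_functor R \<phi>) (omap (cone_functor R \<phi>) M) (omap (cone_functor R \<phi>) N) (amap (cone_functor R \<phi>) M N f))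
      (restrict (cone_in R \<phi> M) (carrier M))"
    using map(2) rmonoid_morD(2)[OF f]
    by (auto simp: fun_eq_iff compose_def cone_functor_def monoid_functor_def)
qed

text \<open>The types \<open>'u\<close> and \<open>'w\<close> are independent: the equivalence needs
  a universe large enough to hold copies of the canonical cones, while the last clause concerns
  cones over an arbitrary type.\<close>

theorem theorem3p1p4:
  fixes R :: "'r monoid" and \<phi> :: "('r \<times> 'r) set \<Rightarrow> real"
  assumes "valuative_monoid R" and "sharp_monoid R" and "divisible_monoid R"
    and "height_one_monoid R"
    and "ordered_embedding R \<phi>"
    and universe: "\<exists>h :: real \<Rightarrow> 'u. inj h"
  shows "essentially_inverse_equivalences
           (toric_category R :: (('u, 'r) rmonoid, 'u \<Rightarrow> 'u) category)
           (cone_category R \<phi> :: ('u vcone, 'u \<Rightarrow> 'u) category)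
           (cone_functor R \<phi>) (monoid_functor R \<phi>) \<and>
         (\<forall>\<sigma> :: 'w vcone. special_cone R \<phi> \<sigma> \<longrightarrow> toric_monoid R (monoid_of_cone R \<phi> \<sigma>))"
proof -
  interpret valued R \<phi> by unfold_locales (use assms in auto)
  show ?thesis by (intro conjI allI impI equivalence[OF universe] toric_monoid_of_cone)
qed

end
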